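(* Let $(Q,g)$ be a complete connected Riemannian manifold, let $T>0$, let $\xi=(q_0,v_0)$ and $\eta=(q_T,v_T)$ be elements of $TQ$, and let $V:Q\to\mathbb{R}$ be smooth and non-negative. Let $\Omega=\Omega^T_{\xi,\eta}$ be the set of curves $q\in H^2([0,T];Q)$ with $q(0)=q_0$, $q(T)=q_T$, $\dot q(0)=v_0$, $\dot q(T)=v_T$, and define $J:\Omega\to\mathbb{R}$ by $$J(q)=\frac12\int_0^T\left(\left\|\frac{D^2q}{dt^2}(t)\right\|^2+V(q(t))\right)dt .$$ Then $J$ attains its minimum in $\Omega$; that is, there exists $q\in\Omega$ with $J(q)\le J(\tilde q)$ for all $\tilde q\in\Omega$.
   Context: $Q$ is finite-dimensional. $\frac{D^2q}{dt^2}=\frac{D}{dt}\dot q$ denotes the covariant derivative of the velocity field $\dot q$ along $q$ with respect to the Levi-Civita connection, and $\|\cdot\|$ is the norm induced by $g$. $H^2([0,T];Q)$ is the set of curves $q:[0,T]\to Q$ such that for every chart $(\mathcal U,\varphi)$ of $Q$ and every closed subinterval $I\subset[0,T]$ with $q(I)\subset\mathcal U$, the restriction $\varphi\circ q|_I$ belongs to the Sobolev space $H^2=W^{2,2}$ on $I$ with values in $\mathbb{R}^{\dim Q}$. *)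

theory Defs
  imports "HOL-Analysis.Analysis"
begin

section \<open>Smooth maps between subsets of normed spaces\<close>

text \<open>
  \<open>E\<close> is the vector space of admissible directions and \<open>W\<close> is (relatively) open in \<open>E\<close>. For
  \<open>E = UNIV\<close> and \<open>W\<close> open this is the usual notion of a map of class \<open>C^k\<close>.
\<close>

primrec Ck_on :: "'a::real_normed_vector set \<Rightarrow> 'a set \<Rightarrow> nat \<Rightarrow> ('a \<Rightarrow> 'b::real_normed_vector) \<Rightarrow> bool"
  where
    "Ck_on E W 0 f \<longleftrightarrow> continuous_on W f"
  | "Ck_on E W (Suc k) f \<longleftrightarrow> f differentiable_on W \<and>
       (\<forall>v\<in>E. Ck_on E W k (\<lambda>x. frechet_derivative f (at x within W) v))"

definition smooth_on :: "'a::real_normed_vector set \<Rightarrow> 'a set \<Rightarrow> ('a \<Rightarrow> 'b::real_normed_vector) \<Rightarrow> bool"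
  where "smooth_on E W f \<longleftrightarrow> (\<forall>k. Ck_on E W k f)"

section \<open>Smooth manifolds\<close>

text \<open>
  The points of the manifold are the elements of a Hausdorff second countable type \<open>'m\<close>. A chart
  is a pair of its domain and its coordinate map; the coordinate map is a total function whose
  values off the domain are irrelevant.

  Charts take values in the model vector space \<open>E\<close>, which is either all of \<open>real ^ 'n\<close> or \<open>{0}\<close>.
  The second possibility serves only to include manifolds of dimension \<open>0\<close>, as no type
  \<open>real ^ 'n\<close> has dimension \<open>0\<close>.
\<close>

type_synonym ('m, 'n) chart = "'m set \<times> ('m \<Rightarrow> real ^ 'n)"

definition param :: "('m, 'n) chart \<Rightarrow> real ^ 'n \<Rightarrow> 'm"
  where "param c = inv_into (fst c) (snd c)"

definition is_chart :: "(real ^ 'n) set \<Rightarrow> ('m::topological_space, 'n::finite) chart \<Rightarrow> bool"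
  where "is_chart E c \<longleftrightarrow> open (fst c) \<and> openin (top_of_set E) (snd c ` fst c) \<and>
    homeomorphism (fst c) (snd c ` fst c) (snd c) (param c)"

definition overlap :: "('m, 'n) chart \<Rightarrow> ('m, 'n) chart \<Rightarrow> (real ^ 'n) set"
  where "overlap c c' = snd c ` (fst c \<inter> fst c')"

definition transition :: "('m, 'n) chart \<Rightarrow> ('m, 'n) chart \<Rightarrow> real ^ 'n \<Rightarrow> real ^ 'n"
  where "transition c c' = snd c' \<circ> param c"

definition compatible :: "(real ^ 'n) set \<Rightarrow> ('m, 'n::finite) chart \<Rightarrow> ('m, 'n) chart \<Rightarrow> bool"
  where "compatible E c c' \<longleftrightarrow>
    smooth_on E (overlap c c') (transition c c') \<and> smooth_on E (overlap c' c) (transition c' c)"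

text \<open>A smooth structure is given by its maximal atlas \<open>A\<close>; its elements are the charts of the manifold.\<close>

definition smooth_structure ::
    "(real ^ 'n) set \<Rightarrow> ('m::{t2_space, second_countable_topology}, 'n::finite) chart set \<Rightarrow> bool"
  where "smooth_structure E A \<longleftrightarrow> (E = UNIV \<or> E = {0}) \<and>
    (\<forall>c\<in>A. is_chart E c) \<and>
    (\<Union>c\<in>A. fst c) = UNIV \<and>
    (\<forall>c\<in>A. \<forall>c'\<in>A. compatible E c c') \<and>
    (\<forall>c. is_chart E c \<and> (\<forall>c'\<in>A. compatible E c c') \<longrightarrow> c \<in> A)"

definition smooth_function ::
    "(real ^ 'n) set \<Rightarrow> ('m, 'n::finite) chart set \<Rightarrow> ('m \<Rightarrow> real) \<Rightarrow> bool"
  where "smooth_function E A f \<longleftrightarrow> (\<forall>c\<in>A. smooth_on E (snd c ` fst c) (f \<circ> param c))"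

section \<open>Tangent vectors\<close>

text \<open>
  A tangent vector at \<open>p\<close> is the family of its coordinate vectors in all charts around \<open>p\<close>,
  transforming by the differentials of the transition maps. The value is \<open>0\<close> at all other pairs,
  so that equality of tangent vectors at \<open>p\<close> is equality of functions; the vector space
  operations are pointwise.
\<close>

type_synonym ('m, 'n) tangent = "('m, 'n) chart \<Rightarrow> real ^ 'n"

definition charts_at :: "('m, 'n) chart set \<Rightarrow> 'm \<Rightarrow> ('m, 'n) chart set"
  where "charts_at A p = {c \<in> A. p \<in> fst c}"

definition transition_deriv ::
    "('m, 'n::finite) chart \<Rightarrow> ('m, 'n) chart \<Rightarrow> 'm \<Rightarrow> real ^ 'n \<Rightarrow> real ^ 'n"
  where "transition_deriv c c' p =
    frechet_derivative (transition c c') (at (snd c p) within overlap c c')"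

definition tangent_space ::
    "(real ^ 'n) set \<Rightarrow> ('m, 'n::finite) chart set \<Rightarrow> 'm \<Rightarrow> ('m, 'n) tangent set"
  where "tangent_space E A p = {v.
    (\<forall>c\<in>charts_at A p. v c \<in> E) \<and>
    (\<forall>c. c \<notin> charts_at A p \<longrightarrow> v c = 0) \<and>
    (\<forall>c\<in>charts_at A p. \<forall>c'\<in>charts_at A p. v c' = transition_deriv c c' p (v c))}"

definition tangent_bundle ::
    "(real ^ 'n) set \<Rightarrow> ('m, 'n::finite) chart set \<Rightarrow> ('m \<times> ('m, 'n) tangent) set"
  where "tangent_bundle E A = Sigma UNIV (tangent_space E A)"

text \<open>The tangent vector at \<open>p\<close> whose coordinate vector in the chart \<open>c\<close> is \<open>u\<close>.\<close>

definition tangent_of_coords ::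
    "('m, 'n::finite) chart set \<Rightarrow> ('m, 'n) chart \<Rightarrow> 'm \<Rightarrow> real ^ 'n \<Rightarrow> ('m, 'n) tangent"
  where "tangent_of_coords A c p u =
    (\<lambda>c'. if c' \<in> charts_at A p then transition_deriv c c' p u else 0)"

text \<open>
  The velocity at time \<open>t\<close> of a curve parametrized by the interval \<open>I\<close> (one-sided at endpoints).
  Curves on \<open>I\<close> are total functions whose values off \<open>I\<close> are irrelevant.
\<close>

definition velocity ::
    "('m, 'n::finite) chart set \<Rightarrow> real set \<Rightarrow> (real \<Rightarrow> 'm) \<Rightarrow> real \<Rightarrow> ('m, 'n) tangent"
  where "velocity A I q t =
    (\<lambda>c. if c \<in> charts_at A (q t) then vector_derivative (snd c \<circ> q) (at t within I) else 0)"

section \<open>Riemannian metrics\<close>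

type_synonym ('m, 'n) metric = "'m \<Rightarrow> ('m, 'n) tangent \<Rightarrow> ('m, 'n) tangent \<Rightarrow> real"

definition metric_coords ::
    "('m, 'n::finite) chart set \<Rightarrow> ('m, 'n) metric \<Rightarrow> ('m, 'n) chart \<Rightarrow>
      real ^ 'n \<Rightarrow> real ^ 'n \<Rightarrow> real ^ 'n \<Rightarrow> real"
  where "metric_coords A g c x u w =
    g (param c x) (tangent_of_coords A c (param c x) u) (tangent_of_coords A c (param c x) w)"

definition riemannian_metric ::
    "(real ^ 'n) set \<Rightarrow> ('m, 'n::finite) chart set \<Rightarrow> ('m, 'n) metric \<Rightarrow> bool"
  where "riemannian_metric E A g \<longleftrightarrow>
    (\<forall>p. \<forall>u\<in>tangent_space E A p. \<forall>v\<in>tangent_space E A p. g p u v = g p v u) \<and>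
    (\<forall>p. \<forall>u\<in>tangent_space E A p. \<forall>v\<in>tangent_space E A p. \<forall>w\<in>tangent_space E A p. \<forall>a b.
        g p (\<lambda>c. a *\<^sub>R u c + b *\<^sub>R v c) w = a * g p u w + b * g p v w) \<and>
    (\<forall>p. \<forall>v\<in>tangent_space E A p. v \<noteq> (\<lambda>c. 0) \<longrightarrow> 0 < g p v v) \<and>
    (\<forall>c\<in>A. \<forall>u\<in>E. \<forall>w\<in>E. smooth_on E (snd c ` fst c) (\<lambda>x. metric_coords A g c x u w))"

definition riemannian_norm :: "('m, 'n) metric \<Rightarrow> 'm \<Rightarrow> ('m, 'n) tangent \<Rightarrow> real"
  where "riemannian_norm g p v = sqrt (g p v v)"

section \<open>The Riemannian distance\<close>

definition C1_on :: "real \<Rightarrow> real \<Rightarrow> (real \<Rightarrow> 'a::real_normed_vector) \<Rightarrow> bool"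
  where "C1_on a b f \<longleftrightarrow> (\<exists>f'. continuous_on {a..b} f' \<and>
    (\<forall>t\<in>{a..b}. (f has_vector_derivative f' t) (at t within {a..b})))"

text \<open>
  \<open>P\<close> is the set of break points. The library's notion of piecewise \<open>C^1\<close> does not require
  one-sided limits of the derivative at the break points and is therefore not used here.
\<close>

definition piecewise_C1_curve ::
    "('m::topological_space, 'n::finite) chart set \<Rightarrow> (real \<Rightarrow> 'm) \<Rightarrow> bool"
  where "piecewise_C1_curve A q \<longleftrightarrow> continuous_on {0..1} q \<and>
    (\<exists>P. finite P \<and> (\<forall>c\<in>A. \<forall>a b. 0 \<le> a \<and> a < b \<and> b \<le> 1 \<and> {a<..<b} \<inter> P = {} \<and>
      q ` {a..b} \<subseteq> fst c \<longrightarrow> C1_on a b (snd c \<circ> q)))"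

definition curve_length ::
    "('m, 'n::finite) chart set \<Rightarrow> ('m, 'n) metric \<Rightarrow> (real \<Rightarrow> 'm) \<Rightarrow> real"
  where "curve_length A g q =
    (LINT t|lebesgue_on {0..1}. riemannian_norm g (q t) (velocity A {0..1} q t))"

definition riemannian_dist ::
    "('m::topological_space, 'n::finite) chart set \<Rightarrow> ('m, 'n) metric \<Rightarrow> 'm \<Rightarrow> 'm \<Rightarrow> real"
  where "riemannian_dist A g p p' =
    Inf {curve_length A g q |q. piecewise_C1_curve A q \<and> q 0 = p \<and> q 1 = p'}"

definition complete_riemannian ::
    "('m::topological_space, 'n::finite) chart set \<Rightarrow> ('m, 'n) metric \<Rightarrow> bool"
  where "complete_riemannian A g \<longleftrightarrow> Metric_space.mcomplete UNIV (riemannian_dist A g)"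

section \<open>The Levi-Civita covariant derivative along a curve\<close>

definition metric_matrix ::
    "('m, 'n::finite) chart set \<Rightarrow> ('m, 'n) metric \<Rightarrow> ('m, 'n) chart \<Rightarrow> real ^ 'n \<Rightarrow> real ^ 'n ^ 'n"
  where "metric_matrix A g c x = (\<chi> i j. metric_coords A g c x (axis i 1) (axis j 1))"

definition metric_partial ::
    "('m, 'n::finite) chart set \<Rightarrow> ('m, 'n) metric \<Rightarrow> ('m, 'n) chart \<Rightarrow> real ^ 'n \<Rightarrow>
      'n \<Rightarrow> 'n \<Rightarrow> 'n \<Rightarrow> real"
  where "metric_partial A g c x l i j =
    frechet_derivative (\<lambda>y. metric_matrix A g c y $ i $ j) (at x within snd c ` fst c) (axis l 1)"

text \<open>The Christoffel symbols of the Levi-Civita connection; \<open>k\<close> is the upper index.\<close>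

definition christoffel ::
    "('m, 'n::finite) chart set \<Rightarrow> ('m, 'n) metric \<Rightarrow> ('m, 'n) chart \<Rightarrow> real ^ 'n \<Rightarrow>
      'n \<Rightarrow> 'n \<Rightarrow> 'n \<Rightarrow> real"
  where "christoffel A g c x k i j =
    (1/2) * (\<Sum>l\<in>UNIV. matrix_inv (metric_matrix A g c x) $ k $ l *
      (metric_partial A g c x i j l + metric_partial A g c x j i l - metric_partial A g c x l i j))"

text \<open>
  The covariant derivative \<open>DX/dt\<close> of a vector field \<open>X\<close> along a curve \<open>q\<close> defined on \<open>I\<close>. It is
  meaningful at every \<open>t\<close> at which the coordinates of \<open>X\<close> are differentiable. If \<open>q\<close> is of class
  \<open>H^2\<close> and \<open>X\<close> is its velocity, these coordinates are locally absolutely continuous, so this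
  is almost every \<open>t\<close>, and there the derivative is a representative of the weak one. For
  the model space \<open>{0}\<close> all velocities vanish, so the meaningless symbols do not contribute.
\<close>

definition covariant_deriv ::
    "('m, 'n::finite) chart set \<Rightarrow> ('m, 'n) metric \<Rightarrow> real set \<Rightarrow> (real \<Rightarrow> 'm) \<Rightarrow>
      (real \<Rightarrow> ('m, 'n) tangent) \<Rightarrow> real \<Rightarrow> ('m, 'n) tangent"
  where "covariant_deriv A g I q X t = (\<lambda>c. if c \<in> charts_at A (q t) then
      vector_derivative (\<lambda>s. X s c) (at t within I) +
      (\<chi> k. \<Sum>i\<in>UNIV. \<Sum>j\<in>UNIV.
        christoffel A g c (snd c (q t)) k i j * velocity A I q t c $ i * X t c $ j)
    else 0)"

section \<open>Sobolev curves\<close>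

definition test_function :: "real \<Rightarrow> real \<Rightarrow> (real \<Rightarrow> real) \<Rightarrow> bool"
  where "test_function a b \<psi> \<longleftrightarrow> smooth_on UNIV UNIV \<psi> \<and>
    (\<exists>K. compact K \<and> K \<subseteq> {a<..<b} \<and> (\<forall>t. t \<notin> K \<longrightarrow> \<psi> t = 0))"

definition L2_on :: "real \<Rightarrow> real \<Rightarrow> (real \<Rightarrow> 'a::euclidean_space) \<Rightarrow> bool"
  where "L2_on a b f \<longleftrightarrow> f \<in> borel_measurable (lebesgue_on {a..b}) \<and>
    integrable (lebesgue_on {a..b}) (\<lambda>t. (norm (f t))\<^sup>2)"

definition weak_deriv_on ::
    "real \<Rightarrow> real \<Rightarrow> (real \<Rightarrow> 'a::euclidean_space) \<Rightarrow> (real \<Rightarrow> 'a) \<Rightarrow> bool"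
  where "weak_deriv_on a b f f' \<longleftrightarrow> (\<forall>\<psi>. test_function a b \<psi> \<longrightarrow>
    (LINT t|lebesgue_on {a..b}. deriv \<psi> t *\<^sub>R f t) = - (LINT t|lebesgue_on {a..b}. \<psi> t *\<^sub>R f' t))"

definition H2_on :: "real \<Rightarrow> real \<Rightarrow> (real \<Rightarrow> 'a::euclidean_space) \<Rightarrow> bool"
  where "H2_on a b f \<longleftrightarrow> (\<exists>f' f''. L2_on a b f \<and> L2_on a b f' \<and> L2_on a b f'' \<and>
    weak_deriv_on a b f f' \<and> weak_deriv_on a b f' f'')"

text \<open>
  Curves are continuous: without this, the condition on charts would hold vacuously for every map
  that sends no nondegenerate interval into a chart domain.
\<close>

definition H2_curves ::
    "('m::topological_space, 'n::finite) chart set \<Rightarrow> real \<Rightarrow> (real \<Rightarrow> 'm) set"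
  where "H2_curves A T = {q. continuous_on {0..T} q \<and>
    (\<forall>c\<in>A. \<forall>a b. 0 \<le> a \<and> a < b \<and> b \<le> T \<and> q ` {a..b} \<subseteq> fst c \<longrightarrow> H2_on a b (snd c \<circ> q))}"

definition admissible_curves ::
    "('m::topological_space, 'n::finite) chart set \<Rightarrow> real \<Rightarrow>
      'm \<times> ('m, 'n) tangent \<Rightarrow> 'm \<times> ('m, 'n) tangent \<Rightarrow> (real \<Rightarrow> 'm) set"
  where "admissible_curves A T \<xi> \<eta> = {q \<in> H2_curves A T.
    q 0 = fst \<xi> \<and> q T = fst \<eta> \<and>
    velocity A {0..T} q 0 = snd \<xi> \<and> velocity A {0..T} q T = snd \<eta>}"

definition action ::
    "('m, 'n::finite) chart set \<Rightarrow> ('m, 'n) metric \<Rightarrow> ('m \<Rightarrow> real) \<Rightarrow> real \<Rightarrow> (real \<Rightarrow> 'm) \<Rightarrow> real"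
  where "action A g V T q = (1/2) * (LINT t|lebesgue_on {0..T}.
    (riemannian_norm g (q t) (covariant_deriv A g {0..T} q (velocity A {0..T} q) t))\<^sup>2 + V (q t))"

end

theory Submission
  imports Defs "HOL-Complex_Analysis.Complex_Analysis" "HOL-Library.Diagonal_Subsequence"
begin

text \<open>
  The theorem is an instance of the direct method of the calculus of variations. The admissible set is
  not empty (\<open>admissible_nonempty\<close>) and the action is bounded below by \<open>0\<close>, so there is a minimizing
  sequence \<open>q\<^sub>n\<close>; because \<open>V \<ge> 0\<close>, the integrals of the squared covariant accelerations of the \<open>q\<^sub>n\<close> stay
  below some \<open>B\<close>.

  Compactness. Along a curve the function \<open>e = g(q', q')\<close> has derivative \<open>2 g(Dq'/dt, q')\<close>. Since all
  \<open>q\<^sub>n\<close> start with the same velocity, this bounds \<open>e\<close> by a constant \<open>R\<^sup>2\<close> that depends only on that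
  velocity, \<open>T\<close> and \<open>B\<close> (\<open>kin_bound\<close>). Hence the \<open>q\<^sub>n\<close> are \<open>R\<close>-Lipschitz for the Riemannian distance
  (\<open>rd_lipschitz\<close>) and have a common starting point. Completeness then makes the set of points
  \<open>q\<^sub>n t\<close> relatively compact for every \<open>t\<close>: the times with this property form a set that is open in
  \<open>{0..T}\<close> because compact sets have compact neighbourhoods, and closed because at a limit time the
  points are totally bounded (\<open>bounded_speed_compact\<close>; this replaces the Hopf-Rinow theorem). A
  diagonal argument over the rational times gives a subsequence that converges pointwise to a
  Lipschitz curve \<open>q\<close> (\<open>bounded_speed_subsequence\<close>).

  Regularity of the limit and lower semicontinuity. Both are local, so they are proved on intervals on
  which \<open>q\<close> stays in one chart (\<open>chart_limit\<close>). There the velocities are bounded, and equicontinuous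
  because their derivative is bounded in \<open>L\<^sup>2\<close>; by the Arzela-Ascoli theorem a subsequence of them
  converges uniformly, which transfers the boundary velocities to \<open>q\<close>. The coordinates
  \<open>D\<^sub>n = v\<^sub>n' + \<Gamma>(x\<^sub>n)(v\<^sub>n, v\<^sub>n)\<close> of the accelerations are bounded in \<open>L\<^sup>2\<close>, hence some of their convex
  combinations converge in \<open>L\<^sup>2\<close> (\<open>Mazur_L2\<close>), and the limit is the acceleration of \<open>q\<close>. As the metric
  along \<open>q\<^sub>n\<close> converges uniformly and the squared norm is convex, the integral for \<open>q\<close> is at most the
  lower limit of those for the \<open>q\<^sub>n\<close>. The intervals are glued by \<open>chart_induction\<close>, and the potential
  term is treated by Fatou's lemma.

  The analytic tool used throughout is the representation of \<open>H\<^sup>2\<close> functions by integrals: a continuous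
  function with weak derivatives \<open>f', f''\<close> in \<open>L\<^sup>2\<close> is an iterated integral of \<open>f''\<close>
  (\<open>H2_on_imp_H2_rep\<close>). The geometric tools are the transformation law of the Christoffel symbols
  (\<open>Gam_change\<close>), which makes the acceleration independent of the chart, and the compatibility of the
  connection with the metric (\<open>kin_AC\<close>).

  If the model space is a point, the connected manifold is a point, and there is only one curve.
\<close>

section \<open>Absolutely continuous functions\<close>

text \<open>
  Absolute continuity on \<open>{a..b}\<close>, with the almost everywhere derivative as an explicit argument. The
  integral formula takes the place of the epsilon-delta definition.
\<close>

definition AC_rep :: "real \<Rightarrow> real \<Rightarrow> (real \<Rightarrow> 'a::euclidean_space) \<Rightarrow> (real \<Rightarrow> 'a) \<Rightarrow> bool" where
  "AC_rep a b f \<alpha> \<longleftrightarrow> \<alpha> absolutely_integrable_on {a..b} \<and>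
     (\<forall>t\<in>{a..b}. f t = f a + integral {a..t} \<alpha>)"

lemma AC_repD_abs: "AC_rep a b f \<alpha> \<Longrightarrow> \<alpha> absolutely_integrable_on {a..b}"
  unfolding AC_rep_def by blast

lemma AC_repD_eq: "AC_rep a b f \<alpha> \<Longrightarrow> a \<le> t \<Longrightarrow> t \<le> b \<Longrightarrow> f t = f a + integral {a..t} \<alpha>"
  unfolding AC_rep_def by (blast intro: atLeastAtMost_iff[THEN iffD2])

lemma AC_repD_integrable:
  assumes "AC_rep a b f \<alpha>" "a \<le> s" "t \<le> b"
  shows "\<alpha> integrable_on {s..t}" "(\<lambda>r. norm (\<alpha> r)) integrable_on {s..t}"
    "\<alpha> absolutely_integrable_on {s..t}"
proof -
  show *: "\<alpha> absolutely_integrable_on {s..t}"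
    using assms by (intro absolutely_integrable_on_subinterval[OF AC_repD_abs[OF assms(1)]]) auto
  then show "\<alpha> integrable_on {s..t}" "(\<lambda>r. norm (\<alpha> r)) integrable_on {s..t}"
    by (auto simp: absolutely_integrable_on_def)
qed

lemma AC_rep_increment:
  assumes "AC_rep a b f \<alpha>" "a \<le> s" "s \<le> t" "t \<le> b"
  shows "f t - f s = integral {s..t} \<alpha>"
proof -
  have "integral {a..s} \<alpha> + integral {s..t} \<alpha> = integral {a..t} \<alpha>"
    using assms AC_repD_integrable(1)[OF assms(1), of a t]
    by (intro Henstock_Kurzweil_Integration.integral_combine) auto
  moreover have "f t = f a + integral {a..t} \<alpha>"
    by (rule AC_repD_eq[OF assms(1)]) (use assms in auto)
  moreover have "f s = f a + integral {a..s} \<alpha>"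
    by (rule AC_repD_eq[OF assms(1)]) (use assms in auto)
  moreover have "x - z = r" if "q + r = p" "x = y + p" "z = y + q" for x y z p q r :: 'a
    using that by (simp add: algebra_simps)
  ultimately show ?thesis by blast
qed

lemma AC_rep_continuous:
  assumes "AC_rep a b f \<alpha>" shows "continuous_on {a..b} f"
proof -
  have "continuous_on {a..b} (\<lambda>t. f a + integral {a..t} \<alpha>)"
    using AC_repD_integrable(1)[OF assms, of a b]
    by (intro continuous_intros indefinite_integral_continuous_1) auto
  then show ?thesis
    by (rule continuous_on_eq) (use AC_repD_eq[OF assms] in \<open>metis atLeastAtMost_iff\<close>)
qed

lemma AC_repI:
  assumes "\<alpha> absolutely_integrable_on {a..b}"
    and "\<And>t. a \<le> t \<Longrightarrow> t \<le> b \<Longrightarrow> f t - f a = integral {a..t} \<alpha>"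
  shows "AC_rep a b f \<alpha>"
  unfolding AC_rep_def
proof (intro conjI ballI assms(1))
  fix t assume "t \<in> {a..b}"
  then have "f t - f a = integral {a..t} \<alpha>" using assms(2) by auto
  then show "f t = f a + integral {a..t} \<alpha>" unfolding diff_eq_eq by (simp only: add.commute)
qed

lemma AC_rep_cong:
  assumes "AC_rep a b f \<alpha>" "\<And>t. a \<le> t \<Longrightarrow> t \<le> b \<Longrightarrow> f t = g t"
    "\<And>t. a \<le> t \<Longrightarrow> t \<le> b \<Longrightarrow> \<alpha> t = \<beta> t"
  shows "AC_rep a b g \<beta>"
proof (rule AC_repI)
  have "\<alpha> absolutely_integrable_on {a..b}" using assms(1) by (rule AC_repD_abs)
  then show "\<beta> absolutely_integrable_on {a..b}"
    by (rule absolutely_integrable_spike[OF _ negligible_empty]) (use assms(3) in auto)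
  fix t assume t: "a \<le> t" "t \<le> b"
  have "integral {a..t} \<alpha> = integral {a..t} \<beta>"
    by (rule Henstock_Kurzweil_Integration.integral_cong) (use t assms(3) in auto)
  then show "g t - g a = integral {a..t} \<beta>"
    using assms t AC_rep_increment[OF assms(1), of a t] by auto
qed

text \<open>
  The product rule needs no differentiation theorem. The defect of the product formula is additive in
  the interval, and on short intervals it is at most a small multiple of the integral of
  \<open>|\<alpha>| + |\<beta>|\<close>, because \<open>f\<close> and \<open>g\<close> are nearly constant there. By bisection the bound holds on every
  interval with an arbitrarily small factor, so the defect vanishes.
\<close>

lemma AC_rep_bilinear:
  fixes f :: "real \<Rightarrow> 'a::euclidean_space" and g :: "real \<Rightarrow> 'b::euclidean_space"
    and prod :: "'a \<Rightarrow> 'b \<Rightarrow> 'c::euclidean_space"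
  assumes "bounded_bilinear prod" and f: "AC_rep a b f \<alpha>" and g: "AC_rep a b g \<beta>"
  shows "AC_rep a b (\<lambda>t. prod (f t) (g t)) (\<lambda>t. prod (f t) (\<beta> t) + prod (\<alpha> t) (g t))"
proof -
  interpret prod: bounded_bilinear prod by fact
  have bil: "bilinear prod" using assms(1) by (simp add: bilinear_conv_bounded_bilinear)
  have bil': "bilinear (\<lambda>x y. prod y x)" using prod.flip by (simp add: bilinear_conv_bounded_bilinear)
  define \<gamma> where "\<gamma> = (\<lambda>t. prod (f t) (\<beta> t) + prod (\<alpha> t) (g t))"
  note cf = AC_rep_continuous[OF f] and cg = AC_rep_continuous[OF g]
  have mf: "f \<in> borel_measurable (lebesgue_on {a..b})" and mg: "g \<in> borel_measurable (lebesgue_on {a..b})"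
    using cf cg by (auto intro!: continuous_imp_measurable_on_sets_lebesgue)
  have bf: "bounded (f ` {a..b})" and bg: "bounded (g ` {a..b})"
    by (intro compact_imp_bounded compact_continuous_image cf cg compact_Icc)+
  have abs1: "(\<lambda>t. prod (f t) (\<beta> t)) absolutely_integrable_on {a..b}"
    using AC_repD_abs[OF g]
    by (intro absolutely_integrable_bounded_measurable_product[OF bil mf _ bf]) auto
  have abs2: "(\<lambda>t. prod (\<alpha> t) (g t)) absolutely_integrable_on {a..b}"
    using AC_repD_abs[OF f] absolutely_integrable_bounded_measurable_product[OF bil' mg _ bg, of \<alpha>]
    by auto
  have abs: "\<gamma> absolutely_integrable_on {a..b}"
    unfolding \<gamma>_def by (intro set_integral_add abs1 abs2)
  have int\<gamma>: "\<gamma> integrable_on {s..t}" if "a \<le> s" "t \<le> b" for s t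
    using absolutely_integrable_on_subinterval[OF abs, of s t] that
    by (auto simp: absolutely_integrable_on_def)
  define \<nu> where "\<nu> = (\<lambda>r. norm (\<alpha> r) + norm (\<beta> r))"
  have int\<nu>: "\<nu> integrable_on {s..t}" if "a \<le> s" "t \<le> b" for s t
    unfolding \<nu>_def using AC_repD_integrable(2)[OF f that] AC_repD_integrable(2)[OF g that]
    by (rule integrable_add)
  define err where "err s t = prod (f t) (g t) - prod (f s) (g s) - integral {s..t} \<gamma>" for s t
  obtain K where K: "K > 0" "\<And>x y. norm (prod x y) \<le> norm x * norm y * K"
    using prod.pos_bounded by blast
  have est: "norm (err s t) \<le> e * integral {s..t} \<nu>" if st: "a \<le> s" "s \<le> t" "t \<le> b" and e: "e > 0" for s t e
  proof -
    have "a \<le> s \<and> t \<le> b \<longrightarrow> norm (err s t) \<le> e * integral {s..t} \<nu>"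
      using \<open>s \<le> t\<close>
    proof (induction rule: Bolzano)
      case (trans u v w)
      show ?case
      proof
        assume uw: "a \<le> u \<and> w \<le> b"
        have "integral {u..v} \<gamma> + integral {v..w} \<gamma> = integral {u..w} \<gamma>"
             "integral {u..v} \<nu> + integral {v..w} \<nu> = integral {u..w} \<nu>"
          using uw trans by (auto intro!: Henstock_Kurzweil_Integration.integral_combine int\<gamma> int\<nu>)
        moreover from this have "err u w = err u v + err v w" by (simp add: err_def algebra_simps)
        moreover have "norm (err u v) \<le> e * integral {u..v} \<nu>" "norm (err v w) \<le> e * integral {v..w} \<nu>"
          using uw trans by auto
        ultimately show "norm (err u w) \<le> e * integral {u..w} \<nu>"
          by (metis (no_types, lifting) distrib_left norm_triangle_mono)
      qed
    next
      case (local x)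
      show ?case
      proof (cases "a \<le> x \<and> x \<le> b")
        case True
        have e': "e / (2 * K) > 0" using e K by simp
        obtain d1 where d1: "d1 > 0" "\<And>r. r \<in> {a..b} \<Longrightarrow> dist r x < d1 \<Longrightarrow> dist (f r) (f x) < e / (2*K)"
          using cf True e' unfolding continuous_on_iff by (metis atLeastAtMost_iff)
        obtain d2 where d2: "d2 > 0" "\<And>r. r \<in> {a..b} \<Longrightarrow> dist r x < d2 \<Longrightarrow> dist (g r) (g x) < e / (2*K)"
          using cg True e' unfolding continuous_on_iff by (metis atLeastAtMost_iff)
        have "norm (err u w) \<le> e * integral {u..w} \<nu>"
          if uw: "u \<le> x" "x \<le> w" "w - u < min d1 d2" "a \<le> u" "w \<le> b" for u w
        proof -
          have close: "norm (f w - f r) \<le> e/K" "norm (g u - g r) \<le> e/K" if r: "r \<in> {u..w}" for r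
          proof -
            have "dist (f r) (f x) < e / (2*K)" "dist (f w) (f x) < e / (2*K)"
              "dist (g r) (g x) < e / (2*K)" "dist (g u) (g x) < e / (2*K)"
              using r uw by (auto intro!: d1 d2 simp: dist_real_def)
            then have "dist (f w) (f r) < e/(2*K) + e/(2*K)" "dist (g u) (g r) < e/(2*K) + e/(2*K)"
              by (metis dist_commute dist_triangle_less_add)+
            then show "norm (f w - f r) \<le> e/K" "norm (g u - g r) \<le> e/K"
              by (simp_all add: dist_norm field_simps)
          qed
          have "((\<lambda>r. prod (f w) (\<beta> r) + prod (\<alpha> r) (g u)) has_integral
                 (prod (f w) (integral {u..w} \<beta>) + prod (integral {u..w} \<alpha>) (g u))) {u..w}"
            using has_integral_linear[OF integrable_integral[OF AC_repD_integrable(1)[OF g \<open>a \<le> u\<close> \<open>w \<le> b\<close>]] prod.bounded_linear_right, of "f w"]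
            has_integral_linear[OF integrable_integral[OF AC_repD_integrable(1)[OF f \<open>a \<le> u\<close> \<open>w \<le> b\<close>]] prod.bounded_linear_left, of "g u"]
            by (intro has_integral_add) (simp_all add: o_def)
          moreover have "prod (f w) (integral {u..w} \<beta>) + prod (integral {u..w} \<alpha>) (g u) = prod (f w) (g w) - prod (f u) (g u)"
            using uw by (simp add: AC_rep_increment[OF f, symmetric] AC_rep_increment[OF g, symmetric] prod.diff_left prod.diff_right)
          ultimately have "((\<lambda>r. prod (f w) (\<beta> r) + prod (\<alpha> r) (g u)) has_integral (prod (f w) (g w) - prod (f u) (g u))) {u..w}"
            by simp
          from has_integral_diff[OF this integrable_integral[OF int\<gamma>[OF \<open>a \<le> u\<close> \<open>w \<le> b\<close>]]]
          \<comment> \<open>With \<open>f\<close> frozen at the right end and \<open>g\<close> at the left end the product formula is exact, so the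
            defect is the integral of the two freezing errors.\<close>
          have hi: "((\<lambda>r. prod (f w - f r) (\<beta> r) + prod (\<alpha> r) (g u - g r)) has_integral err u w) {u..w}"
            by (simp add: err_def \<gamma>_def prod.diff_left prod.diff_right algebra_simps)
          have "norm (err u w) \<le> integral {u..w} (\<lambda>r. e * \<nu> r)"
            unfolding integral_unique[OF hi, symmetric]
          proof (rule integral_norm_bound_integral)
            show "(\<lambda>r. prod (f w - f r) (\<beta> r) + prod (\<alpha> r) (g u - g r)) integrable_on {u..w}"
              using hi by blast
            show "(\<lambda>r. e * \<nu> r) integrable_on {u..w}"
              using integrable_on_cmult_left[OF int\<nu>[OF \<open>a \<le> u\<close> \<open>w \<le> b\<close>], of e] by simp
            fix r assume r: "r \<in> {u..w}"
            have "norm (prod (f w - f r) (\<beta> r)) \<le> (e/K) * norm (\<beta> r) * K"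
              by (rule order_trans[OF K(2)]) (intro mult_right_mono close r, use K in auto)
            moreover have "norm (prod (\<alpha> r) (g u - g r)) \<le> norm (\<alpha> r) * (e/K) * K"
              by (rule order_trans[OF K(2)]) (intro mult_right_mono mult_left_mono close r, use K in auto)
            ultimately show "norm (prod (f w - f r) (\<beta> r) + prod (\<alpha> r) (g u - g r)) \<le> e * \<nu> r"
              using K norm_triangle_ineq[of "prod (f w - f r) (\<beta> r)" "prod (\<alpha> r) (g u - g r)"]
              by (simp add: \<nu>_def algebra_simps)
          qed
          then show ?thesis by simp
        qed
        then show ?thesis using d1(1) d2(1) by (intro exI[of _ "min d1 d2"]) auto
      next
        case False
        then show ?thesis by (intro exI[of _ 1]) auto
      qed
    qed
    then show ?thesis using st by simp
  qed
  have zero: "err a t = 0" if t: "a \<le> t" "t \<le> b" for t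
  proof (rule ccontr)
    assume n: "err a t \<noteq> 0"
    have I: "integral {a..t} \<nu> \<ge> 0"
      by (rule Henstock_Kurzweil_Integration.integral_nonneg) (use int\<nu> t in \<open>auto simp: \<nu>_def\<close>)
    define e where "e = norm (err a t) / (2 * (integral {a..t} \<nu> + 1))"
    have "e > 0" using n I by (simp add: e_def)
    from est[OF order_refl t this] have "norm (err a t) \<le> norm (err a t) * (integral {a..t} \<nu> / (2 * (integral {a..t} \<nu> + 1)))"
      by (simp add: e_def)
    also have "\<dots> < norm (err a t) * 1" using n I by (intro mult_strict_left_mono) (auto simp: field_simps)
    finally show False by simp
  qed
  show ?thesis
    using abs zero unfolding \<gamma>_def err_def by (intro AC_repI) auto
qed

text \<open>
  Lebesgue differentiation. Averages over intervals to the right of a point converge almost everywhere;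
  the left-sided averages are treated by reflecting the integrand.
\<close>

lemma AC_rep_has_vector_derivative:
  assumes "AC_rep a b f \<alpha>"
  obtains N where "negligible N"
    "\<And>t. a < t \<Longrightarrow> t < b \<Longrightarrow> t \<notin> N \<Longrightarrow> (f has_vector_derivative \<alpha> t) (at t)"
proof -
  define A where "A x = (if x \<in> {a..b} then \<alpha> x else 0)" for x
  have "A integrable_on UNIV"
    unfolding A_def using AC_repD_integrable(1)[OF assms order_refl order_refl]
    by (subst integrable_restrict_UNIV)
  then have A: "A integrable_on cbox c d" for c d :: real
    by (rule integrable_on_subcbox) auto
  have B: "(\<lambda>x. A (-x)) integrable_on cbox c d" for c d :: real
    using A[of "-d" "-c"] Henstock_Kurzweil_Integration.integrable_reflect_real[where f=A and a="-d" and b="-c"] by simp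
  obtain N1 where N1: "negligible N1" "\<And>x e. \<lbrakk>x \<notin> N1; 0 < e\<rbrakk> \<Longrightarrow>
      \<exists>d>0. \<forall>h. 0 < h \<and> h < d \<longrightarrow> norm (integral (cbox x (x + h *\<^sub>R One)) A /\<^sub>R h ^ DIM(real) - A x) < e"
    using integrable_ccontinuous_explicit[OF A] by blast
  obtain N2 where N2: "negligible N2" "\<And>x e. \<lbrakk>x \<notin> N2; 0 < e\<rbrakk> \<Longrightarrow>
      \<exists>d>0. \<forall>h. 0 < h \<and> h < d \<longrightarrow> norm (integral (cbox x (x + h *\<^sub>R One)) (\<lambda>x. A (-x)) /\<^sub>R h ^ DIM(real) - A (-x)) < e"
    using integrable_ccontinuous_explicit[OF B] by blast
  have key: "norm (y - h *\<^sub>R z) \<le> e * h" if "norm (y /\<^sub>R h ^ DIM(real) - z) < e" "h > 0" for y z :: 'a and h e :: real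
  proof -
    have "y - h *\<^sub>R z = h *\<^sub>R (y /\<^sub>R h ^ DIM(real) - z)"
      using that by (simp add: algebra_simps)
    then have "norm (y - h *\<^sub>R z) = h * norm (y /\<^sub>R h ^ DIM(real) - z)"
      using that by simp
    also have "\<dots> \<le> h * e" using that by (intro mult_left_mono) auto
    finally show ?thesis by (simp add: mult.commute)
  qed
  show thesis
  proof
    show "negligible (N1 \<union> uminus ` N2)"
      using N1(1) N2(1)
      by (intro negligible_Un negligible_differentiable_image_negligible) (auto intro!: derivative_intros)
    fix t assume t: "a < t" "t < b" "t \<notin> N1 \<union> uminus ` N2"
    have At: "A t = \<alpha> t" using t by (simp add: A_def)
    have tN: "t \<notin> N1" "- t \<notin> N2" using t(3) by force+
    have inc: "f z - f y = integral (cbox y z) A" if "a \<le> y" "y \<le> z" "z \<le> b" for y z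
    proof -
      have "integral {y..z} \<alpha> = integral {y..z} A"
        by (rule Henstock_Kurzweil_Integration.integral_cong) (use that in \<open>auto simp: A_def\<close>)
      then show ?thesis using AC_rep_increment[OF assms that] by simp
    qed
    show "(f has_vector_derivative \<alpha> t) (at t)"
      unfolding has_vector_derivative_def has_derivative_at_alt
    proof (intro conjI bounded_linear_scaleR_left allI impI)
      fix e :: real assume e: "e > 0"
      obtain d1 where d1: "d1 > 0" "\<And>h. 0 < h \<Longrightarrow> h < d1 \<Longrightarrow> norm (integral (cbox t (t + h *\<^sub>R One)) A /\<^sub>R h ^ DIM(real) - A t) < e"
        using N1(2)[OF tN(1) e] by blast
      obtain d2 where d2: "d2 > 0" "\<And>h. 0 < h \<Longrightarrow> h < d2 \<Longrightarrow> norm (integral (cbox (-t) (-t + h *\<^sub>R One)) (\<lambda>x. A (-x)) /\<^sub>R h ^ DIM(real) - A (-(-t))) < e"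
        using N2(2)[OF tN(2) e] by blast
      define d where "d = min (min d1 d2) (min (t - a) (b - t))"
      have "norm (f y - f t - (y - t) *\<^sub>R \<alpha> t) \<le> e * norm (y - t)" if y: "norm (y - t) < d" for y
      proof -
        consider "y = t" | "y > t" | "y < t" by linarith
        then show ?thesis
        proof cases
          case 2
          have "norm (integral (cbox t y) A - (y - t) *\<^sub>R A t) \<le> e * (y - t)"
            using key[OF d1(2)[of "y - t"]] 2 y by (simp add: d_def)
          then show ?thesis using inc[of t y] 2 y t At by (simp add: d_def)
        next
          case 3
          have "norm (integral (cbox (-t) (-y)) (\<lambda>x. A (-x)) - (t - y) *\<^sub>R A t) \<le> e * (t - y)"
            using key[OF d2(2)[of "t - y"]] 3 y by (simp add: d_def)
          moreover have "integral (cbox (-t) (-y)) (\<lambda>x. A (-x)) = integral (cbox y t) A"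
            using Henstock_Kurzweil_Integration.integral_reflect_real[where f=A and a=y and b=t] by simp
          ultimately have "norm ((f t - f y) - (t - y) *\<^sub>R \<alpha> t) \<le> e * (t - y)"
            using inc[of y t] 3 y t At by (simp add: d_def)
          moreover have "norm (f y - f t - (y - t) *\<^sub>R \<alpha> t) = norm ((f t - f y) - (t - y) *\<^sub>R \<alpha> t)"
            by (subst norm_minus_cancel[symmetric]) (simp add: algebra_simps)
          moreover have "norm (y - t) = t - y" using 3 by simp
          ultimately show ?thesis by simp
        qed simp
      qed
      then show "\<exists>d>0. \<forall>y. norm (y - t) < d \<longrightarrow> norm (f y - f t - (y - t) *\<^sub>R \<alpha> t) \<le> e * norm (y - t)"
        using d1(1) d2(1) t by (intro exI[of _ d]) (auto simp: d_def)
    qed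
  qed
qed

lemma AC_rep_C1:
  assumes "\<And>t. a \<le> t \<Longrightarrow> t \<le> b \<Longrightarrow> (f has_vector_derivative f' t) (at t within {a..b})"
    and "continuous_on {a..b} f'"
  shows "AC_rep a b f f'"
proof (rule AC_repI)
  show "f' absolutely_integrable_on {a..b}"
    using assms(2) by (rule absolutely_integrable_continuous_real)
  fix t assume t: "a \<le> t" "t \<le> b"
  have "(f' has_integral f t - f a) {a..t}"
    using t assms(1) by (intro fundamental_theorem_of_calculus) (auto intro!: has_vector_derivative_within_subset[where S="{a..b}" and T="{a..t}"])
  then show "f t - f a = integral {a..t} f'" by (simp add: integral_unique)
qed

lemma AC_rep_const: "AC_rep a b (\<lambda>t. c) (\<lambda>t. 0)"
  by (intro AC_repI) (auto simp: absolutely_integrable_on_def)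

lemma AC_rep_linear:
  assumes "AC_rep a b f \<alpha>" "bounded_linear L"
  shows "AC_rep a b (\<lambda>t. L (f t)) (\<lambda>t. L (\<alpha> t))"
proof (rule AC_repI)
  interpret bounded_linear L by fact
  show "(\<lambda>t. L (\<alpha> t)) absolutely_integrable_on {a..b}"
    using absolutely_integrable_linear[OF AC_repD_abs[OF assms(1)] assms(2)] by (simp add: o_def)
  fix t assume t: "a \<le> t" "t \<le> b"
  have "integral {a..t} (L \<circ> \<alpha>) = L (integral {a..t} \<alpha>)"
    by (rule integral_linear[OF AC_repD_integrable(1)[OF assms(1) order_refl t(2)] assms(2)])
  then show "L (f t) - L (f a) = integral {a..t} (\<lambda>t. L (\<alpha> t))"
    using AC_rep_increment[OF assms(1) order_refl t] by (simp add: o_def diff[symmetric])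
qed

lemma AC_rep_add:
  assumes "AC_rep a b f \<alpha>" "AC_rep a b g \<beta>"
  shows "AC_rep a b (\<lambda>t. f t + g t) (\<lambda>t. \<alpha> t + \<beta> t)"
proof (rule AC_repI)
  show "(\<lambda>t. \<alpha> t + \<beta> t) absolutely_integrable_on {a..b}"
    using assms by (intro set_integral_add AC_repD_abs)
  fix t assume t: "a \<le> t" "t \<le> b"
  have "integral {a..t} (\<lambda>t. \<alpha> t + \<beta> t) = integral {a..t} \<alpha> + integral {a..t} \<beta>"
    by (intro Henstock_Kurzweil_Integration.integral_add AC_repD_integrable(1)[OF assms(1)] AC_repD_integrable(1)[OF assms(2)] t order_refl)
  then show "f t + g t - (f a + g a) = integral {a..t} (\<lambda>t. \<alpha> t + \<beta> t)"
    using AC_rep_increment[OF assms(1) order_refl t] AC_rep_increment[OF assms(2) order_refl t]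
    by (metis add_diff_add)
qed

lemma AC_rep_sum:
  assumes "finite I" "\<And>i. i \<in> I \<Longrightarrow> AC_rep a b (f i) (\<alpha> i)"
  shows "AC_rep a b (\<lambda>t. \<Sum>i\<in>I. f i t) (\<lambda>t. \<Sum>i\<in>I. \<alpha> i t)"
  using assms by (induction I rule: finite_induct) (auto intro: AC_rep_add AC_rep_const)

lemma AC_rep_combine:
  assumes f: "AC_rep a b f \<alpha>" and g: "AC_rep b c f \<beta>" and "a \<le> b" "b \<le> c"
  shows "AC_rep a c f (\<lambda>t. if t \<le> b then \<alpha> t else \<beta> t)" (is "AC_rep a c f ?\<gamma>")
proof (rule AC_repI)
  have 1: "?\<gamma> absolutely_integrable_on {a..b}"
    using absolutely_integrable_spike[OF AC_repD_abs[OF f] negligible_empty, of ?\<gamma>] by auto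
  have 2: "?\<gamma> absolutely_integrable_on {b..c}"
    using absolutely_integrable_spike[OF AC_repD_abs[OF g] negligible_sing[of b], of ?\<gamma>] by auto
  show abs: "?\<gamma> absolutely_integrable_on {a..c}"
    using set_integrable_Un[OF 1 2] assms by (simp add: ivl_disj_un)
  fix t assume t: "a \<le> t" "t \<le> c"
  have i1: "integral {a..u} ?\<gamma> = f u - f a" if "a \<le> u" "u \<le> b" for u
  proof -
    have "integral {a..u} ?\<gamma> = integral {a..u} \<alpha>"
      by (rule Henstock_Kurzweil_Integration.integral_cong) (use that in auto)
    then show ?thesis using AC_rep_increment[OF f order_refl that] by simp
  qed
  show "f t - f a = integral {a..t} ?\<gamma>"
  proof (cases "t \<le> b")
    case True then show ?thesis using i1 t by simp
  next
    case False
    have "integral {b..t} ?\<gamma> = integral {b..t} \<beta>"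
      by (rule integral_spike[OF negligible_sing[of b]]) auto
    then have "integral {b..t} ?\<gamma> = f t - f b"
      using AC_rep_increment[OF g order_refl, of t] False t by simp
    moreover have "integral {a..b} ?\<gamma> + integral {b..t} ?\<gamma> = integral {a..t} ?\<gamma>"
      using False assms t absolutely_integrable_on_subinterval[OF abs, of a t]
      by (intro Henstock_Kurzweil_Integration.integral_combine) (auto simp: absolutely_integrable_on_def)
    ultimately show ?thesis using i1[of b] assms by simp
  qed
qed

lemma AC_rep_derivative_unique:
  assumes "AC_rep a b f \<alpha>" "continuous_on {a..b} \<alpha>" "a \<le> t" "t \<le> b"
  shows "(f has_vector_derivative \<alpha> t) (at t within {a..b})"
proof -
  have "((\<lambda>u. f a + integral {a..u} \<alpha>) has_vector_derivative 0 + \<alpha> t) (at t within {a..b})"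
    using assms by (intro has_vector_derivative_add has_vector_derivative_const integral_has_vector_derivative) auto
  then have d: "((\<lambda>u. f a + integral {a..u} \<alpha>) has_vector_derivative \<alpha> t) (at t within {a..b})" by simp
  show ?thesis
  proof (rule has_vector_derivative_transform[OF _ _ d])
    show "t \<in> {a..b}" using assms by simp
    show "f u = f a + integral {a..u} \<alpha>" if "u \<in> {a..b}" for u
      using that by (intro AC_repD_eq[OF assms(1)]) auto
  qed
qed

section \<open>Square integrable functions\<close>

definition L2 :: "'a measure \<Rightarrow> ('a \<Rightarrow> 'b::euclidean_space) \<Rightarrow> bool" where
  "L2 M f \<longleftrightarrow> f \<in> borel_measurable M \<and> integrable M (\<lambda>x. (norm (f x))\<^sup>2)"

lemma L2_on_L2: "L2_on a b f \<longleftrightarrow> L2 (lebesgue_on {a..b}) f"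
  by (simp add: L2_on_def L2_def)

lemma norm_sum_sq: "(norm (x + y :: 'a::real_normed_vector))\<^sup>2 \<le> 2 * (norm x)\<^sup>2 + 2 * (norm y)\<^sup>2"
proof -
  have "(norm (x + y))\<^sup>2 \<le> (norm x + norm y)\<^sup>2" by (intro power_mono norm_triangle_ineq) simp
  also have "\<dots> \<le> 2 * (norm x)\<^sup>2 + 2 * (norm y)\<^sup>2"
    using zero_le_power2[of "norm x - norm y"] by (simp add: power2_eq_square algebra_simps)
  finally show ?thesis .
qed

lemma L2_bound:
  assumes "L2 M f" "g \<in> borel_measurable M" "\<And>x. x \<in> space M \<Longrightarrow> norm (g x) \<le> C * norm (f x)"
  shows "L2 M g"
  unfolding L2_def
proof
  have "integrable M (\<lambda>x. C\<^sup>2 * (norm (f x))\<^sup>2)" using assms(1) by (simp add: L2_def)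
  then show "integrable M (\<lambda>x. (norm (g x))\<^sup>2)"
  proof (rule Bochner_Integration.integrable_bound)
    show "AE x in M. norm ((norm (g x))\<^sup>2) \<le> norm (C\<^sup>2 * (norm (f x))\<^sup>2)"
      using power_mono[OF assms(3) norm_ge_zero, of _ 2] by (intro AE_I2) (auto simp: power_mult_distrib)
  qed (use assms(2) in measurable)
qed fact

lemma L2_scaleR: "L2 M f \<Longrightarrow> L2 M (\<lambda>x. c *\<^sub>R f x)"
  by (rule L2_bound[where C="\<bar>c\<bar>"]) (auto simp: L2_def)

lemma L2_add:
  assumes "L2 M f" "L2 M g" shows "L2 M (\<lambda>x. f x + g x)"
  unfolding L2_def
proof
  show m: "(\<lambda>x. f x + g x) \<in> borel_measurable M" using assms by (auto simp: L2_def)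
  have "integrable M (\<lambda>x. 2 * (norm (f x))\<^sup>2 + 2 * (norm (g x))\<^sup>2)" using assms by (auto simp: L2_def)
  then show "integrable M (\<lambda>x. (norm (f x + g x))\<^sup>2)"
    by (rule Bochner_Integration.integrable_bound) (use m norm_sum_sq in \<open>auto intro!: AE_I2\<close>)
qed

lemma L2_diff: "L2 M f \<Longrightarrow> L2 M g \<Longrightarrow> L2 M (\<lambda>x. f x - g x)"
  using L2_add[of M f "\<lambda>x. (-1) *\<^sub>R g x"] L2_scaleR[of M g "-1"] by simp

lemma L2_integrable:
  assumes "finite_measure M" "L2 M f" shows "integrable M f"
proof -
  interpret finite_measure M by fact
  have "integrable M (\<lambda>x. 1 + (norm (f x))\<^sup>2)" using assms(2) by (simp add: L2_def)
  then show ?thesis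
  proof (rule Bochner_Integration.integrable_bound)
    have "norm (f x) \<le> 1 + (norm (f x))\<^sup>2" for x
    proof -
      have "2 * norm (f x) \<le> 1 + (norm (f x))\<^sup>2" using zero_le_power2[of "norm (f x) - 1"] by (simp add: power2_diff)
      then show ?thesis using norm_ge_zero[of "f x"] by linarith
    qed
    then show "AE x in M. norm (f x) \<le> norm (1 + (norm (f x))\<^sup>2)" by (auto intro: order_trans abs_ge_self)
  qed (use assms(2) in \<open>auto simp: L2_def\<close>)
qed

lemma finite_measure_lebesgue_Icc: "finite_measure (lebesgue_on {a..b::real})"
  by (rule finite_measure_lebesgue_on) simp

lemma L2_on_abs:
  assumes "L2_on a b f" shows "f absolutely_integrable_on {a..b}"
  using L2_integrable[OF finite_measure_lebesgue_Icc assms[unfolded L2_on_L2]]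
  by (simp add: integrable_restrict_space set_integrable_def)

text \<open>
  Completeness of \<open>L\<^sup>2\<close> over a finite measure, by the Riesz-Fischer argument: along a subsequence the
  successive differences have integrals bounded by a geometric series, so it converges almost
  everywhere, and Fatou's lemma turns the pointwise limit into a limit in \<open>L\<^sup>2\<close>.
\<close>

lemma L2_Cauchy_limit:
  fixes \<kappa> :: "nat \<Rightarrow> 'a \<Rightarrow> 'b::euclidean_space"
  assumes fin: "finite_measure M" and L: "\<And>n. L2 M (\<kappa> n)"
    and C: "\<And>e. e > 0 \<Longrightarrow> \<exists>N. \<forall>m\<ge>N. \<forall>n\<ge>N. (\<integral>x. (norm (\<kappa> m x - \<kappa> n x))\<^sup>2 \<partial>M) < e"
  obtains k where "L2 M k" "(\<lambda>n. \<integral>x. (norm (\<kappa> n x - k x))\<^sup>2 \<partial>M) \<longlonglongrightarrow> 0"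
proof -
  interpret finite_measure M by fact
  have meas[measurable]: "\<kappa> n \<in> borel_measurable M" for n using L by (auto simp: L2_def)
  have Ld: "L2 M (\<lambda>x. \<kappa> m x - \<kappa> n x)" for m n using L by (intro L2_diff)
  have int2: "integrable M (\<lambda>x. (norm (\<kappa> m x - \<kappa> n x))\<^sup>2)" for m n using Ld by (auto simp: L2_def)
  have "\<forall>j. \<exists>N. \<forall>m\<ge>N. \<forall>n\<ge>N. (\<integral>x. (norm (\<kappa> m x - \<kappa> n x))\<^sup>2 \<partial>M) < (1/4)^j"
    using C by simp
  then obtain N where N: "\<And>j m n. m \<ge> N j \<Longrightarrow> n \<ge> N j \<Longrightarrow> (\<integral>x. (norm (\<kappa> m x - \<kappa> n x))\<^sup>2 \<partial>M) < (1/4)^j"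
    by metis
  \<comment> \<open>The summand \<open>j\<close> makes \<open>s\<close> unbounded; the maximum makes both \<open>s j\<close> and \<open>s (Suc j)\<close> at least \<open>N j\<close>.\<close>
  define s where "s j = Max (N ` {..j}) + j" for j
  have sN: "s j \<ge> N j" "s (Suc j) \<ge> N j" "s j \<ge> j" for j
  proof -
    have "N j \<le> Max (N ` {..j})" "N j \<le> Max (N ` {..Suc j})" by (auto intro!: Max_ge simp del: image_insert)
    then show "s j \<ge> N j" "s (Suc j) \<ge> N j" "s j \<ge> j" unfolding s_def by linarith+
  qed
  define \<Delta> where "\<Delta> j x = \<kappa> (s (Suc j)) x - \<kappa> (s j) x" for j x
  have intD: "integrable M (\<lambda>x. norm (\<Delta> j x))" for j
    unfolding \<Delta>_def by (intro integrable_norm L2_integrable[OF fin] Ld)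
  have bD: "(\<integral>x. norm (\<Delta> j x) \<partial>M) \<le> (measure M (space M) + 1) * (1/2)^j" for j
  proof -
    have "(\<integral>x. norm (\<Delta> j x) \<partial>M) \<le> (\<integral>x. (1/2)^j + 2^j * (norm (\<Delta> j x))\<^sup>2 \<partial>M)"
    proof (rule integral_mono)
      show "integrable M (\<lambda>x. norm (\<Delta> j x))" by (rule intD)
      show "integrable M (\<lambda>x. (1/2)^j + 2^j * (norm (\<Delta> j x))\<^sup>2)" using int2 by (auto simp: \<Delta>_def)
      fix x
      \<comment> \<open>The weights \<open>2^j\<close> balance the bound \<open>(1/4)^j\<close> on the integral of the square, so that both terms
        are of order \<open>(1/2)^j\<close>.\<close>
      have "0 \<le> 2^j * (norm (\<Delta> j x) - (1/2)^j)\<^sup>2" by simp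
      also have "\<dots> = 2^j * (norm (\<Delta> j x))\<^sup>2 - 2 * norm (\<Delta> j x) + (1/2)^j"
        by (simp add: power2_eq_square algebra_simps power_one_over)
      finally show "norm (\<Delta> j x) \<le> (1/2)^j + 2^j * (norm (\<Delta> j x))\<^sup>2"
        using norm_ge_zero[of "\<Delta> j x"] by linarith
    qed
    also have "\<dots> = (1/2)^j * measure M (space M) + 2^j * (\<integral>x. (norm (\<Delta> j x))\<^sup>2 \<partial>M)"
      using int2 by (simp add: \<Delta>_def)
    also have "2^j * (\<integral>x. (norm (\<Delta> j x))\<^sup>2 \<partial>M) \<le> 2^j * (1/4)^j"
      using N[OF sN(2) sN(1), of j] by (intro mult_left_mono) (auto simp: \<Delta>_def)
    also have "2^j * (1/4::real)^j = (1/2)^j" by (simp flip: power_mult_distrib)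
    finally show ?thesis by (simp add: algebra_simps)
  qed
  have "(\<integral>\<^sup>+x. (\<Sum>j. ennreal (norm (\<Delta> j x))) \<partial>M) = (\<Sum>j. (\<integral>\<^sup>+x. ennreal (norm (\<Delta> j x)) \<partial>M))"
    by (intro nn_integral_suminf) (auto simp: \<Delta>_def)
  also have "\<dots> = (\<Sum>j. ennreal (\<integral>x. norm (\<Delta> j x) \<partial>M))"
    using intD by (simp add: nn_integral_eq_integral)
  also have "\<dots> \<le> (\<Sum>j. ennreal ((measure M (space M) + 1) * (1/2)^j))"
    by (intro suminf_le ennreal_leI bD) auto
  also have "\<dots> < top"
  proof -
    have "summable (\<lambda>j. (measure M (space M) + 1) * (1/2::real)^j)"
      by (intro summable_mult summable_geometric) simp
    then show ?thesis by (subst suminf_ennreal2) auto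
  qed
  finally have "(\<integral>\<^sup>+x. (\<Sum>j. ennreal (norm (\<Delta> j x))) \<partial>M) \<noteq> \<infinity>" by simp
  then have "AE x in M. (\<Sum>j. ennreal (norm (\<Delta> j x))) \<noteq> \<infinity>"
    by (intro nn_integral_noteq_infinite) (auto simp: \<Delta>_def)
  then have conv: "AE x in M. convergent (\<lambda>j. \<kappa> (s j) x)"
  proof (rule AE_mp, intro AE_I2 impI)
    fix x assume "(\<Sum>j. ennreal (norm (\<Delta> j x))) \<noteq> \<infinity>"
    then have "summable (\<lambda>j. norm (\<Delta> j x))" by (intro summable_suminf_not_top) (auto simp: )
    then have "summable (\<lambda>j. \<Delta> j x)" by (rule summable_norm_cancel)
    then have "convergent (\<lambda>n. \<Sum>j<n. \<Delta> j x)" by (simp add: summable_iff_convergent)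
    moreover have "(\<Sum>j<n. \<Delta> j x) = \<kappa> (s n) x - \<kappa> (s 0) x" for n
      unfolding \<Delta>_def by (rule sum_lessThan_telescope)
    ultimately have "convergent (\<lambda>n. (\<kappa> (s n) x - \<kappa> (s 0) x) + \<kappa> (s 0) x)"
      by (intro convergent_add convergent_const) simp
    then show "convergent (\<lambda>j. \<kappa> (s j) x)" by simp
  qed
  define k where "k x = lim (\<lambda>j. \<kappa> (s j) x)" for x
  have k[measurable]: "k \<in> borel_measurable M"
    unfolding k_def by (rule borel_measurable_lim_metric) simp
  have kl: "AE x in M. (\<lambda>j. \<kappa> (s j) x) \<longlonglongrightarrow> k x"
    using conv by eventually_elim (simp add: k_def convergent_LIMSEQ_iff)
  have fatou: "(\<integral>\<^sup>+x. ennreal ((norm (\<kappa> n x - k x))\<^sup>2) \<partial>M) \<le> ennreal ((1/4)^j)" if n: "n \<ge> N j" for n j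
  proof -
    have "(\<integral>\<^sup>+x. ennreal ((norm (\<kappa> n x - k x))\<^sup>2) \<partial>M)
        = (\<integral>\<^sup>+x. liminf (\<lambda>i. ennreal ((norm (\<kappa> n x - \<kappa> (s i) x))\<^sup>2)) \<partial>M)"
    proof (rule nn_integral_cong_AE)
      show "AE x in M. ennreal ((norm (\<kappa> n x - k x))\<^sup>2) = liminf (\<lambda>i. ennreal ((norm (\<kappa> n x - \<kappa> (s i) x))\<^sup>2))"
        using kl
      proof eventually_elim
        case (elim x)
        have "(\<lambda>i. ennreal ((norm (\<kappa> n x - \<kappa> (s i) x))\<^sup>2)) \<longlonglongrightarrow> ennreal ((norm (\<kappa> n x - k x))\<^sup>2)"
          using elim by (intro tendsto_intros)
        then show ?case by (rule lim_imp_Liminf[OF sequentially_bot, symmetric])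
      qed
    qed
    also have "\<dots> \<le> liminf (\<lambda>i. \<integral>\<^sup>+x. ennreal ((norm (\<kappa> n x - \<kappa> (s i) x))\<^sup>2) \<partial>M)"
      by (rule nn_integral_liminf) simp
    also have "\<dots> \<le> limsup (\<lambda>i. \<integral>\<^sup>+x. ennreal ((norm (\<kappa> n x - \<kappa> (s i) x))\<^sup>2) \<partial>M)"
      by (rule Liminf_le_Limsup) simp
    also have "\<dots> \<le> ennreal ((1/4)^j)"
    proof (rule Limsup_bounded)
      have "\<forall>\<^sub>F i in sequentially. s i \<ge> N j"
        unfolding eventually_sequentially
      proof (intro exI[of _ "N j"] allI impI)
        fix i assume "N j \<le> i"
        then show "N j \<le> s i" using sN(3)[of i] by linarith
      qed
      then show "\<forall>\<^sub>F i in sequentially. (\<integral>\<^sup>+x. ennreal ((norm (\<kappa> n x - \<kappa> (s i) x))\<^sup>2) \<partial>M) \<le> ennreal ((1/4)^j)"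
      proof eventually_elim
        case (elim i)
        have "(\<integral>\<^sup>+x. ennreal ((norm (\<kappa> n x - \<kappa> (s i) x))\<^sup>2) \<partial>M) = ennreal (\<integral>x. (norm (\<kappa> n x - \<kappa> (s i) x))\<^sup>2 \<partial>M)"
          by (intro nn_integral_eq_integral int2) auto
        also have "\<dots> \<le> ennreal ((1/4)^j)" using N[OF n elim] by (intro ennreal_leI) simp
        finally show ?case .
      qed
    qed
    finally show ?thesis .
  qed
  have intk: "integrable M (\<lambda>x. (norm (\<kappa> n x - k x))\<^sup>2)" "(\<integral>x. (norm (\<kappa> n x - k x))\<^sup>2 \<partial>M) \<le> (1/4)^j" if n: "n \<ge> N j" for n j
  proof -
    show i: "integrable M (\<lambda>x. (norm (\<kappa> n x - k x))\<^sup>2)"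
      using fatou[OF n] by (intro integrableI_bounded) (auto intro: le_less_trans)
    have "ennreal (\<integral>x. (norm (\<kappa> n x - k x))\<^sup>2 \<partial>M) \<le> ennreal ((1/4)^j)"
      using fatou[OF n] nn_integral_eq_integral[OF i] by simp
    then show "(\<integral>x. (norm (\<kappa> n x - k x))\<^sup>2 \<partial>M) \<le> (1/4)^j" by simp
  qed
  show thesis
  proof
    have "L2 M (\<lambda>x. \<kappa> (N 0) x - k x)" using intk(1)[of 0 "N 0"] by (simp add: L2_def)
    from L2_diff[OF L[of "N 0"] this] show "L2 M k" by simp
    show "(\<lambda>n. \<integral>x. (norm (\<kappa> n x - k x))\<^sup>2 \<partial>M) \<longlonglongrightarrow> 0"
    proof (rule LIMSEQ_I)
      fix r :: real assume "r > 0"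
      then obtain j where j: "(1/4::real)^j < r" using real_arch_pow_inv[of r "1/4"] by auto
      show "\<exists>no. \<forall>n\<ge>no. norm ((\<integral>x. (norm (\<kappa> n x - k x))\<^sup>2 \<partial>M) - 0) < r"
        using intk(2)[of j] j by (intro exI[of _ "N j"]) (auto intro: le_less_trans)
    qed
  qed
qed

text \<open>
  Closure under midpoints replaces the convex hull: it suffices for the parallelogram argument, and a
  property that is stable under midpoints passes to it by induction, without handling finite sums.
\<close>

inductive_set mid_hull :: "('a \<Rightarrow> 'b::real_vector) set \<Rightarrow> ('a \<Rightarrow> 'b) set" for S where
  base: "f \<in> S \<Longrightarrow> f \<in> mid_hull S"
| mid: "f \<in> mid_hull S \<Longrightarrow> g \<in> mid_hull S \<Longrightarrow> (\<lambda>x. (1/2) *\<^sub>R (f x + g x)) \<in> mid_hull S"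

lemma mid_hull_mono:
  assumes "S \<subseteq> S'" shows "mid_hull S \<subseteq> mid_hull S'"
proof
  fix f assume "f \<in> mid_hull S" then show "f \<in> mid_hull S'"
    by induction (use assms in \<open>auto intro: mid_hull.intros\<close>)
qed

lemma mid_hull_L2:
  assumes "\<And>f. f \<in> S \<Longrightarrow> L2 M f" "f \<in> mid_hull S" shows "L2 M f"
  using assms(2) by induction (auto intro: assms(1) L2_scaleR L2_add)

text \<open>
  The consequence of weak compactness and Mazur's lemma that is needed here, proved without weak
  topology. Let \<open>m N\<close> be the infimum of the squared norm over the midpoint hull of the tail from \<open>N\<close>.
  It is increasing and bounded by \<open>C\<close>. Almost minimizers \<open>\<kappa> N\<close> form a Cauchy sequence by the
  parallelogram law, because the midpoint of two of them lies in the same hull.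
\<close>

lemma Mazur_L2:
  fixes h :: "nat \<Rightarrow> 'a \<Rightarrow> 'b::euclidean_space"
  assumes fin: "finite_measure M" and L: "\<And>n. L2 M (h n)"
    and C: "\<And>n. (\<integral>x. (norm (h n x))\<^sup>2 \<partial>M) \<le> C"
  obtains \<kappa> k where "\<And>N. \<kappa> N \<in> mid_hull (h ` {N..})" "L2 M k"
    "(\<lambda>n. \<integral>x. (norm (\<kappa> n x - k x))\<^sup>2 \<partial>M) \<longlonglongrightarrow> 0"
proof -
  define en where "en f = (\<integral>x. (norm (f x))\<^sup>2 \<partial>M)" for f :: "'a \<Rightarrow> 'b"
  define H where "H N = mid_hull (h ` {N..})" for N
  define m where "m N = Inf (en ` H N)" for N
  have HL: "L2 M f" if "f \<in> H N" for f N using mid_hull_L2[of "h ` {N..}" M f] L that by (auto simp: H_def)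
  have Hmono: "H N' \<subseteq> H N" if "N \<le> N'" for N N' unfolding H_def by (intro mid_hull_mono image_mono) (use that in auto)
  have hH: "h N \<in> H N" for N by (auto simp: H_def intro: mid_hull.base)
  have bdd: "bdd_below (en ` H N)" for N by (rule bdd_belowI[of _ 0]) (auto simp: en_def)
  have m_le: "m N \<le> en f" if "f \<in> H N" for f N unfolding m_def by (intro cInf_lower imageI that bdd)
  have m_mono: "incseq m" unfolding m_def by (intro incseq_SucI cInf_superset_mono image_mono Hmono bdd) (use hH in auto)
  have mC: "m N \<le> C" for N using m_le[OF hH, of N] C[of N] by (simp add: en_def)
  obtain L where L: "m \<longlonglongrightarrow> L" "\<And>i. m i \<le> L"
    using incseq_convergent[OF m_mono, of C] mC by blast
  have "\<exists>f\<in>H N. en f < m N + 1 / (real N + 1)" for N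
  proof -
    have "Inf (en ` H N) < m N + 1 / (real N + 1)" by (simp add: m_def)
    then show ?thesis using cInf_lessD[of "en ` H N"] hH[of N] by blast
  qed
  then obtain \<kappa> where \<kappa>: "\<And>N. \<kappa> N \<in> H N" "\<And>N. en (\<kappa> N) < m N + 1 / (real N + 1)" by metis
  have est: "en (\<lambda>x. \<kappa> i x - \<kappa> j x) \<le> 4 * (L - m N) + 4 / (real N + 1)" if "i \<ge> N" "j \<ge> N" for i j N
  proof -
    have in1: "\<kappa> i \<in> H N" "\<kappa> j \<in> H N" using \<kappa>(1) Hmono that by blast+
    define g where "g = (\<lambda>x. (1/2) *\<^sub>R (\<kappa> i x + \<kappa> j x))"
    have gH: "g \<in> H N" unfolding g_def using in1 unfolding H_def by (rule mid_hull.mid)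
    have ints: "integrable M (\<lambda>x. (norm (f x))\<^sup>2)" if "f \<in> H N" for f using HL[OF that] by (simp add: L2_def)
    have "(norm (\<kappa> i x - \<kappa> j x))\<^sup>2 = 2 * (norm (\<kappa> i x))\<^sup>2 + 2 * (norm (\<kappa> j x))\<^sup>2 - 4 * (norm (g x))\<^sup>2" for x
      unfolding g_def by (simp add: power2_norm_eq_inner algebra_simps inner_commute)
    then have "en (\<lambda>x. \<kappa> i x - \<kappa> j x) = 2 * en (\<kappa> i) + 2 * en (\<kappa> j) - 4 * en g"
      unfolding en_def using ints in1 gH by simp
    also have "\<dots> \<le> 2 * (L + 1 / (real N + 1)) + 2 * (L + 1 / (real N + 1)) - 4 * m N"
    proof -
      have "1 / (real i + 1) \<le> 1 / (real N + 1)" "1 / (real j + 1) \<le> 1 / (real N + 1)"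
        using that by (auto intro!: divide_left_mono)
      then have "en (\<kappa> i) \<le> L + 1 / (real N + 1)" "en (\<kappa> j) \<le> L + 1 / (real N + 1)"
        using \<kappa>(2)[of i] \<kappa>(2)[of j] L(2)[of i] L(2)[of j] by (meson add_mono less_imp_le order_trans)+
      then show ?thesis using m_le[OF gH] by (intro diff_mono add_mono mult_left_mono) auto
    qed
    finally show ?thesis by (simp add: algebra_simps)
  qed
  have lim0: "(\<lambda>N. 4 * (L - m N) + 4 / (real N + 1)) \<longlonglongrightarrow> 4 * (L - L) + 0"
    by (intro tendsto_intros L(1)) real_asymp
  have "\<exists>N. \<forall>i\<ge>N. \<forall>j\<ge>N. (\<integral>x. (norm (\<kappa> i x - \<kappa> j x))\<^sup>2 \<partial>M) < e" if "e > 0" for e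
  proof -
    from order_tendstoD(2)[OF lim0, of e] that obtain N where "4 * (L - m N) + 4 / (real N + 1) < e"
      by (auto simp: eventually_sequentially)
    then show ?thesis using est[of N] unfolding en_def by (intro exI[of _ N]) (auto intro: le_less_trans)
  qed
  from L2_Cauchy_limit[OF fin HL[OF \<kappa>(1)] this] obtain k where
    "L2 M k" "(\<lambda>n. \<integral>x. (norm (\<kappa> n x - k x))\<^sup>2 \<partial>M) \<longlonglongrightarrow> 0" by blast
  then show thesis using that \<kappa>(1) unfolding H_def by blast
qed

section \<open>Test functions\<close>

text \<open>
  Smoothness of a real function through iterated one-variable derivatives, which is easier to verify
  than the definition through Frechet derivatives; \<open>Ck_on_Dk\<close> connects the two.
\<close>

primrec Dk :: "nat \<Rightarrow> (real \<Rightarrow> real) \<Rightarrow> bool" where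
  "Dk 0 f \<longleftrightarrow> continuous_on UNIV f"
| "Dk (Suc k) f \<longleftrightarrow> (\<exists>f'. (\<forall>x. (f has_real_derivative f' x) (at x)) \<and> Dk k f')"

lemma Dk_cmult: "Dk k f \<Longrightarrow> Dk k (\<lambda>x. f x * c)"
proof (induction k arbitrary: f)
  case 0 then show ?case by (auto intro!: continuous_intros)
next
  case (Suc k)
  then obtain f' where f': "\<And>x. (f has_real_derivative f' x) (at x)" "Dk k f'" by auto
  then show ?case using Suc.IH[OF f'(2)] by (auto intro!: exI[of _ "\<lambda>x. f' x * c"] derivative_eq_intros)
qed

lemma Dk_add: "Dk k f \<Longrightarrow> Dk k g \<Longrightarrow> Dk k (\<lambda>x. f x + g x)"
proof (induction k arbitrary: f g)
  case 0 then show ?case by (auto intro!: continuous_intros)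
next
  case (Suc k)
  then obtain f' g' where f': "\<And>x. (f has_real_derivative f' x) (at x)" "Dk k f'"
    and g': "\<And>x. (g has_real_derivative g' x) (at x)" "Dk k g'" by auto
  then show ?case using Suc.IH[OF f'(2) g'(2)] by (auto intro!: exI[of _ "\<lambda>x. f' x + g' x"] derivative_eq_intros)
qed

lemma Dk_continuous: "Dk k f \<Longrightarrow> continuous_on UNIV f"
  by (cases k) (auto intro: DERIV_continuous_on)

lemma Dk_SucD: "Dk (Suc k) f \<Longrightarrow> Dk k f"
proof (induction k arbitrary: f)
  case 0 then show ?case using Dk_continuous[of "Suc 0"] by simp
next
  case (Suc k)
  then obtain f' where "\<And>x. (f has_real_derivative f' x) (at x)" "Dk (Suc k) f'" by auto
  then show ?case using Suc.IH[of f'] by auto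
qed

lemma Dk_mult: "Dk k f \<Longrightarrow> Dk k g \<Longrightarrow> Dk k (\<lambda>x. f x * g x)"
proof (induction k arbitrary: f g)
  case 0 then show ?case by (auto intro!: continuous_intros)
next
  case (Suc k)
  from Suc.prems obtain f' g' where f': "\<And>x. (f has_real_derivative f' x) (at x)" "Dk k f'"
    and g': "\<And>x. (g has_real_derivative g' x) (at x)" "Dk k g'" by auto
  have "Dk k (\<lambda>x. f' x * g x + f x * g' x)"
    using Dk_SucD[OF Suc.prems(1)] Dk_SucD[OF Suc.prems(2)] by (intro Dk_add Suc.IH f'(2) g'(2))
  then show ?case using f'(1) g'(1)
    by (auto intro!: exI[of _ "\<lambda>x. f' x * g x + f x * g' x"] derivative_eq_intros)
qed

lemma Dk_affine: "Dk k f \<Longrightarrow> Dk k (\<lambda>x. f (x * c + d))"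
proof (induction k arbitrary: f)
  case 0 then show ?case by (auto intro!: continuous_on_compose2[of UNIV f] continuous_intros)
next
  case (Suc k)
  then obtain f' where f': "\<And>x. (f has_real_derivative f' x) (at x)" "Dk k f'" by auto
  have "((\<lambda>x. f (x * c + d)) has_real_derivative f' (x * c + d) * c) (at x)" for x
    by (rule DERIV_chain2[OF f'(1)]) (auto intro!: derivative_eq_intros)
  then show ?case using Dk_cmult[OF Suc.IH[OF f'(2)], of c]
    by (intro Dk.simps(2)[THEN iffD2] exI[of _ "\<lambda>x. f' (x * c + d) * c"]) simp
qed

lemma Ck_on_Dk: "Dk k f \<Longrightarrow> Ck_on UNIV UNIV k f"
proof (induction k arbitrary: f)
  case 0 then show ?case by simp
next
  case (Suc k)
  then obtain f' where f': "\<And>x. (f has_real_derivative f' x) (at x)" "Dk k f'" by auto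
  then have fd: "frechet_derivative f (at x) = (\<lambda>v. f' x * v)" for x
    by (metis frechet_derivative_at has_field_derivative_def)
  have "f differentiable_on UNIV"
    using f'(1) by (auto simp: differentiable_on_def differentiable_def has_field_derivative_def)
  then show ?case using Suc.IH[OF Dk_cmult[OF f'(2)]] by (simp add: fd)
qed

lemma poly_exp_tendsto_0: "((\<lambda>y. poly p y * exp (-y)) \<longlongrightarrow> (0::real)) at_top"
proof -
  have "((\<lambda>y. \<Sum>i\<le>degree p. coeff p i * (y ^ i / exp y)) \<longlongrightarrow> (\<Sum>i\<le>degree p. coeff p i * 0)) at_top"
    by (intro tendsto_intros tendsto_power_div_exp_0)
  moreover have "(\<Sum>i\<le>degree p. coeff p i * (y ^ i / exp y)) = poly p y * exp (-y)" for y :: real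
    by (simp add: poly_altdef sum_distrib_right exp_minus divide_inverse mult.assoc)
  ultimately show ?thesis by simp
qed

text \<open>
  The functions \<open>p(1/x) exp(-1/x)\<close> are closed under differentiation when \<open>p\<close> ranges over the
  polynomials, which is why all derivatives of \<open>exp(-1/x)\<close> vanish at \<open>0\<close>.
\<close>

definition expinv :: "real poly \<Rightarrow> real \<Rightarrow> real" where
  "expinv p x = (if x > 0 then poly p (1/x) * exp (-(1/x)) else 0)"

lemma expinv_derivative:
  "(expinv p has_real_derivative expinv ([:0,0,1:] * (p - pderiv p)) x) (at x)"
proof -
  consider "x > 0" | "x < 0" | "x = 0" by linarith
  then show ?thesis
  proof cases
    case 1
    have "((\<lambda>x. poly p (1/x) * exp (-(1/x))) has_real_derivative expinv ([:0,0,1:] * (p - pderiv p)) x) (at x)"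
      using 1 by (auto intro!: derivative_eq_intros DERIV_chain2[OF poly_DERIV] simp: expinv_def field_simps power2_eq_square)
    then show ?thesis
      by (rule DERIV_cong_ev[THEN iffD1, OF refl _ refl, rotated])
         (use 1 eventually_nhds_in_open[of "{0<..}" x] in \<open>auto elim!: eventually_mono simp: expinv_def\<close>)
  next
    case 2
    have "((\<lambda>x. 0) has_real_derivative expinv ([:0,0,1:] * (p - pderiv p)) x) (at x)"
      using 2 by (auto simp: expinv_def)
    then show ?thesis
      by (rule DERIV_cong_ev[THEN iffD1, OF refl _ refl, rotated])
         (use 2 eventually_nhds_in_open[of "{..<0}" x] in \<open>auto elim!: eventually_mono simp: expinv_def\<close>)
  next
    case 3
    have "((\<lambda>h. expinv (pCons 0 p) h) \<longlongrightarrow> 0) (at 0)"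
    proof (rule filterlim_split_at)
      show "((\<lambda>h. expinv (pCons 0 p) h) \<longlongrightarrow> 0) (at_left 0)"
        by (rule tendsto_eventually) (auto simp: eventually_at_filter expinv_def)
      have "((\<lambda>h. poly (pCons 0 p) (inverse h) * exp (- inverse h)) \<longlongrightarrow> 0) (at_right 0)"
        by (rule filterlim_compose[OF poly_exp_tendsto_0 filterlim_inverse_at_top_right])
      then show "((\<lambda>h. expinv (pCons 0 p) h) \<longlongrightarrow> 0) (at_right 0)"
        by (rule Lim_transform_eventually) (auto simp: eventually_at_filter expinv_def inverse_eq_divide)
    qed
    then have "((\<lambda>h. (expinv p (0 + h) - expinv p 0) / h) \<longlongrightarrow> 0) (at 0)"
      by (rule Lim_transform_eventually) (auto simp: eventually_at_filter expinv_def)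
    then show ?thesis using 3 by (simp add: DERIV_def expinv_def)
  qed
qed

lemma Dk_expinv: "Dk k (expinv p)"
proof (induction k arbitrary: p)
  case 0 then show ?case using expinv_derivative[of p] by (auto intro!: DERIV_continuous_on)
next
  case (Suc k) then show ?case using expinv_derivative[of p] by auto
qed

lemma antiderivative_exists:
  assumes "continuous_on UNIV (f :: real \<Rightarrow> real)"
  obtains F where "\<And>x. (F has_real_derivative f x) (at x)" "F c = 0"
proof -
  have "\<exists>F. \<forall>x. (-\<infinity>::ereal) < x \<longrightarrow> x < (\<infinity>::ereal) \<longrightarrow> (F has_vector_derivative f x) (at x)"
    using assms by (intro einterval_antiderivative) (auto simp: continuous_on_eq_continuous_at)
  then obtain F where "\<And>x. (F has_vector_derivative f x) (at x)" by auto
  then have "\<And>x. ((\<lambda>x. F x - F c) has_real_derivative f x) (at x)"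
    by (auto intro!: derivative_eq_intros simp: has_real_derivative_iff_has_vector_derivative)
  then show thesis using that[of "\<lambda>x. F x - F c"] by simp
qed

text \<open>
  A bump function \<open>\<Phi>\<close> on \<open>{-1..1}\<close> together with a first and a second antiderivative that vanish to the
  left of \<open>-1\<close>. To the right of \<open>1\<close> the second one is affine with slope the mass \<open>m\<close> of \<open>\<Phi>\<close>; suitable
  combinations of its translates are therefore test functions whose second derivatives are
  combinations of bumps.
\<close>

lemma bump_exists:
  obtains \<Phi> \<Phi>1 \<Phi>2 m where "\<And>x. (\<Phi>1 has_real_derivative \<Phi> x) (at x)"
    "\<And>x. (\<Phi>2 has_real_derivative \<Phi>1 x) (at x)"
    "\<And>k. Dk k \<Phi>2" "\<And>k. Dk k \<Phi>" "\<And>x. \<Phi> x \<ge> 0" "\<And>x. \<bar>x\<bar> \<ge> 1 \<Longrightarrow> \<Phi> x = 0" "m > (0::real)"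
    "\<And>x. x \<le> -1 \<Longrightarrow> \<Phi>1 x = 0" "\<And>x. x \<ge> 1 \<Longrightarrow> \<Phi>1 x = m"
    "\<And>x. x \<le> -1 \<Longrightarrow> \<Phi>2 x = 0" "\<And>x. x \<ge> 1 \<Longrightarrow> \<Phi>2 x = \<Phi>2 1 + m * (x - 1)"
proof -
  define \<Phi> where "\<Phi> x = expinv 1 (x * 1 + 1) * expinv 1 (x * (-1) + 1)" for x
  have D: "Dk k \<Phi>" for k unfolding \<Phi>_def by (intro Dk_mult Dk_affine Dk_expinv)
  have pos: "\<Phi> x \<ge> 0" for x by (auto simp: \<Phi>_def expinv_def)
  have z: "\<Phi> x = 0" if "\<bar>x\<bar> \<ge> 1" for x using that by (auto simp: \<Phi>_def expinv_def)
  have p0: "\<Phi> x > 0" if "\<bar>x\<bar> < 1" for x using that by (auto simp: \<Phi>_def expinv_def)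
  obtain \<Phi>1 where \<Phi>1: "\<And>x. (\<Phi>1 has_real_derivative \<Phi> x) (at x)" "\<Phi>1 (-1) = 0"
    using antiderivative_exists[OF Dk_continuous[OF D]] by blast
  have c1: "continuous_on UNIV \<Phi>1" using \<Phi>1(1) by (auto intro!: DERIV_continuous_on)
  obtain \<Phi>2 where \<Phi>2: "\<And>x. (\<Phi>2 has_real_derivative \<Phi>1 x) (at x)" "\<Phi>2 (-1) = 0"
    using antiderivative_exists[OF c1] by blast
  have const: "F x = F y" if "x \<le> y" "\<And>z. (F has_real_derivative f z) (at z)" "\<And>z. x \<le> z \<Longrightarrow> z \<le> y \<Longrightarrow> f z = 0" for F f :: "real \<Rightarrow> real" and x y
  proof (cases "x = y")
    case False
    then have "x < y" using that(1) by simp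
    from MVT2[OF this that(2)] obtain z where "x < z" "z < y" "F y - F x = (y - x) * f z" by blast
    then show ?thesis using that by auto
  qed auto
  have a1: "\<Phi>1 x = 0" if "x \<le> -1" for x
    using const[of x "-1" \<Phi>1 \<Phi>] that \<Phi>1 z by auto
  have a2: "\<Phi>1 x = \<Phi>1 1" if "x \<ge> 1" for x
    using const[of 1 x \<Phi>1 \<Phi>] that \<Phi>1 z by auto
  have m: "\<Phi>1 1 > 0"
  proof -
    obtain z where "-1 < z" "z < 1" "\<Phi>1 1 - \<Phi>1 (-1) = (1 - (-1)) * \<Phi> z"
      using MVT2[of "-1" 1 \<Phi>1 \<Phi>] \<Phi>1 by auto
    then show ?thesis using p0[of z] \<Phi>1(2) by simp
  qed
  have b1: "\<Phi>2 x = 0" if "x \<le> -1" for x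
    using const[of x "-1" \<Phi>2 \<Phi>1] that \<Phi>2 a1 by auto
  have b2: "\<Phi>2 x = \<Phi>2 1 + \<Phi>1 1 * (x - 1)" if "x \<ge> 1" for x
  proof -
    have "(\<lambda>z. \<Phi>2 z - \<Phi>1 1 * (z - 1)) 1 = (\<lambda>z. \<Phi>2 z - \<Phi>1 1 * (z - 1)) x"
    proof (rule const[where f="\<lambda>z. \<Phi>1 z - \<Phi>1 1" and F="\<lambda>z. \<Phi>2 z - \<Phi>1 1 * (z - 1)"])
      show "((\<lambda>z. \<Phi>2 z - \<Phi>1 1 * (z - 1)) has_real_derivative \<Phi>1 z - \<Phi>1 1) (at z)" for z
        by (auto intro!: derivative_eq_intros \<Phi>2(1))
      show "\<Phi>1 z - \<Phi>1 1 = 0" if "1 \<le> z" "z \<le> x" for z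
        unfolding a2[OF that(1)] by simp
    qed (use that in auto)
    then show ?thesis by simp
  qed
  have D2: "Dk k \<Phi>2" for k
  proof -
    have "Dk (Suc (Suc k)) \<Phi>2" using D[of k] \<Phi>1(1) \<Phi>2(1) by auto
    then show ?thesis by (rule Dk_SucD[OF Dk_SucD])
  qed
  show thesis using that[OF \<Phi>1(1) \<Phi>2(1) D2 D pos z m a1 a2 b1 b2] by blast
qed

section \<open>Weak derivatives\<close>

lemma smooth_real_deriv:
  assumes "smooth_on UNIV UNIV (\<psi> :: real \<Rightarrow> real)"
  shows "(\<psi> has_real_derivative deriv \<psi> x) (at x)" "smooth_on UNIV UNIV (deriv \<psi>)"
proof -
  have d: "\<psi> differentiable (at x)" for x
    using assms[unfolded smooth_on_def, rule_format, of 1] by (simp add: differentiable_on_def)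
  then show h: "(\<psi> has_real_derivative deriv \<psi> x) (at x)" for x
    by (metis DERIV_deriv_iff_real_differentiable)
  have "frechet_derivative \<psi> (at x) 1 = deriv \<psi> x" for x
    using frechet_derivative_at[OF h[of x, unfolded has_field_derivative_def]] by (metis mult.right_neutral)
  then show "smooth_on UNIV UNIV (deriv \<psi>)"
    using assms unfolding smooth_on_def
    by (metis (no_types, lifting) Ck_on.simps(2) UNIV_I ext)
qed

lemma test_function_deriv:
  assumes "test_function a b \<psi>" shows "test_function a b (deriv \<psi>)"
proof -
  from assms obtain K where K: "smooth_on UNIV UNIV \<psi>" "compact K" "K \<subseteq> {a<..<b}" "\<And>t. t \<notin> K \<Longrightarrow> \<psi> t = 0"
    by (auto simp: test_function_def)
  have "deriv \<psi> t = 0" if t: "t \<notin> K" for t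
  proof -
    have "\<forall>\<^sub>F x in nhds t. 0 = \<psi> x"
      using eventually_nhds_in_open[of "- K" t] K(2,4) t by (auto elim!: eventually_mono simp: compact_imp_closed open_Compl)
    then have "(\<psi> has_real_derivative 0) (at t)"
      by (rule DERIV_cong_ev[THEN iffD1, OF refl _ refl]) simp
    then show ?thesis by (rule DERIV_imp_deriv)
  qed
  then show ?thesis using K smooth_real_deriv(2) by (auto simp: test_function_def)
qed

text \<open>
  A test function vanishes in neighbourhoods of the endpoints, hence integration by parts on \<open>{a..b}\<close>
  produces no boundary terms.
\<close>

lemma test_function_AC:
  assumes "test_function a b \<psi>"
  shows "AC_rep a b \<psi> (deriv \<psi>)" "\<psi> a = 0" "\<psi> b = 0" "continuous_on S \<psi>" "continuous_on S (deriv \<psi>)"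
proof -
  have s: "smooth_on UNIV UNIV \<psi>" "smooth_on UNIV UNIV (deriv \<psi>)"
    using assms test_function_deriv[OF assms] by (auto simp: test_function_def)
  then show c: "continuous_on S \<psi>" "continuous_on S (deriv \<psi>)" for S
    unfolding smooth_on_def by (metis Ck_on.simps(1) continuous_on_subset top_greatest)+
  show "AC_rep a b \<psi> (deriv \<psi>)"
    using smooth_real_deriv(1)[OF s(1)] c
    by (intro AC_rep_C1) (auto simp: has_real_derivative_iff_has_vector_derivative intro: has_vector_derivative_at_within)
  show "\<psi> a = 0" "\<psi> b = 0" using assms by (auto simp: test_function_def)
qed

lemma LINT_eq_integral:
  fixes f :: "real \<Rightarrow> 'b::euclidean_space"
  assumes "f absolutely_integrable_on {a..b}"
  shows "integrable (lebesgue_on {a..b}) f" "(LINT t|lebesgue_on {a..b}. f t) = integral {a..b} f"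
proof -
  show i: "integrable (lebesgue_on {a..b}) f"
    using assms by (simp add: integrable_restrict_space set_integrable_def)
  then show "(LINT t|lebesgue_on {a..b}. f t) = integral {a..b} f"
    by (rule lebesgue_integral_eq_integral) simp
qed

lemma abs_integrable_continuous_scaleR:
  fixes f :: "real \<Rightarrow> 'b::euclidean_space"
  assumes "continuous_on {a..b} (\<phi> :: real \<Rightarrow> real)" "f absolutely_integrable_on {a..b}"
  shows "(\<lambda>t. \<phi> t *\<^sub>R f t) absolutely_integrable_on {a..b}"
  using assms
  by (intro absolutely_integrable_bounded_measurable_product[where h="(*\<^sub>R)"])
     (auto simp: bilinear_conv_bounded_bilinear bounded_bilinear_scaleR intro!: continuous_imp_measurable_on_sets_lebesgue compact_imp_bounded compact_continuous_image)

lemma AC_rep_weak_deriv: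
  fixes f :: "real \<Rightarrow> 'b::euclidean_space"
  assumes "AC_rep a b f \<alpha>" "a \<le> b" shows "weak_deriv_on a b f \<alpha>"
  unfolding weak_deriv_on_def
proof (intro allI impI)
  fix \<psi> assume \<psi>: "test_function a b \<psi>"
  note t = test_function_AC[OF \<psi>]
  note P = AC_rep_bilinear[OF bounded_bilinear_scaleR t(1) assms(1)]
  have "integral {a..b} (\<lambda>t. \<psi> t *\<^sub>R \<alpha> t + deriv \<psi> t *\<^sub>R f t) = 0"
    using AC_rep_increment[OF P order_refl assms(2) order_refl] t(2,3) by simp
  moreover have a1: "(\<lambda>t. \<psi> t *\<^sub>R \<alpha> t) absolutely_integrable_on {a..b}"
    by (intro abs_integrable_continuous_scaleR t AC_repD_abs[OF assms(1)])
  moreover have a2: "(\<lambda>t. deriv \<psi> t *\<^sub>R f t) absolutely_integrable_on {a..b}"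
    by (intro abs_integrable_continuous_scaleR t absolutely_integrable_continuous_real AC_rep_continuous[OF assms(1)])
  ultimately have "integral {a..b} (\<lambda>t. \<psi> t *\<^sub>R \<alpha> t) + integral {a..b} (\<lambda>t. deriv \<psi> t *\<^sub>R f t) = 0"
    by (simp add: absolutely_integrable_on_def Henstock_Kurzweil_Integration.integral_add)
  then show "(LINT t|lebesgue_on {a..b}. deriv \<psi> t *\<^sub>R f t) = - (LINT t|lebesgue_on {a..b}. \<psi> t *\<^sub>R \<alpha> t)"
    using LINT_eq_integral(2)[OF a1] LINT_eq_integral(2)[OF a2] by (simp add: eq_neg_iff_add_eq_0 add.commute)
qed

text \<open>
  The lemma of du Bois-Reymond for second derivatives. For interior points \<open>r, r'\<close> and
  \<open>s = l r + (1 - l) r'\<close>, the function \<open>\<psi>\<close> that combines the second antiderivatives of bumps of width \<open>e\<close>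
  at \<open>r, s, r'\<close> with weights \<open>l, -1, 1 - l\<close> is a test function: to the right of all three points the
  affine parts cancel, as the weights have zero sum and zero first moment. Testing with \<open>\<psi>\<close> says that the
  mollifications of \<open>u\<close> satisfy the affine relation, and \<open>e \<rightarrow> 0\<close> gives it for \<open>u\<close>.
\<close>

lemma weakly_affine:
  fixes u :: "real \<Rightarrow> 'b::euclidean_space"
  assumes ab: "a < b" and u: "continuous_on {a..b} u"
    and w: "\<And>\<psi>. test_function a b \<psi> \<Longrightarrow> (LINT t|lebesgue_on {a..b}. deriv (deriv \<psi>) t *\<^sub>R u t) = 0"
    and t: "a \<le> t" "t \<le> b"
  shows "u t = u a + ((t - a) / (b - a)) *\<^sub>R (u b - u a)"
proof -
  obtain \<Phi> \<Phi>1 \<Phi>2 m where \<Phi>: "\<And>x. (\<Phi>1 has_real_derivative \<Phi> x) (at x)"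
    "\<And>x. (\<Phi>2 has_real_derivative \<Phi>1 x) (at x)"
    "\<And>k. Dk k \<Phi>2" "\<And>k. Dk k \<Phi>" "\<And>x. \<Phi> x \<ge> 0" "\<And>x. \<bar>x\<bar> \<ge> 1 \<Longrightarrow> \<Phi> x = 0" "m > (0::real)"
    "\<And>x. x \<le> -1 \<Longrightarrow> \<Phi>1 x = 0" "\<And>x. x \<ge> 1 \<Longrightarrow> \<Phi>1 x = m"
    "\<And>x. x \<le> -1 \<Longrightarrow> \<Phi>2 x = 0" "\<And>x. x \<ge> 1 \<Longrightarrow> \<Phi>2 x = \<Phi>2 1 + m * (x - 1)"
    by (rule bump_exists) blast
  have c\<Phi>: "continuous_on S \<Phi>" for S using Dk_continuous[OF \<Phi>(4)] continuous_on_subset by blast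
  have cS: "continuous_on S (\<lambda>t. \<Phi> ((t - r) / e))" if "e > 0" for S r e
    by (rule continuous_on_compose2[OF c\<Phi>[of UNIV]]) (use that in \<open>auto intro!: continuous_intros\<close>)
  \<comment> \<open>The mollification of \<open>u\<close> at \<open>r\<close>, up to the normalizing factor \<open>e * m\<close>, is close to \<open>u r\<close>.\<close>
  have mol: "norm ((LINT t|lebesgue_on {a..b}. \<Phi> ((t - r) / e) *\<^sub>R u t) - (e * m) *\<^sub>R u r) \<le> \<eta> * (e * m)"
    if e: "e > 0" "a < r - e" "r + e < b" and close: "\<And>t. \<bar>t - r\<bar> < e \<Longrightarrow> norm (u t - u r) \<le> \<eta>" for r e \<eta>
  proof -
    have "((\<lambda>t. \<Phi> ((t - r) / e)) has_integral e * \<Phi>1 ((b - r) / e) - e * \<Phi>1 ((a - r) / e)) {a..b}"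
    proof (rule fundamental_theorem_of_calculus)
      fix x assume "x \<in> {a..b}"
      have "((\<lambda>t. e * \<Phi>1 ((t - r) / e)) has_real_derivative e * (\<Phi> ((x - r) / e) * (1 / e))) (at x)"
        using e by (auto intro!: derivative_eq_intros DERIV_chain2[OF \<Phi>(1)])
      then show "((\<lambda>t. e * \<Phi>1 ((t - r) / e)) has_vector_derivative \<Phi> ((x - r) / e)) (at x within {a..b})"
        using e by (auto simp: has_real_derivative_iff_has_vector_derivative[symmetric] intro: has_field_derivative_at_within)
    qed (use ab in auto)
    moreover have "(b - r) / e \<ge> 1" "(a - r) / e \<le> -1" using e by (auto simp: field_simps)
    ultimately have hi: "integral {a..b} (\<lambda>t. \<Phi> ((t - r) / e)) = e * m"
      using \<Phi>(8,9) by (simp add: integral_unique)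
    have a1: "(\<lambda>t. \<Phi> ((t - r) / e) *\<^sub>R u t) absolutely_integrable_on {a..b}"
      by (intro abs_integrable_continuous_scaleR cS e absolutely_integrable_continuous_real u)
    have a2: "(\<lambda>t. \<Phi> ((t - r) / e) *\<^sub>R u r) absolutely_integrable_on {a..b}"
      by (intro abs_integrable_continuous_scaleR cS e absolutely_integrable_continuous_real continuous_on_const)
    have "integral {a..b} (\<lambda>t. \<Phi> ((t - r) / e) *\<^sub>R u r) = (e * m) *\<^sub>R u r"
      using has_integral_scaleR_left[OF integrable_integral[OF integrable_continuous_interval[OF cS[OF e(1)]]], where c="u r"] hi
      by (metis integral_unique)
    then have "(LINT t|lebesgue_on {a..b}. \<Phi> ((t - r) / e) *\<^sub>R u t) - (e * m) *\<^sub>R u r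
       = integral {a..b} (\<lambda>t. \<Phi> ((t - r) / e) *\<^sub>R u t - \<Phi> ((t - r) / e) *\<^sub>R u r)"
      using a1 a2 by (simp add: LINT_eq_integral(2)[OF a1] absolutely_integrable_on_def Henstock_Kurzweil_Integration.integral_diff)
    also have "norm \<dots> \<le> integral {a..b} (\<lambda>t. \<eta> * \<Phi> ((t - r) / e))"
    proof (rule integral_norm_bound_integral)
      show "(\<lambda>t. \<Phi> ((t - r) / e) *\<^sub>R u t - \<Phi> ((t - r) / e) *\<^sub>R u r) integrable_on {a..b}"
        using a1 a2 by (auto simp: absolutely_integrable_on_def intro!: integrable_diff)
      show "(\<lambda>t. \<eta> * \<Phi> ((t - r) / e)) integrable_on {a..b}"
        by (intro integrable_continuous_interval continuous_intros cS e)
      fix x assume "x \<in> {a..b}"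
      show "norm (\<Phi> ((x - r) / e) *\<^sub>R u x - \<Phi> ((x - r) / e) *\<^sub>R u r) \<le> \<eta> * \<Phi> ((x - r) / e)"
      proof (cases "\<bar>x - r\<bar> < e")
        case True
        have "norm (\<Phi> ((x - r) / e) *\<^sub>R u x - \<Phi> ((x - r) / e) *\<^sub>R u r) = \<Phi> ((x - r) / e) * norm (u x - u r)"
          using \<Phi>(5) by (simp flip: scaleR_diff_right)
        also have "\<dots> \<le> \<Phi> ((x - r) / e) * \<eta>" using close[OF True] \<Phi>(5) by (rule mult_left_mono)
        finally show ?thesis by (simp add: mult.commute)
      next
        case False
        then have "\<bar>(x - r) / e\<bar> \<ge> 1" using e by (simp add: field_simps)
        then show ?thesis using \<Phi>(6) by simp
      qed
    qed
    also have "\<dots> = \<eta> * (e * m)" using hi by simp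
    finally show ?thesis .
  qed
  have aff: "u s = l *\<^sub>R u r + (1 - l) *\<^sub>R u r'"
    if r: "a < r" "r < b" "a < r'" "r' < b" and l: "0 \<le> l" "l \<le> 1" and s: "s = l * r + (1 - l) * r'" for r r' l s
  proof -
    have sab: "a < s" "s < b"
    proof -
      have "s \<le> max r r'" "min r r' \<le> s" unfolding s
        using l convex_bound_le[of r "max r r'" r' l "1-l"] convex_bound_le[of "-r" "- min r r'" "-r'" l "1-l"] by auto
      then show "a < s" "s < b" using r by auto
    qed
    have "norm (u s - (l *\<^sub>R u r + (1 - l) *\<^sub>R u r')) \<le> \<eta> + \<eta>" if "\<eta> > 0" for \<eta>
    proof -
      have "\<forall>p\<in>{r,s,r'}. \<exists>d>0. \<forall>t. \<bar>t - p\<bar> < d \<longrightarrow> norm (u t - u p) \<le> \<eta>"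
      proof
        fix p assume "p \<in> {r,s,r'}"
        then have "a < p" "p < b" using r sab by auto
        then have "isCont u p" using u by (intro continuous_on_interior) auto
        then show "\<exists>d>0. \<forall>t. \<bar>t - p\<bar> < d \<longrightarrow> norm (u t - u p) \<le> \<eta>"
          unfolding continuous_at_eps_delta using \<open>\<eta> > 0\<close> by (metis dist_norm less_imp_le real_norm_def)
      qed
      then obtain d where d: "\<And>p. p \<in> {r,s,r'} \<Longrightarrow> d p > 0" "\<And>p t. p \<in> {r,s,r'} \<Longrightarrow> \<bar>t - p\<bar> < d p \<Longrightarrow> norm (u t - u p) \<le> \<eta>"
        by metis
      define e where "e = Min ({d r, d s, d r'} \<union> {(r - a)/2, (s - a)/2, (r' - a)/2, (b - r)/2, (b - s)/2, (b - r')/2})"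
      have e0: "e > 0" unfolding e_def using d(1) r sab by (subst Min_gr_iff) auto
      have ele: "e \<le> d r" "e \<le> d s" "e \<le> d r'" "e \<le> (r - a)/2" "e \<le> (s - a)/2" "e \<le> (r' - a)/2" "e \<le> (b - r)/2" "e \<le> (b - s)/2" "e \<le> (b - r')/2"
        unfolding e_def by (rule Min_le; simp)+
      define J where "J p = (LINT t|lebesgue_on {a..b}. \<Phi> ((t - p) / e) *\<^sub>R u t)" for p
      have Jb: "norm (J p - (e * m) *\<^sub>R u p) \<le> \<eta> * (e * m)" if "p \<in> {r,s,r'}" for p
        unfolding J_def using that d(2) ele r sab e0 by (intro mol) auto
      define \<psi> where "\<psi> t = \<Phi>2 (t * (1/e) + (- r/e)) * l + (\<Phi>2 (t * (1/e) + (- s/e)) * (-1) + \<Phi>2 (t * (1/e) + (- r'/e)) * (1 - l))" for t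
      have sm: "smooth_on UNIV UNIV \<psi>"
        unfolding smooth_on_def \<psi>_def by (intro allI Ck_on_Dk Dk_add Dk_cmult Dk_affine \<Phi>(3))
      define K where "K = {min r r' - e .. max r r' + e}"
      have srr: "s \<le> max r r'" "min r r' \<le> s" unfolding s
        using l convex_bound_le[of r "max r r'" r' l "1-l"] convex_bound_le[of "-r" "- min r r'" "-r'" l "1-l"] by auto
      have sK: "\<psi> t = 0" if t: "t \<notin> K" for t
      proof -
        consider "t < min r r' - e" | "t > max r r' + e" using t by (force simp: K_def)
        then show ?thesis
        proof cases
          case 1
          then have "t * (1/e) + (- r/e) \<le> -1" "t * (1/e) + (- s/e) \<le> -1" "t * (1/e) + (- r'/e) \<le> -1"
            using e0 srr by (auto simp: field_simps min_def split: if_splits)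
          then show ?thesis by (simp add: \<psi>_def \<Phi>(10))
        next
          case 2
          then have g: "t * (1/e) + (- r/e) \<ge> 1" "t * (1/e) + (- s/e) \<ge> 1" "t * (1/e) + (- r'/e) \<ge> 1"
            using e0 srr by (auto simp: field_simps max_def split: if_splits)
          show ?thesis unfolding \<psi>_def \<Phi>(11)[OF g(1)] \<Phi>(11)[OF g(2)] \<Phi>(11)[OF g(3)]
            using e0 by (simp add: s field_simps)
        qed
      qed
      have tf: "test_function a b \<psi>"
        unfolding test_function_def using sm sK r ele e0
        by (intro conjI exI[of _ K]) (auto simp: K_def min_def max_def field_simps split: if_splits)
      have aff_deriv: "((\<lambda>t. F (t * (1/e) + (- p/e))) has_real_derivative f (t * (1/e) + (- p/e)) * (1/e)) (at t)"
        if "\<And>x. (F has_real_derivative f x) (at x)" for F f :: "real \<Rightarrow> real" and p t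
        by (rule DERIV_chain2[OF that]) (use e0 in \<open>auto intro!: derivative_eq_intros\<close>)
      note comb = DERIV_add[OF DERIV_cmult_right DERIV_add[OF DERIV_cmult_right DERIV_cmult_right]]
      have d1: "deriv \<psi> = (\<lambda>t. (\<Phi>1 (t * (1/e) + (- r/e)) * l + (\<Phi>1 (t * (1/e) + (- s/e)) * (-1) + \<Phi>1 (t * (1/e) + (- r'/e)) * (1 - l))) * (1/e))"
        unfolding \<psi>_def
        by (rule ext, rule DERIV_imp_deriv, rule DERIV_cong[OF comb[OF aff_deriv[OF \<Phi>(2)] aff_deriv[OF \<Phi>(2)] aff_deriv[OF \<Phi>(2)]]])
           (simp add: algebra_simps diff_divide_distrib)
      have d2: "deriv (deriv \<psi>) = (\<lambda>t. (\<Phi> ((t - r) / e) * l + (\<Phi> ((t - s) / e) * (-1) + \<Phi> ((t - r') / e) * (1 - l))) * (1/e^2))"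
        unfolding d1
        by (rule ext, rule DERIV_imp_deriv, rule DERIV_cong[OF DERIV_cmult_right[OF comb[OF aff_deriv[OF \<Phi>(1)] aff_deriv[OF \<Phi>(1)] aff_deriv[OF \<Phi>(1)]]]])
           (use e0 in \<open>simp add: algebra_simps power2_eq_square diff_divide_distrib\<close>)
      have i: "integrable (lebesgue_on {a..b}) (\<lambda>t. \<Phi> ((t - p) / e) *\<^sub>R u t)" for p
        by (intro LINT_eq_integral(1) abs_integrable_continuous_scaleR cS e0 absolutely_integrable_continuous_real u)
      have "0 = (LINT t|lebesgue_on {a..b}. deriv (deriv \<psi>) t *\<^sub>R u t)" using w[OF tf] by simp
      also have "\<dots> = (LINT t|lebesgue_on {a..b}. (1/e^2) *\<^sub>R (l *\<^sub>R (\<Phi> ((t - r) / e) *\<^sub>R u t) + ((-1) *\<^sub>R (\<Phi> ((t - s) / e) *\<^sub>R u t) + (1 - l) *\<^sub>R (\<Phi> ((t - r') / e) *\<^sub>R u t))))"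
        unfolding d2 by (intro Bochner_Integration.integral_cong) (auto simp: algebra_simps)
      also have "\<dots> = (1/e^2) *\<^sub>R (l *\<^sub>R J r + ((-1) *\<^sub>R J s + (1 - l) *\<^sub>R J r'))"
        unfolding J_def using i by (simp del: scaleR_scaleR)
      finally have "l *\<^sub>R J r + ((-1) *\<^sub>R J s + (1 - l) *\<^sub>R J r') = 0" using e0 by simp
      then have "(e * m) *\<^sub>R (u s - (l *\<^sub>R u r + (1 - l) *\<^sub>R u r'))
         = l *\<^sub>R (J r - (e * m) *\<^sub>R u r) + (1 - l) *\<^sub>R (J r' - (e * m) *\<^sub>R u r') - (J s - (e * m) *\<^sub>R u s)"
        by (simp add: algebra_simps)
      then have "(e * m) * norm (u s - (l *\<^sub>R u r + (1 - l) *\<^sub>R u r'))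
         = norm (l *\<^sub>R (J r - (e * m) *\<^sub>R u r) + (1 - l) *\<^sub>R (J r' - (e * m) *\<^sub>R u r') - (J s - (e * m) *\<^sub>R u s))"
        using e0 \<Phi>(7) by (metis abs_of_pos mult_pos_pos norm_scaleR)
      also have "\<dots> \<le> (l * (\<eta> * (e * m)) + (1 - l) * (\<eta> * (e * m))) + \<eta> * (e * m)"
      proof -
        have tri: "norm (p + q - z) \<le> (norm p + norm q) + norm z" for p q z :: 'b
          by (rule order_trans[OF norm_triangle_ineq4 add_right_mono[OF norm_triangle_ineq]])
        have sc: "norm (c *\<^sub>R p) \<le> c * B" if "c \<ge> 0" "norm p \<le> B" for c B and p :: 'b
          using that by (simp add: mult_left_mono)
        show ?thesis
          by (rule order_trans[OF tri], intro add_mono sc Jb) (use l in auto)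
      qed
      also have "\<dots> = (e * m) * (\<eta> + \<eta>)" by (simp add: algebra_simps)
      finally show ?thesis using e0 \<Phi>(7) by simp
    qed
    from this[of "norm (u s - (l *\<^sub>R u r + (1 - l) *\<^sub>R u r')) / 4"] show ?thesis by fastforce
  qed
  define l where "l = (b - t) / (b - a)"
  have lb: "l * (b - a) = b - t" using ab by (simp add: l_def)
  have l: "0 \<le> l" "l \<le> 1" using t ab by (auto simp: l_def field_simps)
  have l3: "t = l * a + (1 - l) * b" using lb by (simp add: algebra_simps)
  \<comment> \<open>The affine relation is known for interior points only; the endpoints are reached by continuity.
    The offset \<open>3\<close> keeps the shifted endpoints inside the interval.\<close>
  define q where "q n = (b - a) / (real n + 3)" for n
  have q: "0 < q n" "q n < b - a" "q \<longlonglongrightarrow> 0" for n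
  proof -
    show "0 < q n" using ab by (auto simp: q_def)
    have "(b - a) / (real n + 3) < (b - a) / 1" using ab by (intro divide_strict_left_mono) auto
    then show "q n < b - a" by (simp add: q_def)
    show "q \<longlonglongrightarrow> 0" unfolding q_def by real_asymp
  qed
  have ua: "(\<lambda>n. u (a + q n)) \<longlonglongrightarrow> u a"
    by (rule continuous_on_tendsto_compose[OF u]) (use q ab in \<open>auto intro!: tendsto_eq_intros always_eventually less_imp_le simp: add.commute less_diff_eq\<close>)
  have ub: "(\<lambda>n. u (b - q n)) \<longlonglongrightarrow> u b"
    by (rule continuous_on_tendsto_compose[OF u]) (use q ab in \<open>auto intro!: tendsto_eq_intros always_eventually less_imp_le simp: algebra_simps\<close>)
  define s where "s n = l * (a + q n) + (1 - l) * (b - q n)" for n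
  have sab: "s n \<in> {a..b}" for n
  proof -
    have "s n \<le> b" unfolding s_def
      using l convex_bound_le[of "a + q n" b "b - q n" l "1 - l"] q(1,2)[of n] by auto
    moreover have "a \<le> s n"
      using l convex_bound_le[of "-(a + q n)" "-a" "-(b - q n)" l "1 - l"] q(1,2)[of n]
      by (simp add: s_def algebra_simps)
    ultimately show ?thesis by simp
  qed
  have us: "(\<lambda>n. u (s n)) \<longlonglongrightarrow> u t"
  proof (rule continuous_on_tendsto_compose[OF u])
    show "s \<longlonglongrightarrow> t" unfolding s_def by (subst l3) (auto intro!: tendsto_eq_intros q(3))
  qed (use t sab in auto)
  have "u (s n) = l *\<^sub>R u (a + q n) + (1 - l) *\<^sub>R u (b - q n)" for n
    by (rule aff) (use q(1,2)[of n] l in \<open>auto simp: s_def\<close>)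
  then have "(\<lambda>n. l *\<^sub>R u (a + q n) + (1 - l) *\<^sub>R u (b - q n)) \<longlonglongrightarrow> u t" using us by simp
  moreover have "(\<lambda>n. l *\<^sub>R u (a + q n) + (1 - l) *\<^sub>R u (b - q n)) \<longlonglongrightarrow> l *\<^sub>R u a + (1 - l) *\<^sub>R u b"
    by (intro tendsto_intros ua ub)
  ultimately have "u t = l *\<^sub>R u a + (1 - l) *\<^sub>R u b" using LIMSEQ_unique by blast
  moreover have "(t - a) / (b - a) = 1 - l" using ab by (simp add: l_def field_simps)
  ultimately show ?thesis by (simp only:) (simp add: algebra_simps)
qed

section \<open>Functions of class H2\<close>

text \<open>
  A function of class \<open>H\<^sup>2\<close> together with its derivative \<open>v\<close>, which is continuous, and its second
  derivative \<open>h\<close> in \<open>L\<^sup>2\<close>.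
\<close>

definition H2_rep :: "real \<Rightarrow> real \<Rightarrow> (real \<Rightarrow> 'a::euclidean_space) \<Rightarrow> (real \<Rightarrow> 'a) \<Rightarrow> (real \<Rightarrow> 'a) \<Rightarrow> bool" where
  "H2_rep a b f v h \<longleftrightarrow> AC_rep a b f v \<and> AC_rep a b v h \<and> L2_on a b h"

lemma L2_on_continuous:
  fixes f :: "real \<Rightarrow> 'b::euclidean_space"
  assumes "continuous_on {a..b} f" shows "L2_on a b f"
  unfolding L2_on_def
proof
  show "f \<in> borel_measurable (lebesgue_on {a..b})"
    using assms by (auto intro!: continuous_imp_measurable_on_sets_lebesgue)
  show "integrable (lebesgue_on {a..b}) (\<lambda>t. (norm (f t))\<^sup>2)"
    by (intro LINT_eq_integral(1) absolutely_integrable_continuous_real continuous_intros assms)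
qed

lemma H2_rep_imp_H2_on:
  assumes "H2_rep a b f v h" "a \<le> b" shows "H2_on a b f"
  unfolding H2_on_def
  using assms AC_rep_weak_deriv[of a b f v] AC_rep_weak_deriv[of a b v h] AC_rep_continuous[of a b f v] AC_rep_continuous[of a b v h]
  by (intro exI[of _ v] exI[of _ h]) (auto simp: H2_rep_def intro: L2_on_continuous)

text \<open>
  Subtracting the twofold integral of the second weak derivative leaves a continuous function whose
  second weak derivative is \<open>0\<close>, and such a function is affine. Continuity is needed because weak
  derivatives determine a function only almost everywhere.
\<close>

lemma H2_on_imp_H2_rep:
  assumes "H2_on a b f" "a < b" "continuous_on {a..b} f"
  obtains v h where "H2_rep a b f v h"
proof -
  from assms(1) obtain f' f'' where L: "L2_on a b f'" "L2_on a b f''"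
    and w: "weak_deriv_on a b f f'" "weak_deriv_on a b f' f''" by (auto simp: H2_on_def)
  define G where "G t = integral {a..t} f''" for t
  define H where "H t = integral {a..t} G" for t
  have G: "AC_rep a b G f''" using L2_on_abs[OF L(2)] by (intro AC_repI) (auto simp: G_def)
  have cG: "continuous_on {a..b} G" using AC_rep_continuous[OF G] .
  have H: "AC_rep a b H G" using cG by (intro AC_repI absolutely_integrable_continuous_real) (auto simp: H_def)
  have cH: "continuous_on {a..b} H" using AC_rep_continuous[OF H] .
  define u where "u t = f t - H t" for t
  have cu: "continuous_on {a..b} u" unfolding u_def by (intro continuous_intros assms cH)
  have wu: "(LINT t|lebesgue_on {a..b}. deriv (deriv \<psi>) t *\<^sub>R u t) = 0" if \<psi>: "test_function a b \<psi>" for \<psi>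
  proof -
    have \<psi>': "test_function a b (deriv \<psi>)" by (rule test_function_deriv[OF \<psi>])
    have "(LINT t|lebesgue_on {a..b}. deriv (deriv \<psi>) t *\<^sub>R f t) = (LINT t|lebesgue_on {a..b}. \<psi> t *\<^sub>R f'' t)"
      using w \<psi> \<psi>' by (simp add: weak_deriv_on_def)
    moreover have "(LINT t|lebesgue_on {a..b}. deriv (deriv \<psi>) t *\<^sub>R H t) = (LINT t|lebesgue_on {a..b}. \<psi> t *\<^sub>R f'' t)"
      using AC_rep_weak_deriv[OF H] AC_rep_weak_deriv[OF G] \<psi> \<psi>' assms(2) by (simp add: weak_deriv_on_def)
    moreover have "integrable (lebesgue_on {a..b}) (\<lambda>t. deriv (deriv \<psi>) t *\<^sub>R f t)"
       "integrable (lebesgue_on {a..b}) (\<lambda>t. deriv (deriv \<psi>) t *\<^sub>R H t)"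
      using assms(3) cH test_function_AC(5)[OF \<psi>']
      by (auto intro!: LINT_eq_integral(1) abs_integrable_continuous_scaleR absolutely_integrable_continuous_real continuous_on_scaleR)
    ultimately show ?thesis unfolding u_def by (simp add: scaleR_diff_right Bochner_Integration.integral_diff)
  qed
  define c where "c = (u b - u a) /\<^sub>R (b - a)"
  have "u t = u a + (t - a) *\<^sub>R c" if "a \<le> t" "t \<le> b" for t
    using weakly_affine[OF assms(2) cu wu that] by (simp add: c_def divide_inverse mult.commute)
  then have feq: "H t + (u a + (t - a) *\<^sub>R c) = f t" if "a \<le> t" "t \<le> b" for t
    using that by (metis add_diff_cancel_left' add_diff_eq diff_add_cancel u_def)
  have "AC_rep a b (\<lambda>t. u a + (t - a) *\<^sub>R c) (\<lambda>t. c)"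
    by (intro AC_rep_C1) (auto intro!: derivative_eq_intros)
  from AC_rep_add[OF H this] have 1: "AC_rep a b f (\<lambda>t. G t + c)"
    by (rule AC_rep_cong) (use feq in auto)
  from AC_rep_add[OF G AC_rep_const[of a b c]] have 2: "AC_rep a b (\<lambda>t. G t + c) f''" by simp
  show thesis using that[of "\<lambda>t. G t + c" f''] 1 2 L(2) by (simp add: H2_rep_def)
qed

section \<open>Smooth maps on open sets\<close>

lemma smooth_on_has_derivative:
  assumes "smooth_on UNIV W f" "open W" "x \<in> W"
  shows "(f has_derivative frechet_derivative f (at x within W)) (at x)"
proof -
  have "f differentiable_on W" using assms(1)[unfolded smooth_on_def, rule_format, of 1] by simp
  then have "f differentiable (at x)"
    using assms by (metis at_within_open differentiable_on_def)
  then show ?thesis using assms by (metis at_within_open frechet_derivative_works)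
qed

lemma smooth_on_continuous: "smooth_on UNIV W f \<Longrightarrow> continuous_on W f"
  unfolding smooth_on_def by (metis Ck_on.simps(1))

lemma smooth_on_derivative:
  assumes "smooth_on UNIV W f"
  shows "smooth_on UNIV W (\<lambda>x. frechet_derivative f (at x within W) v)"
  unfolding smooth_on_def
proof
  fix k
  show "Ck_on UNIV W k (\<lambda>x. frechet_derivative f (at x within W) v)"
    using assms[unfolded smooth_on_def, rule_format, of "Suc k"] by simp
qed

text \<open>
  The mean value theorem, applied first in direction \<open>u\<close> and then in direction \<open>w\<close>, expresses the second
  difference quotient, which is symmetric in \<open>u\<close> and \<open>w\<close>, by a mixed derivative at a nearby point.
\<close>

lemma mixed_derivative_approx:
  fixes f :: "'a::real_normed_vector \<Rightarrow> real"
  assumes f: "\<And>y. y \<in> W \<Longrightarrow> (f has_derivative f' y) (at y)"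
    and fu: "\<And>y. y \<in> W \<Longrightarrow> ((\<lambda>z. f' z u) has_derivative fu y) (at y)"
    and t: "t > 0" and W: "\<And>a b. 0 \<le> a \<Longrightarrow> a \<le> t \<Longrightarrow> 0 \<le> b \<Longrightarrow> b \<le> t \<Longrightarrow> x + a *\<^sub>R u + b *\<^sub>R w \<in> W"
  obtains \<xi> \<zeta> where "0 < \<xi>" "\<xi> < t" "0 < \<zeta>" "\<zeta> < t"
    "f (x + t *\<^sub>R u + t *\<^sub>R w) - f (x + t *\<^sub>R u) - f (x + t *\<^sub>R w) + f x = t * (t * fu (x + \<xi> *\<^sub>R u + \<zeta> *\<^sub>R w) w)"
proof -
  define p where "p s = f (x + s *\<^sub>R u + t *\<^sub>R w) - f (x + s *\<^sub>R u + 0 *\<^sub>R w)" for s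
  have p: "(p has_real_derivative f' (x + s *\<^sub>R u + t *\<^sub>R w) u - f' (x + s *\<^sub>R u + 0 *\<^sub>R w) u) (at s)"
    if s: "0 \<le> s" "s \<le> t" for s
  proof -
    have *: "((\<lambda>s. f (x + s *\<^sub>R u + b *\<^sub>R w)) has_real_derivative f' (x + s *\<^sub>R u + b *\<^sub>R w) u) (at s)" if "0 \<le> b" "b \<le> t" for b
    proof -
      have d: "(f has_derivative f' (x + s *\<^sub>R u + b *\<^sub>R w)) (at (x + s *\<^sub>R u + b *\<^sub>R w))" using f W s that by blast
      interpret bounded_linear "f' (x + s *\<^sub>R u + b *\<^sub>R w)" using d has_derivative_bounded_linear by blast
      have "((\<lambda>s. x + s *\<^sub>R u + b *\<^sub>R w) has_derivative (\<lambda>h. h *\<^sub>R u)) (at s)"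
        by (auto intro!: derivative_eq_intros)
      from has_derivative_compose[OF this d] show ?thesis
        unfolding has_field_derivative_def by (simp add: scaleR mult_commute_abs)
    qed
    show ?thesis unfolding p_def using t by (intro DERIV_diff *) auto
  qed
  obtain \<xi> where \<xi>: "0 < \<xi>" "\<xi> < t" "p t - p 0 = (t - 0) * (f' (x + \<xi> *\<^sub>R u + t *\<^sub>R w) u - f' (x + \<xi> *\<^sub>R u + 0 *\<^sub>R w) u)"
    using MVT2[OF t p] by blast
  define r where "r b = f' (x + \<xi> *\<^sub>R u + b *\<^sub>R w) u" for b
  have r: "(r has_real_derivative fu (x + \<xi> *\<^sub>R u + b *\<^sub>R w) w) (at b)" if "0 \<le> b" "b \<le> t" for b
  proof -
    have d: "((\<lambda>z. f' z u) has_derivative fu (x + \<xi> *\<^sub>R u + b *\<^sub>R w)) (at (x + \<xi> *\<^sub>R u + b *\<^sub>R w))"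
      using fu W \<xi> that by force
    interpret bounded_linear "fu (x + \<xi> *\<^sub>R u + b *\<^sub>R w)" using d has_derivative_bounded_linear by blast
    have "((\<lambda>b. x + \<xi> *\<^sub>R u + b *\<^sub>R w) has_derivative (\<lambda>h. h *\<^sub>R w)) (at b)"
      by (auto intro!: derivative_eq_intros)
    from has_derivative_compose[OF this d] show ?thesis
      unfolding has_field_derivative_def r_def by (simp add: scaleR mult_commute_abs)
  qed
  obtain \<zeta> where \<zeta>: "0 < \<zeta>" "\<zeta> < t" "r t - r 0 = (t - 0) * fu (x + \<xi> *\<^sub>R u + \<zeta> *\<^sub>R w) w"
    using MVT2[OF t r] by blast
  show thesis
    using that[OF \<xi>(1,2) \<zeta>(1,2)] \<xi>(3) \<zeta>(3) by (simp add: p_def r_def)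
qed

lemma mixed_derivatives_real:
  fixes f :: "'a::real_normed_vector \<Rightarrow> real"
  assumes "open W" "x \<in> W"
    and f: "\<And>y. y \<in> W \<Longrightarrow> (f has_derivative f' y) (at y)"
    and fu: "\<And>y. y \<in> W \<Longrightarrow> ((\<lambda>z. f' z u) has_derivative fu y) (at y)" "continuous_on W (\<lambda>y. fu y w)"
    and fw: "\<And>y. y \<in> W \<Longrightarrow> ((\<lambda>z. f' z w) has_derivative fw y) (at y)" "continuous_on W (\<lambda>y. fw y u)"
  shows "fu x w = fw x u"
proof (rule ccontr)
  assume "fu x w \<noteq> fw x u"
  define e where "e = \<bar>fu x w - fw x u\<bar> / 2"
  have e: "e > 0" using \<open>fu x w \<noteq> fw x u\<close> by (simp add: e_def)
  have "isCont (\<lambda>y. fu y w) x" "isCont (\<lambda>y. fw y u) x"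
    using assms by (auto simp: continuous_on_eq_continuous_at)
  then obtain d1 d2 where d1: "d1 > 0" "\<And>y. norm (y - x) < d1 \<Longrightarrow> \<bar>fu y w - fu x w\<bar> < e"
    and d2: "d2 > 0" "\<And>y. norm (y - x) < d2 \<Longrightarrow> \<bar>fw y u - fw x u\<bar> < e"
    unfolding continuous_at_eps_delta using e by (metis dist_norm real_norm_def)
  obtain d3 where d3: "d3 > 0" "\<And>y. norm (y - x) < d3 \<Longrightarrow> y \<in> W"
    using assms(1,2) by (metis dist_norm openE mem_ball dist_commute subsetD)
  define d where "d = min (min d1 d2) d3"
  define t where "t = d / (2 * (norm u + norm w + 1))"
  have t0: "t > 0" using d1 d2 d3 by (auto simp: t_def d_def intro!: divide_pos_pos add_nonneg_pos)
  have small: "norm ((x + a *\<^sub>R u + b *\<^sub>R w) - x) < d" if "0 \<le> a" "a \<le> t" "0 \<le> b" "b \<le> t" for a b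
  proof -
    have "norm ((x + a *\<^sub>R u + b *\<^sub>R w) - x) \<le> a * norm u + b * norm w"
      using norm_triangle_ineq[of "a *\<^sub>R u" "b *\<^sub>R w"] that by simp
    also have "\<dots> \<le> t * norm u + t * norm w" using that by (intro add_mono mult_right_mono) auto
    also have "\<dots> < t * (2 * (norm u + norm w + 1))"
      using t0 norm_ge_zero[of u] norm_ge_zero[of w] by (simp add: distrib_left add_nonneg_pos)
    also have "\<dots> = d" unfolding t_def by (simp add: add_nonneg_pos less_imp_neq[THEN not_sym])
    finally show ?thesis .
  qed
  have inW: "x + a *\<^sub>R u + b *\<^sub>R w \<in> W" if "0 \<le> a" "a \<le> t" "0 \<le> b" "b \<le> t" for a b
    using small[OF that] d3 by (auto simp: d_def)
  have inW': "x + a *\<^sub>R w + b *\<^sub>R u \<in> W" if "0 \<le> a" "a \<le> t" "0 \<le> b" "b \<le> t" for a b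
    using inW[of b a] that by (simp add: algebra_simps)
  obtain \<xi> \<zeta> where 1: "0 < \<xi>" "\<xi> < t" "0 < \<zeta>" "\<zeta> < t"
    "f (x + t *\<^sub>R u + t *\<^sub>R w) - f (x + t *\<^sub>R u) - f (x + t *\<^sub>R w) + f x = t * (t * fu (x + \<xi> *\<^sub>R u + \<zeta> *\<^sub>R w) w)"
    using mixed_derivative_approx[OF f fu(1) t0 inW] by blast
  obtain \<xi>' \<zeta>' where 2: "0 < \<xi>'" "\<xi>' < t" "0 < \<zeta>'" "\<zeta>' < t"
    "f (x + t *\<^sub>R w + t *\<^sub>R u) - f (x + t *\<^sub>R w) - f (x + t *\<^sub>R u) + f x = t * (t * fw (x + \<xi>' *\<^sub>R w + \<zeta>' *\<^sub>R u) u)"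
    using mixed_derivative_approx[OF f fw(1) t0 inW'] by blast
  have "t * (t * fu (x + \<xi> *\<^sub>R u + \<zeta> *\<^sub>R w) w) = t * (t * fw (x + \<zeta>' *\<^sub>R u + \<xi>' *\<^sub>R w) u)"
    unfolding 1(5)[symmetric] using 2(5) by (simp add: algebra_simps)
  then have "fu (x + \<xi> *\<^sub>R u + \<zeta> *\<^sub>R w) w = fw (x + \<zeta>' *\<^sub>R u + \<xi>' *\<^sub>R w) u" using t0 by simp
  moreover have "\<bar>fu (x + \<xi> *\<^sub>R u + \<zeta> *\<^sub>R w) w - fu x w\<bar> < e"
    using 1 small[of \<xi> \<zeta>] by (intro d1) (auto simp: d_def)
  moreover have "\<bar>fw (x + \<zeta>' *\<^sub>R u + \<xi>' *\<^sub>R w) u - fw x u\<bar> < e"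
    using 2 small[of \<zeta>' \<xi>'] by (intro d2) (auto simp: d_def)
  ultimately have "\<bar>fu x w - fw x u\<bar> < 2 * e" by linarith
  then show False by (simp add: e_def)
qed

text \<open>
  Componentwise application of Schwarz's theorem, in the form in which second derivatives of transition
  maps occur below.
\<close>

lemma second_derivative_symmetric:
  fixes f :: "'a::real_normed_vector \<Rightarrow> real ^ 'k::finite"
  assumes sm: "smooth_on UNIV W f" and W: "open W" "x \<in> W"
  defines "D \<equiv> \<lambda>y u. frechet_derivative f (at y within W) u"
  shows "frechet_derivative (\<lambda>y. D y u) (at x within W) w = frechet_derivative (\<lambda>y. D y w) (at x within W) u"
proof -
  define D2 where "D2 u y w = frechet_derivative (\<lambda>y. D y u) (at y within W) w" for u y w
  have d1: "(f has_derivative D y) (at y)" if "y \<in> W" for y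
    using smooth_on_has_derivative[OF sm W(1) that] by (simp add: D_def)
  have sm1: "smooth_on UNIV W (\<lambda>y. D y u)" for u unfolding D_def by (rule smooth_on_derivative[OF sm])
  have d2: "((\<lambda>y. D y u) has_derivative D2 u y) (at y)" if "y \<in> W" for y u
    using smooth_on_has_derivative[OF sm1 W(1) that] unfolding D2_def .
  have c: "continuous_on W (\<lambda>y. D2 u y w)" for u w
    unfolding D2_def by (rule smooth_on_continuous[OF smooth_on_derivative[OF sm1]])
  have "D2 u x w $ i = D2 w x u $ i" for i
  proof (rule mixed_derivatives_real[OF W, where f="\<lambda>y. f y $ i" and f'="\<lambda>y v. D y v $ i" and fu="\<lambda>y v. D2 u y v $ i" and fw="\<lambda>y v. D2 w y v $ i"])
    show "((\<lambda>y. f y $ i) has_derivative (\<lambda>v. D y v $ i)) (at y)" if "y \<in> W" for y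
      using bounded_linear.has_derivative[OF bounded_linear_vec_nth d1[OF that]] .
    show "((\<lambda>z. D z u $ i) has_derivative (\<lambda>v. D2 u y v $ i)) (at y)" if "y \<in> W" for y
      using bounded_linear.has_derivative[OF bounded_linear_vec_nth d2[OF that]] .
    show "((\<lambda>z. D z w $ i) has_derivative (\<lambda>v. D2 w y v $ i)) (at y)" if "y \<in> W" for y
      using bounded_linear.has_derivative[OF bounded_linear_vec_nth d2[OF that]] .
  qed (auto intro!: continuous_intros c)
  then show ?thesis by (simp add: vec_eq_iff D2_def)
qed

lemma linear_axis_expand:
  fixes f :: "real ^ 'n::finite \<Rightarrow> 'b::real_vector"
  assumes "linear f" shows "f u = (\<Sum>i\<in>UNIV. u $ i *\<^sub>R f (axis i 1))"
proof -
  have "f u = f (\<Sum>i\<in>UNIV. u $ i *\<^sub>R axis i 1)"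
    by (simp add: basis_expansion[of u, unfolded scalar_mult_eq_scaleR])
  also have "\<dots> = (\<Sum>i\<in>UNIV. u $ i *\<^sub>R f (axis i 1))"
    using assms by (simp add: linear_sum linear_scale)
  finally show ?thesis .
qed

section \<open>Charts and tangent vectors\<close>

\<comment> \<open>Charts are pairs, and quantifiers over charts should stay quantifiers over charts.\<close>
declare split_paired_All [simp del] split_paired_Ex [simp del]

text \<open>
  Manifolds modelled on the whole space \<open>\<real>\<^sup>n\<close> with \<open>n > 0\<close>. Zero-dimensional manifolds, whose model
  space is \<open>{0}\<close>, are treated in the last section.
\<close>

locale riemannian =
  fixes A :: "('m::{t2_space, second_countable_topology}, 'n::finite) chart set"
    and g :: "('m, 'n) metric"
  assumes smooth_struct: "smooth_structure UNIV A" and metric: "riemannian_metric UNIV A g"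
begin

abbreviation X :: "('m, 'n) chart \<Rightarrow> (real ^ 'n) set" where "X c \<equiv> snd c ` fst c"
abbreviation gm where "gm \<equiv> metric_coords A g"
abbreviation TD where "TD \<equiv> transition_deriv"

lemma chart:
  assumes "c \<in> A"
  shows "open (fst c)" "open (X c)" "homeomorphism (fst c) (X c) (snd c) (param c)"
    "\<And>p. p \<in> fst c \<Longrightarrow> param c (snd c p) = p" "\<And>x. x \<in> X c \<Longrightarrow> snd c (param c x) = x"
    "\<And>x. x \<in> X c \<Longrightarrow> param c x \<in> fst c" "continuous_on (fst c) (snd c)" "continuous_on (X c) (param c)"
proof -
  have "is_chart UNIV c" using smooth_struct assms unfolding smooth_structure_def by blast
  then show "open (fst c)" "open (X c)" and h: "homeomorphism (fst c) (X c) (snd c) (param c)"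
    by (auto simp: is_chart_def)
  from h show "\<And>p. p \<in> fst c \<Longrightarrow> param c (snd c p) = p" "\<And>x. x \<in> X c \<Longrightarrow> snd c (param c x) = x"
    "\<And>x. x \<in> X c \<Longrightarrow> param c x \<in> fst c" "continuous_on (fst c) (snd c)" "continuous_on (X c) (param c)"
    by (auto simp: homeomorphism_def)
qed

lemma chart_exists: obtains c where "c \<in> A" "p \<in> fst c"
proof -
  have "p \<in> (\<Union>c\<in>A. fst c)" using smooth_struct unfolding smooth_structure_def by (metis UNIV_I)
  then show thesis using that by blast
qed

lemma open_chart_image:
  assumes "c \<in> A" "open U" "U \<subseteq> fst c" shows "open (snd c ` U)"
proof -
  have "openin (top_of_set (X c)) (snd c ` U)"
    using homeomorphism_imp_open_map[OF chart(3)[OF assms(1)], of U] assms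
    by (metis chart(1) openin_open_eq)
  then show ?thesis using chart(2)[OF assms(1)] openin_open_trans by blast
qed

lemma overlap_open: "c \<in> A \<Longrightarrow> c' \<in> A \<Longrightarrow> open (overlap c c')"
  unfolding overlap_def by (intro open_chart_image) (auto intro: chart(1))

lemma transition_smooth: "c \<in> A \<Longrightarrow> c' \<in> A \<Longrightarrow> smooth_on UNIV (overlap c c') (transition c c')"
  using smooth_struct unfolding smooth_structure_def compatible_def by blast

lemma transition_coords: "c \<in> A \<Longrightarrow> p \<in> fst c \<Longrightarrow> transition c c' (snd c p) = snd c' p"
  by (simp add: transition_def chart)

lemma TD_has_derivative:
  assumes "c \<in> A" "c' \<in> A" "p \<in> fst c" "p \<in> fst c'"
  shows "(transition c c' has_derivative TD c c' p) (at (snd c p))"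
proof -
  have "snd c p \<in> overlap c c'" using assms by (auto simp: overlap_def)
  then show ?thesis
    using smooth_on_has_derivative[OF transition_smooth overlap_open] assms
    unfolding transition_deriv_def by blast
qed

lemma TD_linear:
  assumes "c \<in> A" "c' \<in> A" "p \<in> fst c" "p \<in> fst c'" shows "bounded_linear (TD c c' p)"
  using TD_has_derivative[OF assms] by (rule has_derivative_bounded_linear)

lemma TD_id:
  assumes "c \<in> A" "p \<in> fst c" shows "TD c c p u = u"
proof -
  have "((\<lambda>x. x) has_derivative TD c c p) (at (snd c p))"
  proof (rule has_derivative_transform_within_open[OF TD_has_derivative[OF assms(1,1,2,2)] chart(2)[OF assms(1)]])
    show "snd c p \<in> X c" using assms by blast
    show "transition c c x = x" if "x \<in> X c" for x using chart(5)[OF assms(1) that] by (simp add: transition_def)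
  qed
  from has_derivative_unique[OF this has_derivative_ident] show ?thesis by (simp add: fun_eq_iff)
qed

lemma TD_chain:
  assumes "c \<in> A" "c' \<in> A" "c'' \<in> A" "p \<in> fst c" "p \<in> fst c'" "p \<in> fst c''"
  shows "TD c' c'' p (TD c c' p u) = TD c c'' p u"
proof -
  have "(transition c' c'' has_derivative TD c' c'' p) (at (transition c c' (snd c p)))"
    using TD_has_derivative[of c' c'' p] assms by (simp add: transition_coords)
  from has_derivative_compose[OF TD_has_derivative this] assms
  have "((\<lambda>x. transition c' c'' (transition c c' x)) has_derivative (\<lambda>x. TD c' c'' p (TD c c' p x))) (at (snd c p))"
    by blast
  then have "(transition c c'' has_derivative (\<lambda>x. TD c' c'' p (TD c c' p x))) (at (snd c p))"
  proof (rule has_derivative_transform_within_open)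
    show "open (snd c ` (fst c \<inter> fst c' \<inter> fst c''))" using assms by (intro open_chart_image) (auto intro!: chart(1) open_Int)
    show "snd c p \<in> snd c ` (fst c \<inter> fst c' \<inter> fst c'')" using assms by blast
    show "transition c' c'' (transition c c' x) = transition c c'' x" if "x \<in> snd c ` (fst c \<inter> fst c' \<inter> fst c'')" for x
      using that assms by (auto simp: transition_coords)
  qed
  from has_derivative_unique[OF this TD_has_derivative[of c c'' p]] assms show ?thesis by (simp add: fun_eq_iff)
qed

abbreviation toc where "toc \<equiv> tangent_of_coords A"

lemma toc_at: "c' \<in> A \<Longrightarrow> p \<in> fst c' \<Longrightarrow> toc c p u c' = TD c c' p u"
  by (simp add: tangent_of_coords_def charts_at_def)

lemma toc_tangent:
  assumes "c \<in> A" "p \<in> fst c" shows "toc c p u \<in> tangent_space UNIV A p"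
  using assms TD_chain[of c] by (auto simp: tangent_space_def tangent_of_coords_def charts_at_def)

text \<open>
  A tangent vector is determined by its coordinates in one chart, since its other coordinates are
  obtained by the derivatives of the transition maps.
\<close>

lemma tangent_eq_toc:
  assumes "v \<in> tangent_space UNIV A p" "c \<in> A" "p \<in> fst c" shows "v = toc c p (v c)"
proof
  fix c' show "v c' = toc c p (v c) c'"
  proof (cases "c' \<in> charts_at A p")
    case True
    moreover have "c \<in> charts_at A p" using assms by (simp add: charts_at_def)
    ultimately have "v c' = TD c c' p (v c)" using assms(1) unfolding tangent_space_def by blast
    with True show ?thesis by (simp add: tangent_of_coords_def)
  next
    case False
    then have "v c' = 0" using assms(1) unfolding tangent_space_def by blast
    with False show ?thesis by (simp add: tangent_of_coords_def)
  qed
qed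

lemma toc_change:
  assumes "c \<in> A" "c' \<in> A" "p \<in> fst c" "p \<in> fst c'" shows "toc c p u = toc c' p (TD c c' p u)"
  using tangent_eq_toc[OF toc_tangent, of c p c' u] assms by (simp add: toc_at)

lemma toc_lin:
  assumes "c \<in> A" "p \<in> fst c"
  shows "toc c p (a *\<^sub>R u + b *\<^sub>R v) = (\<lambda>c'. a *\<^sub>R toc c p u c' + b *\<^sub>R toc c p v c')"
proof
  fix c'
  show "toc c p (a *\<^sub>R u + b *\<^sub>R v) c' = a *\<^sub>R toc c p u c' + b *\<^sub>R toc c p v c'"
  proof (cases "c' \<in> A \<and> p \<in> fst c'")
    case True
    interpret bounded_linear "TD c c' p" using TD_linear assms True by blast
    show ?thesis using True by (simp add: toc_at add scaleR)
  qed (auto simp: tangent_of_coords_def charts_at_def)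
qed

section \<open>The metric in coordinates\<close>

lemma gm_coords: "c \<in> A \<Longrightarrow> p \<in> fst c \<Longrightarrow> gm c (snd c p) u w = g p (toc c p u) (toc c p w)"
  by (simp add: metric_coords_def chart)

lemma g_eq_gm:
  assumes "u \<in> tangent_space UNIV A p" "w \<in> tangent_space UNIV A p" "c \<in> A" "p \<in> fst c"
  shows "g p u w = gm c (snd c p) (u c) (w c)"
  using gm_coords[OF assms(3,4)] tangent_eq_toc[OF assms(1,3,4)] tangent_eq_toc[OF assms(2,3,4)] by simp

lemma gm_sym:
  assumes "c \<in> A" "x \<in> X c" shows "gm c x u w = gm c x w u"
  using assms metric toc_tangent[OF assms(1) chart(6)[OF assms]]
  by (auto simp: riemannian_metric_def metric_coords_def)

lemma gm_lin:
  assumes "c \<in> A" "x \<in> X c" shows "gm c x (a *\<^sub>R u + b *\<^sub>R v) w = a * gm c x u w + b * gm c x v w"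
  using assms metric toc_tangent[OF assms(1) chart(6)[OF assms]] toc_lin[OF assms(1) chart(6)[OF assms]]
  unfolding riemannian_metric_def metric_coords_def by auto

lemma gm_linear1: assumes "c \<in> A" "x \<in> X c" shows "linear (\<lambda>u. gm c x u w)"
  using gm_lin[OF assms, of 1 _ 1 _ w] gm_lin[OF assms, of _ _ 0 0 w] by (intro linearI) auto

lemma gm_linear2: assumes "c \<in> A" "x \<in> X c" shows "linear (\<lambda>w. gm c x u w)"
  using gm_linear1[OF assms, of u] gm_sym[OF assms, of u] by simp

lemma gm_pos:
  assumes "c \<in> A" "x \<in> X c" "u \<noteq> 0" shows "gm c x u u > 0"
proof -
  have p: "param c x \<in> fst c" using assms chart by blast
  have "toc c (param c x) u \<noteq> (\<lambda>c. 0)"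
    using toc_at[OF assms(1) p, of c u] TD_id[OF assms(1) p, of u] assms(3) by metis
  then show ?thesis using metric toc_tangent[OF assms(1) p, of u] unfolding riemannian_metric_def metric_coords_def by blast
qed

lemma gm_nonneg: assumes "c \<in> A" "x \<in> X c" shows "gm c x u u \<ge> 0"
  using gm_pos[OF assms, of u] linear_0[OF gm_linear1[OF assms], of u] by (cases "u = 0") auto

lemma gm_smooth: "c \<in> A \<Longrightarrow> smooth_on UNIV (X c) (\<lambda>x. gm c x u w)"
  using metric by (auto simp: riemannian_metric_def)

abbreviation Gm where "Gm c x i j \<equiv> gm c x (axis i 1) (axis j 1)"

lemma gm_expand:
  assumes "c \<in> A" "x \<in> X c"
  shows "gm c x u w = (\<Sum>i\<in>UNIV. \<Sum>j\<in>UNIV. u $ i * w $ j * Gm c x i j)"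
proof -
  have "gm c x u w = (\<Sum>i\<in>UNIV. u $ i *\<^sub>R gm c x (axis i 1) w)"
    by (rule linear_axis_expand[OF gm_linear1[OF assms]])
  also have "\<dots> = (\<Sum>i\<in>UNIV. u $ i *\<^sub>R (\<Sum>j\<in>UNIV. w $ j *\<^sub>R Gm c x i j))"
    using linear_axis_expand[OF gm_linear2[OF assms]] by metis
  finally show ?thesis by (simp add: sum_distrib_left mult.assoc)
qed

lemma gm_continuous:
  assumes "c \<in> A" "continuous_on S x" "continuous_on S u" "continuous_on S w" "x ` S \<subseteq> X c"
  shows "continuous_on S (\<lambda>t. gm c (x t) (u t) (w t))"
proof -
  have "continuous_on S (\<lambda>t. \<Sum>i\<in>UNIV. \<Sum>j\<in>UNIV. u t $ i * w t $ j * Gm c (x t) i j)"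
    using assms by (intro continuous_intros continuous_on_compose2[OF smooth_on_continuous[OF gm_smooth[OF assms(1)]] assms(2)]) auto
  then show ?thesis
    by (rule continuous_on_eq) (rule gm_expand[symmetric, OF assms(1)], use assms(5) in blast)
qed

text \<open>The derivative of the metric coefficients in direction \<open>z\<close>, as a trilinear form.\<close>

definition dG :: "('m, 'n) chart \<Rightarrow> real ^ 'n \<Rightarrow> real ^ 'n \<Rightarrow> real ^ 'n \<Rightarrow> real ^ 'n \<Rightarrow> real" where
  "dG c x z u w = frechet_derivative (\<lambda>y. gm c y u w) (at x within X c) z"

lemma dG_has_derivative:
  assumes "c \<in> A" "x \<in> X c" shows "((\<lambda>y. gm c y u w) has_derivative (\<lambda>z. dG c x z u w)) (at x)"
  unfolding dG_def using smooth_on_has_derivative[OF gm_smooth[OF assms(1)] chart(2)[OF assms(1)] assms(2)] by simp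

lemma metric_partial_eq:
  "metric_partial A g c x l i j = dG c x (axis l 1) (axis i 1) (axis j 1)"
  by (simp add: metric_partial_def dG_def metric_matrix_def)

lemma dG_expand2:
  assumes "c \<in> A" "x \<in> X c"
  shows "dG c x z u w = (\<Sum>i\<in>UNIV. \<Sum>j\<in>UNIV. u $ i * w $ j * dG c x z (axis i 1) (axis j 1))"
proof -
  have "((\<lambda>y. \<Sum>i\<in>UNIV. \<Sum>j\<in>UNIV. u $ i * w $ j * Gm c y i j) has_derivative
     (\<lambda>z. \<Sum>i\<in>UNIV. \<Sum>j\<in>UNIV. u $ i * w $ j * dG c x z (axis i 1) (axis j 1))) (at x)"
    by (intro has_derivative_sum has_derivative_mult_right dG_has_derivative assms)
  then have "((\<lambda>y. gm c y u w) has_derivative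
     (\<lambda>z. \<Sum>i\<in>UNIV. \<Sum>j\<in>UNIV. u $ i * w $ j * dG c x z (axis i 1) (axis j 1))) (at x)"
    by (rule has_derivative_transform_within_open[OF _ chart(2)[OF assms(1)] assms(2)]) (simp add: gm_expand assms)
  from has_derivative_unique[OF this dG_has_derivative[OF assms]] show ?thesis by (simp add: fun_eq_iff)
qed

lemma dG_expand:
  assumes "c \<in> A" "x \<in> X c"
  shows "dG c x z u w = (\<Sum>l\<in>UNIV. \<Sum>i\<in>UNIV. \<Sum>j\<in>UNIV. z $ l * u $ i * w $ j * metric_partial A g c x l i j)"
proof -
  have "linear (\<lambda>z. dG c x z u w)"
    using dG_has_derivative[OF assms] has_derivative_bounded_linear bounded_linear.linear by blast
  then have "dG c x z u w = (\<Sum>l\<in>UNIV. z $ l *\<^sub>R dG c x (axis l 1) u w)" by (rule linear_axis_expand)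
  then show ?thesis
    by (simp add: dG_expand2[OF assms, of "axis _ 1" u w] metric_partial_eq sum_distrib_left mult.assoc)
qed

end

lemma continuous_on_det:
  fixes M :: "'a::topological_space \<Rightarrow> real ^ 'n ^ 'n"
  assumes "\<And>i j. continuous_on S (\<lambda>t. M t $ i $ j)"
  shows "continuous_on S (\<lambda>t. det (M t))"
  unfolding det_def by (intro continuous_on_sum continuous_on_mult continuous_on_const continuous_on_prod assms)

context riemannian begin

lemma gm_scale: "c \<in> A \<Longrightarrow> x \<in> X c \<Longrightarrow> gm c x (a *\<^sub>R u) (b *\<^sub>R w) = a * b * gm c x u w"
  using linear_scale[OF gm_linear1] linear_scale[OF gm_linear2] by simp

text \<open>
  On a compact set of base points the metric is comparable with the Euclidean norm: by homogeneity it is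
  enough to take the extrema over unit vectors, which exist by compactness.
\<close>

lemma gm_compact_bounds:
  assumes "c \<in> A" "compact K" "K \<subseteq> X c"
  obtains \<kappa> C where "\<kappa> > 0" "C > 0" "\<And>x u. x \<in> K \<Longrightarrow> \<kappa> * (norm u)\<^sup>2 \<le> gm c x u u"
    "\<And>x u. x \<in> K \<Longrightarrow> gm c x u u \<le> C * (norm u)\<^sup>2"
proof (cases "K = {}")
  case True then show thesis using that[of 1 1] by simp
next
  case False
  define f where "f z = gm c (fst z) (snd z) (snd z)" for z
  have comp: "compact (K \<times> sphere (0 :: real ^ 'n) 1)" using assms by (intro compact_Times) auto
  have ne: "K \<times> sphere (0 :: real ^ 'n) 1 \<noteq> {}" using False by (auto simp: sphere_eq_empty)
  have cf: "continuous_on (K \<times> sphere (0 :: real ^ 'n) 1) f"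
    unfolding f_def using assms by (intro gm_continuous continuous_intros) auto
  obtain z1 where z1: "z1 \<in> K \<times> sphere 0 1" "\<And>z. z \<in> K \<times> sphere 0 1 \<Longrightarrow> f z1 \<le> f z"
    using continuous_attains_inf[OF comp ne cf] by blast
  obtain z2 where z2: "z2 \<in> K \<times> sphere 0 1" "\<And>z. z \<in> K \<times> sphere 0 1 \<Longrightarrow> f z \<le> f z2"
    using continuous_attains_sup[OF comp ne cf] by blast
  have pos: "f z > 0" if "z \<in> K \<times> sphere 0 1" for z
    unfolding f_def using that assms by (intro gm_pos) auto
  have eq: "gm c x u u = (norm u)\<^sup>2 * f (x, u /\<^sub>R norm u)" if "x \<in> K" "u \<noteq> 0" for x u
  proof -
    have x: "x \<in> X c" using that assms by auto
    show ?thesis unfolding f_def fst_conv snd_conv gm_scale[OF assms(1) x]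
      using that by (simp add: power2_eq_square field_simps)
  qed
  have z0: "gm c x 0 0 = 0" if "x \<in> K" for x
    using gm_scale[of c x 0 0 0 0] assms that by auto
  show thesis
  proof (rule that[of "f z1" "f z2"])
    fix x u assume x: "x \<in> K"
    have "f z1 * (norm u)\<^sup>2 \<le> gm c x u u \<and> gm c x u u \<le> f z2 * (norm u)\<^sup>2"
    proof (cases "u = 0")
      case False
      then have "(x, u /\<^sub>R norm u) \<in> K \<times> sphere 0 1" using x by simp
      then show ?thesis unfolding eq[OF x False] using z1(2) z2(2)
        by (metis mult.commute mult_left_mono zero_le_power2)
    qed (use z0 x in auto)
    then show "f z1 * (norm u)\<^sup>2 \<le> gm c x u u" "gm c x u u \<le> f z2 * (norm u)\<^sup>2" by auto
  qed (use z1 z2 pos in auto)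
qed

lemma gm_amgm:
  assumes "c \<in> A" "x \<in> X c" "l > 0"
  shows "2 * gm c x u w \<le> l * gm c x u u + gm c x w w / l"
proof -
  note l1 = gm_linear1[OF assms(1,2)] and l2 = gm_linear2[OF assms(1,2)]
  have "0 \<le> gm c x (l *\<^sub>R u - w) (l *\<^sub>R u - w)" by (rule gm_nonneg[OF assms(1,2)])
  also have "\<dots> = l * l * gm c x u u - 2 * l * gm c x u w + gm c x w w"
    by (simp add: linear_diff[OF l1] linear_diff[OF l2] linear_scale[OF l1] linear_scale[OF l2]
        gm_sym[OF assms(1,2), of w u] algebra_simps)
  finally have "0 \<le> (l * l * gm c x u u - 2 * l * gm c x u w + gm c x w w) / l" using assms(3) by simp
  then show ?thesis using assms(3) by (simp add: field_simps)
qed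

section \<open>The Christoffel symbols\<close>

text \<open>
  The quadratic form defined by the Christoffel symbols, that is, the correction term by which the
  covariant acceleration of a curve with velocity \<open>w\<close> differs from its second derivative.
\<close>

definition Gam :: "('m, 'n) chart \<Rightarrow> real ^ 'n \<Rightarrow> real ^ 'n \<Rightarrow> real ^ 'n" where
  "Gam c x w = (\<chi> k. \<Sum>i\<in>UNIV. \<Sum>j\<in>UNIV. christoffel A g c x k i j * w $ i * w $ j)"

text \<open>The vector whose Euclidean inner products are the right-hand side of the Koszul formula.\<close>

definition koszul :: "('m, 'n) chart \<Rightarrow> real ^ 'n \<Rightarrow> real ^ 'n \<Rightarrow> real ^ 'n" where
  "koszul c x w = (\<chi> l. dG c x w w (axis l 1) - dG c x (axis l 1) w w / 2)"

lemma metric_matrix_gm: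
  assumes "c \<in> A" "x \<in> X c"
  shows "gm c x u z = z \<bullet> (metric_matrix A g c x *v u)"
proof -
  have "gm c x u z = gm c x z u" by (rule gm_sym[OF assms])
  also have "\<dots> = z \<bullet> (metric_matrix A g c x *v u)"
    unfolding gm_expand[OF assms, of z u]
    by (simp add: inner_vec_def matrix_vector_mult_def metric_matrix_def sum_distrib_left mult_ac)
  finally show ?thesis .
qed

lemma metric_matrix_invertible:
  assumes "c \<in> A" "x \<in> X c" shows "invertible (metric_matrix A g c x)"
proof -
  have "u = 0" if "metric_matrix A g c x *v u = 0" for u
    using gm_pos[OF assms, of u] metric_matrix_gm[OF assms, of u u] that by fastforce
  then show ?thesis
    using matrix_left_invertible_ker[of "metric_matrix A g c x"] invertible_left_inverse by blast
qed

lemma matrix_inv_mult: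
  fixes M :: "real ^ 'k ^ 'k" assumes "invertible M" shows "M ** matrix_inv M = mat 1"
  using assms someI_ex[of "\<lambda>B. M ** B = mat 1 \<and> B ** M = mat 1"]
  unfolding invertible_def matrix_inv_def by blast

lemma koszul_inner:
  assumes "c \<in> A" "x \<in> X c"
  shows "z \<bullet> koszul c x w = dG c x w w z - dG c x z w w / 2"
proof -
  have lin: "linear (\<lambda>z. dG c x w w z - dG c x z w w / 2)"
  proof -
    have "dG c x w w z = (\<Sum>j\<in>UNIV. z $ j * (\<Sum>i\<in>UNIV. w $ i * dG c x w (axis i 1) (axis j 1)))" for z
      unfolding dG_expand2[OF assms, of w w z]
      by (subst sum.swap) (simp add: sum_distrib_left mult_ac)
    then have "linear (\<lambda>z. dG c x w w z)"
      by (auto intro!: linearI simp: sum.distrib[symmetric] sum_distrib_left algebra_simps intro!: sum.cong)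
    moreover have "linear (\<lambda>z. dG c x z w w)"
      using dG_has_derivative[OF assms] has_derivative_bounded_linear bounded_linear.linear by blast
    ultimately have "linear (\<lambda>z. dG c x w w z - (1/2) *\<^sub>R dG c x z w w)"
      by (intro linear_compose_sub linear_compose_scale_right)
    then show ?thesis by simp
  qed
  show ?thesis unfolding linear_axis_expand[OF lin, of z]
    by (simp add: inner_vec_def koszul_def)
qed

lemma Gam_solves:
  assumes "c \<in> A" "x \<in> X c"
  shows "metric_matrix A g c x *v Gam c x w = koszul c x w"
proof -
  let ?P = "metric_partial A g c x" and ?I = "matrix_inv (metric_matrix A g c x)"
  have k: "koszul c x w $ l = (1/2) * (\<Sum>i\<in>UNIV. \<Sum>j\<in>UNIV. (?P i j l + ?P j i l - ?P l i j) * w $ i * w $ j)" for l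
  proof -
    have 1: "dG c x w w (axis l 1) = (\<Sum>i\<in>UNIV. \<Sum>j\<in>UNIV. ?P i j l * w $ i * w $ j)"
      unfolding dG_expand[OF assms]
      by (intro sum.cong refl) (simp add: axis_def if_distrib if_distribR sum.delta mult_ac cong: if_cong)
    have 2: "(\<Sum>i\<in>UNIV. \<Sum>j\<in>UNIV. ?P i j l * w $ i * w $ j) = (\<Sum>i\<in>UNIV. \<Sum>j\<in>UNIV. ?P j i l * w $ i * w $ j)"
      by (subst sum.swap) (simp add: mult_ac)
    have 3: "dG c x (axis l 1) w w = (\<Sum>i\<in>UNIV. \<Sum>j\<in>UNIV. ?P l i j * w $ i * w $ j)"
      unfolding dG_expand2[OF assms, of "axis l 1" w w] metric_partial_eq by (simp add: mult_ac)
    have "(\<Sum>i\<in>UNIV. \<Sum>j\<in>UNIV. (?P i j l + ?P j i l - ?P l i j) * w $ i * w $ j)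
      = dG c x w w (axis l 1) + dG c x w w (axis l 1) - dG c x (axis l 1) w w"
    proof -
      have "(\<Sum>i\<in>UNIV. \<Sum>j\<in>UNIV. (?P i j l + ?P j i l - ?P l i j) * w $ i * w $ j)
        = (\<Sum>i\<in>UNIV. \<Sum>j\<in>UNIV. ?P i j l * w $ i * w $ j) + (\<Sum>i\<in>UNIV. \<Sum>j\<in>UNIV. ?P j i l * w $ i * w $ j)
          - (\<Sum>i\<in>UNIV. \<Sum>j\<in>UNIV. ?P l i j * w $ i * w $ j)"
        by (simp only: left_diff_distrib distrib_right sum.distrib sum_subtractf)
      then show ?thesis unfolding 1 3 2[symmetric] .
    qed
    then show ?thesis unfolding koszul_def by simp
  qed
  have "Gam c x w = ?I *v koszul c x w"
  proof (rule vec_eq_iff[THEN iffD2], rule allI)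
    fix k'
    have "Gam c x w $ k' = (\<Sum>i\<in>UNIV. \<Sum>j\<in>UNIV. \<Sum>l\<in>UNIV. ?I $ k' $ l * ((1/2) * ((?P i j l + ?P j i l - ?P l i j) * w $ i * w $ j)))"
      unfolding Gam_def christoffel_def
      by (simp add: sum_distrib_left sum_distrib_right mult.assoc mult.left_commute)
    also have "\<dots> = (\<Sum>l\<in>UNIV. \<Sum>i\<in>UNIV. \<Sum>j\<in>UNIV. ?I $ k' $ l * ((1/2) * ((?P i j l + ?P j i l - ?P l i j) * w $ i * w $ j)))"
      by (subst (2) sum.swap, subst sum.swap) simp
    also have "\<dots> = (?I *v koszul c x w) $ k'"
      unfolding matrix_vector_mult_def k by (simp add: sum_distrib_left)
    finally show "Gam c x w $ k' = (?I *v koszul c x w) $ k'" .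
  qed
  then show ?thesis
    using matrix_inv_mult[OF metric_matrix_invertible[OF assms]]
    by (simp add: matrix_vector_mul_assoc)
qed

text \<open>
  The Koszul formula for the diagonal of the connection. It characterizes \<open>Gam\<close> by inner products, so
  the transformation law and the compatibility with the metric follow from it without index
  computations.
\<close>

lemma gm_Gam:
  assumes "c \<in> A" "x \<in> X c"
  shows "gm c x (Gam c x w) z = dG c x w w z - dG c x z w w / 2"
  unfolding metric_matrix_gm[OF assms] Gam_solves[OF assms] by (rule koszul_inner[OF assms])

lemma dG_continuous:
  assumes "c \<in> A" shows "continuous_on (X c) (\<lambda>x. dG c x z u w)"
  unfolding dG_def by (rule smooth_on_continuous[OF smooth_on_derivative[OF gm_smooth[OF assms]]])

lemma Gam_continuous:
  assumes c: "c \<in> A" and x: "continuous_on S x" "x ` S \<subseteq> X c" and w: "continuous_on S w"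
  shows "continuous_on S (\<lambda>t. Gam c (x t) (w t))"
proof -
  let ?M = "\<lambda>t. metric_matrix A g c (x t)" and ?b = "\<lambda>t. koszul c (x t) (w t)"
  have xX: "x t \<in> X c" if "t \<in> S" for t using x that by blast
  have cM: "continuous_on S (\<lambda>t. ?M t $ i $ j)" for i j
    unfolding metric_matrix_def
    using continuous_on_compose2[OF smooth_on_continuous[OF gm_smooth[OF c]] x] by simp
  have cP: "continuous_on S (\<lambda>t. metric_partial A g c (x t) l i j)" for l i j
    unfolding metric_partial_eq by (rule continuous_on_compose2[OF dG_continuous[OF c] x])
  have cb: "continuous_on S (\<lambda>t. ?b t $ l)" for l
  proof -
    have "continuous_on S (\<lambda>t. (\<Sum>i\<in>UNIV. \<Sum>j\<in>UNIV. \<Sum>k\<in>UNIV. w t $ i * w t $ j * axis l 1 $ k * metric_partial A g c (x t) i j k)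
       - (\<Sum>i\<in>UNIV. \<Sum>j\<in>UNIV. \<Sum>k\<in>UNIV. axis l 1 $ i * w t $ j * w t $ k * metric_partial A g c (x t) i j k) / 2)"
      by (intro continuous_intros cP w) auto
    then show ?thesis
      by (rule continuous_on_eq) (simp add: koszul_def dG_expand[OF c xX])
  qed
  have det: "det (?M t) \<noteq> 0" if "t \<in> S" for t
    using metric_matrix_invertible[OF c xX[OF that]] invertible_det_nz by blast
  have "continuous_on S (\<lambda>t. \<chi> k. det (\<chi> i j. if j = k then ?b t $ i else ?M t $ i $ j) / det (?M t))"
  proof (intro continuous_on_vec_lambda continuous_on_divide continuous_on_det)
    show "continuous_on S (\<lambda>t. (\<chi> i j. if j = k then ?b t $ i else ?M t $ i $ j) $ i $ j)" for k i j
      using cb cM by (cases "j = k") auto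
  qed (use cM det in auto)
  then show ?thesis
  proof (rule continuous_on_eq)
    fix t assume t: "t \<in> S"
    show "(\<chi> k. det (\<chi> i j. if j = k then ?b t $ i else ?M t $ i $ j) / det (?M t)) = Gam c (x t) (w t)"
      using cramer[OF det[OF t], THEN iffD1, OF Gam_solves[OF c xX[OF t], of "w t"]] by simp
  qed
qed

text \<open>
  The product rule for the metric along a moving base point. The bilinearity in the vectors is
  exploited through the expansion in the metric coefficients, whose derivatives are given by \<open>dG\<close>.
\<close>

lemma gm_has_derivative:
  assumes c: "c \<in> A" and yX: "y s \<in> X c" and sS: "s \<in> S" and y: "(y has_derivative y') (at s within S)"
    and a: "(a has_derivative a') (at s within S)" and b: "(b has_derivative b') (at s within S)"
  shows "((\<lambda>r. gm c (y r) (a r) (b r)) has_derivative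
    (\<lambda>h. dG c (y s) (y' h) (a s) (b s) + gm c (y s) (a' h) (b s) + gm c (y s) (a s) (b' h))) (at s within S)"
proof -
  have dGy: "((\<lambda>r. Gm c (y r) i j) has_derivative (\<lambda>h. dG c (y s) (y' h) (axis i 1) (axis j 1))) (at s within S)" for i j
    by (rule has_derivative_compose[OF y dG_has_derivative[OF c yX]])
  have comp: "((\<lambda>r. f r $ i) has_derivative (\<lambda>h. f' h $ i)) (at s within S)" if "(f has_derivative f') (at s within S)" for f f' :: "_ \<Rightarrow> real ^ 'n" and i
    using bounded_linear.has_derivative[OF bounded_linear_vec_nth that] .
  have "((\<lambda>r. \<Sum>i\<in>UNIV. \<Sum>j\<in>UNIV. a r $ i * b r $ j * Gm c (y r) i j) has_derivative
    (\<lambda>h. \<Sum>i\<in>UNIV. \<Sum>j\<in>UNIV. a s $ i * b s $ j * dG c (y s) (y' h) (axis i 1) (axis j 1)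
        + (a s $ i * b' h $ j + a' h $ i * b s $ j) * Gm c (y s) i j)) (at s within S)"
    by (intro has_derivative_sum has_derivative_mult comp a b dGy)
  moreover have "(\<Sum>i\<in>UNIV. \<Sum>j\<in>UNIV. a s $ i * b s $ j * dG c (y s) (y' h) (axis i 1) (axis j 1)
        + (a s $ i * b' h $ j + a' h $ i * b s $ j) * Gm c (y s) i j)
     = dG c (y s) (y' h) (a s) (b s) + gm c (y s) (a' h) (b s) + gm c (y s) (a s) (b' h)" for h
    unfolding dG_expand2[OF c yX, of "y' h" "a s" "b s"] gm_expand[OF c yX, of "a' h" "b s"] gm_expand[OF c yX, of "a s" "b' h"]
    by (simp add: distrib_right sum.distrib)
  ultimately have D: "((\<lambda>r. \<Sum>i\<in>UNIV. \<Sum>j\<in>UNIV. a r $ i * b r $ j * Gm c (y r) i j) has_derivative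
    (\<lambda>h. dG c (y s) (y' h) (a s) (b s) + gm c (y s) (a' h) (b s) + gm c (y s) (a s) (b' h))) (at s within S)"
    by simp
  have "continuous (at s within S) y" using y has_derivative_continuous by blast
  then have ev: "\<forall>\<^sub>F r in at s within S. y r \<in> X c"
    unfolding continuous_within using chart(2)[OF c] yX topological_tendstoD by blast
  show ?thesis
  proof (rule has_derivative_transform_eventually[OF D _ _ sS])
    show "\<forall>\<^sub>F r in at s within S. (\<Sum>i\<in>UNIV. \<Sum>j\<in>UNIV. a r $ i * b r $ j * Gm c (y r) i j) = gm c (y r) (a r) (b r)"
      using ev by eventually_elim (rule gm_expand[OF c, symmetric])
  qed (rule gm_expand[OF c yX, symmetric])
qed

text \<open>The second derivative of the transition map at \<open>p\<close>, as a bilinear map.\<close>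

definition T2 :: "('m, 'n) chart \<Rightarrow> ('m, 'n) chart \<Rightarrow> 'm \<Rightarrow> real ^ 'n \<Rightarrow> real ^ 'n \<Rightarrow> real ^ 'n" where
  "T2 c c' p w z = frechet_derivative (\<lambda>x. frechet_derivative (transition c c') (at x within overlap c c') w)
     (at (snd c p) within overlap c c') z"

lemma in_overlap: "p \<in> fst c \<Longrightarrow> p \<in> fst c' \<Longrightarrow> snd c p \<in> overlap c c'"
  by (auto simp: overlap_def)

lemma overlapE: assumes "x \<in> overlap c c'" obtains p where "p \<in> fst c" "p \<in> fst c'" "x = snd c p"
  using assms by (auto simp: overlap_def)

lemma T2_has_derivative:
  assumes "c \<in> A" "c' \<in> A" "p \<in> fst c" "p \<in> fst c'"
  shows "((\<lambda>x. frechet_derivative (transition c c') (at x within overlap c c') w) has_derivative T2 c c' p w) (at (snd c p))"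
  using smooth_on_has_derivative[OF smooth_on_derivative[OF transition_smooth] overlap_open in_overlap] assms
  unfolding T2_def by fastforce

lemma T2_sym:
  assumes "c \<in> A" "c' \<in> A" "p \<in> fst c" "p \<in> fst c'" shows "T2 c c' p w z = T2 c c' p z w"
  unfolding T2_def
  by (rule second_derivative_symmetric[OF transition_smooth overlap_open in_overlap]) (use assms in auto)

text \<open>
  Differentiate the identity that expresses the metric in one chart by the metric in the other. The
  derivative hits the base point and the two derivatives of the transition map.
\<close>

lemma dG_change:
  assumes c: "c \<in> A" "c' \<in> A" and p: "p \<in> fst c" "p \<in> fst c'"
  shows "dG c (snd c p) z u v = dG c' (snd c' p) (TD c c' p z) (TD c c' p u) (TD c c' p v)
    + gm c' (snd c' p) (T2 c c' p u z) (TD c c' p v) + gm c' (snd c' p) (TD c c' p u) (T2 c c' p v z)"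
proof -
  let ?\<tau> = "transition c c'" and ?O = "overlap c c'"
  let ?D = "\<lambda>u x. frechet_derivative ?\<tau> (at x within ?O) u"
  have TDe: "TD c c' q = (\<lambda>u. ?D u (snd c q))" for q by (simp add: transition_deriv_def)
  have y: "(?\<tau> has_derivative TD c c' p) (at (snd c p))" by (rule TD_has_derivative[OF c p])
  have "((\<lambda>x. gm c' (?\<tau> x) (?D u x) (?D v x)) has_derivative
    (\<lambda>h. dG c' (?\<tau> (snd c p)) (TD c c' p h) (?D u (snd c p)) (?D v (snd c p))
       + gm c' (?\<tau> (snd c p)) (T2 c c' p u h) (?D v (snd c p)) + gm c' (?\<tau> (snd c p)) (?D u (snd c p)) (T2 c c' p v h))) (at (snd c p))"
    by (rule gm_has_derivative[OF c(2) _ UNIV_I y T2_has_derivative[OF c p] T2_has_derivative[OF c p]])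
       (use c p in \<open>auto simp: transition_coords\<close>)
  then have "((\<lambda>x. gm c x u v) has_derivative
    (\<lambda>h. dG c' (?\<tau> (snd c p)) (TD c c' p h) (?D u (snd c p)) (?D v (snd c p))
       + gm c' (?\<tau> (snd c p)) (T2 c c' p u h) (?D v (snd c p)) + gm c' (?\<tau> (snd c p)) (?D u (snd c p)) (T2 c c' p v h))) (at (snd c p))"
  proof (rule has_derivative_transform_within_open[OF _ overlap_open[OF c] in_overlap[OF p]])
    fix x assume "x \<in> ?O"
    then obtain q where q: "q \<in> fst c" "q \<in> fst c'" "x = snd c q" by (rule overlapE)
    show "gm c' (?\<tau> x) (?D u x) (?D v x) = gm c x u v"
      using gm_coords[OF c(1) q(1), of u v] gm_coords[OF c(2) q(2), of "TD c c' q u" "TD c c' q v"]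
        toc_change[OF c q(1,2)] by (simp add: q transition_coords[OF c(1)] TDe)
  qed
  from has_derivative_unique[OF this dG_has_derivative[OF c(1)]] p c show ?thesis
    by (auto simp: fun_eq_iff transition_coords TDe)
qed

text \<open>
  The transformation law of the Christoffel symbols. By the Koszul formula and \<open>dG_change\<close> both sides
  have the same inner product with every vector; the terms in which the second derivative is paired with
  a test direction cancel by its symmetry.
\<close>

lemma Gam_change:
  assumes c: "c \<in> A" "c' \<in> A" and p: "p \<in> fst c" "p \<in> fst c'"
  shows "TD c c' p (Gam c (snd c p) w) = Gam c' (snd c' p) (TD c c' p w) + T2 c c' p w w"
proof -
  let ?B = "TD c c' p" and ?x = "snd c p" and ?y = "snd c' p"
  have xX: "?x \<in> X c" and yX: "?y \<in> X c'" using p by auto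
  define n where "n = ?B (Gam c ?x w) - (Gam c' ?y (?B w) + T2 c c' p w w)"
  have change: "gm c ?x u v = gm c' ?y (?B u) (?B v)" for u v
    using gm_coords[OF c(1) p(1), of u v] gm_coords[OF c(2) p(2), of "?B u" "?B v"] toc_change[OF c p] by simp
  have "gm c' ?y n (?B z) = 0" for z
  proof -
    have "gm c' ?y (?B (Gam c ?x w)) (?B z) = gm c ?x (Gam c ?x w) z" by (simp add: change)
    also have "\<dots> = dG c ?x w w z - dG c ?x z w w / 2" by (rule gm_Gam[OF c(1) xX])
    also have "\<dots> = dG c' ?y (?B w) (?B w) (?B z) - dG c' ?y (?B z) (?B w) (?B w) / 2 + gm c' ?y (T2 c c' p w w) (?B z)"
      unfolding dG_change[OF c p] T2_sym[OF c p, of w z]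
      by (simp add: gm_sym[OF c(2) yX, of "?B w"] field_simps)
    also have "\<dots> = gm c' ?y (Gam c' ?y (?B w)) (?B z) + gm c' ?y (T2 c c' p w w) (?B z)"
      by (simp add: gm_Gam[OF c(2) yX])
    finally show ?thesis
      unfolding n_def by (simp add: linear_diff[OF gm_linear1[OF c(2) yX]] linear_add[OF gm_linear1[OF c(2) yX]])
  qed
  \<comment> \<open>Every vector is in the image of \<open>?B\<close>, in particular the difference \<open>n\<close> itself.\<close>
  from this[of "TD c' c p n"] have "gm c' ?y n n = 0"
    using TD_chain[OF c(2,1,2) p(2,1,2)] TD_id[OF c(2) p(2)] by simp
  then have "n = 0" using gm_pos[OF c(2) yX, of n] by fastforce
  then show ?thesis by (simp add: n_def)
qed

lemma TD_bounded_expand: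
  assumes "c \<in> A" "c' \<in> A" "p \<in> fst c" "p \<in> fst c'"
  shows "TD c c' p u = (\<Sum>k\<in>UNIV. u $ k *\<^sub>R TD c c' p (axis k 1))"
  using linear_axis_expand[OF bounded_linear.linear[OF TD_linear[OF assms]]] by blast

text \<open>
  The expression \<open>h + \<Gamma>(v, v)\<close> transforms like a tangent vector: differentiating
  \<open>v' = d\<tau>(v)\<close> produces the second derivative of the transition map \<open>\<tau>\<close>, which is exactly what the
  transformation law of the Christoffel symbols compensates.
\<close>

lemma acceleration_change:
  fixes q :: "real \<Rightarrow> 'm"
  assumes c: "c \<in> A" "c' \<in> A" and p: "q t \<in> fst c" "q t \<in> fst c'" and t: "t \<in> I"
    and x: "((snd c \<circ> q) has_vector_derivative v t) (at t within I)"
    and v: "(v has_vector_derivative h) (at t within I)"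
    and ev: "\<forall>\<^sub>F s in at t within I. q s \<in> fst c \<and> q s \<in> fst c' \<and> v' s = TD c c' (q s) (v s)"
    and vt: "v' t = TD c c' (q t) (v t)"
  shows "(v' has_vector_derivative (TD c c' (q t) (h + Gam c (snd c (q t)) (v t)) - Gam c' (snd c' (q t)) (v' t))) (at t within I)"
proof -
  let ?D = "\<lambda>u x. frechet_derivative (transition c c') (at x within overlap c c') u"
  have TDe: "TD c c' q = (\<lambda>u. ?D u (snd c q))" for q by (simp add: transition_deriv_def)
  have 1: "((\<lambda>s. ?D u (snd c (q s))) has_derivative (\<lambda>r. T2 c c' (q t) u (r *\<^sub>R v t))) (at t within I)" for u
    using has_derivative_compose[OF x[unfolded has_vector_derivative_def o_def] T2_has_derivative[OF c p]] .
  have 2: "((\<lambda>s. v s $ k) has_derivative (\<lambda>r. (r *\<^sub>R h) $ k)) (at t within I)" for k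
    using bounded_linear.has_derivative[OF bounded_linear_vec_nth v[unfolded has_vector_derivative_def]] .
  have "((\<lambda>s. \<Sum>k\<in>UNIV. v s $ k *\<^sub>R ?D (axis k 1) (snd c (q s))) has_derivative
     (\<lambda>r. \<Sum>k\<in>UNIV. v t $ k *\<^sub>R T2 c c' (q t) (axis k 1) (r *\<^sub>R v t) + (r *\<^sub>R h) $ k *\<^sub>R ?D (axis k 1) (snd c (q t)))) (at t within I)"
    by (intro has_derivative_sum has_derivative_scaleR 1 2)
  moreover have "(\<Sum>k\<in>UNIV. v t $ k *\<^sub>R T2 c c' (q t) (axis k 1) (r *\<^sub>R v t) + (r *\<^sub>R h) $ k *\<^sub>R ?D (axis k 1) (snd c (q t)))
     = r *\<^sub>R (T2 c c' (q t) (v t) (v t) + TD c c' (q t) h)" for r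
  proof -
    have lin: "linear (T2 c c' (q t) u)" for u
      using T2_has_derivative[OF c p] has_derivative_bounded_linear bounded_linear.linear by blast
    have sy: "T2 c c' (q t) (v t) (axis k 1) = T2 c c' (q t) (axis k 1) (v t)" for k by (rule T2_sym[OF c p])
    have "(\<Sum>k\<in>UNIV. v t $ k *\<^sub>R T2 c c' (q t) (axis k 1) (v t)) = T2 c c' (q t) (v t) (v t)"
      using linear_axis_expand[OF lin, of "v t" "v t"] by (simp add: sy)
    moreover have "(\<Sum>k\<in>UNIV. h $ k *\<^sub>R ?D (axis k 1) (snd c (q t))) = TD c c' (q t) h"
      using TD_bounded_expand[OF c p, of h] by (simp add: TDe)
    moreover have "(\<Sum>k\<in>UNIV. v t $ k *\<^sub>R T2 c c' (q t) (axis k 1) (r *\<^sub>R v t) + (r *\<^sub>R h) $ k *\<^sub>R ?D (axis k 1) (snd c (q t)))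
      = r *\<^sub>R ((\<Sum>k\<in>UNIV. v t $ k *\<^sub>R T2 c c' (q t) (axis k 1) (v t)) + (\<Sum>k\<in>UNIV. h $ k *\<^sub>R ?D (axis k 1) (snd c (q t))))"
      by (simp add: linear_scale[OF lin] sum.distrib scaleR_sum_right scaleR_add_right mult.commute)
    ultimately show ?thesis by simp
  qed
  ultimately have "((\<lambda>s. \<Sum>k\<in>UNIV. v s $ k *\<^sub>R ?D (axis k 1) (snd c (q s))) has_vector_derivative
     (T2 c c' (q t) (v t) (v t) + TD c c' (q t) h)) (at t within I)"
    by (simp add: has_vector_derivative_def)
  then have d: "(v' has_vector_derivative (T2 c c' (q t) (v t) (v t) + TD c c' (q t) h)) (at t within I)"
    unfolding has_vector_derivative_def
  proof (rule has_derivative_transform_eventually[OF _ _ _ t])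
    show "\<forall>\<^sub>F s in at t within I. (\<Sum>k\<in>UNIV. v s $ k *\<^sub>R ?D (axis k 1) (snd c (q s))) = v' s"
      using ev
    proof eventually_elim
      case (elim s)
      then show ?case using TD_bounded_expand[OF c, of "q s" "v s"] by (simp add: TDe)
    qed
    show "(\<Sum>k\<in>UNIV. v t $ k *\<^sub>R ?D (axis k 1) (snd c (q t))) = v' t"
      using vt TD_bounded_expand[OF c p, of "v t"] by (simp add: TDe)
  qed
  have "T2 c c' (q t) (v t) (v t) + TD c c' (q t) h = TD c c' (q t) (h + Gam c (snd c (q t)) (v t)) - Gam c' (snd c' (q t)) (v' t)"
    using Gam_change[OF c p, of "v t"] linear_add[OF bounded_linear.linear[OF TD_linear[OF c p]]] vt by (simp add: algebra_simps)
  with d show ?thesis by simp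
qed

end

lemma absolutely_integrable_combine_real:
  fixes f :: "real \<Rightarrow> 'b::euclidean_space"
  assumes "f absolutely_integrable_on {a..b}" "f absolutely_integrable_on {b..c}" "a \<le> b" "b \<le> c"
  shows "f absolutely_integrable_on {a..c}"
  using set_integrable_Un[OF assms(1,2)] assms(3,4) by (simp add: ivl_disj_un)

context riemannian begin

section \<open>Curves of class H2\<close>

text \<open>
  The equality of the filters allows one-sided derivatives at the ends of the whole time interval and
  derivatives on the small interval to be exchanged.
\<close>

lemma chart_neighbourhood:
  fixes q :: "real \<Rightarrow> 'm" and T :: real
  assumes q: "continuous_on {0..T} q" and t: "0 \<le> t" "t \<le> T" and T: "T > 0" and c: "c \<in> A" "q t \<in> fst c"
  obtains a b d where "0 \<le> a" "a < b" "b \<le> T" "a \<le> t" "t \<le> b" "q ` {a..b} \<subseteq> fst c"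
    "at t within {0..T} = at t within {a..b}" "d > 0" "\<And>s. 0 \<le> s \<Longrightarrow> s \<le> T \<Longrightarrow> \<bar>s - t\<bar> < d \<Longrightarrow> s \<in> {a..b}"
proof -
  have "\<forall>\<^sub>F s in at t within {0..T}. q s \<in> fst c"
    using q t c chart(1)[OF c(1)] by (auto simp: continuous_on_def intro: topological_tendstoD)
  then obtain d where d: "d > 0" "\<And>s. s \<in> {0..T} \<Longrightarrow> s \<noteq> t \<Longrightarrow> dist s t < d \<Longrightarrow> q s \<in> fst c"
    unfolding eventually_at by metis
  define a where "a = max 0 (t - d/2)"
  define b where "b = min T (t + d/2)"
  have in1: "s \<in> {a..b}" if "0 \<le> s" "s \<le> T" "\<bar>s - t\<bar> < d/2" for s
    using that unfolding a_def b_def atLeastAtMost_iff by linarith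
  show thesis
  proof (rule that[of a b "d/2"])
    show "q ` {a..b} \<subseteq> fst c"
      using d c(2) by (force simp: a_def b_def dist_real_def image_subset_iff)
    show "at t within {0..T} = at t within {a..b}"
    proof (rule at_within_nhd[where S="ball t (d/2)"])
      show "{0..T} \<inter> ball t (d/2) - {t} = {a..b} \<inter> ball t (d/2) - {t}"
      proof (intro set_eqI iffI)
        fix x assume "x \<in> {0..T} \<inter> ball t (d/2) - {t}"
        then show "x \<in> {a..b} \<inter> ball t (d/2) - {t}" using in1[of x] by (auto simp: dist_real_def abs_minus_commute)
      next
        fix x assume "x \<in> {a..b} \<inter> ball t (d/2) - {t}"
        then show "x \<in> {0..T} \<inter> ball t (d/2) - {t}" by (auto simp: a_def b_def)
      qed
    qed (use d in auto)
  qed (use d t T in1 in \<open>auto simp: a_def b_def\<close>)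
qed

text \<open>
  Statements that are stable under concatenation of intervals need to be proved only on intervals on
  which the curve stays in one chart domain: compactness of the time interval, in the form of
  Bolzano's bisection principle.
\<close>

lemma chart_induction [consumes 4, case_names trans triv chart]:
  fixes q :: "real \<Rightarrow> 'm" and T :: real
  assumes q: "continuous_on {0..T} q" and ab: "0 \<le> a" "a \<le> b" "b \<le> T"
    and trans: "\<And>r s t. a \<le> r \<Longrightarrow> r \<le> s \<Longrightarrow> s \<le> t \<Longrightarrow> t \<le> b \<Longrightarrow> P r s \<Longrightarrow> P s t \<Longrightarrow> P r t"
    and triv: "\<And>s. a \<le> s \<Longrightarrow> s \<le> b \<Longrightarrow> P s s"
    and chart: "\<And>c s t. c \<in> A \<Longrightarrow> a \<le> s \<Longrightarrow> s < t \<Longrightarrow> t \<le> b \<Longrightarrow> q ` {s..t} \<subseteq> fst c \<Longrightarrow> P s t"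
  shows "P a b"
proof -
  have "a \<le> a \<and> b \<le> b \<longrightarrow> P a b"
  proof (rule Bolzano[where P="\<lambda>r t. a \<le> r \<and> t \<le> b \<longrightarrow> P r t", OF ab(2)])
    fix r s t
    assume "a \<le> r \<and> s \<le> b \<longrightarrow> P r s" "a \<le> s \<and> t \<le> b \<longrightarrow> P s t" "r \<le> s" "s \<le> t"
    then show "a \<le> r \<and> t \<le> b \<longrightarrow> P r t" using trans[of r s t] by auto
  next
    fix x assume local: "a \<le> x" "x \<le> b"
    show "\<exists>d>0. \<forall>r t. r \<le> x \<and> x \<le> t \<and> t - r < d \<longrightarrow> a \<le> r \<and> t \<le> b \<longrightarrow> P r t"
    proof (cases "T > 0")
      case True
      obtain c where c: "c \<in> A" "q x \<in> fst c" by (rule chart_exists)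
      have x: "0 \<le> x" "x \<le> T" using local ab by auto
      obtain a' b' d where n: "q ` {a'..b'} \<subseteq> fst c" "d > 0" "\<And>s. 0 \<le> s \<Longrightarrow> s \<le> T \<Longrightarrow> \<bar>s - x\<bar> < d \<Longrightarrow> s \<in> {a'..b'}"
        using chart_neighbourhood[OF q x True c] by metis
      have "P s t" if st: "s \<le> x" "x \<le> t" "t - s < d" "a \<le> s" "t \<le> b" for s t
      proof (cases "s = t")
        case False
        have "{s..t} \<subseteq> {a'..b'}"
        proof
          fix r assume "r \<in> {s..t}"
          then show "r \<in> {a'..b'}" using n(3)[of r] st ab by auto
        qed
        then show ?thesis using chart[OF c(1), of s t] st False n(1) by (meson image_mono order_le_less order_trans)
      qed (use triv st in auto)
      then show ?thesis using n(2) by blast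
    next
      case False
      then have "P s t" if "s \<le> x" "x \<le> t" "a \<le> s" "t \<le> b" for s t
        using triv[of s] that ab by (metis local order.antisym order_trans not_less)
      then show ?thesis by (intro exI[of _ 1]) auto
    qed
  qed
  then show ?thesis by simp
qed

lemma H2_curvesD:
  assumes "q \<in> H2_curves A T"
  shows "continuous_on {0..T} q"
    "\<And>c a b. c \<in> A \<Longrightarrow> 0 \<le> a \<Longrightarrow> a < b \<Longrightarrow> b \<le> T \<Longrightarrow> q ` {a..b} \<subseteq> fst c \<Longrightarrow> H2_on a b (snd c \<circ> q)"
  using assms by (auto simp: H2_curves_def)

lemma H2_curve_chart_rep:
  assumes q: "q \<in> H2_curves A T" and c: "c \<in> A" and ab: "0 \<le> a" "a < b" "b \<le> T" "q ` {a..b} \<subseteq> fst c"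
  obtains v h where "H2_rep a b (snd c \<circ> q) v h"
proof -
  have "continuous_on {a..b} (snd c \<circ> q)"
    using H2_curvesD(1)[OF q] chart(7)[OF c] ab
    by (intro continuous_on_compose) (auto intro: continuous_on_subset)
  then show thesis using H2_on_imp_H2_rep[OF H2_curvesD(2)[OF q c ab] ab(2)] that by blast
qed

lemma H2_rep_has_vector_derivative:
  "H2_rep a b f v h \<Longrightarrow> a \<le> t \<Longrightarrow> t \<le> b \<Longrightarrow> (f has_vector_derivative v t) (at t within {a..b})"
  unfolding H2_rep_def using AC_rep_derivative_unique AC_rep_continuous by blast

lemma velocity_derivative:
  assumes q: "q \<in> H2_curves A T" and T: "T > 0" and t: "0 \<le> t" "t \<le> T" and c: "c \<in> A" "q t \<in> fst c"
  shows "((snd c \<circ> q) has_vector_derivative velocity A {0..T} q t c) (at t within {0..T})"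
proof -
  obtain a b where n: "0 \<le> a" "a < b" "b \<le> T" "a \<le> t" "t \<le> b" "q ` {a..b} \<subseteq> fst c"
    "at t within {0..T} = at t within {a..b}"
    using chart_neighbourhood[OF H2_curvesD(1)[OF q] t T c] by metis
  obtain v h where "H2_rep a b (snd c \<circ> q) v h" using H2_curve_chart_rep[OF q c(1) n(1-3,6)] .
  from H2_rep_has_vector_derivative[OF this n(4,5)]
  have d: "((snd c \<circ> q) has_vector_derivative v t) (at t within {0..T})" using n(7) by simp
  then have "vector_derivative (snd c \<circ> q) (at t within {0..T}) = v t"
    using t T by (intro vector_derivative_within_closed_interval) auto
  then show ?thesis using d c by (simp add: velocity_def charts_at_def)
qed

lemma velocity_unique:
  assumes "((snd c \<circ> q) has_vector_derivative v) (at t within {0..T})" "0 \<le> t" "t \<le> T" "T > 0" "c \<in> A" "q t \<in> fst c"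
  shows "velocity A {0..T} q t c = v"
  using vector_derivative_within_closed_interval[OF _ _ assms(1)] assms(2-) by (simp add: velocity_def charts_at_def)

text \<open>
  The first derivative in the representation of a coordinate curve is continuous, hence it is the
  classical derivative and agrees with the velocity of the curve.
\<close>

lemma H2_curve_rep:
  assumes q: "q \<in> H2_curves A T" and c: "c \<in> A" and ab: "0 \<le> a" "a < b" "b \<le> T" "q ` {a..b} \<subseteq> fst c"
  obtains h where "H2_rep a b (snd c \<circ> q) (\<lambda>t. velocity A {0..T} q t c) h"
proof -
  obtain v h where r: "H2_rep a b (snd c \<circ> q) v h" using H2_curve_chart_rep[OF q c ab] .
  have eq: "v t = velocity A {0..T} q t c" if "a \<le> t" "t \<le> b" for t
  proof (rule vector_derivative_unique_within_closed_interval[OF ab(2), of t "snd c \<circ> q"])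
    show "((snd c \<circ> q) has_vector_derivative v t) (at t within cbox a b)"
      using H2_rep_has_vector_derivative[OF r that] by simp
    have "((snd c \<circ> q) has_vector_derivative velocity A {0..T} q t c) (at t within {0..T})"
      using that ab c by (intro velocity_derivative[OF q]) auto
    then show "((snd c \<circ> q) has_vector_derivative velocity A {0..T} q t c) (at t within cbox a b)"
      by (rule has_vector_derivative_within_subset) (use ab in auto)
  qed (use that in auto)
  have "H2_rep a b (snd c \<circ> q) (\<lambda>t. velocity A {0..T} q t c) h"
    using r eq unfolding H2_rep_def by (auto intro: AC_rep_cong)
  then show thesis by (rule that)
qed

lemma velocity_change:
  assumes q: "q \<in> H2_curves A T" and T: "T > 0" and t: "0 \<le> t" "t \<le> T"
    and c: "c \<in> A" "q t \<in> fst c" and c': "c' \<in> A" "q t \<in> fst c'"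
  shows "velocity A {0..T} q t c' = TD c c' (q t) (velocity A {0..T} q t c)"
proof (rule velocity_unique[where c=c' and q=q and t=t and T=T, OF _ t T c'])
  have "((transition c c' \<circ> (snd c \<circ> q)) has_vector_derivative TD c c' (q t) (velocity A {0..T} q t c)) (at t within {0..T})"
  proof -
    have "(transition c c' has_derivative TD c c' (q t)) (at ((snd c \<circ> q) t))"
      using TD_has_derivative[OF c(1) c'(1) c(2) c'(2)] by simp
    from has_derivative_compose[OF velocity_derivative[OF q T t c, unfolded has_vector_derivative_def] this]
    show ?thesis using linear_scale[OF bounded_linear.linear[OF TD_linear[OF c(1) c'(1) c(2) c'(2)]]]
      by (simp add: has_vector_derivative_def o_def)
  qed
  then show "((snd c' \<circ> q) has_vector_derivative TD c c' (q t) (velocity A {0..T} q t c)) (at t within {0..T})"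
    unfolding has_vector_derivative_def
  proof (rule has_derivative_transform_eventually)
    have "\<forall>\<^sub>F s in at t within {0..T}. q s \<in> fst c"
      using H2_curvesD(1)[OF q] t c chart(1)[OF c(1)] by (auto simp: continuous_on_def intro: topological_tendstoD)
    then show "\<forall>\<^sub>F s in at t within {0..T}. (transition c c' \<circ> (snd c \<circ> q)) s = (snd c' \<circ> q) s"
      by eventually_elim (simp add: transition_coords[OF c(1)])
  qed (use t c in \<open>auto simp: transition_coords\<close>)
qed

lemma velocity_tangent:
  assumes q: "q \<in> H2_curves A T" and T: "T > 0" and t: "0 \<le> t" "t \<le> T"
  shows "velocity A {0..T} q t \<in> tangent_space UNIV A (q t)"
  using velocity_change[OF q T t] unfolding tangent_space_def charts_at_def
  by (auto simp: velocity_def charts_at_def)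

definition acc :: "real \<Rightarrow> (real \<Rightarrow> 'm) \<Rightarrow> real \<Rightarrow> real" where
  "acc T q t = (riemannian_norm g (q t) (covariant_deriv A g {0..T} q (velocity A {0..T} q) t))\<^sup>2"

definition acc_coords :: "('m, 'n) chart \<Rightarrow> (real \<Rightarrow> real ^ 'n) \<Rightarrow> (real \<Rightarrow> real ^ 'n) \<Rightarrow> (real \<Rightarrow> real ^ 'n) \<Rightarrow> real \<Rightarrow> real ^ 'n" where
  "acc_coords c x v h t = h t + Gam c (x t) (v t)"

text \<open>
  The coordinates of the covariant derivative in a chart \<open>c'\<close> involve the derivative of the velocity
  coordinates in \<open>c'\<close>. Their existence at a given time has to be derived from a single chart \<open>c\<close>; this
  is what the transformation of the acceleration is for. As a result, one exceptional null set
  serves all charts.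
\<close>

lemma covariant_deriv_coords:
  assumes q: "q \<in> H2_curves A T" and T: "T > 0" and t: "0 < t" "t < T" and c: "c \<in> A" "q t \<in> fst c"
    and h: "((\<lambda>s. velocity A {0..T} q s c) has_vector_derivative h) (at t)"
  shows "covariant_deriv A g {0..T} q (velocity A {0..T} q) t
    = toc c (q t) (h + Gam c (snd c (q t)) (velocity A {0..T} q t c))"
proof
  fix c'
  let ?v = "velocity A {0..T} q"
  show "covariant_deriv A g {0..T} q ?v t c' = toc c (q t) (h + Gam c (snd c (q t)) (?v t c)) c'"
  proof (cases "c' \<in> charts_at A (q t)")
    case True
    then have c': "c' \<in> A" "q t \<in> fst c'" by (auto simp: charts_at_def)
    have h': "((\<lambda>s. ?v s c) has_vector_derivative h) (at t within {0..T})"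
      using h by (rule has_vector_derivative_at_within)
    have "\<forall>\<^sub>F s in at t within {0..T}. q s \<in> fst c" "\<forall>\<^sub>F s in at t within {0..T}. q s \<in> fst c'"
      using H2_curvesD(1)[OF q] t c c' chart(1)[OF c(1)] chart(1)[OF c'(1)] by (auto simp: continuous_on_def intro: topological_tendstoD)
    moreover have "\<forall>\<^sub>F s in at t within {0..T}. s \<in> {0..T}" by (simp add: eventually_at_filter)
    ultimately have ev: "\<forall>\<^sub>F s in at t within {0..T}. q s \<in> fst c \<and> q s \<in> fst c' \<and> ?v s c' = TD c c' (q s) (?v s c)"
    proof eventually_elim
      case (elim s)
      then show ?case using velocity_change[OF q T, of s c c'] c(1) c'(1) by auto
    qed
    have "((\<lambda>s. ?v s c') has_vector_derivative (TD c c' (q t) (h + Gam c (snd c (q t)) (?v t c)) - Gam c' (snd c' (q t)) (?v t c'))) (at t within {0..T})"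
      by (rule acceleration_change[OF c(1) c'(1) c(2) c'(2) _ _ h' ev])
         (use t c c' velocity_derivative[OF q T _ _ c] velocity_change[OF q T _ _ c c'] in auto)
    then have "vector_derivative (\<lambda>s. ?v s c') (at t within {0..T}) = TD c c' (q t) (h + Gam c (snd c (q t)) (?v t c)) - Gam c' (snd c' (q t)) (?v t c')"
      using t T by (intro vector_derivative_within_closed_interval) auto
    then show ?thesis using True toc_at[OF c', of c "h + Gam c (snd c (q t)) (?v t c)"]
      by (simp add: covariant_deriv_def Gam_def)
  qed (simp add: covariant_deriv_def tangent_of_coords_def)
qed

lemma acc_coords:
  assumes q: "q \<in> H2_curves A T" and T: "T > 0" and c: "c \<in> A" and ab: "0 \<le> a" "a < b" "b \<le> T" "q ` {a..b} \<subseteq> fst c"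
    and r: "H2_rep a b (snd c \<circ> q) (\<lambda>t. velocity A {0..T} q t c) h"
  defines "D \<equiv> acc_coords c (snd c \<circ> q) (\<lambda>t. velocity A {0..T} q t c) h"
  obtains N where "negligible N" "\<And>t. t \<in> {a..b} - N \<Longrightarrow> acc T q t = gm c (snd c (q t)) (D t) (D t)"
proof -
  obtain N where N: "negligible N" "\<And>t. a < t \<Longrightarrow> t < b \<Longrightarrow> t \<notin> N \<Longrightarrow> ((\<lambda>t. velocity A {0..T} q t c) has_vector_derivative h t) (at t)"
    using AC_rep_has_vector_derivative[of a b "\<lambda>t. velocity A {0..T} q t c" h] r unfolding H2_rep_def by blast
  show thesis
  proof
    show "negligible (N \<union> {a, b})" using N(1) by (intro negligible_Un) auto
    fix t assume t: "t \<in> {a..b} - (N \<union> {a, b})"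
    then have ct: "q t \<in> fst c" using ab by auto
    have "covariant_deriv A g {0..T} q (velocity A {0..T} q) t = toc c (q t) (D t)"
      using covariant_deriv_coords[OF q T _ _ c ct N(2)] t ab by (auto simp: D_def acc_coords_def)
    moreover have "gm c (snd c (q t)) (D t) (D t) = g (q t) (toc c (q t) (D t)) (toc c (q t) (D t))"
      by (rule gm_coords[OF c ct])
    moreover have "gm c (snd c (q t)) (D t) (D t) \<ge> 0" using gm_nonneg[OF c, of "snd c (q t)"] ct by simp
    ultimately show "acc T q t = gm c (snd c (q t)) (D t) (D t)"
      by (simp add: acc_def riemannian_norm_def)
  qed
qed

text \<open>
  On a compact coordinate set the integrand is dominated by a multiple of \<open>|D|\<^sup>2\<close>; measurability follows
  from the expansion in the metric coefficients.
\<close>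

lemma gm_L2_integrable:
  assumes c: "c \<in> A" and x: "continuous_on {a..b} x" "x ` {a..b} \<subseteq> X c" and D: "L2_on a b D"
  shows "(\<lambda>t. gm c (x t) (D t) (D t)) absolutely_integrable_on {a..b}"
proof -
  have "(\<lambda>t. D t $ i * D t $ j) absolutely_integrable_on {a..b}" for i j
  proof -
    have "integrable (lebesgue_on {a..b}) (\<lambda>t. D t $ i * D t $ j)"
    proof (rule Bochner_Integration.integrable_bound)
      show "integrable (lebesgue_on {a..b}) (\<lambda>t. (norm (D t))\<^sup>2)" using D by (simp add: L2_on_def)
      have m: "(\<lambda>t. D t $ i) \<in> borel_measurable (lebesgue_on {a..b})" for i
        using D borel_measurable_continuous_onI[OF linear_continuous_on[OF bounded_linear_vec_nth]]
        unfolding L2_on_def by (auto intro: measurable_compose)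
      show "(\<lambda>t. D t $ i * D t $ j) \<in> borel_measurable (lebesgue_on {a..b})" using m by simp
      show "AE t in lebesgue_on {a..b}. norm (D t $ i * D t $ j) \<le> norm ((norm (D t))\<^sup>2)"
        by (intro AE_I2) (auto simp: abs_mult power2_eq_square intro!: mult_mono component_le_norm_cart)
    qed
    then show ?thesis by (simp add: integrable_restrict_space set_integrable_def)
  qed
  then have "(\<lambda>t. \<Sum>i\<in>UNIV. \<Sum>j\<in>UNIV. Gm c (x t) i j *\<^sub>R (D t $ i * D t $ j)) absolutely_integrable_on {a..b}"
    by (intro absolutely_integrable_sum abs_integrable_continuous_scaleR
         continuous_on_compose2[OF smooth_on_continuous[OF gm_smooth[OF c]] x(1)]) (use x in auto)
  then show ?thesis
  proof (rule absolutely_integrable_spike[OF _ negligible_empty])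
    fix t assume "t \<in> {a..b} - {}"
    then have "x t \<in> X c" using x by auto
    from gm_expand[OF c this, of "D t" "D t"]
    show "gm c (x t) (D t) (D t) = (\<Sum>i\<in>UNIV. \<Sum>j\<in>UNIV. Gm c (x t) i j *\<^sub>R (D t $ i * D t $ j))"
      by (simp add: mult.commute)
  qed
qed

lemma H2_rep_continuous:
  assumes "H2_rep a b x v h" shows "continuous_on {a..b} x" "continuous_on {a..b} v"
  using assms AC_rep_continuous unfolding H2_rep_def by blast+

lemma acc_coords_L2:
  assumes c: "c \<in> A" and r: "H2_rep a b x v h" and x: "x ` {a..b} \<subseteq> X c"
  shows "L2_on a b (acc_coords c x v h)"
  unfolding L2_on_L2 acc_coords_def
proof (intro L2_add)
  show "L2 (lebesgue_on {a..b}) h" using r unfolding H2_rep_def L2_on_L2 by blast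
  show "L2 (lebesgue_on {a..b}) (\<lambda>t. Gam c (x t) (v t))"
    unfolding L2_on_L2[symmetric] by (intro L2_on_continuous Gam_continuous c x H2_rep_continuous[OF r])
qed

text \<open>
  Integrability has to be known before the action can be compared: the integral of a function that is
  not integrable is \<open>0\<close> by convention.
\<close>

lemma acc_integrable:
  assumes q: "q \<in> H2_curves A T" and T: "T > 0" and ab: "0 \<le> a" "a \<le> b" "b \<le> T"
  shows "acc T q absolutely_integrable_on {a..b}"
  using H2_curvesD(1)[OF q] ab
proof (induction rule: chart_induction)
  case (trans r s t) then show ?case by (intro absolutely_integrable_combine_real[where a=r and b=s and c=t])
next
  case (triv s)
  show ?case using integrable_on_refl[of "acc T q" s] integrable_on_refl[of "\<lambda>x. \<bar>acc T q x\<bar>" s]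
    by (simp add: absolutely_integrable_on_def)
next
  case (chart c s t)
  have st: "0 \<le> s" "s < t" "t \<le> T" "q ` {s..t} \<subseteq> fst c" using chart ab by auto
  obtain h where r: "H2_rep s t (snd c \<circ> q) (\<lambda>t. velocity A {0..T} q t c) h" using H2_curve_rep[OF q chart(1) st] .
  obtain N where N: "negligible N" "\<And>u. u \<in> {s..t} - N \<Longrightarrow> acc T q u = gm c (snd c (q u))
     (acc_coords c (snd c \<circ> q) (\<lambda>t. velocity A {0..T} q t c) h u) (acc_coords c (snd c \<circ> q) (\<lambda>t. velocity A {0..T} q t c) h u)"
    using acc_coords[OF q T chart(1) st r] by blast
  have sub: "(snd c \<circ> q) ` {s..t} \<subseteq> X c" using st(4) by auto
  show ?case
    by (rule absolutely_integrable_spike[OF gm_L2_integrable[OF chart(1) H2_rep_continuous(1)[OF r] sub acc_coords_L2[OF chart(1) r sub]] N(1)])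
       (use N(2) in simp)
qed

definition kin :: "real \<Rightarrow> (real \<Rightarrow> 'm) \<Rightarrow> real \<Rightarrow> real" where
  "kin T q t = g (q t) (velocity A {0..T} q t) (velocity A {0..T} q t)"

lemma kin_coords:
  assumes q: "q \<in> H2_curves A T" and T: "T > 0" and t: "0 \<le> t" "t \<le> T" and c: "c \<in> A" "q t \<in> fst c"
  shows "kin T q t = gm c (snd c (q t)) (velocity A {0..T} q t c) (velocity A {0..T} q t c)"
  unfolding kin_def by (intro g_eq_gm velocity_tangent[OF q T t] c)

text \<open>
  Compatibility of the Levi-Civita connection with the metric, along a curve: the derivative of
  \<open>g(v, v)\<close> is \<open>2 g(Dv/dt, v)\<close>. The derivative of the metric coefficients that the product rule
  produces is the one in the Koszul formula with \<open>z = w\<close>.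
\<close>

lemma kin_AC:
  assumes c: "c \<in> A" and r: "H2_rep a b x v h" and x: "x ` {a..b} \<subseteq> X c"
  shows "AC_rep a b (\<lambda>t. gm c (x t) (v t) (v t)) (\<lambda>t. 2 * gm c (x t) (acc_coords c x v h t) (v t))"
proof -
  note cx = H2_rep_continuous(1)[OF r] and cv = H2_rep_continuous(2)[OF r]
  have v: "AC_rep a b v h" using r by (simp add: H2_rep_def)
  have vi: "AC_rep a b (\<lambda>t. v t $ i) (\<lambda>t. h t $ i)" for i
    by (rule AC_rep_linear[OF v bounded_linear_vec_nth])
  have Gx: "AC_rep a b (\<lambda>t. Gm c (x t) i j) (\<lambda>t. dG c (x t) (v t) (axis i 1) (axis j 1))" for i j
  proof (rule AC_rep_C1)
    fix t assume t: "a \<le> t" "t \<le> b"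
    then have xt: "x t \<in> X c" using x by auto
    have "((\<lambda>t. Gm c (x t) i j) has_derivative (\<lambda>r. dG c (x t) (r *\<^sub>R v t) (axis i 1) (axis j 1))) (at t within {a..b})"
      by (rule has_derivative_compose[OF H2_rep_has_vector_derivative[OF r t, unfolded has_vector_derivative_def] dG_has_derivative[OF c xt]])
    moreover have "linear (\<lambda>z. dG c (x t) z (axis i 1) (axis j 1))"
      using dG_has_derivative[OF c xt] has_derivative_bounded_linear bounded_linear.linear by blast
    ultimately show "((\<lambda>t. Gm c (x t) i j) has_vector_derivative dG c (x t) (v t) (axis i 1) (axis j 1)) (at t within {a..b})"
      using linear_scale[of "\<lambda>z. dG c (x t) z (axis i 1) (axis j 1)"] by (simp add: has_vector_derivative_def)
  next
    have "continuous_on {a..b} (\<lambda>t. \<Sum>l\<in>UNIV. v t $ l * metric_partial A g c (x t) l i j)"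
      unfolding metric_partial_eq
      by (intro continuous_intros cv continuous_on_compose2[OF dG_continuous[OF c] cx] x)
    then show "continuous_on {a..b} (\<lambda>t. dG c (x t) (v t) (axis i 1) (axis j 1))"
    proof (rule continuous_on_eq)
      fix t assume "t \<in> {a..b}"
      then have xt: "x t \<in> X c" using x by auto
      have "linear (\<lambda>z. dG c (x t) z (axis i 1) (axis j 1))"
        using dG_has_derivative[OF c xt] has_derivative_bounded_linear bounded_linear.linear by blast
      from linear_axis_expand[OF this, of "v t"]
      show "(\<Sum>l\<in>UNIV. v t $ l * metric_partial A g c (x t) l i j) = dG c (x t) (v t) (axis i 1) (axis j 1)"
        by (simp add: metric_partial_eq)
    qed
  qed
  note bm = bounded_bilinear_mult[where 'a=real]
  have "AC_rep a b (\<lambda>t. \<Sum>i\<in>UNIV. \<Sum>j\<in>UNIV. (v t $ i * v t $ j) * Gm c (x t) i j)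
    (\<lambda>t. \<Sum>i\<in>UNIV. \<Sum>j\<in>UNIV. (v t $ i * v t $ j) * dG c (x t) (v t) (axis i 1) (axis j 1)
      + (v t $ i * h t $ j + h t $ i * v t $ j) * Gm c (x t) i j)"
    by (intro AC_rep_sum finite AC_rep_bilinear[OF bm] vi Gx)
  then show ?thesis
  proof (rule AC_rep_cong)
    fix t assume t: "a \<le> t" "t \<le> b"
    then have xt: "x t \<in> X c" using x by auto
    show "(\<Sum>i\<in>UNIV. \<Sum>j\<in>UNIV. v t $ i * v t $ j * Gm c (x t) i j) = gm c (x t) (v t) (v t)"
      by (rule gm_expand[OF c xt, symmetric])
    have "(\<Sum>i\<in>UNIV. \<Sum>j\<in>UNIV. v t $ i * v t $ j * dG c (x t) (v t) (axis i 1) (axis j 1)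
        + (v t $ i * h t $ j + h t $ i * v t $ j) * Gm c (x t) i j)
      = dG c (x t) (v t) (v t) (v t) + gm c (x t) (v t) (h t) + gm c (x t) (h t) (v t)"
      unfolding dG_expand2[OF c xt, of "v t" "v t" "v t"] gm_expand[OF c xt, of "v t" "h t"] gm_expand[OF c xt, of "h t" "v t"]
      by (simp add: distrib_right sum.distrib)
    also have "\<dots> = 2 * gm c (x t) (acc_coords c x v h t) (v t)"
      unfolding acc_coords_def linear_add[OF gm_linear1[OF c xt]] gm_Gam[OF c xt]
      using gm_sym[OF c xt, of "v t" "h t"] by simp
    finally show "(\<Sum>i\<in>UNIV. \<Sum>j\<in>UNIV. v t $ i * v t $ j * dG c (x t) (v t) (axis i 1) (axis j 1)
        + (v t $ i * h t $ j + h t $ i * v t $ j) * Gm c (x t) i j) = 2 * gm c (x t) (acc_coords c x v h t) (v t)" .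
  qed
qed

lemma kin_nonneg:
  assumes q: "q \<in> H2_curves A T" and T: "T > 0" and t: "0 \<le> t" "t \<le> T" shows "kin T q t \<ge> 0"
proof -
  obtain c where c: "c \<in> A" "q t \<in> fst c" by (rule chart_exists)
  show ?thesis unfolding kin_coords[OF q T t c] by (rule gm_nonneg) (use c in auto)
qed

lemma kin_continuous:
  assumes q: "q \<in> H2_curves A T" and T: "T > 0" shows "continuous_on {0..T} (kin T q)"
  unfolding continuous_on_eq_continuous_within
proof
  fix t assume "t \<in> {0..T}"
  then have t: "0 \<le> t" "t \<le> T" by auto
  obtain c where c: "c \<in> A" "q t \<in> fst c" by (rule chart_exists)
  obtain a b where n: "0 \<le> a" "a < b" "b \<le> T" "a \<le> t" "t \<le> b" "q ` {a..b} \<subseteq> fst c"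
    "at t within {0..T} = at t within {a..b}"
    using chart_neighbourhood[OF H2_curvesD(1)[OF q] t T c] by metis
  obtain h where r: "H2_rep a b (snd c \<circ> q) (\<lambda>t. velocity A {0..T} q t c) h" using H2_curve_rep[OF q c(1) n(1-3,6)] .
  have "continuous_on {a..b} (\<lambda>t. gm c ((snd c \<circ> q) t) (velocity A {0..T} q t c) (velocity A {0..T} q t c))"
    using n(6) by (intro gm_continuous c H2_rep_continuous[OF r]) auto
  then have "continuous_on {a..b} (kin T q)"
    by (rule continuous_on_eq) (use n kin_coords[OF q T _ _ c(1)] in \<open>auto simp: image_subset_iff\<close>)
  then show "continuous (at t within {0..T}) (kin T q)"
    using n by (simp add: continuous_on_eq_continuous_within)
qed

text \<open>
  The derivative \<open>2 g(Dv/dt, v)\<close> of the energy is estimated by Young's inequality. The weight \<open>2 T\<close> makes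
  the integral of the second term over \<open>{0..T}\<close> at most half of the maximal energy.
\<close>

lemma kin_increment:
  assumes q: "q \<in> H2_curves A T" and T: "T > 0" and ab: "0 \<le> a" "a \<le> b" "b \<le> T"
  shows "kin T q b - kin T q a \<le> integral {a..b} (\<lambda>t. 2 * T * acc T q t + kin T q t / (2 * T))"
  using H2_curvesD(1)[OF q] ab
proof (induction rule: chart_induction)
  case (trans r s t)
  have i: "(\<lambda>t. 2 * T * acc T q t + kin T q t / (2 * T)) integrable_on {r..t}"
  proof (intro integrable_add)
    show "(\<lambda>x. 2 * T * acc T q x) integrable_on {r..t}"
      using integrable_on_cmult_left[of "acc T q" "{r..t}" "2 * T"] acc_integrable[OF q T, of r t] trans ab
      by (auto simp: absolutely_integrable_on_def)
    show "(\<lambda>x. kin T q x / (2 * T)) integrable_on {r..t}"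
      using trans ab T by (intro integrable_continuous_interval continuous_intros continuous_on_subset[OF kin_continuous[OF q T]]) auto
  qed
  show ?case
    using Henstock_Kurzweil_Integration.integral_combine[OF trans(2,3) i] trans by linarith
next
  case (chart c s t)
  have st: "0 \<le> s" "s < t" "t \<le> T" "q ` {s..t} \<subseteq> fst c" using chart ab by auto
  let ?v = "\<lambda>t. velocity A {0..T} q t c" and ?x = "snd c \<circ> q"
  obtain h where r: "H2_rep s t ?x ?v h" using H2_curve_rep[OF q chart(1) st] .
  let ?D = "acc_coords c ?x ?v h"
  obtain N where N: "negligible N" "\<And>u. u \<in> {s..t} - N \<Longrightarrow> acc T q u = gm c (snd c (q u)) (?D u) (?D u)"
    using acc_coords[OF q T chart(1) st r] by blast
  have sub: "?x ` {s..t} \<subseteq> X c" using st(4) by auto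
  have xX: "?x u \<in> X c" if "u \<in> {s..t}" for u using sub that by blast
  have k: "kin T q u = gm c (?x u) (?v u) (?v u)" if "u \<in> {s..t}" for u
    using kin_coords[OF q T _ _ chart(1), of u] that st by (auto simp: image_subset_iff)
  note AC = kin_AC[OF chart(1) r sub]
  have cont: "continuous_on {s..t} (\<lambda>u. gm c (?x u) (?v u) (?v u))"
    by (intro gm_continuous chart(1) H2_rep_continuous[OF r] sub)
  have i1: "(\<lambda>u. 2 * T * gm c (?x u) (?D u) (?D u)) integrable_on {s..t}"
    using integrable_on_cmult_left[of "\<lambda>u. gm c (?x u) (?D u) (?D u)" "{s..t}" "2 * T"]
      gm_L2_integrable[OF chart(1) H2_rep_continuous(1)[OF r] sub acc_coords_L2[OF chart(1) r sub]]
    by (auto simp: absolutely_integrable_on_def)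
  have i2: "(\<lambda>u. gm c (?x u) (?v u) (?v u) / (2 * T)) integrable_on {s..t}"
    using T by (intro integrable_continuous_interval continuous_intros cont) auto
  have "kin T q t - kin T q s = integral {s..t} (\<lambda>u. 2 * gm c (?x u) (?D u) (?v u))"
    using AC_rep_increment[OF AC order_refl _ order_refl] k st by simp
  also have "\<dots> \<le> integral {s..t} (\<lambda>u. 2 * T * gm c (?x u) (?D u) (?D u) + gm c (?x u) (?v u) (?v u) / (2 * T))"
  proof (rule integral_le)
    show "(\<lambda>u. 2 * gm c (?x u) (?D u) (?v u)) integrable_on {s..t}"
      using AC_repD_integrable(1)[OF AC order_refl order_refl] .
    show "(\<lambda>u. 2 * T * gm c (?x u) (?D u) (?D u) + gm c (?x u) (?v u) (?v u) / (2 * T)) integrable_on {s..t}"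
      by (intro integrable_add i1 i2)
    show "2 * gm c (?x u) (?D u) (?v u) \<le> 2 * T * gm c (?x u) (?D u) (?D u) + gm c (?x u) (?v u) (?v u) / (2 * T)" if "u \<in> {s..t}" for u
      using gm_amgm[OF chart(1) xX[OF that], of "2 * T"] T by simp
  qed
  also have "\<dots> = integral {s..t} (\<lambda>t. 2 * T * acc T q t + kin T q t / (2 * T))"
    by (rule integral_spike[OF N(1)]) (use N(2) k in auto)
  finally show ?case .
qed simp

text \<open>
  Apply the increment estimate between \<open>0\<close> and a time \<open>m\<close> at which the energy is maximal: half of the
  maximum is absorbed into the left-hand side.
\<close>

lemma kin_bound:
  assumes q: "q \<in> H2_curves A T" and T: "T > 0" and t: "0 \<le> t" "t \<le> T"
  shows "kin T q t \<le> 2 * kin T q 0 + 4 * T * integral {0..T} (acc T q)"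
proof -
  obtain m where m: "m \<in> {0..T}" "\<And>s. s \<in> {0..T} \<Longrightarrow> kin T q s \<le> kin T q m"
    using continuous_attains_sup[OF _ _ kin_continuous[OF q T]] T by force
  have ai: "acc T q integrable_on {0..s}" if "0 \<le> s" "s \<le> T" for s
    using acc_integrable[OF q T order_refl that] by (simp add: absolutely_integrable_on_def)
  have k0: "kin T q m \<ge> 0" using kin_nonneg[OF q T] m by simp
  have ki: "kin T q integrable_on {0..m}"
    using m by (intro integrable_continuous_interval continuous_on_subset[OF kin_continuous[OF q T]]) auto
  have "integral {0..m} (\<lambda>t. 2 * T * acc T q t + kin T q t / (2 * T)) = 2 * T * integral {0..m} (acc T q) + integral {0..m} (kin T q) / (2 * T)"
  proof -
    have "((\<lambda>t. 2 * T * acc T q t + kin T q t / (2 * T)) has_integral (2 * T * integral {0..m} (acc T q) + integral {0..m} (kin T q) / (2 * T))) {0..m}"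
      using has_integral_add[OF has_integral_mult_right[OF integrable_integral[OF ai], of m "2 * T"] has_integral_divide[OF integrable_integral[OF ki], of "2 * T"]] m
      by auto
    then show ?thesis by (rule integral_unique)
  qed
  moreover have "integral {0..m} (acc T q) \<le> integral {0..T} (acc T q)"
    using m by (intro integral_subset_le ai) (auto simp: acc_def)
  moreover have "integral {0..m} (kin T q) \<le> T * kin T q m"
  proof -
    have "integral {0..m} (kin T q) \<le> integral {0..m} (\<lambda>_. kin T q m)"
      using m by (intro integral_le ki) auto
    also have "\<dots> = m * kin T q m" using m by simp
    also have "\<dots> \<le> T * kin T q m" using m k0 by (intro mult_right_mono) auto
    finally show ?thesis .
  qed
  ultimately have "integral {0..m} (\<lambda>t. 2 * T * acc T q t + kin T q t / (2 * T)) \<le> 2 * T * integral {0..T} (acc T q) + kin T q m / 2"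
    using T by (simp add: field_simps add_mono)
  then have "kin T q m - kin T q 0 \<le> 2 * T * integral {0..T} (acc T q) + kin T q m / 2"
    using kin_increment[OF q T, of 0 m] m by simp
  then have "kin T q m \<le> 2 * kin T q 0 + 4 * T * integral {0..T} (acc T q)" by simp
  then show ?thesis using m(2)[of t] t by auto
qed

end

text \<open>A property that is stable under concatenation need only be checked between consecutive break points.\<close>

lemma break_induction [consumes 2, case_names trans step]:
  fixes s t :: real
  assumes "finite P" "s < t"
    and trans: "\<And>a b c. s \<le> a \<Longrightarrow> a < b \<Longrightarrow> b < c \<Longrightarrow> c \<le> t \<Longrightarrow> Q a b \<Longrightarrow> Q b c \<Longrightarrow> Q a c"
    and step: "\<And>a b. s \<le> a \<Longrightarrow> a < b \<Longrightarrow> b \<le> t \<Longrightarrow> {a<..<b} \<inter> P = {} \<Longrightarrow> Q a b"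
  shows "Q s t"
proof -
  have "Q a b" if "s \<le> a" "a < b" "b \<le> t" "card ({a<..<b} \<inter> P) = n" for n a b
    using that
  proof (induction n arbitrary: a b rule: less_induct)
    case (less n)
    show ?case
    proof (cases "{a<..<b} \<inter> P = {}")
      case True then show ?thesis using step less.prems by blast
    next
      case False
      then obtain p where p: "a < p" "p < b" "p \<in> P" by auto
      have "{a<..<p} \<inter> P \<subset> {a<..<b} \<inter> P" "{p<..<b} \<inter> P \<subset> {a<..<b} \<inter> P" using p by auto
      then have "card ({a<..<p} \<inter> P) < n" "card ({p<..<b} \<inter> P) < n"
        using \<open>finite P\<close> less.prems(4) by (auto intro!: psubset_card_mono)
      then have "Q a p" "Q p b" using less.IH p less.prems by auto
      then show ?thesis using trans p less.prems by blast
    qed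
  qed
  then show ?thesis using \<open>s < t\<close> by blast
qed

lemma C1_on_affine:
  assumes "C1_on a' b' f" and im: "\<And>t. t \<in> {a..b} \<Longrightarrow> \<alpha> * t + \<beta> \<in> {a'..b'}"
  shows "C1_on a b (\<lambda>t. f (\<alpha> * t + \<beta>))"
proof -
  obtain f' where f': "continuous_on {a'..b'} f'" "\<And>t. t \<in> {a'..b'} \<Longrightarrow> (f has_vector_derivative f' t) (at t within {a'..b'})"
    using assms(1) by (auto simp: C1_on_def)
  show ?thesis unfolding C1_on_def
  proof (intro exI[of _ "\<lambda>t. \<alpha> *\<^sub>R f' (\<alpha> * t + \<beta>)"] conjI ballI)
    show "continuous_on {a..b} (\<lambda>t. \<alpha> *\<^sub>R f' (\<alpha> * t + \<beta>))"
      by (intro continuous_intros continuous_on_compose2[OF f'(1)]) (use im in auto)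
    fix t assume t: "t \<in> {a..b}"
    have 1: "((\<lambda>t. \<alpha> * t + \<beta>) has_derivative (\<lambda>h. \<alpha> * h)) (at t within {a..b})"
      by (auto intro!: derivative_eq_intros)
    have 2: "(f has_derivative (\<lambda>h. h *\<^sub>R f' (\<alpha> * t + \<beta>))) (at (\<alpha> * t + \<beta>) within (\<lambda>t. \<alpha> * t + \<beta>) ` {a..b})"
      by (rule has_derivative_subset[OF f'(2)[OF im[OF t], unfolded has_vector_derivative_def]]) (use im in auto)
    show "((\<lambda>t. f (\<alpha> * t + \<beta>)) has_vector_derivative \<alpha> *\<^sub>R f' (\<alpha> * t + \<beta>)) (at t within {a..b})"
      using has_derivative_in_compose[OF 1 2] by (simp add: has_vector_derivative_def mult.commute)
  qed
qed

context riemannian begin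

section \<open>Piecewise C1 curves and the Riemannian distance\<close>

text \<open>
  At an interior time, differentiability of the coordinates in one chart gives the velocity in all
  charts. The criterion is pointwise, so that it applies to piecewise differentiable curves between
  their break points and to reparametrizations of \<open>H\<^sup>2\<close> curves alike.
\<close>

lemma velocity_toc:
  fixes q :: "real \<Rightarrow> 'm" and T :: real
  assumes t: "0 < t" "t < T" and c: "c \<in> A" "q t \<in> fst c" and ev: "\<forall>\<^sub>F s in at t. q s \<in> fst c"
    and d: "((snd c \<circ> q) has_vector_derivative w) (at t)"
  shows "velocity A {0..T} q t = toc c (q t) w"
proof
  fix c'
  show "velocity A {0..T} q t c' = toc c (q t) w c'"
  proof (cases "c' \<in> charts_at A (q t)")
    case True
    then have c': "c' \<in> A" "q t \<in> fst c'" by (auto simp: charts_at_def)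
    have "(transition c c' has_derivative TD c c' (q t)) (at ((snd c \<circ> q) t))"
      using TD_has_derivative[OF c(1) c'(1) c(2) c'(2)] by simp
    from has_derivative_compose[OF d[unfolded has_vector_derivative_def] this]
    have "((\<lambda>s. transition c c' (snd c (q s))) has_vector_derivative TD c c' (q t) w) (at t)"
      using linear_scale[OF bounded_linear.linear[OF TD_linear[OF c(1) c'(1) c(2) c'(2)]]]
      by (simp add: has_vector_derivative_def o_def)
    then have "((snd c' \<circ> q) has_vector_derivative TD c c' (q t) w) (at t)"
      unfolding has_vector_derivative_def
    proof (rule has_derivative_transform_eventually)
      show "\<forall>\<^sub>F s in at t. transition c c' (snd c (q s)) = (snd c' \<circ> q) s"
        using ev by eventually_elim (simp add: transition_coords[OF c(1)])
    qed (use t c in \<open>auto simp: transition_coords\<close>)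
    then have "((snd c' \<circ> q) has_vector_derivative TD c c' (q t) w) (at t within {0..T})"
      by (rule has_vector_derivative_at_within)
    then have "vector_derivative (snd c' \<circ> q) (at t within {0..T}) = TD c c' (q t) w"
      using t by (intro vector_derivative_within_closed_interval) auto
    then show ?thesis using True toc_at[OF c'] by (simp add: velocity_def)
  qed (simp add: velocity_def tangent_of_coords_def)
qed

abbreviation speed where "speed q t \<equiv> riemannian_norm g (q t) (velocity A {0..1} q t)"

text \<open>The definition of piecewise differentiable curves with the set of break points made explicit.\<close>

definition pwC1 :: "real set \<Rightarrow> (real \<Rightarrow> 'm) \<Rightarrow> bool" where
  "pwC1 P q \<longleftrightarrow> finite P \<and> continuous_on {0..1} q \<and> (\<forall>c\<in>A. \<forall>a b. 0 \<le> a \<and> a < b \<and> b \<le> 1 \<and> {a<..<b} \<inter> P = {} \<and>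
      q ` {a..b} \<subseteq> fst c \<longrightarrow> C1_on a b (snd c \<circ> q))"

lemma piecewise_pwC1: "piecewise_C1_curve A q \<longleftrightarrow> (\<exists>P. pwC1 P q)"
  unfolding piecewise_C1_curve_def pwC1_def by blast

lemma speed_toc:
  assumes c: "c \<in> A" "q t \<in> fst c" and v: "velocity A {0..1} q t = toc c (q t) w"
  shows "speed q t = sqrt (gm c (snd c (q t)) w w)"
  unfolding riemannian_norm_def v gm_coords[OF c] ..

lemma pwC1_chart:
  assumes q: "pwC1 P q" and c: "c \<in> A" and ab: "0 \<le> a" "a < b" "b \<le> 1" "q ` {a..b} \<subseteq> fst c" "{a<..<b} \<inter> P = {}"
  obtains f where "continuous_on {a..b} f" "AC_rep a b (snd c \<circ> q) f"
    "\<And>t. a < t \<Longrightarrow> t < b \<Longrightarrow> velocity A {0..1} q t = toc c (q t) (f t)"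
    "\<And>t. a < t \<Longrightarrow> t < b \<Longrightarrow> speed q t = sqrt (gm c (snd c (q t)) (f t) (f t))"
proof -
  have "C1_on a b (snd c \<circ> q)" using q c ab unfolding pwC1_def by blast
  then obtain f where f: "continuous_on {a..b} f" "\<And>t. t \<in> {a..b} \<Longrightarrow> ((snd c \<circ> q) has_vector_derivative f t) (at t within {a..b})"
    by (auto simp: C1_on_def)
  have v: "velocity A {0..1} q t = toc c (q t) (f t)" if t: "a < t" "t < b" for t
  proof (rule velocity_toc)
    show "((snd c \<circ> q) has_vector_derivative f t) (at t)"
      using f(2)[of t] t by (simp add: at_within_Icc_at)
    have "\<forall>\<^sub>F s in at t. s \<in> {a<..<b}" using t by (intro eventually_at_in_open') auto
    then show "\<forall>\<^sub>F s in at t. q s \<in> fst c" by eventually_elim (use ab(4) in auto)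
  qed (use t ab c in auto)
  show thesis
  proof (rule that[OF f(1) _ v])
    show "AC_rep a b (snd c \<circ> q) f" by (rule AC_rep_C1) (use f in auto)
    show "speed q t = sqrt (gm c (snd c (q t)) (f t) (f t))" if "a < t" "t < b" for t
      using that ab by (intro speed_toc c v) auto
  qed
qed

lemma speed_chart_integrable:
  assumes q: "pwC1 P q" and c: "c \<in> A" and ab: "0 \<le> a" "a < b" "b \<le> 1" "q ` {a..b} \<subseteq> fst c"
  shows "speed q absolutely_integrable_on {a..b}"
proof -
  have "finite P" using q by (simp add: pwC1_def)
  then show ?thesis using ab(2)
  proof (induction rule: break_induction)
    case (trans r s t) then show ?case by (intro absolutely_integrable_combine_real[where a=r and b=s and c=t]) auto
  next
    case (step s t)
    have sub: "q ` {s..t} \<subseteq> fst c" using ab(4) step by (auto simp: image_subset_iff)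
    have s0: "0 \<le> s" and t1: "t \<le> 1" using ab step by auto
    obtain f where f: "continuous_on {s..t} f" "AC_rep s t (snd c \<circ> q) f"
      "\<And>u. s < u \<Longrightarrow> u < t \<Longrightarrow> speed q u = sqrt (gm c (snd c (q u)) (f u) (f u))"
      using pwC1_chart[OF q c s0 step(2) t1 sub step(4)] by metis
    have "continuous_on {s..t} (\<lambda>u. sqrt (gm c ((snd c \<circ> q) u) (f u) (f u)))"
      using sub by (intro continuous_on_real_sqrt gm_continuous c f AC_rep_continuous[OF f(2)]) auto
    then have "(\<lambda>u. sqrt (gm c ((snd c \<circ> q) u) (f u) (f u))) absolutely_integrable_on {s..t}"
      by (rule absolutely_integrable_continuous_real)
    then show ?case
      by (rule absolutely_integrable_spike[where S="{s,t}"]) (use f(3) in auto)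
  qed
qed

lemma speed_integrable:
  assumes q: "pwC1 P q" and ab: "0 \<le> a" "a \<le> b" "b \<le> 1"
  shows "speed q absolutely_integrable_on {a..b}"
proof -
  have "continuous_on {0..1} q" using q by (simp add: pwC1_def)
  then show ?thesis using ab
  proof (induction rule: chart_induction)
    case (trans r s t) then show ?case by (intro absolutely_integrable_combine_real[where a=r and b=s and c=t])
  next
    case (triv s)
    show ?case using integrable_on_refl[of "speed q" s] integrable_on_refl[of "\<lambda>x. \<bar>speed q x\<bar>" s]
      by (simp add: absolutely_integrable_on_def)
  next
    case (chart c s t) then show ?case using ab by (intro speed_chart_integrable[OF q, of c]) auto
  qed
qed

text \<open>
  In a chart, the Euclidean displacement is at most a constant times the length, if the metric dominates
  the Euclidean norm there. The estimate is proved between break points and added up.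
\<close>

lemma speed_chart_bounds:
  assumes q: "pwC1 P q" and c: "c \<in> A" and ab: "0 \<le> a" "a < b" "b \<le> 1" "q ` {a..b} \<subseteq> fst c"
    and K: "(snd c \<circ> q) ` {a..b} \<subseteq> K" and k: "\<And>x u. x \<in> K \<Longrightarrow> norm u \<le> C * sqrt (gm c x u u)"
  shows "norm (snd c (q b) - snd c (q a)) \<le> C * integral {a..b} (speed q) \<and> integral {a..b} (speed q) \<ge> 0"
proof -
  have "finite P" using q by (simp add: pwC1_def)
  then show ?thesis using ab(2)
  proof (induction rule: break_induction)
    case (trans r s t)
    have "speed q integrable_on {r..t}" using speed_integrable[OF q, of r t] trans ab by (simp add: absolutely_integrable_on_def)
    then have "integral {r..t} (speed q) = integral {r..s} (speed q) + integral {s..t} (speed q)"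
      using trans by (intro Henstock_Kurzweil_Integration.integral_combine[symmetric]) auto
    moreover have "norm (snd c (q t) - snd c (q r)) \<le> norm (snd c (q t) - snd c (q s)) + norm (snd c (q s) - snd c (q r))"
      using norm_triangle_ineq[of "snd c (q t) - snd c (q s)" "snd c (q s) - snd c (q r)"] by simp
    ultimately show ?case using trans(5,6) by (simp add: distrib_left)
  next
    case (step s t)
    have sub: "q ` {s..t} \<subseteq> fst c" using ab(4) step by (auto simp: image_subset_iff)
    have s0: "0 \<le> s" and t1: "t \<le> 1" using ab step by auto
    obtain f where f: "continuous_on {s..t} f" "AC_rep s t (snd c \<circ> q) f"
      "\<And>u. s < u \<Longrightarrow> u < t \<Longrightarrow> speed q u = sqrt (gm c (snd c (q u)) (f u) (f u))"
      using pwC1_chart[OF q c s0 step(2) t1 sub step(4)] by metis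
    let ?s = "\<lambda>u. sqrt (gm c ((snd c \<circ> q) u) (f u) (f u))"
    have cont: "continuous_on {s..t} ?s"
      using sub by (intro continuous_on_real_sqrt gm_continuous c f AC_rep_continuous[OF f(2)]) auto
    have eq: "integral {s..t} (speed q) = integral {s..t} ?s"
      by (rule integral_spike[where S="{s,t}"]) (use f(3) in auto)
    have "norm (snd c (q t) - snd c (q s)) = norm (integral {s..t} f)"
      using AC_rep_increment[OF f(2) order_refl _ order_refl] step by simp
    also have "\<dots> \<le> integral {s..t} (\<lambda>u. C * ?s u)"
    proof (rule integral_norm_bound_integral)
      show "f integrable_on {s..t}" by (rule integrable_continuous_interval[OF f(1)])
      show "(\<lambda>u. C * ?s u) integrable_on {s..t}" by (intro integrable_continuous_interval continuous_intros cont)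
      show "norm (f u) \<le> C * ?s u" if "u \<in> {s..t}" for u using K that step by (intro k) auto
    qed
    finally have 1: "norm (snd c (q t) - snd c (q s)) \<le> C * integral {s..t} (speed q)" unfolding eq by simp
    have "integral {s..t} (speed q) \<ge> 0" unfolding eq
      by (rule Henstock_Kurzweil_Integration.integral_nonneg[OF integrable_continuous_interval[OF cont]])
         (use gm_nonneg[OF c] sub in \<open>auto simp: image_subset_iff\<close>)
    with 1 show ?case by simp
  qed
qed

lemma speed_integral_nonneg:
  assumes q: "pwC1 P q" and ab: "0 \<le> a" "a \<le> b" "b \<le> 1"
  shows "integral {a..b} (speed q) \<ge> 0"
proof -
  have "continuous_on {0..1} q" using q by (simp add: pwC1_def)
  then show ?thesis using ab
  proof (induction rule: chart_induction)
    case (trans r s t)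
    have "speed q integrable_on {r..t}" using speed_integrable[OF q, of r t] trans ab by (simp add: absolutely_integrable_on_def)
    then have "integral {r..t} (speed q) = integral {r..s} (speed q) + integral {s..t} (speed q)"
      using trans by (intro Henstock_Kurzweil_Integration.integral_combine[symmetric]) auto
    then show ?case using trans by simp
  next
    case (triv s) then show ?case by simp
  next
    case pc: (chart c s t)
    have sub: "q ` {s..t} \<subseteq> fst c" "s < t" "0 \<le> s" "t \<le> 1" using pc ab by auto
    have cq: "continuous_on {s..t} (snd c \<circ> q)"
    proof (rule continuous_on_compose)
      show "continuous_on {s..t} q" using q sub unfolding pwC1_def by (auto intro: continuous_on_subset)
      show "continuous_on (q ` {s..t}) (snd c)" using continuous_on_subset[OF chart(7)[OF pc(1)] sub(1)] .
    qed
    obtain k C where k: "k > 0" "\<And>x u. x \<in> (snd c \<circ> q) ` {s..t} \<Longrightarrow> k * (norm u)\<^sup>2 \<le> gm c x u u"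
      using gm_compact_bounds[OF pc(1) compact_continuous_image[OF cq compact_Icc]] sub by (metis image_comp image_mono)
    have "norm u \<le> (1 / sqrt k) * sqrt (gm c x u u)" if "x \<in> (snd c \<circ> q) ` {s..t}" for x u
    proof -
      have "sqrt (k * (norm u)\<^sup>2) \<le> sqrt (gm c x u u)" using k(2)[OF that] by simp
      then show ?thesis using k(1) by (simp add: real_sqrt_mult field_simps)
    qed
    from speed_chart_bounds[OF q pc(1) sub(3,2,4,1) order_refl this] show ?case by simp
  qed
qed

lemma curve_length_integral:
  assumes "pwC1 P q" shows "curve_length A g q = integral {0..1} (speed q)"
  unfolding curve_length_def by (rule LINT_eq_integral(2)[OF speed_integrable[OF assms]]) auto

lemma curve_length_nonneg: "piecewise_C1_curve A q \<Longrightarrow> curve_length A g q \<ge> 0"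
  using curve_length_integral speed_integral_nonneg by (auto simp: piecewise_pwC1)

lemma curve_length_le:
  assumes "pwC1 P q" "finite N" "\<And>t. 0 < t \<Longrightarrow> t < 1 \<Longrightarrow> t \<notin> N \<Longrightarrow> speed q t \<le> L"
  shows "curve_length A g q \<le> L"
proof -
  define f where "f t = (if t \<in> N \<union> {0,1} then L else speed q t)" for t
  have N: "negligible (N \<union> {0,1})" using assms(2) by (intro negligible_finite) auto
  have "speed q integrable_on {0..1}" using speed_integrable[OF assms(1), of 0 1] by (simp add: absolutely_integrable_on_def)
  then have fi: "f integrable_on {0..1}" by (rule integrable_spike[OF _ N]) (auto simp: f_def)
  have "curve_length A g q = integral {0..1} f"
    unfolding curve_length_integral[OF assms(1)] by (rule integral_spike[OF N]) (auto simp: f_def)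
  also have "\<dots> \<le> integral {0..1} (\<lambda>t::real. L)"
    by (rule integral_le[OF fi]) (use assms(3) in \<open>force simp: f_def\<close>)+
  also have "\<dots> = L" by simp
  finally show ?thesis .
qed

text \<open>
  A curve that starts at \<open>p\<close> and leaves a coordinate ball around \<open>p\<close> has to cover half of its radius
  inside the ball, where length dominates Euclidean displacement. This is the estimate that makes the
  Riemannian distance separate points and refine the topology of the manifold.
\<close>

lemma short_curve_stays:
  assumes W: "open W" "p \<in> W"
  obtains r where "r > 0" "\<And>q. piecewise_C1_curve A q \<Longrightarrow> q 0 = p \<Longrightarrow> curve_length A g q < r \<Longrightarrow> q 1 \<in> W"
proof -
  obtain c where c: "c \<in> A" "p \<in> fst c" by (rule chart_exists)
  have "open (snd c ` (W \<inter> fst c))" using W chart(1)[OF c(1)] by (intro open_chart_image c) auto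
  moreover have "snd c p \<in> snd c ` (W \<inter> fst c)" using W c by blast
  ultimately obtain \<rho> where \<rho>: "\<rho> > 0" "cball (snd c p) \<rho> \<subseteq> snd c ` (W \<inter> fst c)"
    unfolding open_contains_cball by blast
  have sub: "cball (snd c p) \<rho> \<subseteq> X c" using \<rho>(2) by auto
  obtain k C where k: "k > 0" "\<And>x u. x \<in> cball (snd c p) \<rho> \<Longrightarrow> k * (norm u)\<^sup>2 \<le> gm c x u u"
    using gm_compact_bounds[OF c(1) compact_cball sub] by metis
  define C' where "C' = 1 / sqrt k"
  have C': "C' > 0" using k by (simp add: C'_def)
  have kC: "norm u \<le> C' * sqrt (gm c x u u)" if "x \<in> cball (snd c p) \<rho>" for x u
  proof -
    have "sqrt (k * (norm u)\<^sup>2) \<le> sqrt (gm c x u u)" using k(2)[OF that] by simp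
    then show ?thesis using k(1) by (simp add: C'_def real_sqrt_mult field_simps)
  qed
  define U where "U = fst c \<inter> snd c -` ball (snd c p) \<rho>"
  have oU: "open U" unfolding U_def
    by (intro continuous_open_preimage chart c open_ball)
  \<comment> \<open>A compact neighbourhood of \<open>p\<close> inside \<open>U\<close>. Up to the first exit time from \<open>U\<close> a short curve stays
    in \<open>Z\<close>, hence also at that time, a contradiction. The image of the ball is closed in the manifold
    because it is compact and the manifold is Hausdorff.\<close>
  define Z where "Z = param c ` cball (snd c p) (\<rho>/2)"
  have "cball (snd c p) (\<rho>/2) \<subseteq> cball (snd c p) \<rho>" using \<rho>(1) by (intro subset_cball) auto
  then have "cball (snd c p) (\<rho>/2) \<subseteq> X c" using sub by blast
  then have "compact Z" unfolding Z_def
    by (intro compact_continuous_image compact_cball continuous_on_subset[OF chart(8)[OF c(1)]])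
  then have cZ: "closed Z" by (rule compact_imp_closed)
  have ZU: "Z \<subseteq> U"
  proof
    fix z assume "z \<in> Z"
    then obtain x where x: "x \<in> cball (snd c p) (\<rho>/2)" "z = param c x" by (auto simp: Z_def)
    then have "x \<in> X c" using sub \<rho> by auto
    then show "z \<in> U" using chart(5,6)[OF c(1)] x \<rho> by (auto simp: U_def)
  qed
  have UW: "U \<subseteq> W"
  proof
    fix z assume z: "z \<in> U"
    then have "snd c z \<in> snd c ` (W \<inter> fst c)" using \<rho>(2) by (auto simp: U_def)
    then obtain z' where "z' \<in> W \<inter> fst c" "snd c z = snd c z'" by auto
    then show "z \<in> W" using chart(4)[OF c(1)] z by (metis IntD1 IntD2 U_def)
  qed
  show thesis
  proof (rule that[of "\<rho> / (2 * C')"])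
    show "\<rho> / (2 * C') > 0" using \<rho> C' by simp
    fix q assume "piecewise_C1_curve A q" and q0: "q 0 = p" and len: "curve_length A g q < \<rho> / (2 * C')"
    then obtain P where q: "pwC1 P q" by (auto simp: piecewise_pwC1)
    have cq: "continuous_on {0..1} q" using q by (simp add: pwC1_def)
    define S where "S = {t \<in> {0..1}. q t \<notin> U}"
    have "q 1 \<in> U"
    proof (rule ccontr)
      assume "q 1 \<notin> U"
      then have ne: "S \<noteq> {}" by (auto simp: S_def)
      have "closedin (top_of_set {0..1}) ({0..1} \<inter> q -` (- U))"
        using oU by (intro continuous_closedin_preimage[OF cq]) auto
      moreover have "S = {0..1} \<inter> q -` (- U)" by (auto simp: S_def)
      ultimately have clS: "closed S" using closedin_closed_trans closed_atLeastAtMost by metis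
      define \<tau> where "\<tau> = Inf S"
      have bdd: "bdd_below S" by (rule bdd_belowI[of _ 0]) (auto simp: S_def)
      have \<tau>S: "\<tau> \<in> S" unfolding \<tau>_def by (rule closed_contains_Inf[OF ne bdd clS])
      have before: "q t \<in> U" if "0 \<le> t" "t < \<tau>" for t
      proof (rule ccontr)
        assume "q t \<notin> U"
        then have "t \<in> S" using that \<tau>S by (auto simp: S_def)
        then show False using cInf_lower[OF _ bdd, of t] that by (simp add: \<tau>_def)
      qed
      have pU: "p \<in> U" using c \<rho> by (auto simp: U_def)
      have \<tau>0: "0 < \<tau>" "\<tau> \<le> 1" using \<tau>S pU q0 by (auto simp: S_def less_le)
      have inZ: "q t \<in> Z" if t: "0 < t" "t < \<tau>" for t
      proof -
        have "q ` {0..t} \<subseteq> U" using before t by auto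
        then have s: "q ` {0..t} \<subseteq> fst c" "(snd c \<circ> q) ` {0..t} \<subseteq> cball (snd c p) \<rho>"
          by (auto simp: U_def image_subset_iff)
        have "integral {0..t} (speed q) \<le> integral {0..t} (speed q) + integral {t..1} (speed q)"
          using speed_integral_nonneg[OF q, of t 1] t \<tau>0 by simp
        also have "\<dots> = integral {0..1} (speed q)"
          using t \<tau>0 speed_integrable[OF q, of 0 1]
          by (intro Henstock_Kurzweil_Integration.integral_combine) (auto simp: absolutely_integrable_on_def)
        finally have short: "integral {0..t} (speed q) < \<rho> / (2 * C')" using len curve_length_integral[OF q] by simp
        have "norm (snd c (q t) - snd c (q 0)) \<le> C' * integral {0..t} (speed q)"
          using speed_chart_bounds[OF q c(1) order_refl t(1) _ s kC] t \<tau>0 by auto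
        also have "\<dots> \<le> C' * (\<rho> / (2 * C'))" using short C' by (intro mult_left_mono) auto
        finally have "norm (snd c (q t) - snd c p) \<le> C' * (\<rho> / (2 * C'))" unfolding q0 .
        then have "snd c (q t) \<in> cball (snd c p) (\<rho>/2)" using C' by (simp add: dist_norm norm_minus_commute)
        moreover have "q t = param c (snd c (q t))" using chart(4)[OF c(1), of "q t"] s(1) t by (simp add: image_subset_iff)
        ultimately show ?thesis unfolding Z_def by blast
      qed
      have "q \<tau> \<in> Z"
      proof (rule Lim_in_closed_set[OF cZ, where F="at \<tau> within {0<..<\<tau>}" and f=q])
        show "\<forall>\<^sub>F t in at \<tau> within {0<..<\<tau>}. q t \<in> Z" using inZ by (auto simp: eventually_at_filter)
        have "\<tau> islimpt {0<..<\<tau>}" using \<tau>0 by (simp add: islimpt_greaterThanLessThan2)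
        then show "at \<tau> within {0<..<\<tau>} \<noteq> bot" by (simp add: trivial_limit_within)
        have "(q \<longlongrightarrow> q \<tau>) (at \<tau> within {0..1})" using cq \<tau>0 by (auto simp: continuous_on_def)
        then show "(q \<longlongrightarrow> q \<tau>) (at \<tau> within {0<..<\<tau>})" by (rule tendsto_within_subset) (use \<tau>0 in auto)
      qed
      then show False using ZU \<tau>S by (auto simp: S_def)
    qed
    then show "q 1 \<in> W" using UW by auto
  qed
qed

text \<open>
  The third conclusion writes the derivative as a finite sum of products of continuous functions; the
  sum can be differentiated once more.
\<close>

lemma smooth_compose_C1:
  fixes F :: "real ^ 'n \<Rightarrow> real ^ 'n"
  assumes F: "smooth_on UNIV W F" and W: "open W" and xW: "x ` {a..b} \<subseteq> W"
    and x: "\<And>t. t \<in> {a..b} \<Longrightarrow> (x has_vector_derivative x' t) (at t within {a..b})" and x': "continuous_on {a..b} x'"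
  shows "\<And>t. t \<in> {a..b} \<Longrightarrow> ((\<lambda>t. F (x t)) has_vector_derivative frechet_derivative F (at (x t) within W) (x' t)) (at t within {a..b})"
    and "continuous_on {a..b} (\<lambda>t. frechet_derivative F (at (x t) within W) (x' t))"
    and "\<And>t. t \<in> {a..b} \<Longrightarrow> frechet_derivative F (at (x t) within W) (x' t) = (\<Sum>k\<in>UNIV. x' t $ k *\<^sub>R frechet_derivative F (at (x t) within W) (axis k 1))"
proof -
  let ?D = "\<lambda>y. frechet_derivative F (at y within W)"
  have lin: "bounded_linear (?D (x t))" if "t \<in> {a..b}" for t
    using smooth_on_has_derivative[OF F W] that xW has_derivative_bounded_linear by blast
  have cx: "continuous_on {a..b} x" using x by (meson continuous_on_eq_continuous_within has_vector_derivative_continuous)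
  show ex: "?D (x t) (x' t) = (\<Sum>k\<in>UNIV. x' t $ k *\<^sub>R ?D (x t) (axis k 1))" if "t \<in> {a..b}" for t
    by (rule linear_axis_expand[OF bounded_linear.linear[OF lin[OF that]]])
  have "continuous_on {a..b} (\<lambda>t. \<Sum>k\<in>UNIV. x' t $ k *\<^sub>R ?D (x t) (axis k 1))"
    by (intro continuous_intros x' continuous_on_compose2[OF smooth_on_continuous[OF smooth_on_derivative[OF F]] cx xW])
  then show "continuous_on {a..b} (\<lambda>t. ?D (x t) (x' t))"
    by (rule continuous_on_eq) (rule ex[symmetric])
  fix t assume t: "t \<in> {a..b}"
  have "(F has_derivative ?D (x t)) (at (x t))" using smooth_on_has_derivative[OF F W] t xW by blast
  from has_derivative_compose[OF x[OF t, unfolded has_vector_derivative_def] this]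
  show "((\<lambda>t. F (x t)) has_vector_derivative ?D (x t) (x' t)) (at t within {a..b})"
    using linear_scale[OF bounded_linear.linear[OF lin[OF t]]] by (simp add: has_vector_derivative_def)
qed

lemma C1_transition:
  assumes c: "c \<in> A" "c' \<in> A" and x: "continuous_on {a..b} x'" "\<And>t. t \<in> {a..b} \<Longrightarrow> (x has_vector_derivative x' t) (at t within {a..b})"
    and o: "x ` {a..b} \<subseteq> overlap c c'"
  shows "C1_on a b (\<lambda>t. transition c c' (x t))"
  unfolding C1_on_def
  using smooth_compose_C1(1,2)[OF transition_smooth[OF c] overlap_open[OF c] o x(2,1)]
  by (intro exI[of _ "\<lambda>t. frechet_derivative (transition c c') (at (x t) within overlap c c') (x' t)"]) auto

text \<open>
  A segment in a convex coordinate set is differentiable in every chart, as transition maps are smooth,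
  and its speed is at most \<open>C\<close> times the Euclidean length of the segment.
\<close>

lemma segment_curve:
  assumes c: "c \<in> A" and K: "convex K" "K \<subseteq> X c" and xy: "x \<in> K" "y \<in> K"
    and C: "\<And>z u. z \<in> K \<Longrightarrow> gm c z u u \<le> C\<^sup>2 * (norm u)\<^sup>2" "C \<ge> 0"
  obtains q where "piecewise_C1_curve A q" "q 0 = param c x" "q 1 = param c y" "curve_length A g q \<le> C * norm (y - x)"
proof -
  define z where "z t = x + t *\<^sub>R (y - x)" for t
  have zK: "z t \<in> K" if "0 \<le> t" "t \<le> 1" for t
    using convexD_alt[OF K(1) xy that] by (simp add: z_def algebra_simps)
  have zd: "(z has_vector_derivative (y - x)) (at t within S)" for t S
    unfolding z_def by (auto intro!: derivative_eq_intros)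
  have cz: "continuous_on S z" for S unfolding z_def by (intro continuous_intros)
  define q where "q t = param c (z t)" for t
  have qc: "q t \<in> fst c" "snd c (q t) = z t" if "0 \<le> t" "t \<le> 1" for t
    using zK[OF that] K(2) chart(5,6)[OF c] by (auto simp: q_def)
  have pw: "pwC1 {} q"
    unfolding pwC1_def
  proof (intro conjI ballI allI impI)
    show "continuous_on {0..1} q" unfolding q_def
      by (rule continuous_on_compose2[OF chart(8)[OF c] cz]) (use zK K(2) in auto)
    fix c' a b assume c': "c' \<in> A" and ab: "0 \<le> a \<and> a < b \<and> b \<le> 1 \<and> {a<..<b} \<inter> {} = {} \<and> q ` {a..b} \<subseteq> fst c'"
    have ov: "z ` {a..b} \<subseteq> overlap c c'"
    proof
      fix w assume "w \<in> z ` {a..b}"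
      then obtain t where t: "t \<in> {a..b}" "w = z t" by auto
      then have "q t \<in> fst c" "q t \<in> fst c'" "snd c (q t) = w" using qc[of t] ab by auto
      then show "w \<in> overlap c c'" by (auto simp: overlap_def)
    qed
    have "C1_on a b (\<lambda>t. transition c c' (z t))"
      by (rule C1_transition[OF c c' continuous_on_const zd ov])
    then show "C1_on a b (snd c' \<circ> q)" by (simp add: transition_def q_def o_def)
  qed simp
  show thesis
  proof (rule that[of q])
    show "piecewise_C1_curve A q" using pw piecewise_pwC1 by blast
    show "curve_length A g q \<le> C * norm (y - x)"
    proof (rule curve_length_le[OF pw finite.emptyI])
      fix t :: real assume t: "0 < t" "t < 1"
      have ev: "\<forall>\<^sub>F s in at t. s \<in> {0<..<1}" using t by (intro eventually_at_in_open') auto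
      have "((snd c \<circ> q) has_vector_derivative (y - x)) (at t)"
        using zd unfolding has_vector_derivative_def
        by (rule has_derivative_transform_eventually)
           (use ev qc t in \<open>auto elim!: eventually_mono\<close>)
      moreover have "\<forall>\<^sub>F s in at t. q s \<in> fst c" using ev by eventually_elim (use qc in auto)
      ultimately have "velocity A {0..1} q t = toc c (q t) (y - x)"
        using t qc c by (intro velocity_toc) auto
      then have "speed q t = sqrt (gm c (z t) (y - x) (y - x))"
        using speed_toc[OF c, of q t "y - x"] qc[of t] t by simp
      also have "\<dots> \<le> sqrt ((C * norm (y - x))\<^sup>2)"
        using C(1)[OF zK[of t], of "y - x"] t by (simp add: power_mult_distrib)
      also have "\<dots> = C * norm (y - x)" using C(2) by simp
      finally show "speed q t \<le> C * norm (y - x)" .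
    qed
  qed (auto simp: q_def z_def)
qed

lemma short_segments:
  assumes "e > 0"
  obtains U where "open U" "p \<in> U" "\<And>y. y \<in> U \<Longrightarrow> \<exists>q. piecewise_C1_curve A q \<and> q 0 = p \<and> q 1 = y \<and> curve_length A g q < e"
proof -
  obtain c where c: "c \<in> A" "p \<in> fst c" by (rule chart_exists)
  have "open (X c)" "snd c p \<in> X c" using chart(2) c by auto
  then obtain \<rho> where \<rho>: "\<rho> > 0" "cball (snd c p) \<rho> \<subseteq> X c" unfolding open_contains_cball by blast
  obtain k C where k: "C > 0" "\<And>x u. x \<in> cball (snd c p) \<rho> \<Longrightarrow> gm c x u u \<le> C * (norm u)\<^sup>2"
    using gm_compact_bounds[OF c(1) compact_cball \<rho>(2)] by metis
  define r where "r = min \<rho> (e / sqrt C)"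
  have r: "r > 0" using \<rho> k assms by (simp add: r_def)
  define U where "U = fst c \<inter> snd c -` ball (snd c p) r"
  show thesis
  proof (rule that[of U])
    show "open U" unfolding U_def by (intro continuous_open_preimage chart c open_ball)
    show "p \<in> U" using c r by (simp add: U_def)
    fix y assume y: "y \<in> U"
    obtain q where "piecewise_C1_curve A q" "q 0 = param c (snd c p)" "q 1 = param c (snd c y)" "curve_length A g q \<le> sqrt C * norm (snd c y - snd c p)"
      by (rule segment_curve[where x="snd c p" and y="snd c y" and C="sqrt C", OF c(1) convex_cball \<rho>(2)])
         (use y \<rho> k in \<open>auto simp: U_def r_def\<close>)
    moreover have "sqrt C * norm (snd c y - snd c p) < e"
    proof -
      have "norm (snd c y - snd c p) < e / sqrt C" using y by (auto simp: U_def r_def dist_norm norm_minus_commute)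
      then show ?thesis using k by (simp add: field_simps)
    qed
    ultimately show "\<exists>q. piecewise_C1_curve A q \<and> q 0 = p \<and> q 1 = y \<and> curve_length A g q < e"
      using chart(4)[OF c(1)] y c by (intro exI[of _ q]) (auto simp: U_def)
  qed
qed

text \<open>
  An affine image \<open>r\<close> of \<open>q\<close> on a subinterval \<open>{u..w}\<close>; negative slopes are allowed. Reversal and the two
  halves of a concatenation are the special cases used below.
\<close>

lemma affine_piece:
  assumes q: "pwC1 P q" and al: "\<alpha> \<noteq> 0" and uw: "0 \<le> u" "u < w" "w \<le> 1"
    and im: "(\<lambda>t. \<alpha> * t + \<beta>) ` {u..w} = {0..1}"
    and eq: "\<And>t. t \<in> {u..w} \<Longrightarrow> r t = q (\<alpha> * t + \<beta>)"
  shows "(speed r has_integral curve_length A g q) {u..w}"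
    and "\<And>c a b. c \<in> A \<Longrightarrow> u \<le> a \<Longrightarrow> a < b \<Longrightarrow> b \<le> w \<Longrightarrow> {a<..<b} \<inter> (\<lambda>s. (s - \<beta>) / \<alpha>) ` P = {} \<Longrightarrow> r ` {a..b} \<subseteq> fst c \<Longrightarrow> C1_on a b (snd c \<circ> r)"
    and "continuous_on {u..w} r"
proof -
  have fP: "finite P" and cq: "continuous_on {0..1} q" using q by (auto simp: pwC1_def)
  have in01: "\<alpha> * t + \<beta> \<in> {0..1}" if "t \<in> {u..w}" for t using im that by blast
  show "continuous_on {u..w} r"
  proof (rule continuous_on_eq[where f="\<lambda>t. q (\<alpha> * t + \<beta>)"])
    show "continuous_on {u..w} (\<lambda>t. q (\<alpha> * t + \<beta>))"
      by (rule continuous_on_compose2[OF cq]) (use in01 in \<open>auto intro!: continuous_intros\<close>)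
  qed (use eq in auto)
  show C1: "C1_on a b (snd c \<circ> r)" if c: "c \<in> A" and ab: "u \<le> a" "a < b" "b \<le> w" "{a<..<b} \<inter> (\<lambda>s. (s - \<beta>) / \<alpha>) ` P = {}" "r ` {a..b} \<subseteq> fst c" for c a b
  proof -
    define a' where "a' = min (\<alpha> * a + \<beta>) (\<alpha> * b + \<beta>)"
    define b' where "b' = max (\<alpha> * a + \<beta>) (\<alpha> * b + \<beta>)"
    have cs: "\<alpha> > 0 \<and> a' = \<alpha> * a + \<beta> \<and> b' = \<alpha> * b + \<beta> \<or> \<alpha> < 0 \<and> a' = \<alpha> * b + \<beta> \<and> b' = \<alpha> * a + \<beta>"
    proof (cases "\<alpha> > 0")
      case True
      then have "\<alpha> * a < \<alpha> * b" using ab(2) by simp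
      then show ?thesis using True by (simp add: a'_def b'_def)
    next
      case False
      then have "\<alpha> < 0" using al by simp
      moreover from this have "\<alpha> * b < \<alpha> * a" using ab(2) by simp
      ultimately show ?thesis by (simp add: a'_def b'_def)
    qed
    have im': "\<alpha> * t + \<beta> \<in> {a'..b'}" if "t \<in> {a..b}" for t
      using cs that by (auto simp: mult_left_mono mult_left_mono_neg)
    have inv: "(s - \<beta>) / \<alpha> \<in> {a..b}" if "s \<in> {a'..b'}" for s
      using cs that by (auto simp: field_simps)
    have inv': "(s - \<beta>) / \<alpha> \<in> {a<..<b}" if "s \<in> {a'<..<b'}" for s
      using cs that by (auto simp: field_simps)
    have s_eq: "\<alpha> * ((s - \<beta>) / \<alpha>) + \<beta> = s" for s using al by simp
    have ab': "0 \<le> a'" "a' < b'" "b' \<le> 1"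
      using in01[of a] in01[of b] ab al by (auto simp: a'_def b'_def min_def max_def)
    have "{a'<..<b'} \<inter> P = {}" using inv' ab(4) by blast
    moreover have "q ` {a'..b'} \<subseteq> fst c"
    proof
      fix p assume "p \<in> q ` {a'..b'}"
      then obtain s where s: "s \<in> {a'..b'}" "p = q s" by auto
      then have "p = r ((s - \<beta>) / \<alpha>)" using eq[of "(s - \<beta>) / \<alpha>"] inv[of s] ab s_eq by auto
      then show "p \<in> fst c" using inv[OF s(1)] ab(5) by blast
    qed
    ultimately have "C1_on a' b' (snd c \<circ> q)" using q c ab' unfolding pwC1_def by blast
    from C1_on_affine[OF this im'] have C: "C1_on a b (\<lambda>t. (snd c \<circ> q) (\<alpha> * t + \<beta>))" by blast
    have "(snd c \<circ> q) (\<alpha> * t + \<beta>) = (snd c \<circ> r) t" if "t \<in> {a..b}" for t using eq[of t] that ab by auto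
    moreover obtain F where F: "continuous_on {a..b} F"
      "\<And>t. t \<in> {a..b} \<Longrightarrow> ((\<lambda>t. (snd c \<circ> q) (\<alpha> * t + \<beta>)) has_vector_derivative F t) (at t within {a..b})"
      using C by (auto simp: C1_on_def)
    ultimately show ?thesis unfolding C1_on_def
      by (intro exI[of _ F] conjI ballI F(1) has_vector_derivative_transform[OF _ _ F(2)]) auto
  qed
  define Q where "Q = (\<lambda>s. (s - \<beta>) / \<alpha>) ` (P \<union> {0,1}) \<union> {u,w}"
  have fQ: "finite Q" using fP by (simp add: Q_def)
  have sp: "speed r t = \<bar>\<alpha>\<bar> * speed q (\<alpha> * t + \<beta>)" if t: "t \<in> {u..w} - Q" for t
  proof -
    define s where "s = \<alpha> * t + \<beta>"
    have ts: "t = (s - \<beta>) / \<alpha>" using al by (simp add: s_def)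
    have s: "0 < s" "s < 1" "s \<notin> P" using t in01[of t] ts unfolding Q_def s_def[symmetric]
      by (auto simp: less_le)
    have t': "u < t" "t < w" "0 < t" "t < 1" using t uw by (auto simp: Q_def less_le)
    obtain c where c: "c \<in> A" "q s \<in> fst c" by (rule chart_exists)
    obtain a0 b0 d where n: "q ` {a0..b0} \<subseteq> fst c" "d > 0" "\<And>s'. 0 \<le> s' \<Longrightarrow> s' \<le> 1 \<Longrightarrow> \<bar>s' - s\<bar> < d \<Longrightarrow> s' \<in> {a0..b0}"
      using chart_neighbourhood[OF cq _ _ _ c] s by (metis less_imp_le zero_less_one)
    obtain e where e: "e > 0" "\<And>s'. \<bar>s' - s\<bar> < e \<Longrightarrow> s' \<notin> P"
      using finite_imp_closed[OF fP] s(3) open_contains_ball[of "- P"]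
      by (metis Compl_iff dist_real_def mem_ball open_Compl subsetD abs_minus_commute)
    define \<epsilon> where "\<epsilon> = min (min (d/2) e) (min s (1 - s))"
    have \<epsilon>: "\<epsilon> > 0" "\<epsilon> \<le> d/2" "\<epsilon> \<le> e" "\<epsilon> \<le> s" "\<epsilon> \<le> 1 - s" using n(2) e(1) s(1,2) unfolding \<epsilon>_def by linarith+
    have sub: "q ` {s - \<epsilon>..s + \<epsilon>} \<subseteq> fst c"
    proof -
      have "s' \<in> {a0..b0}" if "s' \<in> {s - \<epsilon>..s + \<epsilon>}" for s'
        using that \<epsilon> n(2) by (intro n(3)) (auto simp: abs_le_iff)
      then show ?thesis using n(1) by blast
    qed
    have e0: "0 \<le> s - \<epsilon>" "s - \<epsilon> < s + \<epsilon>" "s + \<epsilon> \<le> 1" using \<epsilon> by auto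
    have dis: "{s - \<epsilon><..<s + \<epsilon>} \<inter> P = {}" using e(2) \<epsilon> by (fastforce simp: abs_less_iff)
    obtain f where f: "continuous_on {s - \<epsilon>..s + \<epsilon>} f" "AC_rep (s - \<epsilon>) (s + \<epsilon>) (snd c \<circ> q) f"
      "\<And>t. s - \<epsilon> < t \<Longrightarrow> t < s + \<epsilon> \<Longrightarrow> speed q t = sqrt (gm c (snd c (q t)) (f t) (f t))"
      using pwC1_chart[OF q c(1) e0 sub dis] by metis
    have fd: "((snd c \<circ> q) has_vector_derivative f s) (at s)"
      using AC_rep_derivative_unique[OF f(2,1), of s] \<epsilon> by (simp add: at_within_Icc_at)
    have aff: "((\<lambda>t. \<alpha> * t + \<beta>) has_vector_derivative \<alpha>) (at t)" by (auto intro!: derivative_eq_intros)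
    have "((\<lambda>t. (snd c \<circ> q) (\<alpha> * t + \<beta>)) has_vector_derivative \<alpha> *\<^sub>R f s) (at t)"
      using vector_diff_chain_at[OF aff, of "snd c \<circ> q" "f s"] fd by (simp add: s_def o_def)
    moreover have ev: "\<forall>\<^sub>F t' in at t. t' \<in> {u<..<w}" using t' by (intro eventually_at_in_open') auto
    ultimately have rd: "((snd c \<circ> r) has_vector_derivative \<alpha> *\<^sub>R f s) (at t)"
      unfolding has_vector_derivative_def
    proof (rule_tac has_derivative_transform_eventually)
      show "\<forall>\<^sub>F t' in at t. (snd c \<circ> q) (\<alpha> * t' + \<beta>) = (snd c \<circ> r) t'"
        using ev by eventually_elim (simp add: eq)
    qed (use t eq in auto)
    have rs: "r t = q s" using eq[of t] t by (simp add: s_def)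
    have "isCont (\<lambda>t. \<alpha> * t + \<beta>) t" by (intro continuous_intros)
    then have "((\<lambda>t. \<alpha> * t + \<beta>) \<longlongrightarrow> s) (at t)" by (simp add: isCont_def s_def)
    then have "\<forall>\<^sub>F t' in at t. \<alpha> * t' + \<beta> \<in> {s - \<epsilon><..<s + \<epsilon>}"
      by (rule topological_tendstoD) (use \<epsilon> in auto)
    with ev have "\<forall>\<^sub>F t' in at t. r t' \<in> fst c"
    proof eventually_elim
      case (elim t')
      then have "r t' = q (\<alpha> * t' + \<beta>)" using eq[of t'] by simp
      moreover have "q (\<alpha> * t' + \<beta>) \<in> fst c" using sub elim(2) by (simp add: image_subset_iff)
      ultimately show ?case by simp
    qed
    then have "velocity A {0..1} r t = toc c (r t) (\<alpha> *\<^sub>R f s)"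
      using rd rs c t' by (intro velocity_toc) auto
    then have "speed r t = sqrt (gm c (snd c (q s)) (\<alpha> *\<^sub>R f s) (\<alpha> *\<^sub>R f s))"
      using speed_toc[OF c(1), of r t] rs c(2) by simp
    also have "\<dots> = \<bar>\<alpha>\<bar> * sqrt (gm c (snd c (q s)) (f s) (f s))"
      using gm_scale[OF c(1), of "snd c (q s)" \<alpha> "f s" \<alpha> "f s"] c(2) by (simp add: real_sqrt_mult)
    finally show ?thesis using f(3)[of s] \<epsilon> by (simp add: s_def)
  qed
  have "(speed q has_integral curve_length A g q) (cbox 0 1)"
    using speed_integrable[OF q, of 0 1] by (simp add: curve_length_integral[OF q] absolutely_integrable_on_def integrable_integral)
  from has_integral_affinity[OF this al, of \<beta>]
  have "((\<lambda>t. speed q (\<alpha> * t + \<beta>)) has_integral (1 / \<bar>\<alpha>\<bar>) * curve_length A g q) ((\<lambda>x. (1 / \<alpha>) *\<^sub>R x + - ((1 / \<alpha>) *\<^sub>R \<beta>)) ` cbox 0 1)"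
    by simp
  moreover have "(\<lambda>x. (1 / \<alpha>) *\<^sub>R x + - ((1 / \<alpha>) *\<^sub>R \<beta>)) ` cbox 0 1 = {u..w}"
  proof -
    have "(\<lambda>x. (1 / \<alpha>) *\<^sub>R x + - ((1 / \<alpha>) *\<^sub>R \<beta>)) ` (\<lambda>t. \<alpha> * t + \<beta>) ` {u..w} = (\<lambda>t. t) ` {u..w}"
      unfolding image_image using al by (intro image_cong) (auto simp: field_simps)
    then show ?thesis using im by simp
  qed
  ultimately have "((\<lambda>t. speed q (\<alpha> * t + \<beta>)) has_integral (1 / \<bar>\<alpha>\<bar>) * curve_length A g q) {u..w}" by simp
  from has_integral_mult_right[OF this, of "\<bar>\<alpha>\<bar>"]
  have "((\<lambda>t. \<bar>\<alpha>\<bar> * speed q (\<alpha> * t + \<beta>)) has_integral curve_length A g q) {u..w}" using al by simp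
  then show "(speed r has_integral curve_length A g q) {u..w}"
    by (rule has_integral_spike[OF negligible_finite[OF fQ], rotated]) (use sp in auto)
qed

lemma curve_reverse:
  assumes "piecewise_C1_curve A q"
  obtains r where "piecewise_C1_curve A r" "r 0 = q 1" "r 1 = q 0" "curve_length A g r = curve_length A g q"
proof -
  obtain P where q: "pwC1 P q" using assms piecewise_pwC1 by blast
  define r where "r t = q ((-1) * t + 1)" for t
  have im: "(\<lambda>t. (-1) * t + 1) ` {0..1::real} = {0..1}"
    by (subst image_affinity_atLeastAtMost) simp
  have r: "pwC1 ((\<lambda>s. (s - 1) / (-1)) ` P) r"
    unfolding pwC1_def using affine_piece(2,3)[OF q _ _ _ _ im, of r] q by (auto simp: r_def pwC1_def)
  have "(speed r has_integral curve_length A g q) {0..1}"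
    using affine_piece(1)[OF q _ _ _ _ im, of r] by (simp add: r_def)
  then show thesis using that[of r] r piecewise_pwC1 curve_length_integral[OF r] by (auto simp: r_def integral_unique)
qed

lemma curve_concat:
  assumes "piecewise_C1_curve A q" "piecewise_C1_curve A q'" "q 1 = q' 0"
  obtains r where "piecewise_C1_curve A r" "r 0 = q 0" "r 1 = q' 1" "curve_length A g r = curve_length A g q + curve_length A g q'"
proof -
  obtain P P' where q: "pwC1 P q" and q': "pwC1 P' q'" using assms piecewise_pwC1 by blast
  define r where "r t = (if t \<le> 1/2 then q (2 * t + 0) else q' (2 * t + (-1)))" for t :: real
  have im1: "(\<lambda>t. 2 * t + 0) ` {0..1/2::real} = {0..1}"
    by (subst image_affinity_atLeastAtMost) simp
  have im2: "(\<lambda>t. 2 * t + (-1)) ` {1/2..1::real} = {0..1}"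
    by (subst image_affinity_atLeastAtMost) simp
  have r1: "r t = q (2 * t + 0)" if "t \<in> {0..1/2}" for t using that by (simp add: r_def)
  have r2: "r t = q' (2 * t + (-1))" if "t \<in> {1/2..1}" for t
  proof (cases "t = 1/2")
    case True
    show ?thesis unfolding True r_def using assms(3) by simp
  qed (use that in \<open>auto simp: r_def\<close>)
  note p1 = affine_piece[OF q _ _ _ _ im1 r1] and p2 = affine_piece[OF q' _ _ _ _ im2 r2]
  define R where "R = {1/2} \<union> (\<lambda>s. (s - 0) / 2) ` P \<union> (\<lambda>s. (s - (-1)) / 2) ` P'"
  have r: "pwC1 R r"
    unfolding pwC1_def
  proof (intro conjI ballI allI impI)
    show "finite R" using q q' by (simp add: R_def pwC1_def)
    have "continuous_on ({0..1/2} \<union> {1/2..1}) r" using p1(3) p2(3) by (intro continuous_on_closed_Un) auto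
    then show "continuous_on {0..1} r" by (simp add: ivl_disj_un)
    fix c a b assume c: "c \<in> A" and ab: "0 \<le> a \<and> a < b \<and> b \<le> 1 \<and> {a<..<b} \<inter> R = {} \<and> r ` {a..b} \<subseteq> fst c"
    then have "b \<le> 1/2 \<or> 1/2 \<le> a" by (auto simp: R_def)
    then show "C1_on a b (snd c \<circ> r)"
    proof
      assume "b \<le> 1/2"
      moreover have "{a<..<b} \<inter> (\<lambda>s. (s - 0) / 2) ` P = {}" using ab unfolding R_def by blast
      ultimately show ?thesis using p1(2)[of c a b] c ab by auto
    next
      assume "1/2 \<le> a"
      moreover have "{a<..<b} \<inter> (\<lambda>s. (s - (-1)) / 2) ` P' = {}" using ab unfolding R_def by blast
      ultimately show ?thesis using p2(2)[of c a b] c ab by auto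
    qed
  qed
  have "(speed r has_integral (curve_length A g q + curve_length A g q')) {0..1}"
    by (rule has_integral_combine[OF _ _ p1(1) p2(1)]) auto
  then show thesis using that[of r] r piecewise_pwC1 curve_length_integral[OF r] by (auto simp: r_def integral_unique)
qed

text \<open>
  A piece of an \<open>H\<^sup>2\<close> curve is continuously differentiable; its affine reparametrization by \<open>{0..1}\<close> has
  speed \<open>(t - s) |q'| \<le> (t - s) R\<close>.
\<close>

lemma C1_subcurve:
  assumes q: "q \<in> H2_curves A T" and T: "T > 0" and st: "0 \<le> s" "s < t" "t \<le> T"
    and R: "R \<ge> 0" "\<And>u. 0 \<le> u \<Longrightarrow> u \<le> T \<Longrightarrow> kin T q u \<le> R\<^sup>2"
  obtains r where "piecewise_C1_curve A r" "r 0 = q s" "r 1 = q t" "curve_length A g r \<le> R * (t - s)"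
proof -
  define r where "r u = q ((t - s) * u + s)" for u
  have in0T: "(t - s) * u + s \<in> {s..t}" if "0 \<le> u" "u \<le> 1" for u
  proof -
    have "(t - s) * u \<le> (t - s) * 1" using that st by (intro mult_left_mono) auto
    moreover have "0 \<le> (t - s) * u" using that st by simp
    ultimately show ?thesis unfolding atLeastAtMost_iff mult_1_right by linarith
  qed
  have r: "pwC1 {} r"
    unfolding pwC1_def
  proof (intro conjI ballI allI impI)
    show "continuous_on {0..1} r" unfolding r_def
      by (rule continuous_on_compose2[OF H2_curvesD(1)[OF q]]) (use in0T st in \<open>force intro!: continuous_intros\<close>)+
    fix c a b assume c: "c \<in> A" and ab: "0 \<le> a \<and> a < b \<and> b \<le> 1 \<and> {a<..<b} \<inter> {} = {} \<and> r ` {a..b} \<subseteq> fst c"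
    define a' where "a' = (t - s) * a + s"
    define b' where "b' = (t - s) * b + s"
    have ab': "0 \<le> a'" "a' < b'" "b' \<le> T" using in0T[of a] in0T[of b] ab st by (auto simp: a'_def b'_def)
    have "q ` {a'..b'} \<subseteq> fst c"
    proof
      fix p assume "p \<in> q ` {a'..b'}"
      then obtain v where v: "v \<in> {a'..b'}" "p = q v" by auto
      then have "(v - s) / (t - s) \<in> {a..b}" using st by (auto simp: a'_def b'_def field_simps)
      moreover have "r ((v - s) / (t - s)) = q v" using st by (simp add: r_def)
      ultimately show "p \<in> fst c" using ab v by (metis image_eqI subsetD)
    qed
    then obtain h where h: "H2_rep a' b' (snd c \<circ> q) (\<lambda>t. velocity A {0..T} q t c) h"
      using H2_curve_rep[OF q c ab'] by blast
    have "C1_on a' b' (snd c \<circ> q)" unfolding C1_on_def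
      using H2_rep_continuous[OF h] H2_rep_has_vector_derivative[OF h]
      by (intro exI[of _ "\<lambda>t. velocity A {0..T} q t c"]) auto
    from C1_on_affine[OF this, of a b "t - s" s] ab st
    have "C1_on a b (\<lambda>u. (snd c \<circ> q) ((t - s) * u + s))" by (auto simp: a'_def b'_def mult_left_mono)
    then show "C1_on a b (snd c \<circ> r)" by (simp add: r_def o_def)
  qed simp
  show thesis
  proof (rule that[of r])
    show "piecewise_C1_curve A r" using r piecewise_pwC1 by blast
    show "curve_length A g r \<le> R * (t - s)"
    proof (rule curve_length_le[OF r finite.emptyI])
      fix u :: real assume u: "0 < u" "u < 1"
      define v where "v = (t - s) * u + s"
      have "(t - s) * u < (t - s) * 1" using u st by (intro mult_strict_left_mono) auto
      moreover have "0 < (t - s) * u" using u st by simp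
      ultimately have v: "s < v" "v < t" "0 < v" "v < T" using st unfolding v_def mult_1_right by linarith+
      obtain c where c: "c \<in> A" "q v \<in> fst c" by (rule chart_exists)
      have "((snd c \<circ> q) has_vector_derivative velocity A {0..T} q v c) (at v within {0..T})"
        using v by (intro velocity_derivative[OF q T] c) auto
      then have d: "((snd c \<circ> q) has_vector_derivative velocity A {0..T} q v c) (at v)" using v by (simp add: at_within_Icc_at)
      have aff: "((\<lambda>u. (t - s) * u + s) has_vector_derivative (t - s)) (at u)" by (auto intro!: derivative_eq_intros)
      have rd: "((snd c \<circ> r) has_vector_derivative (t - s) *\<^sub>R velocity A {0..T} q v c) (at u)"
        using vector_diff_chain_at[OF aff, of "snd c \<circ> q"] d by (simp add: v_def o_def r_def)
      have "isCont r u"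
        using r u unfolding pwC1_def by (auto intro: continuous_on_interior)
      then have "(r \<longlongrightarrow> r u) (at u)" by (simp add: isCont_def)
      then have "\<forall>\<^sub>F u' in at u. r u' \<in> fst c"
        by (rule topological_tendstoD) (use c chart(1) in \<open>auto simp: r_def v_def\<close>)
      then have "velocity A {0..1} r u = toc c (r u) ((t - s) *\<^sub>R velocity A {0..T} q v c)"
        using rd u c by (intro velocity_toc) (auto simp: r_def v_def)
      then have "speed r u = sqrt (gm c (snd c (q v)) ((t - s) *\<^sub>R velocity A {0..T} q v c) ((t - s) *\<^sub>R velocity A {0..T} q v c))"
        using speed_toc[OF c(1), of r u] c by (simp add: r_def v_def)
      also have "\<dots> = (t - s) * sqrt (kin T q v)"
        using gm_scale[OF c(1), of "snd c (q v)" "t - s" _ "t - s"] c v st kin_coords[OF q T _ _ c] by (simp add: real_sqrt_mult)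
      also have "\<dots> \<le> (t - s) * sqrt (R\<^sup>2)" using R(2)[of v] v st by (intro mult_left_mono real_sqrt_le_mono) auto
      finally show "speed r u \<le> R * (t - s)" using R(1) by (simp add: mult.commute)
    qed
  qed (auto simp: r_def)
qed

abbreviation "rd \<equiv> riemannian_dist A g"

lemma rd_le: "piecewise_C1_curve A q \<Longrightarrow> q 0 = p \<Longrightarrow> q 1 = p' \<Longrightarrow> rd p p' \<le> curve_length A g q"
  unfolding riemannian_dist_def
  by (rule cInf_lower) (auto intro!: bdd_belowI[of _ 0] curve_length_nonneg)

end

locale connected_riemannian = riemannian A g
  for A :: "('m::{t2_space, second_countable_topology}, 'n::finite) chart set" and g :: "('m, 'n) metric" +
  assumes conn: "connected (UNIV :: 'm set)"
begin

text \<open>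
  The set of points that can be reached from \<open>x\<close> is open and closed, because nearby points are joined by
  coordinate segments.
\<close>

lemma curve_exists: "\<exists>q. piecewise_C1_curve A q \<and> q 0 = x \<and> q 1 = y"
proof -
  define R where "R = {y. \<exists>q. piecewise_C1_curve A q \<and> q 0 = x \<and> q 1 = y}"
  have loc: "\<exists>U. open U \<and> p \<in> U \<and> (\<forall>y\<in>U. \<exists>q. piecewise_C1_curve A q \<and> q 0 = p \<and> q 1 = y)" for p
    using short_segments[of 1 p] by (metis zero_less_one)
  have "open R"
    unfolding open_subopen[of R]
  proof
    fix p assume "p \<in> R"
    then obtain q where q: "piecewise_C1_curve A q" "q 0 = x" "q 1 = p" by (auto simp: R_def)
    obtain U where U: "open U" "p \<in> U" "\<forall>y\<in>U. \<exists>q. piecewise_C1_curve A q \<and> q 0 = p \<and> q 1 = y" using loc by blast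
    have "U \<subseteq> R"
    proof
      fix y assume "y \<in> U"
      then obtain q' where q': "piecewise_C1_curve A q'" "q' 0 = p" "q' 1 = y" using U by blast
      then obtain r where "piecewise_C1_curve A r" "r 0 = q 0" "r 1 = q' 1"
        using curve_concat[OF q(1), of q'] q(3) by metis
      then show "y \<in> R" using q(2) q'(3) by (auto simp: R_def)
    qed
    then show "\<exists>T. open T \<and> p \<in> T \<and> T \<subseteq> R" using U by blast
  qed
  moreover have "open (- R)"
    unfolding open_subopen[of "- R"]
  proof
    fix p assume p: "p \<in> - R"
    obtain U where U: "open U" "p \<in> U" "\<forall>y\<in>U. \<exists>q. piecewise_C1_curve A q \<and> q 0 = p \<and> q 1 = y" using loc by blast
    have "U \<subseteq> - R"
    proof
      fix y assume "y \<in> U"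
      then obtain q' where q': "piecewise_C1_curve A q'" "q' 0 = p" "q' 1 = y" using U by blast
      then obtain q'' where q'': "piecewise_C1_curve A q''" "q'' 0 = y" "q'' 1 = p" using curve_reverse[OF q'(1)] by metis
      show "y \<in> - R"
      proof
        assume "y \<in> R"
        then obtain q where q: "piecewise_C1_curve A q" "q 0 = x" "q 1 = y" by (auto simp: R_def)
        obtain r where "piecewise_C1_curve A r" "r 0 = q 0" "r 1 = q'' 1"
          using curve_concat[OF q(1) q''(1)] q(3) q''(2) by metis
        then have "p \<in> R" using q(2) q''(3) by (auto simp: R_def)
        then show False using p by simp
      qed
    qed
    then show "\<exists>T. open T \<and> p \<in> T \<and> T \<subseteq> - R" using U by blast
  qed
  moreover have "x \<in> R" using loc[of x] by (auto simp: R_def)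
  ultimately have "R = UNIV"
    using conn connected_clopen[of "UNIV :: 'm set"] by (auto simp: closed_def)
  then show ?thesis by (auto simp: R_def)
qed

lemma rd_less:
  assumes "rd x y < e" obtains q where "piecewise_C1_curve A q" "q 0 = x" "q 1 = y" "curve_length A g q < e"
proof -
  have "{curve_length A g q |q. piecewise_C1_curve A q \<and> q 0 = x \<and> q 1 = y} \<noteq> {}" using curve_exists by blast
  from cInf_lessD[OF this assms[unfolded riemannian_dist_def]] show thesis using that by blast
qed

lemma rd_nonneg: "rd x y \<ge> 0"
proof (rule ccontr)
  assume "\<not> ?thesis"
  then obtain q where "piecewise_C1_curve A q" "curve_length A g q < 0" using rd_less[of x y 0] by auto
  then show False using curve_length_nonneg by fastforce
qed

text \<open>
  Small segments are short: the topology of the manifold refines the one of the distance. The converse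
  is \<open>rd_ball_subset\<close>.
\<close>

lemma rd_small_nhd:
  assumes "e > 0" obtains U where "open U" "p \<in> U" "\<And>y. y \<in> U \<Longrightarrow> rd p y < e"
proof -
  obtain U where U: "open U" "p \<in> U" "\<And>y. y \<in> U \<Longrightarrow> \<exists>q. piecewise_C1_curve A q \<and> q 0 = p \<and> q 1 = y \<and> curve_length A g q < e"
    by (rule short_segments[OF assms, of p]) blast
  have "rd p y < e" if y: "y \<in> U" for y
  proof -
    obtain q where "piecewise_C1_curve A q" "q 0 = p" "q 1 = y" "curve_length A g q < e" using U(3)[OF y] by blast
    then show ?thesis using rd_le[of q p y] by linarith
  qed
  then show thesis using that U(1,2) by blast
qed

lemma rd_ball_subset:
  assumes "open W" "p \<in> W" obtains r where "r > 0" "\<And>y. rd p y < r \<Longrightarrow> y \<in> W"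
proof -
  obtain r where r: "r > 0" "\<And>q. piecewise_C1_curve A q \<Longrightarrow> q 0 = p \<Longrightarrow> curve_length A g q < r \<Longrightarrow> q 1 \<in> W"
    by (rule short_curve_stays[OF assms]) blast
  have "y \<in> W" if y: "rd p y < r" for y
  proof -
    obtain q where "piecewise_C1_curve A q" "q 0 = p" "q 1 = y" "curve_length A g q < r" using rd_less[OF y] by blast
    then show ?thesis using r(2)[of q] by simp
  qed
  then show thesis using that r(1) by blast
qed

sublocale M: Metric_space UNIV rd
proof
  have le: "rd y x \<le> rd x y" for x y
  proof (rule field_le_epsilon)
    fix e :: real assume "e > 0"
    then obtain q where q: "piecewise_C1_curve A q" "q 0 = x" "q 1 = y" "curve_length A g q < rd x y + e" using rd_less[of x y "rd x y + e"] by auto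
    obtain r where "piecewise_C1_curve A r" "r 0 = y" "r 1 = x" "curve_length A g r = curve_length A g q" using curve_reverse[OF q(1)] q(2,3) by metis
    then show "rd y x \<le> rd x y + e" using rd_le[of r y x] q by simp
  qed
  show "rd x y \<ge> 0" for x y by (rule rd_nonneg)
  show "rd x y = rd y x" for x y using le by (simp add: antisym)
  show "rd x y = 0 \<longleftrightarrow> x = y" for x y
  proof
    assume 0: "rd x y = 0"
    show "x = y"
    proof (rule ccontr)
      assume "x \<noteq> y"
      then obtain r where "r > 0" "\<And>z. rd x z < r \<Longrightarrow> z \<in> - {y}" using rd_ball_subset[of "- {y}" x] by (metis ComplI open_Compl closed_singleton singletonD)
      then show False using 0 by force
    qed
  next
    assume "x = y"
    have "rd x x \<le> 0 + e" if "e > 0" for e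
      using rd_small_nhd[OF that, of x] by (metis add_0 less_imp_le)
    then have "rd x x \<le> 0" by (rule field_le_epsilon)
    then show "rd x y = 0" using rd_nonneg[of x x] \<open>x = y\<close> by simp
  qed
  show "rd x z \<le> rd x y + rd y z" for x y z
  proof (rule field_le_epsilon)
    fix e :: real assume e: "e > 0"
    obtain q where q: "piecewise_C1_curve A q" "q 0 = x" "q 1 = y" "curve_length A g q < rd x y + e/2" using rd_less[of x y "rd x y + e/2"] e by auto
    obtain q' where q': "piecewise_C1_curve A q'" "q' 0 = y" "q' 1 = z" "curve_length A g q' < rd y z + e/2" using rd_less[of y z "rd y z + e/2"] e by auto
    obtain r where "piecewise_C1_curve A r" "r 0 = x" "r 1 = z" "curve_length A g r = curve_length A g q + curve_length A g q'"
      using curve_concat[OF q(1) q'(1)] q(2,3) q'(2,3) by metis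
    then show "rd x z \<le> rd x y + rd y z + e" using rd_le[of r x z] q q' by simp
  qed
qed

text \<open>
  The two inclusions between the topologies are \<open>rd_ball_subset\<close> and \<open>rd_small_nhd\<close>. Compactness and
  limits may henceforth be expressed in either topology.
\<close>

lemma mtopology_euclidean: "M.mtopology = euclidean"
proof (rule topology_eq[THEN iffD2], intro allI)
  fix S
  show "openin M.mtopology S = openin euclidean S"
  proof
    assume S: "openin M.mtopology S"
    have "open S"
      unfolding open_subopen[of S]
    proof
      fix x assume "x \<in> S"
      then obtain r where r: "r > 0" "M.mball x r \<subseteq> S" using S by (auto simp: M.openin_mtopology)
      obtain U where "open U" "x \<in> U" "\<And>y. y \<in> U \<Longrightarrow> rd x y < r" by (rule rd_small_nhd[OF r(1), of x]) blast
      then show "\<exists>T. open T \<and> x \<in> T \<and> T \<subseteq> S" using r by (intro exI[of _ U]) (auto simp: subset_iff)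
    qed
    then show "openin euclidean S" using open_openin by blast
  next
    assume "openin euclidean S"
    then have "open S" using open_openin by blast
    then show "openin M.mtopology S"
      unfolding M.openin_mtopology
    proof (intro conjI allI impI subset_UNIV)
      fix x assume "x \<in> S"
      obtain r where "r > 0" "\<And>y. rd x y < r \<Longrightarrow> y \<in> S" by (rule rd_ball_subset[OF \<open>open S\<close> \<open>x \<in> S\<close>]) blast
      then show "\<exists>r>0. M.mball x r \<subseteq> S" by auto
    qed
  qed
qed

text \<open>
  The distance is an infimum of lengths, and the piece of the curve between the two times is one of the
  competitors.
\<close>

lemma rd_lipschitz:
  assumes q: "q \<in> H2_curves A T" and T: "T > 0" and st: "0 \<le> s" "s \<le> T" "0 \<le> t" "t \<le> T"
    and R: "R \<ge> 0" "\<And>u. 0 \<le> u \<Longrightarrow> u \<le> T \<Longrightarrow> kin T q u \<le> R\<^sup>2"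
  shows "rd (q s) (q t) \<le> R * \<bar>t - s\<bar>"
proof -
  have *: "rd (q s) (q t) \<le> R * (t - s)" if ss: "0 \<le> s" "s < t" "t \<le> T" for s t
  proof -
    obtain r where "piecewise_C1_curve A r" "r 0 = q s" "r 1 = q t" "curve_length A g r \<le> R * (t - s)"
      by (rule C1_subcurve[OF q T ss R]) blast+
    then show ?thesis using rd_le[of r "q s" "q t"] by linarith
  qed
  consider "s < t" | "s = t" | "t < s" by linarith
  then show ?thesis
  proof cases
    case 3 then show ?thesis using *[of t s] st M.commute[of "q s" "q t"] by simp
  qed (use * st in auto)
qed

end

lemma H2_rep_combine:
  assumes f: "H2_rep a b f v h" and g: "H2_rep b c f v' h'" and "a \<le> b" "b \<le> c" and "v b = v' b"
  shows "H2_rep a c f (\<lambda>t. if t \<le> b then v t else v' t) (\<lambda>t. if t \<le> b then h t else h' t)"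
  unfolding H2_rep_def
proof (intro conjI)
  let ?v = "\<lambda>t. if t \<le> b then v t else v' t" and ?h = "\<lambda>t. if t \<le> b then h t else h' t"
  show "AC_rep a c f ?v" using f g assms by (intro AC_rep_combine) (auto simp: H2_rep_def)
  have "AC_rep a b ?v h" using f unfolding H2_rep_def by (auto intro: AC_rep_cong)
  moreover have "AC_rep b c ?v h'"
    using g assms(5) unfolding H2_rep_def by (auto intro!: AC_rep_cong[of b c v' h'])
  ultimately show "AC_rep a c ?v ?h" using assms by (intro AC_rep_combine)
  have ab: "?h absolutely_integrable_on {a..c}"
    by (rule AC_repD_abs[OF \<open>AC_rep a c ?v ?h\<close>])
  have Lh: "h \<in> borel_measurable (lebesgue_on {a..b})" "(\<lambda>t. (norm (h t))\<^sup>2) absolutely_integrable_on {a..b}"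
    and Lh': "h' \<in> borel_measurable (lebesgue_on {b..c})" "(\<lambda>t. (norm (h' t))\<^sup>2) absolutely_integrable_on {b..c}"
    using f g unfolding H2_rep_def L2_on_def by (auto simp: integrable_restrict_space set_integrable_def)
  have "(\<lambda>t. (norm (?h t))\<^sup>2) absolutely_integrable_on {a..b}"
    by (rule absolutely_integrable_spike[OF Lh(2) negligible_empty]) auto
  moreover have "(\<lambda>t. (norm (?h t))\<^sup>2) absolutely_integrable_on {b..c}"
    by (rule absolutely_integrable_spike[OF Lh'(2) negligible_sing[of b]]) auto
  ultimately have "(\<lambda>t. (norm (?h t))\<^sup>2) absolutely_integrable_on {a..c}"
    using assms by (intro absolutely_integrable_combine_real[where a=a and b=b and c=c])
  from LINT_eq_integral(1)[OF this] LINT_eq_integral(1)[OF ab] show "L2_on a c ?h"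
    unfolding L2_on_def using borel_measurable_integrable by blast
qed

lemma H2_rep_cong:
  assumes "H2_rep a b f v h" "\<And>t. a \<le> t \<Longrightarrow> t \<le> b \<Longrightarrow> f t = g t" shows "H2_rep a b g v h"
  using assms unfolding H2_rep_def by (auto intro: AC_rep_cong)

context riemannian begin

section \<open>Existence of admissible curves\<close>

text \<open>
  Being connected by an \<open>H\<^sup>2\<close> curve with prescribed position and velocity at both ends. The velocity
  conditions are attached to the coordinate representations, so that concatenation and restriction need
  no separate argument for one-sided derivatives.
\<close>

definition joins :: "real \<Rightarrow> real \<Rightarrow> 'm \<times> ('m, 'n) tangent \<Rightarrow> 'm \<times> ('m, 'n) tangent \<Rightarrow> bool" where
  "joins a b \<xi> \<eta> \<longleftrightarrow> (\<exists>q. continuous_on {a..b} q \<and> q a = fst \<xi> \<and> q b = fst \<eta> \<and>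
     (\<forall>c\<in>A. \<forall>s t. a \<le> s \<and> s < t \<and> t \<le> b \<and> q ` {s..t} \<subseteq> fst c \<longrightarrow>
       (\<exists>v h. H2_rep s t (snd c \<circ> q) v h \<and> (s = a \<longrightarrow> v s = snd \<xi> c) \<and> (t = b \<longrightarrow> v t = snd \<eta> c))))"

text \<open>
  Matching velocities at \<open>b\<close> are what makes the concatenated coordinate curve \<open>H\<^sup>2\<close> on intervals that
  contain \<open>b\<close>.
\<close>

lemma joins_trans:
  assumes "joins a b \<xi> \<eta>" "joins b d \<eta> \<zeta>" "a < b" "b < d" shows "joins a d \<xi> \<zeta>"
proof -
  obtain q where q: "continuous_on {a..b} q" "q a = fst \<xi>" "q b = fst \<eta>"
    "\<And>c s t. c \<in> A \<Longrightarrow> a \<le> s \<Longrightarrow> s < t \<Longrightarrow> t \<le> b \<Longrightarrow> q ` {s..t} \<subseteq> fst c \<Longrightarrow>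
       (\<exists>v h. H2_rep s t (snd c \<circ> q) v h \<and> (s = a \<longrightarrow> v s = snd \<xi> c) \<and> (t = b \<longrightarrow> v t = snd \<eta> c))"
    using assms(1) unfolding joins_def by metis
  obtain q' where q': "continuous_on {b..d} q'" "q' b = fst \<eta>" "q' d = fst \<zeta>"
    "\<And>c s t. c \<in> A \<Longrightarrow> b \<le> s \<Longrightarrow> s < t \<Longrightarrow> t \<le> d \<Longrightarrow> q' ` {s..t} \<subseteq> fst c \<Longrightarrow>
       (\<exists>v h. H2_rep s t (snd c \<circ> q') v h \<and> (s = b \<longrightarrow> v s = snd \<eta> c) \<and> (t = d \<longrightarrow> v t = snd \<zeta> c))"
    using assms(2) unfolding joins_def by metis
  define r where "r t = (if t \<le> b then q t else q' t)" for t
  have r1: "r t = q t" if "t \<le> b" for t using that by (simp add: r_def)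
  have r2: "r t = q' t" if "b \<le> t" for t using that q q' by (auto simp: r_def)
  show ?thesis
    unfolding joins_def
  proof (intro exI[of _ r] conjI ballI allI impI)
    have "continuous_on {a..b} r" by (rule continuous_on_eq[OF q(1)]) (simp add: r1)
    moreover have "continuous_on {b..d} r" by (rule continuous_on_eq[OF q'(1)]) (simp add: r2)
    ultimately have "continuous_on ({a..b} \<union> {b..d}) r" by (intro continuous_on_closed_Un) auto
    then show "continuous_on {a..d} r" using assms by (simp add: ivl_disj_un)
    show "r a = fst \<xi>" "r d = fst \<zeta>" using r1[of a] r2[of d] assms q q' by auto
    fix c s t assume c: "c \<in> A" and st: "a \<le> s \<and> s < t \<and> t \<le> d \<and> r ` {s..t} \<subseteq> fst c"
    consider "t \<le> b" | "b \<le> s" | "s < b" "b < t" by linarith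
    then show "\<exists>v h. H2_rep s t (snd c \<circ> r) v h \<and> (s = a \<longrightarrow> v s = snd \<xi> c) \<and> (t = d \<longrightarrow> v t = snd \<zeta> c)"
    proof cases
      case 1
      then have "q ` {s..t} \<subseteq> fst c" using st r1 by (force simp: image_subset_iff)
      then obtain v h where "H2_rep s t (snd c \<circ> q) v h" "s = a \<longrightarrow> v s = snd \<xi> c"
        using q(4)[OF c, of s t] st 1 by auto
      then show ?thesis using 1 r1 assms
        by (intro exI[of _ v] exI[of _ h]) (auto elim!: H2_rep_cong)
    next
      case 2
      then have "q' ` {s..t} \<subseteq> fst c" using st r2 by (force simp: image_subset_iff)
      then obtain v h where "H2_rep s t (snd c \<circ> q') v h" "t = d \<longrightarrow> v t = snd \<zeta> c"
        using q'(4)[OF c, of s t] st 2 by auto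
      then show ?thesis using 2 r2 assms
        by (intro exI[of _ v] exI[of _ h]) (auto elim!: H2_rep_cong)
    next
      case 3
      have "q ` {s..b} \<subseteq> fst c" using st r1 3 by (force simp: image_subset_iff)
      then obtain v h where v: "H2_rep s b (snd c \<circ> q) v h" "s = a \<longrightarrow> v s = snd \<xi> c" "v b = snd \<eta> c"
        using q(4)[OF c, of s b] st 3 by auto
      have "q' ` {b..t} \<subseteq> fst c"
      proof
        fix p assume "p \<in> q' ` {b..t}"
        then obtain u where "u \<in> {b..t}" "p = q' u" by auto
        then have "p = r u" "u \<in> {s..t}" using r2[of u] 3 by auto
        then show "p \<in> fst c" using st by blast
      qed
      then obtain v' h' where v': "H2_rep b t (snd c \<circ> q') v' h'" "v' b = snd \<eta> c" "t = d \<longrightarrow> v' t = snd \<zeta> c"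
        using q'(4)[OF c, of b t] st 3 by auto
      have "H2_rep s t (snd c \<circ> r) (\<lambda>t. if t \<le> b then v t else v' t) (\<lambda>t. if t \<le> b then h t else h' t)"
        using 3 v(3) v'(2) H2_rep_cong[OF v(1), of "snd c \<circ> r"] H2_rep_cong[OF v'(1), of "snd c \<circ> r"] r1 r2
        by (intro H2_rep_combine) auto
      then show ?thesis using v v' 3
        by (intro exI[of _ "\<lambda>t. if t \<le> b then v t else v' t"] exI[of _ "\<lambda>t. if t \<le> b then h t else h' t"]) auto
    qed
  qed
qed

lemma joins_admissible:
  assumes j: "joins 0 T \<xi> \<eta>" and T: "T > 0" and \<xi>: "\<xi> \<in> tangent_bundle UNIV A" and \<eta>: "\<eta> \<in> tangent_bundle UNIV A"
  shows "admissible_curves A T \<xi> \<eta> \<noteq> {}"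
proof -
  obtain q where q: "continuous_on {0..T} q" "q 0 = fst \<xi>" "q T = fst \<eta>"
    "\<And>c s t. c \<in> A \<Longrightarrow> 0 \<le> s \<Longrightarrow> s < t \<Longrightarrow> t \<le> T \<Longrightarrow> q ` {s..t} \<subseteq> fst c \<Longrightarrow>
       (\<exists>v h. H2_rep s t (snd c \<circ> q) v h \<and> (s = 0 \<longrightarrow> v s = snd \<xi> c) \<and> (t = T \<longrightarrow> v t = snd \<eta> c))"
    using j unfolding joins_def by metis
  have qH: "q \<in> H2_curves A T"
    unfolding H2_curves_def
  proof (intro CollectI conjI ballI allI impI q(1))
    fix c a b assume "c \<in> A" and ab: "0 \<le> a \<and> a < b \<and> b \<le> T \<and> q ` {a..b} \<subseteq> fst c"
    then obtain v h where "H2_rep a b (snd c \<circ> q) v h" using q(4)[of c a b] by blast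
    then show "H2_on a b (snd c \<circ> q)" by (rule H2_rep_imp_H2_on) (use ab in simp)
  qed
  have ends: "velocity A {0..T} q t = snd \<zeta>"
    if \<zeta>: "\<zeta> \<in> tangent_bundle UNIV A" "q t = fst \<zeta>" and t: "t = 0 \<or> t = T"
      and v: "\<And>c a b v h. a \<le> t \<Longrightarrow> t \<le> b \<Longrightarrow> (t = 0 \<longrightarrow> a = 0 \<and> v 0 = snd \<xi> c) \<Longrightarrow> (t = T \<longrightarrow> b = T \<and> v T = snd \<eta> c) \<Longrightarrow> v t = snd \<zeta> c" for t \<zeta>
  proof
    fix c
    show "velocity A {0..T} q t c = snd \<zeta> c"
    proof (cases "c \<in> charts_at A (q t)")
      case True
      then have c: "c \<in> A" "q t \<in> fst c" by (auto simp: charts_at_def)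
      have t0T: "0 \<le> t" "t \<le> T" using t T by auto
      obtain a b where n: "0 \<le> a" "a < b" "b \<le> T" "a \<le> t" "t \<le> b" "q ` {a..b} \<subseteq> fst c"
        "at t within {0..T} = at t within {a..b}"
        using chart_neighbourhood[OF q(1) t0T T c] by metis
      obtain v h where vh: "H2_rep a b (snd c \<circ> q) v h" "a = 0 \<longrightarrow> v a = snd \<xi> c" "b = T \<longrightarrow> v b = snd \<eta> c"
        using q(4)[OF c(1) n(1-3,6)] by blast
      have "((snd c \<circ> q) has_vector_derivative v t) (at t within {0..T})"
        using H2_rep_has_vector_derivative[OF vh(1) n(4,5)] n(7) by simp
      then have "velocity A {0..T} q t c = v t" by (rule velocity_unique[where c=c and q=q and t=t and T=T, OF _ t0T T c])
      also have "\<dots> = snd \<zeta> c"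
        by (rule v[of a b v c]) (use n vh T in auto)
      finally show ?thesis .
    next
      case False
      then have "snd \<zeta> c = 0" using \<zeta> unfolding tangent_bundle_def tangent_space_def by auto
      then show ?thesis using False by (simp add: velocity_def)
    qed
  qed
  have "velocity A {0..T} q 0 = snd \<xi>" by (rule ends) (use \<xi> q(2) T in auto)
  moreover have "velocity A {0..T} q T = snd \<eta>" by (rule ends) (use \<eta> q(3) T in auto)
  ultimately show ?thesis using qH q(2,3) unfolding admissible_curves_def by blast
qed

lemma smooth_compose_H2_rep:
  fixes F :: "real ^ 'n \<Rightarrow> real ^ 'n"
  assumes F: "smooth_on UNIV W F" and W: "open W" and xW: "x ` {a..b} \<subseteq> W"
    and x: "\<And>t. t \<in> {a..b} \<Longrightarrow> (x has_vector_derivative x' t) (at t within {a..b})"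
    and x': "\<And>t. t \<in> {a..b} \<Longrightarrow> (x' has_vector_derivative x'' t) (at t within {a..b})" and x'': "continuous_on {a..b} x''"
  obtains h where "H2_rep a b (\<lambda>t. F (x t)) (\<lambda>t. frechet_derivative F (at (x t) within W) (x' t)) h"
proof -
  let ?D = "\<lambda>k y. frechet_derivative F (at y within W) (axis k 1)"
  let ?DD = "\<lambda>k y. frechet_derivative (?D k) (at y within W)"
  have cx': "continuous_on {a..b} x'" using x' by (meson continuous_on_eq_continuous_within has_vector_derivative_continuous)
  note C1 = smooth_compose_C1[OF F W xW x cx']
  note C2 = smooth_compose_C1[OF smooth_on_derivative[OF F] W xW x cx']
  have cD: "continuous_on {a..b} (\<lambda>t. ?D k (x t))" for k
  proof -
    have cx: "continuous_on {a..b} x" using x by (meson continuous_on_eq_continuous_within has_vector_derivative_continuous)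
    show ?thesis by (rule continuous_on_compose2[OF smooth_on_continuous[OF smooth_on_derivative[OF F]] cx xW])
  qed
  have ax: "AC_rep a b (\<lambda>t. x' t $ k) (\<lambda>t. x'' t $ k)" for k
    by (rule AC_rep_linear[OF AC_rep_C1[OF x' x''] bounded_linear_vec_nth]) auto
  have aD: "AC_rep a b (\<lambda>t. ?D k (x t)) (\<lambda>t. ?DD k (x t) (x' t))" for k
    by (rule AC_rep_C1[OF C2(1) C2(2)]) auto
  define h where "h t = (\<Sum>k\<in>UNIV. x' t $ k *\<^sub>R ?DD k (x t) (x' t) + x'' t $ k *\<^sub>R ?D k (x t))" for t
  have "AC_rep a b (\<lambda>t. \<Sum>k\<in>UNIV. x' t $ k *\<^sub>R ?D k (x t)) h"
    unfolding h_def by (intro AC_rep_sum finite AC_rep_bilinear[OF bounded_bilinear_scaleR] ax aD)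
  then have "AC_rep a b (\<lambda>t. frechet_derivative F (at (x t) within W) (x' t)) h"
    by (rule AC_rep_cong) (use C1(3) in auto)
  moreover have "AC_rep a b (\<lambda>t. F (x t)) (\<lambda>t. frechet_derivative F (at (x t) within W) (x' t))"
    by (rule AC_rep_C1[OF C1(1,2)]) auto
  moreover have "L2_on a b h"
    unfolding h_def by (intro L2_on_continuous continuous_intros cx' x'' cD C2(2))
  ultimately show thesis using that by (simp add: H2_rep_def)
qed

text \<open>
  The building block for all connections: motion along a coordinate line, \<open>s \<mapsto> x0 + P s w\<close>, with a
  twice differentiable profile \<open>P\<close> on \<open>{0..1}\<close> that is run through during \<open>{a..b}\<close>.
\<close>

lemma joins_polynomial:
  fixes P P' P'' :: "real \<Rightarrow> real"
  assumes c: "c \<in> A" and ab: "a < b"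
    and P: "\<And>s. (P has_real_derivative P' s) (at s)" "\<And>s. (P' has_real_derivative P'' s) (at s)" "continuous_on UNIV P''"
    and sub: "\<And>s. 0 \<le> s \<Longrightarrow> s \<le> 1 \<Longrightarrow> x0 + P s *\<^sub>R w \<in> X c"
  shows "joins a b (param c (x0 + P 0 *\<^sub>R w), toc c (param c (x0 + P 0 *\<^sub>R w)) ((P' 0 / (b - a)) *\<^sub>R w))
     (param c (x0 + P 1 *\<^sub>R w), toc c (param c (x0 + P 1 *\<^sub>R w)) ((P' 1 / (b - a)) *\<^sub>R w))"
proof -
  define \<sigma> where "\<sigma> t = (t - a) / (b - a)" for t
  have s01: "0 \<le> \<sigma> t" "\<sigma> t \<le> 1" if "t \<in> {a..b}" for t using that ab by (auto simp: \<sigma>_def field_simps)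
  have s0: "\<sigma> a = 0" and s1: "\<sigma> b = 1" using ab by (auto simp: \<sigma>_def)
  have ds: "(\<sigma> has_real_derivative 1 / (b - a)) (at t within S)" for t S
    unfolding \<sigma>_def using ab by (auto intro!: derivative_eq_intros)
  define x where "x t = x0 + P (\<sigma> t) *\<^sub>R w" for t
  define x' where "x' t = (P' (\<sigma> t) / (b - a)) *\<^sub>R w" for t
  define x'' where "x'' t = (P'' (\<sigma> t) / (b - a) / (b - a)) *\<^sub>R w" for t
  have dx: "(x has_vector_derivative x' t) (at t within S)" for t S
  proof -
    have "((\<lambda>t. P (\<sigma> t)) has_real_derivative P' (\<sigma> t) * (1 / (b - a))) (at t within S)"
      by (rule DERIV_chain2[OF P(1) ds])
    from has_vector_derivative_add[OF has_vector_derivative_const[of x0] bounded_linear.has_vector_derivative[OF bounded_linear_scaleR_left this[unfolded has_real_derivative_iff_has_vector_derivative], of w]]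
    show ?thesis unfolding x_def x'_def by simp
  qed
  have dx': "(x' has_vector_derivative x'' t) (at t within S)" for t S
  proof -
    have "((\<lambda>t. P' (\<sigma> t) / (b - a)) has_real_derivative P'' (\<sigma> t) * (1 / (b - a)) / (b - a)) (at t within S)"
      by (rule DERIV_cdivide[OF DERIV_chain2[OF P(2) ds]])
    from bounded_linear.has_vector_derivative[OF bounded_linear_scaleR_left this[unfolded has_real_derivative_iff_has_vector_derivative], of w]
    show ?thesis unfolding x'_def x''_def by simp
  qed
  have cx'': "continuous_on S x''" for S
  proof -
    have "continuous_on S \<sigma>" unfolding \<sigma>_def by (intro continuous_intros) (use ab in auto)
    then have "continuous_on S (\<lambda>t. P'' (\<sigma> t))" by (rule continuous_on_compose2[OF P(3)]) auto
    then show ?thesis unfolding x''_def using ab by (intro continuous_intros) auto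
  qed
  have cx: "continuous_on S x" for S using dx by (meson continuous_on_eq_continuous_within has_vector_derivative_continuous)
  have xX: "x t \<in> X c" if "t \<in> {a..b}" for t unfolding x_def by (intro sub s01 that)
  define q where "q t = param c (x t)" for t
  have qc: "q t \<in> fst c" "snd c (q t) = x t" if "t \<in> {a..b}" for t
    using xX[OF that] chart(5,6)[OF c] by (auto simp: q_def)
  have xa: "x a = x0 + P 0 *\<^sub>R w" "x b = x0 + P 1 *\<^sub>R w" "x' a = (P' 0 / (b - a)) *\<^sub>R w" "x' b = (P' 1 / (b - a)) *\<^sub>R w"
    by (simp_all add: x_def x'_def s0 s1)
  show ?thesis
    unfolding joins_def xa[symmetric] fst_conv snd_conv
  proof (intro exI[of _ q] conjI ballI allI impI)
    show "continuous_on {a..b} q" unfolding q_def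
      by (rule continuous_on_compose2[OF chart(8)[OF c] cx]) (use xX in auto)
    fix c' s t assume c': "c' \<in> A" and st: "a \<le> s \<and> s < t \<and> t \<le> b \<and> q ` {s..t} \<subseteq> fst c'"
    have ov: "x ` {s..t} \<subseteq> overlap c c'"
    proof
      fix y assume "y \<in> x ` {s..t}"
      then obtain r where r: "r \<in> {s..t}" "y = x r" by auto
      then have "q r \<in> fst c" "q r \<in> fst c'" "snd c (q r) = y" using qc[of r] st by auto
      then show "y \<in> overlap c c'" by (auto simp: overlap_def)
    qed
    obtain h where h: "H2_rep s t (\<lambda>t. transition c c' (x t)) (\<lambda>t. frechet_derivative (transition c c') (at (x t) within overlap c c') (x' t)) h"
      by (rule smooth_compose_H2_rep[OF transition_smooth[OF c c'] overlap_open[OF c c'] ov dx dx' cx''])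
    have endv: "frechet_derivative (transition c c') (at (x r) within overlap c c') (x' r) = toc c (param c (x r)) (x' r) c'" if "r \<in> {s..t}" for r
    proof -
      have "q r \<in> fst c'" using st that by blast
      then show ?thesis using toc_at[OF c', of "q r" c "x' r"] qc[of r] that st by (simp add: transition_deriv_def q_def)
    qed
    show "\<exists>v h. H2_rep s t (snd c' \<circ> q) v h \<and> (s = a \<longrightarrow> v s = toc c (param c (x a)) (x' a) c') \<and>
        (t = b \<longrightarrow> v t = toc c (param c (x b)) (x' b) c')"
      using h endv[of s] endv[of t] st
      by (intro exI[of _ "\<lambda>t. frechet_derivative (transition c c') (at (x t) within overlap c c') (x' t)"] exI[of _ h])
         (auto simp: transition_def q_def o_def)
  qed (auto simp: q_def)
qed

abbreviation rest :: "'m \<Rightarrow> 'm \<times> ('m, 'n) tangent" where "rest p \<equiv> (p, \<lambda>c. 0)"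

lemma toc_zero: "c \<in> A \<Longrightarrow> p \<in> fst c \<Longrightarrow> toc c p 0 = (\<lambda>c. 0)"
  using toc_lin[of c p 0 0 0 0] by simp

text \<open>The profile \<open>3 s\<^sup>2 - 2 s\<^sup>3\<close> increases from \<open>0\<close> to \<open>1\<close> and has zero derivative at both ends.\<close>

lemma joins_rest_chart:
  assumes c: "c \<in> A" and K: "convex K" "K \<subseteq> X c" and xy: "x \<in> K" "y \<in> K" and ab: "a < b"
  shows "joins a b (rest (param c x)) (rest (param c y))"
proof -
  have z: "toc c (param c z) 0 = (\<lambda>c. 0)" if "z \<in> K" for z using toc_zero c chart(6) K that by blast
  have in01: "0 \<le> 3 * s\<^sup>2 - 2 * s^3 \<and> 3 * s\<^sup>2 - 2 * s^3 \<le> 1" if "0 \<le> s" "s \<le> 1" for s :: real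
  proof
    have "0 \<le> s\<^sup>2 * (3 - 2 * s)" using that by simp
    then show "0 \<le> 3 * s\<^sup>2 - 2 * s^3" by (simp add: algebra_simps power2_eq_square power3_eq_cube)
    have "0 \<le> (1 - s)\<^sup>2 * (1 + 2 * s)" using that by simp
    then show "3 * s\<^sup>2 - 2 * s^3 \<le> 1" by (simp add: algebra_simps power2_eq_square power3_eq_cube)
  qed
  have "joins a b (param c (x + (3 * 0\<^sup>2 - 2 * 0^3) *\<^sub>R (y - x)), toc c (param c (x + (3 * 0\<^sup>2 - 2 * 0^3) *\<^sub>R (y - x))) (((6 * 0 - 6 * 0\<^sup>2) / (b - a)) *\<^sub>R (y - x)))
     (param c (x + (3 * 1\<^sup>2 - 2 * 1^3) *\<^sub>R (y - x)), toc c (param c (x + (3 * 1\<^sup>2 - 2 * 1^3) *\<^sub>R (y - x))) (((6 * 1 - 6 * 1\<^sup>2) / (b - a)) *\<^sub>R (y - x)))"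
  proof (rule joins_polynomial[OF c ab, where P="\<lambda>s. 3 * s\<^sup>2 - 2 * s^3" and P'="\<lambda>s. 6 * s - 6 * s\<^sup>2" and P''="\<lambda>s. 6 - 12 * s"])
    show "x + (3 * s\<^sup>2 - 2 * s^3) *\<^sub>R (y - x) \<in> X c" if "0 \<le> s" "s \<le> 1" for s
      using convexD_alt[OF K(1) xy, of "3 * s\<^sup>2 - 2 * s^3"] in01[OF that] K(2) by (auto simp: algebra_simps)
  qed (auto intro!: derivative_eq_intros continuous_intros simp: power2_eq_square)
  then show ?thesis using z[OF xy(1)] z[OF xy(2)] by simp
qed

text \<open>
  Braking and accelerating: the profiles \<open>s (1 - s)\<^sup>2\<close> and \<open>s\<^sup>2 (s - 1)\<close> vanish at both ends and have
  derivative \<open>1\<close> at one end and \<open>0\<close> at the other. During a short time the excursion stays in the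
  chart.
\<close>

lemma joins_start:
  assumes \<xi>: "\<xi> \<in> tangent_bundle UNIV A"
  obtains \<delta> where "\<delta> > 0" "\<And>a b. a < b \<Longrightarrow> b - a < \<delta> \<Longrightarrow> joins a b \<xi> (rest (fst \<xi>)) \<and> joins a b (rest (fst \<xi>)) \<xi>"
proof -
  obtain c where c: "c \<in> A" "fst \<xi> \<in> fst c" by (rule chart_exists)
  let ?x = "snd c (fst \<xi>)" and ?v = "snd \<xi> c"
  have \<xi>e: "\<xi> = (fst \<xi>, toc c (fst \<xi>) ?v)"
    using tangent_eq_toc[of "snd \<xi>" "fst \<xi>" c] c \<xi> unfolding tangent_bundle_def by (metis SigmaE2 prod.collapse)
  have "open (X c)" "?x \<in> X c" using chart(2) c by auto
  then obtain \<rho> where \<rho>: "\<rho> > 0" "cball ?x \<rho> \<subseteq> X c" unfolding open_contains_cball by blast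
  have px: "param c ?x = fst \<xi>" by (rule chart(4)[OF c])
  have tz: "toc c (fst \<xi>) 0 = (\<lambda>c. 0)" by (rule toc_zero[OF c])
  define \<delta> where "\<delta> = \<rho> / (norm ?v + 1)"
  have stay: "?x + r *\<^sub>R ((b - a) *\<^sub>R ?v) \<in> X c" if "\<bar>r\<bar> \<le> 1" "a < b" "b - a < \<delta>" for r a b
  proof -
    have "norm (r *\<^sub>R ((b - a) *\<^sub>R ?v)) = \<bar>r\<bar> * ((b - a) * norm ?v)" using that by (simp add: abs_mult)
    also have "\<dots> \<le> 1 * (\<delta> * (norm ?v + 1))" using that by (intro mult_mono) auto
    also have "\<dots> = \<rho>" unfolding \<delta>_def by (simp add: add_nonneg_pos less_imp_neq[THEN not_sym])
    finally show ?thesis using \<rho>(2) by (auto simp: dist_norm)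
  qed
  show thesis
  proof (rule that[of \<delta>])
    show "\<delta> > 0" using \<rho> by (simp add: \<delta>_def add_nonneg_pos)
    fix a b :: real assume ab: "a < b" "b - a < \<delta>"
    have le1: "\<bar>s * (1 - s)\<^sup>2\<bar> \<le> 1" "\<bar>s\<^sup>2 * (s - 1)\<bar> \<le> 1" if "0 \<le> s" "s \<le> 1" for s :: real
    proof -
      have "\<bar>s\<bar> \<le> 1" "\<bar>1 - s\<bar> \<le> 1" "\<bar>s - 1\<bar> \<le> 1" using that by auto
      then show "\<bar>s * (1 - s)\<^sup>2\<bar> \<le> 1" "\<bar>s\<^sup>2 * (s - 1)\<bar> \<le> 1"
        unfolding abs_mult power_abs by (auto intro!: mult_le_one power_le_one)
    qed
    have "joins a b (param c (?x + (0 * (1 - 0)\<^sup>2) *\<^sub>R ((b - a) *\<^sub>R ?v)), toc c (param c (?x + (0 * (1 - 0)\<^sup>2) *\<^sub>R ((b - a) *\<^sub>R ?v))) (((1 - 4 * 0 + 3 * 0\<^sup>2) / (b - a)) *\<^sub>R ((b - a) *\<^sub>R ?v)))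
       (param c (?x + (1 * (1 - 1)\<^sup>2) *\<^sub>R ((b - a) *\<^sub>R ?v)), toc c (param c (?x + (1 * (1 - 1)\<^sup>2) *\<^sub>R ((b - a) *\<^sub>R ?v))) (((1 - 4 * 1 + 3 * 1\<^sup>2) / (b - a)) *\<^sub>R ((b - a) *\<^sub>R ?v)))"
    proof (rule joins_polynomial[OF c(1) ab(1), where P="\<lambda>s. s * (1 - s)\<^sup>2" and P'="\<lambda>s. 1 - 4 * s + 3 * s\<^sup>2" and P''="\<lambda>s. - 4 + 6 * s"])
      show "?x + (s * (1 - s)\<^sup>2) *\<^sub>R ((b - a) *\<^sub>R ?v) \<in> X c" if "0 \<le> s" "s \<le> 1" for s
        by (intro stay ab le1 that)
    qed (auto intro!: derivative_eq_intros continuous_intros simp: power2_eq_square algebra_simps)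
    then have 1: "joins a b \<xi> (rest (fst \<xi>))" using ab by (simp add: px tz \<xi>e[symmetric])
    have "joins a b (param c (?x + (0\<^sup>2 * (0 - 1)) *\<^sub>R ((b - a) *\<^sub>R ?v)), toc c (param c (?x + (0\<^sup>2 * (0 - 1)) *\<^sub>R ((b - a) *\<^sub>R ?v))) (((3 * 0\<^sup>2 - 2 * 0) / (b - a)) *\<^sub>R ((b - a) *\<^sub>R ?v)))
       (param c (?x + (1\<^sup>2 * (1 - 1)) *\<^sub>R ((b - a) *\<^sub>R ?v)), toc c (param c (?x + (1\<^sup>2 * (1 - 1)) *\<^sub>R ((b - a) *\<^sub>R ?v))) (((3 * 1\<^sup>2 - 2 * 1) / (b - a)) *\<^sub>R ((b - a) *\<^sub>R ?v)))"
    proof (rule joins_polynomial[OF c(1) ab(1), where P="\<lambda>s. s\<^sup>2 * (s - 1)" and P'="\<lambda>s. 3 * s\<^sup>2 - 2 * s" and P''="\<lambda>s. 6 * s - 2"])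
      show "?x + (s\<^sup>2 * (s - 1)) *\<^sub>R ((b - a) *\<^sub>R ?v) \<in> X c" if "0 \<le> s" "s \<le> 1" for s
        by (intro stay ab le1 that)
    qed (auto intro!: derivative_eq_intros continuous_intros simp: power2_eq_square algebra_simps)
    then have 2: "joins a b (rest (fst \<xi>)) \<xi>" using ab by (simp add: px tz \<xi>e[symmetric])
    from 1 2 show "joins a b \<xi> (rest (fst \<xi>)) \<and> joins a b (rest (fst \<xi>)) \<xi>" by blast
  qed
qed

lemma joins_rest_local:
  obtains U where "open U" "p \<in> U" "\<And>y a b. y \<in> U \<Longrightarrow> a < b \<Longrightarrow> joins a b (rest p) (rest y) \<and> joins a b (rest y) (rest p)"
proof -
  obtain c where c: "c \<in> A" "p \<in> fst c" by (rule chart_exists)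
  have "open (X c)" "snd c p \<in> X c" using chart(2) c by auto
  then obtain \<rho> where \<rho>: "\<rho> > 0" "ball (snd c p) \<rho> \<subseteq> X c" unfolding open_contains_ball by blast
  define U where "U = fst c \<inter> snd c -` ball (snd c p) \<rho>"
  show thesis
  proof (rule that[of U])
    show "open U" unfolding U_def by (intro continuous_open_preimage chart c open_ball)
    show "p \<in> U" using c \<rho> by (simp add: U_def)
    fix y and a b :: real assume y: "y \<in> U" and ab: "a < b"
    have yp: "param c (snd c y) = y" "param c (snd c p) = p" "snd c y \<in> ball (snd c p) \<rho>" "snd c p \<in> ball (snd c p) \<rho>"
      using chart(4)[OF c(1)] y c \<rho> by (auto simp: U_def)
    show "joins a b (rest p) (rest y) \<and> joins a b (rest y) (rest p)"
      using joins_rest_chart[OF c(1) convex_ball \<rho>(2) yp(3,4) ab] joins_rest_chart[OF c(1) convex_ball \<rho>(2) yp(4,3) ab] yp(1,2)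
      by simp
  qed
qed

end

context connected_riemannian begin

text \<open>
  States of rest at different points can be joined in arbitrarily short time; the set of points that can
  be reached from rest at \<open>x\<close> is open and closed.
\<close>

lemma joins_rest:
  assumes "a < b" shows "joins a b (rest x) (rest y)"
proof -
  define R where "R = {y. \<forall>a b. a < b \<longrightarrow> joins a b (rest x) (rest y)}"
  have step: "z \<in> R" if y: "y \<in> R" and z: "\<And>a b. a < b \<Longrightarrow> joins a b (rest y) (rest z)" for y z
    unfolding R_def
  proof (intro CollectI allI impI)
    fix a b :: real assume "a < b"
    then have "a < (a + b) / 2" "(a + b) / 2 < b" by auto
    then show "joins a b (rest x) (rest z)"
      using joins_trans[of a "(a + b) / 2" "rest x" "rest y" b "rest z"] y z by (auto simp: R_def)
  qed
  have "open R" unfolding open_subopen[of R]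
  proof
    fix p assume p: "p \<in> R"
    obtain U where U: "open U" "p \<in> U" "\<And>y a b. y \<in> U \<Longrightarrow> a < b \<Longrightarrow> joins a b (rest p) (rest y) \<and> joins a b (rest y) (rest p)"
      using joins_rest_local by metis
    have "U \<subseteq> R" using step[OF p] U(3) by blast
    then show "\<exists>T. open T \<and> p \<in> T \<and> T \<subseteq> R" using U by blast
  qed
  moreover have "open (- R)" unfolding open_subopen[of "- R"]
  proof
    fix p assume p: "p \<in> - R"
    obtain U where U: "open U" "p \<in> U" "\<And>y a b. y \<in> U \<Longrightarrow> a < b \<Longrightarrow> joins a b (rest p) (rest y) \<and> joins a b (rest y) (rest p)"
      using joins_rest_local by metis
    have "U \<subseteq> - R" using step[of _ p] U(3) p by blast
    then show "\<exists>T. open T \<and> p \<in> T \<and> T \<subseteq> - R" using U by blast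
  qed
  moreover have "x \<in> R"
  proof -
    obtain U where U: "x \<in> U" "\<And>y a b. y \<in> U \<Longrightarrow> a < b \<Longrightarrow> joins a b (rest x) (rest y) \<and> joins a b (rest y) (rest x)"
      using joins_rest_local by metis
    show ?thesis using U(2)[OF U(1)] by (simp add: R_def)
  qed
  ultimately have "R = UNIV"
    using conn connected_clopen[of "UNIV :: 'm set"] by (auto simp: closed_def)
  then show ?thesis using assms by (auto simp: R_def)
qed

text \<open>Brake at the starting point, move from rest to rest, and accelerate at the end point.\<close>

lemma admissible_nonempty:
  assumes T: "T > 0" and \<xi>: "\<xi> \<in> tangent_bundle UNIV A" and \<eta>: "\<eta> \<in> tangent_bundle UNIV A"
  shows "admissible_curves A T \<xi> \<eta> \<noteq> {}"
proof -
  obtain d1 where d1: "d1 > 0" "\<And>a b. a < b \<Longrightarrow> b - a < d1 \<Longrightarrow> joins a b \<xi> (rest (fst \<xi>))"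
    using joins_start[OF \<xi>] by metis
  obtain d2 where d2: "d2 > 0" "\<And>a b. a < b \<Longrightarrow> b - a < d2 \<Longrightarrow> joins a b (rest (fst \<eta>)) \<eta>"
    using joins_start[OF \<eta>] by metis
  define e where "e = min (min d1 d2) T / 3"
  have e: "0 < e" "e < d1" "e < d2" "e < T - e" using d1(1) d2(1) T by (auto simp: e_def min_def)
  have "joins 0 e \<xi> (rest (fst \<xi>))" "joins (T - e) T (rest (fst \<eta>)) \<eta>" "joins e (T - e) (rest (fst \<xi>)) (rest (fst \<eta>))"
    using d1(2)[of 0 e] d2(2)[of "T - e" T] joins_rest e by auto
  then have "joins 0 T \<xi> \<eta>" using e by (meson joins_trans diff_gt_0_iff_gt less_trans diff_less_eq less_add_same_cancel1)
  then show ?thesis by (rule joins_admissible[OF _ T \<xi> \<eta>])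
qed

end

lemma L2_on_norm_square:
  fixes f :: "real \<Rightarrow> 'b::euclidean_space"
  assumes "L2_on a b f"
  shows "(\<lambda>t. (norm (f t))\<^sup>2) absolutely_integrable_on {a..b}"
    "(LINT t|lebesgue_on {a..b}. (norm (f t))\<^sup>2) = integral {a..b} (\<lambda>t. (norm (f t))\<^sup>2)"
proof -
  show *: "(\<lambda>t. (norm (f t))\<^sup>2) absolutely_integrable_on {a..b}"
    using assms unfolding L2_on_def by (simp add: integrable_restrict_space set_integrable_def)
  show "(LINT t|lebesgue_on {a..b}. (norm (f t))\<^sup>2) = integral {a..b} (\<lambda>t. (norm (f t))\<^sup>2)"
    by (rule LINT_eq_integral(2)[OF *])
qed

lemma real_le_square: "(d::real) \<le> l * d\<^sup>2 + 1 / l" if "l > 0" "d \<ge> 0"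
proof -
  have "0 \<le> l * (d - 1 / l)\<^sup>2" using that by simp
  also have "\<dots> = l * d\<^sup>2 - 2 * d + 1 / l" using that by (simp add: power2_eq_square field_simps)
  finally show ?thesis using that by linarith
qed

text \<open>
  A linear substitute for the Cauchy-Schwarz inequality: the parameter \<open>l\<close> is chosen according to the
  desired accuracy.
\<close>

lemma L2_on_norm_integral_le:
  fixes f :: "real \<Rightarrow> 'b::euclidean_space"
  assumes f: "L2_on a b f" and st: "a \<le> s" "s \<le> t" "t \<le> b" and l: "l > 0"
  shows "norm (integral {s..t} f) \<le> l * integral {a..b} (\<lambda>t. (norm (f t))\<^sup>2) + (t - s) / l"
proof -
  have sub: "{s..t} \<subseteq> {a..b}" using st by auto
  have f1: "f integrable_on {s..t}"
    using absolutely_integrable_on_subinterval[OF L2_on_abs[OF f] sub] by (simp add: absolutely_integrable_on_def)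
  have f2: "(\<lambda>t. (norm (f t))\<^sup>2) integrable_on {s..t}" "(\<lambda>t. (norm (f t))\<^sup>2) integrable_on {a..b}"
    using absolutely_integrable_on_subinterval[OF L2_on_norm_square(1)[OF f] sub] L2_on_norm_square(1)[OF f]
    by (auto simp: absolutely_integrable_on_def)
  have i3: "((\<lambda>r. l * (norm (f r))\<^sup>2 + 1 / l) has_integral (l * integral {s..t} (\<lambda>t. (norm (f t))\<^sup>2) + (t - s) *\<^sub>R (1 / l))) {s..t}"
    using has_integral_add[OF has_integral_mult_right[OF integrable_integral[OF f2(1)], of l] has_integral_const_real[of "1 / l" s t]] st by simp
  have "norm (integral {s..t} f) \<le> integral {s..t} (\<lambda>r. l * (norm (f r))\<^sup>2 + 1 / l)"
    by (rule integral_norm_bound_integral[OF f1]) (use i3 real_le_square[OF l norm_ge_zero] in auto)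
  also have "\<dots> = l * integral {s..t} (\<lambda>t. (norm (f t))\<^sup>2) + (t - s) / l"
    using integral_unique[OF i3] by simp
  also have "\<dots> \<le> l * integral {a..b} (\<lambda>t. (norm (f t))\<^sup>2) + (t - s) / l"
    using l f2 sub by (intro add_right_mono mult_left_mono integral_subset_le) auto
  finally show ?thesis .
qed

context riemannian begin

section \<open>Lower semicontinuity in a chart\<close>

text \<open>
  Young's inequality applied to \<open>u = w + (u - w)\<close>: the value at \<open>u\<close> is almost bounded by the value at a
  nearby \<open>w\<close>.
\<close>

lemma gm_split:
  assumes "c \<in> A" "x \<in> X c" "l > 0"
  shows "gm c x u u \<le> (1 + l) * gm c x w w + (1 + 1 / l) * gm c x (u - w) (u - w)"
proof -
  note l1 = gm_linear1[OF assms(1,2)] and l2 = gm_linear2[OF assms(1,2)]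
  have "gm c x u u = gm c x (w + (u - w)) (w + (u - w))" by simp
  also have "\<dots> = gm c x w w + 2 * gm c x w (u - w) + gm c x (u - w) (u - w)"
    unfolding linear_add[OF l1] linear_add[OF l2] gm_sym[OF assms(1,2), of "u - w" w] by simp
  also have "2 * gm c x w (u - w) \<le> l * gm c x w w + gm c x (u - w) (u - w) / l" by (rule gm_amgm[OF assms])
  finally show ?thesis by (simp add: algebra_simps)
qed

lemma gm_midpoint:
  assumes "c \<in> A" "x \<in> X c"
  shows "gm c x ((1/2) *\<^sub>R (u + w)) ((1/2) *\<^sub>R (u + w)) \<le> (gm c x u u + gm c x w w) / 2"
proof -
  note l1 = gm_linear1[OF assms(1,2)] and l2 = gm_linear2[OF assms(1,2)]
  have "2 * gm c x u w \<le> 1 * gm c x u u + gm c x w w / 1" by (rule gm_amgm[OF assms]) simp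
  then show ?thesis
    unfolding gm_scale[OF assms] linear_add[OF l1] linear_add[OF l2] gm_sym[OF assms(1,2), of w u] by simp
qed

text \<open>Uniform continuity of the metric over unit vectors and a compact set of base points.\<close>

lemma gm_uniform:
  assumes c: "c \<in> A" and K: "compact K" "K \<subseteq> X c" and d: "d > 0"
  obtains \<rho> where "\<rho> > 0" "\<And>z z' u. z \<in> K \<Longrightarrow> z' \<in> K \<Longrightarrow> norm (z - z') < \<rho> \<Longrightarrow> gm c z u u \<le> gm c z' u u + d * (norm u)\<^sup>2"
proof -
  define f where "f z = gm c (fst z) (snd z) (snd z)" for z
  have comp: "compact (K \<times> sphere (0 :: real ^ 'n) 1)" using K by (intro compact_Times) auto
  have "continuous_on (K \<times> sphere (0 :: real ^ 'n) 1) f"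
    unfolding f_def using K c by (intro gm_continuous continuous_intros) auto
  then have "uniformly_continuous_on (K \<times> sphere (0 :: real ^ 'n) 1) f"
    by (rule compact_uniformly_continuous[OF _ comp])
  then obtain \<rho> where \<rho>: "\<rho> > 0" "\<And>z z'. z \<in> K \<times> sphere 0 1 \<Longrightarrow> z' \<in> K \<times> sphere 0 1 \<Longrightarrow> dist z' z < \<rho> \<Longrightarrow> dist (f z') (f z) < d"
    unfolding uniformly_continuous_on_def using d by metis
  show thesis
  proof (rule that[OF \<rho>(1)])
    fix z z' u assume z: "z \<in> K" "z' \<in> K" "norm (z - z') < \<rho>"
    have zX: "z \<in> X c" "z' \<in> X c" using z K by auto
    show "gm c z u u \<le> gm c z' u u + d * (norm u)\<^sup>2"
    proof (cases "u = 0")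
      case True
      then show ?thesis using gm_scale[OF c zX(1), of 0 0 0 0] gm_scale[OF c zX(2), of 0 0 0 0] by simp
    next
      case False
      define w where "w = u /\<^sub>R norm u"
      have u: "u = norm u *\<^sub>R w" using False by (simp add: w_def)
      have "dist (f (z', w)) (f (z, w)) < d"
        by (rule \<rho>(2)) (use z False in \<open>auto simp: w_def dist_Pair_Pair dist_norm norm_minus_commute\<close>)
      then have "gm c z w w \<le> gm c z' w w + d" by (auto simp: f_def dist_real_def)
      then have "norm u * norm u * gm c z w w \<le> norm u * norm u * (gm c z' w w + d)" by (intro mult_left_mono) auto
      moreover have "gm c z u u = norm u * norm u * gm c z w w" "gm c z' u u = norm u * norm u * gm c z' w w"
        using gm_scale[OF c zX(1), of "norm u" w "norm u" w] gm_scale[OF c zX(2), of "norm u" w "norm u" w] u by simp_all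
      ultimately show ?thesis by (simp add: power2_eq_square algebra_simps)
    qed
  qed
qed

text \<open>
  The analytic core. From the bounds on energy and acceleration and from pointwise convergence in a chart,
  it follows that the limit \<open>y\<close> is of class \<open>H\<^sup>2\<close>, that velocities converge along a subsequence, and that
  the acceleration integral of \<open>y\<close> does not exceed all the others by a fixed amount. The last statement
  is weaker than lower semicontinuity, but applied to subsequences it gives the latter.
\<close>

lemma chart_limit:
  fixes qn :: "nat \<Rightarrow> real \<Rightarrow> 'm" and y :: "real \<Rightarrow> real ^ 'n"
  assumes T: "T > 0" and qn: "\<And>n. qn n \<in> H2_curves A T"
    and c: "c \<in> A" and ab: "0 \<le> a" "a < b" "b \<le> T"
    and K: "compact K" "K \<subseteq> X c"
    and inK: "\<And>n t. t \<in> {a..b} \<Longrightarrow> qn n t \<in> fst c \<and> snd c (qn n t) \<in> K"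
    and lim: "\<And>t. t \<in> {a..b} \<Longrightarrow> (\<lambda>n. snd c (qn n t)) \<longlonglongrightarrow> y t"
    and kinR: "\<And>n t. t \<in> {a..b} \<Longrightarrow> kin T (qn n) t \<le> R\<^sup>2"
    and accB: "\<And>n. integral {a..b} (acc T (qn n)) \<le> B"
  obtains v h r where "H2_rep a b y v h" "strict_mono r"
    "\<And>t. t \<in> {a..b} \<Longrightarrow> (\<lambda>n. velocity A {0..T} (qn (r n)) t c) \<longlonglongrightarrow> v t"
    "\<And>e. e > 0 \<Longrightarrow> \<exists>n. integral {a..b} (\<lambda>t. gm c (y t) (acc_coords c y v h t) (acc_coords c y v h t))
        < integral {a..b} (acc T (qn n)) + e"
proof -
  define x where "x n t = snd c (qn n t)" for n t
  define vn where "vn n t = velocity A {0..T} (qn n) t c" for n t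
  have "\<exists>h. H2_rep a b (x n) (vn n) h" for n
  proof -
    have "qn n ` {a..b} \<subseteq> fst c" using inK by auto
    from H2_curve_rep[OF qn c ab this] obtain h where "H2_rep a b (snd c \<circ> qn n) (\<lambda>t. velocity A {0..T} (qn n) t c) h" by blast
    then show ?thesis unfolding x_def vn_def by (auto simp: o_def)
  qed
  then obtain hn where r: "\<And>n. H2_rep a b (x n) (vn n) (hn n)" by metis
  have xK: "x n t \<in> K" if "t \<in> {a..b}" for n t using inK[OF that] by (simp add: x_def)
  have xX: "x n ` {a..b} \<subseteq> X c" for n using xK K(2) by blast
  note cx = H2_rep_continuous(1)[OF r] and cv = H2_rep_continuous(2)[OF r]
  define D where "D n = acc_coords c (x n) (vn n) (hn n)" for n
  have DL: "L2_on a b (D n)" for n unfolding D_def by (rule acc_coords_L2[OF c r xX])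
  have acc_eq: "integral {a..b} (acc T (qn n)) = integral {a..b} (\<lambda>t. gm c (x n t) (D n t) (D n t))" for n
  proof -
    have "qn n ` {a..b} \<subseteq> fst c" using inK by auto
    moreover have "H2_rep a b (snd c \<circ> qn n) (\<lambda>t. velocity A {0..T} (qn n) t c) (hn n)"
      using r[of n] unfolding x_def vn_def by (simp add: o_def)
    ultimately obtain N where N: "negligible N" "\<And>t. t \<in> {a..b} - N \<Longrightarrow> acc T (qn n) t = gm c (x n t) (D n t) (D n t)"
      using acc_coords[OF qn T c ab] unfolding D_def x_def vn_def o_def by metis
    show ?thesis by (rule integral_spike[OF N(1)]) (simp add: N(2))
  qed
  have gmD: "(\<lambda>t. gm c (x n t) (D n t) (D n t)) integrable_on {a..b}" for n
    using gm_L2_integrable[OF c cx xX DL] by (simp add: absolutely_integrable_on_def)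
  obtain \<kappa> C where \<kappa>: "\<kappa> > 0" "C > 0" "\<And>z u. z \<in> K \<Longrightarrow> \<kappa> * (norm u)\<^sup>2 \<le> gm c z u u" "\<And>z u. z \<in> K \<Longrightarrow> gm c z u u \<le> C * (norm u)\<^sup>2"
    using gm_compact_bounds[OF c K] by metis
  define B' where "B' = B / \<kappa>"
  have D2i: "(\<lambda>t. (norm (D n t))\<^sup>2) integrable_on {a..b}" for n
    using L2_on_norm_square(1)[OF DL] by (simp add: absolutely_integrable_on_def)
  have DB: "integral {a..b} (\<lambda>t. (norm (D n t))\<^sup>2) \<le> B'" for n
  proof -
    have "integral {a..b} (\<lambda>t. \<kappa> * (norm (D n t))\<^sup>2) \<le> integral {a..b} (\<lambda>t. gm c (x n t) (D n t) (D n t))"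
      by (rule integral_le) (use D2i gmD \<kappa>(3) xK in \<open>auto intro: integrable_on_mult_right\<close>)
    then have "\<kappa> * integral {a..b} (\<lambda>t. (norm (D n t))\<^sup>2) \<le> B" using accB[of n] acc_eq by simp
    then show ?thesis using \<kappa>(1) by (simp add: B'_def field_simps)
  qed
  have B'0: "B' \<ge> 0"
    using DB[of 0] Henstock_Kurzweil_Integration.integral_nonneg[OF D2i[of 0]] by fastforce
  define M where "M = sqrt (R\<^sup>2 / \<kappa>)"
  have vM: "norm (vn n t) \<le> M" if t: "t \<in> {a..b}" for n t
  proof -
    have "kin T (qn n) t = gm c (x n t) (vn n t) (vn n t)"
      unfolding x_def vn_def by (rule kin_coords[OF qn T _ _ c]) (use t ab inK in auto)
    then have "\<kappa> * (norm (vn n t))\<^sup>2 \<le> R\<^sup>2" using \<kappa>(3)[OF xK[OF t, of n], of "vn n t"] kinR[OF t, of n] by linarith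
    then have "(norm (vn n t))\<^sup>2 \<le> R\<^sup>2 / \<kappa>" using \<kappa>(1) by (simp add: field_simps)
    then show ?thesis unfolding M_def by (rule real_le_rsqrt)
  qed
  have cGam: "continuous_on (X c \<times> UNIV) (\<lambda>z. Gam c (fst z) (snd z))"
    by (rule Gam_continuous[OF c]) (auto intro!: continuous_intros)
  have "compact ((\<lambda>z. Gam c (fst z) (snd z)) ` (K \<times> cball 0 M))"
    using K by (intro compact_continuous_image compact_Times compact_cball continuous_on_subset[OF cGam]) auto
  from compact_imp_bounded[OF this, unfolded bounded_pos]
  obtain \<Gamma> where \<Gamma>0: "\<Gamma> > 0" "\<forall>w \<in> (\<lambda>z. Gam c (fst z) (snd z)) ` (K \<times> cball 0 M). norm w \<le> \<Gamma>"
    by (elim exE conjE)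
  have \<Gamma>: "\<Gamma> > 0" "norm (Gam c z u) \<le> \<Gamma>" if "z \<in> K" "norm u \<le> M" for z u
  proof -
    have "Gam c z u \<in> (\<lambda>z. Gam c (fst z) (snd z)) ` (K \<times> cball 0 M)"
      by (rule image_eqI[of _ _ "(z, u)"]) (use that in auto)
    then show "norm (Gam c z u) \<le> \<Gamma>" using \<Gamma>0(2) by blast
  qed (rule \<Gamma>0(1))
  have GamI: "(\<lambda>t. Gam c (x n t) (vn n t)) integrable_on {s..t}" if "a \<le> s" "t \<le> b" for n s t
    by (rule integrable_continuous_interval, rule continuous_on_subset[OF Gam_continuous[OF c cx xX cv]]) (use that in auto)
  have Di: "D n integrable_on {s..t}" if "a \<le> s" "t \<le> b" for n s t
    using absolutely_integrable_on_subinterval[OF L2_on_abs[OF DL[of n]], of s t] that by (auto simp: absolutely_integrable_on_def)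
  have v_inc: "integral {s..t} (D n) = vn n t - vn n s + integral {s..t} (\<lambda>t. Gam c (x n t) (vn n t))"
    if st: "a \<le> s" "s \<le> t" "t \<le> b" for n s t
  proof -
    have h: "AC_rep a b (vn n) (hn n)" using r[of n] by (simp add: H2_rep_def)
    have "integral {s..t} (D n) = integral {s..t} (hn n) + integral {s..t} (\<lambda>t. Gam c (x n t) (vn n t))"
      unfolding D_def acc_coords_def
      by (rule Henstock_Kurzweil_Integration.integral_add[OF AC_repD_integrable(1)[OF h st(1,3)] GamI[OF st(1,3)]])
    then show ?thesis using AC_rep_increment[OF h st] by simp
  qed
  \<comment> \<open>The velocities are uniformly equicontinuous, since \<open>vn' = D - \<Gamma>\<close> with \<open>D\<close> bounded in \<open>L\<^sup>2\<close> and the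
    Christoffel term bounded.\<close>
  have equi: "norm (vn n t - vn n s) \<le> l * B' + (t - s) * (1 / l + \<Gamma>)" if st: "a \<le> s" "s \<le> t" "t \<le> b" and l: "l > 0" for n s t l
  proof -
    have "norm (integral {s..t} (\<lambda>t. Gam c (x n t) (vn n t))) \<le> integral {s..t} (\<lambda>t. \<Gamma>)"
      by (rule integral_norm_bound_integral[OF GamI[OF st(1,3)]]) (use st xK vM \<Gamma>(2) in auto)
    then have 1: "norm (integral {s..t} (\<lambda>t. Gam c (x n t) (vn n t))) \<le> (t - s) * \<Gamma>" using st by simp
    have "norm (integral {s..t} (D n)) \<le> l * integral {a..b} (\<lambda>t. (norm (D n t))\<^sup>2) + (t - s) / l"
      by (rule L2_on_norm_integral_le[OF DL st l])
    also have "\<dots> \<le> l * B' + (t - s) / l" using DB[of n] l by simp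
    finally have 2: "norm (integral {s..t} (D n)) \<le> l * B' + (t - s) / l" .
    have "vn n t - vn n s = integral {s..t} (D n) - integral {s..t} (\<lambda>t. Gam c (x n t) (vn n t))"
      using v_inc[OF st] by simp
    then have "norm (vn n t - vn n s) \<le> norm (integral {s..t} (D n)) + norm (integral {s..t} (\<lambda>t. Gam c (x n t) (vn n t)))"
      by (simp add: norm_triangle_ineq4)
    then show ?thesis using 1 2 by (simp add: algebra_simps)
  qed
  have equicont: "\<exists>d. 0 < d \<and> (\<forall>n t. t \<in> {a..b} \<and> norm (s - t) < d \<longrightarrow> norm (vn n s - vn n t) < e)" if s: "s \<in> {a..b}" and e: "e > 0" for s e
  proof -
    define l where "l = e / (2 * (B' + 1))"
    have l: "l > 0" "l * B' \<le> e / 2" using e B'0 by (auto simp: l_def field_simps)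
    define p where "p = 1 / l + \<Gamma>"
    have pos: "p > 0" unfolding p_def using l \<Gamma>0(1) by (simp add: add_pos_pos)
    define d where "d = e / 2 / p"
    have d: "d > 0" using e pos by (simp add: d_def)
    have "norm (vn n s - vn n t) < e" if t: "t \<in> {a..b}" "norm (s - t) < d" for n t
    proof -
      have "norm (vn n s - vn n t) \<le> l * B' + \<bar>s - t\<bar> * p"
        unfolding p_def using equi[of s t l n] equi[of t s l n] s t l by (cases "s \<le> t") (auto simp: norm_minus_commute)
      also have "\<dots> < e / 2 + d * p" using l t pos by (intro add_le_less_mono mult_strict_right_mono) auto
      also have "d * p = e / 2" using pos by (simp add: d_def)
      finally show ?thesis by simp
    qed
    then show ?thesis using d by blast
  qed
  obtain v k where v: "continuous_on {a..b} v" "strict_mono (k :: nat \<Rightarrow> nat)"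
      "\<And>e. 0 < e \<Longrightarrow> \<exists>N. \<forall>n t. n \<ge> N \<and> t \<in> {a..b} \<longrightarrow> norm (vn (k n) t - v t) < e"
    by (rule Arzela_Ascoli[OF compact_Icc vM equicont]) blast+
  have vlim: "(\<lambda>n. vn (k n) t) \<longlonglongrightarrow> v t" if "t \<in> {a..b}" for t
    by (rule LIMSEQ_I) (use v(3) that in blast)
  have xlim: "(\<lambda>n. x (k n) t) \<longlonglongrightarrow> y t" if "t \<in> {a..b}" for t
    using LIMSEQ_subseq_LIMSEQ[OF lim[OF that] v(2)] by (simp add: x_def o_def)
  have yK: "y t \<in> K" if "t \<in> {a..b}" for t
    by (rule closed_sequentially[OF compact_imp_closed[OF K(1)] _ xlim[OF that]]) (use xK that in blast)
  have vlM: "norm (v t) \<le> M" if "t \<in> {a..b}" for t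
    by (rule Lim_bounded[OF tendsto_norm[OF vlim[OF that]]]) (use vM that in blast)
  have yv: "AC_rep a b y v"
  proof (rule AC_repI)
    show "v absolutely_integrable_on {a..b}" by (rule absolutely_integrable_continuous_real[OF v(1)])
    fix t assume t: "a \<le> t" "t \<le> b"
    have "(\<lambda>n. integral {a..t} (vn (k n))) \<longlonglongrightarrow> integral {a..t} v"
    proof (rule dominated_convergence(2)[where h="\<lambda>_. M"])
      show "vn (k n) integrable_on {a..t}" for n
        using t by (intro integrable_continuous_interval continuous_on_subset[OF cv]) auto
    qed (use t vM vlim in auto)
    moreover have "integral {a..t} (vn (k n)) = x (k n) t - x (k n) a" for n
      using AC_rep_increment[of a b "x (k n)" "vn (k n)" a t] r[of "k n"] t by (simp add: H2_rep_def)
    moreover have "(\<lambda>n. x (k n) t - x (k n) a) \<longlonglongrightarrow> y t - y a" using t ab by (intro tendsto_diff xlim) auto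
    ultimately show "y t - y a = integral {a..t} v" using LIMSEQ_unique by auto
  qed
  note cy = AC_rep_continuous[OF yv]
  have yX: "y ` {a..b} \<subseteq> X c" using yK K(2) by blast
  have cGy: "continuous_on {a..b} (\<lambda>t. Gam c (y t) (v t))" by (rule Gam_continuous[OF c cy yX v(1)])
  have Glim: "(\<lambda>n. Gam c (x (k n) t) (vn (k n) t)) \<longlonglongrightarrow> Gam c (y t) (v t)" if t: "t \<in> {a..b}" for t
  proof -
    have L: "(\<lambda>n. (x (k n) t, vn (k n) t)) \<longlonglongrightarrow> (y t, v t)" by (intro tendsto_Pair xlim vlim t)
    have "\<And>n. x (k n) t \<in> X c" "y t \<in> X c" using xK[OF t] yK[OF t] K(2) by blast+
    then have "(\<lambda>n. (\<lambda>z. Gam c (fst z) (snd z)) (x (k n) t, vn (k n) t)) \<longlonglongrightarrow> (\<lambda>z. Gam c (fst z) (snd z)) (y t, v t)"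
      by (intro continuous_on_tendsto_compose[OF cGam L]) auto
    then show ?thesis by simp
  qed
  \<comment> \<open>The limits of the integrals of the accelerations. Once \<open>W\<close> is the integral of some \<open>Dl\<close>, the velocity
    \<open>v\<close> is absolutely continuous with derivative \<open>Dl - \<Gamma>(y)(v, v)\<close>.\<close>
  define W where "W t = v t - v a + integral {a..t} (\<lambda>s. Gam c (y s) (v s))" for t
  have DW: "(\<lambda>n. integral {a..t} (D (k n))) \<longlonglongrightarrow> W t" if t: "a \<le> t" "t \<le> b" for t
  proof -
    have "(\<lambda>n. integral {a..t} (\<lambda>s. Gam c (x (k n) s) (vn (k n) s))) \<longlonglongrightarrow> integral {a..t} (\<lambda>s. Gam c (y s) (v s))"
      by (rule dominated_convergence(2)[where h="\<lambda>_. \<Gamma>"]) (use t GamI xK vM \<Gamma>(2) Glim in auto)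
    then show ?thesis unfolding W_def v_inc[OF order_refl t]
      using t ab by (intro tendsto_intros vlim) auto
  qed
  have fin: "finite_measure (lebesgue_on {a..b})" by (rule finite_measure_lebesgue_Icc)
  obtain m Dl where m: "\<And>N. m N \<in> mid_hull ((\<lambda>n. D (k n)) ` {N..})" and Dl: "L2_on a b Dl"
    and mlim: "(\<lambda>n. LINT t|lebesgue_on {a..b}. (norm (m n t - Dl t))\<^sup>2) \<longlonglongrightarrow> 0"
    by (rule Mazur_L2[OF fin, where h="\<lambda>n. D (k n)" and C=B'])
       (use DL DB L2_on_norm_square(2)[OF DL] in \<open>auto simp: L2_on_L2\<close>)
  have hullL: "L2_on a b f" if "f \<in> mid_hull ((\<lambda>n. D (k n)) ` {N..})" for f N
    unfolding L2_on_L2 by (rule mid_hull_L2[OF _ that]) (use DL in \<open>auto simp: L2_on_L2\<close>)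
  have mL: "L2_on a b (m N)" for N by (rule hullL[OF m])
  have mdL: "L2_on a b (\<lambda>t. m N t - Dl t)" for N using mL Dl L2_diff unfolding L2_on_L2 by blast
  define I where "I N = integral {a..b} (\<lambda>t. (norm (m N t - Dl t))\<^sup>2)" for N
  have Ilim: "I \<longlonglongrightarrow> 0" using mlim unfolding I_def L2_on_norm_square(2)[OF mdL] .
  have Lint: "f integrable_on {a..t}" if "L2_on a b f" "t \<le> b" for f :: "real \<Rightarrow> real ^ 'n" and t
    using absolutely_integrable_on_subinterval[OF L2_on_abs[OF that(1)], of a t] that by (auto simp: absolutely_integrable_on_def)
  \<comment> \<open>The integrals of the midpoint combinations converge both to the limit \<open>W t\<close> of the original
    integrals and, by convergence in \<open>L\<^sup>2\<close>, to the integral of \<open>Dl\<close>.\<close>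
  have DlW: "integral {a..t} Dl = W t" if t: "a \<le> t" "t \<le> b" for t
  proof (rule LIMSEQ_unique)
    show "(\<lambda>N. integral {a..t} (m N)) \<longlonglongrightarrow> W t"
    proof (rule LIMSEQ_I)
      fix e :: real assume "e > 0"
      then obtain N where N: "\<And>n. n \<ge> N \<Longrightarrow> norm (integral {a..t} (D (k n)) - W t) < e"
        using LIMSEQ_D[OF DW[OF t]] by blast
      have "norm (integral {a..t} f - W t) < e" if f: "f \<in> mid_hull ((\<lambda>n. D (k n)) ` {N'..})" and N': "N' \<ge> N" for f N'
        using f
      proof induction
        case (base f) then show ?case using N N' by auto
      next
        case (mid f f')
        have i: "f integrable_on {a..t}" "f' integrable_on {a..t}" using Lint hullL mid t by blast+
        have "integral {a..t} (\<lambda>s. (1/2) *\<^sub>R (f s + f' s)) - W t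
           = (1/2) *\<^sub>R (integral {a..t} f - W t) + (1/2) *\<^sub>R (integral {a..t} f' - W t)"
          using i by (simp add: Henstock_Kurzweil_Integration.integral_add algebra_simps flip: scaleR_add_left)
        also have "norm \<dots> < e" using norm_triangle_ineq[of "(1/2) *\<^sub>R (integral {a..t} f - W t)" "(1/2) *\<^sub>R (integral {a..t} f' - W t)"] mid.IH
          by simp
        finally show ?case .
      qed
      then show "\<exists>no. \<forall>N\<ge>no. norm (integral {a..t} (m N) - W t) < e" using m by blast
    qed
    show "(\<lambda>N. integral {a..t} (m N)) \<longlonglongrightarrow> integral {a..t} Dl"
    proof (rule LIMSEQ_I)
      fix e :: real assume e: "e > 0"
      define l where "l = 2 * (b - a + 1) / e"
      have l: "l > 0" "(b - a) / l < e / 2" using e ab by (auto simp: l_def field_simps)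
      have "e / 2 / l > 0" using e l by simp
      then obtain N where N: "\<And>n. n \<ge> N \<Longrightarrow> I n < e / 2 / l" using order_tendstoD(2)[OF Ilim] unfolding eventually_sequentially by blast
      show "\<exists>no. \<forall>n\<ge>no. norm (integral {a..t} (m n) - integral {a..t} Dl) < e"
      proof (intro exI[of _ N] allI impI)
        fix n assume n: "n \<ge> N"
        have "integral {a..t} (m n) - integral {a..t} Dl = integral {a..t} (\<lambda>s. m n s - Dl s)"
          by (rule Henstock_Kurzweil_Integration.integral_diff[symmetric]) (use Lint mL Dl t in auto)
        also have "norm \<dots> \<le> l * I n + (t - a) / l"
          unfolding I_def by (rule L2_on_norm_integral_le[OF mdL order_refl t l(1)])
        also have "\<dots> \<le> l * I n + (b - a) / l" using t l by (intro add_left_mono divide_right_mono) auto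
        also have "\<dots> < l * (e / 2 / l) + e / 2" using N[OF n] l by (intro add_strict_mono mult_strict_left_mono) auto
        also have "\<dots> = e" using l by simp
        finally show "norm (integral {a..t} (m n) - integral {a..t} Dl) < e" .
      qed
    qed
  qed
  define h where "h t = Dl t - Gam c (y t) (v t)" for t
  have hD: "acc_coords c y v h = Dl" by (simp add: acc_coords_def h_def fun_eq_iff)
  have hL: "L2_on a b h" using L2_diff Dl L2_on_continuous[OF cGy] unfolding L2_on_L2 h_def by blast
  have "AC_rep a b v h"
  proof (rule AC_repI[OF L2_on_abs[OF hL]])
    fix t assume t: "a \<le> t" "t \<le> b"
    have "integral {a..t} h = integral {a..t} Dl - integral {a..t} (\<lambda>s. Gam c (y s) (v s))"
      unfolding h_def
      by (rule Henstock_Kurzweil_Integration.integral_diff[OF Lint[OF Dl t(2)]])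
         (use t in \<open>intro integrable_continuous_interval continuous_on_subset[OF cGy], auto\<close>)
    then show "v t - v a = integral {a..t} h" using DlW[OF t] by (simp add: W_def)
  qed
  then have rep: "H2_rep a b y v h" using yv hL by (simp add: H2_rep_def)
  define Q where "Q f = integral {a..b} (\<lambda>t. gm c (y t) (f t) (f t))" for f
  have Qi: "(\<lambda>t. gm c (y t) (f t) (f t)) integrable_on {a..b}" if "L2_on a b f" for f
    using gm_L2_integrable[OF c cy yX that] by (simp add: absolutely_integrable_on_def)
  have yXt: "y t \<in> X c" if "t \<in> {a..b}" for t using yX that by blast
  have Q0: "Q f \<ge> 0" if "L2_on a b f" for f
    unfolding Q_def by (rule Henstock_Kurzweil_Integration.integral_nonneg[OF Qi[OF that]]) (use gm_nonneg[OF c yXt] in auto)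
  \<comment> \<open>Positions converge uniformly, because the velocities do and the positions converge at \<open>a\<close>.\<close>
  have unif: "\<exists>N. \<forall>n\<ge>N. \<forall>t\<in>{a..b}. norm (y t - x (k n) t) < \<rho>" if \<rho>: "\<rho> > 0" for \<rho>
  proof -
    define e where "e = \<rho> / (2 * (b - a + 1))"
    have e: "e > 0" "e * (b - a) \<le> \<rho> / 2" using \<rho> ab by (auto simp: e_def field_simps)
    obtain N1 where N1: "\<And>n t. n \<ge> N1 \<Longrightarrow> t \<in> {a..b} \<Longrightarrow> norm (vn (k n) t - v t) < e" using v(3)[OF e(1)] by blast
    have a_in: "a \<in> {a..b}" using ab by auto
    obtain N2 where N2: "\<And>n. n \<ge> N2 \<Longrightarrow> norm (x (k n) a - y a) < \<rho> / 2" using LIMSEQ_D[OF xlim[OF a_in], of "\<rho>/2"] \<rho> by auto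
    have "norm (y t - x (k n) t) < \<rho>" if n: "n \<ge> max N1 N2" and t: "t \<in> {a..b}" for n t
    proof -
      have vi: "vn (k n) integrable_on {a..t}" "v integrable_on {a..t}"
        using t by (auto intro!: integrable_continuous_interval continuous_on_subset[OF cv] continuous_on_subset[OF v(1)])
      have xn: "x (k n) t - x (k n) a = integral {a..t} (vn (k n))"
        using AC_rep_increment[of a b "x (k n)" "vn (k n)" a t] r[of "k n"] t by (simp add: H2_rep_def)
      have yn: "y t - y a = integral {a..t} v" using AC_rep_increment[OF yv, of a t] t by simp
      have "norm (integral {a..t} (\<lambda>s. vn (k n) s - v s)) \<le> integral {a..t} (\<lambda>s. e)"
        by (rule integral_norm_bound_integral) (use vi N1 n t in \<open>auto intro!: integrable_diff less_imp_le\<close>)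
      also have "\<dots> \<le> e * (b - a)" using t e by (simp add: mult.commute)
      finally have "norm (integral {a..t} (vn (k n)) - integral {a..t} v) \<le> \<rho> / 2"
        using e(2) vi by (simp add: Henstock_Kurzweil_Integration.integral_diff)
      moreover have "y t - x (k n) t = - ((integral {a..t} (vn (k n)) - integral {a..t} v) + (x (k n) a - y a))"
        unfolding xn[symmetric] yn[symmetric] by simp
      then have "norm (y t - x (k n) t) \<le> norm (integral {a..t} (vn (k n)) - integral {a..t} v) + norm (x (k n) a - y a)"
        unfolding norm_minus_cancel by (simp only: norm_minus_cancel norm_triangle_ineq)
      ultimately show ?thesis using N2[of n] n by simp
    qed
    then show ?thesis by blast
  qed
  \<comment> \<open>If all integrals were below \<open>Q Dl - e\<close>, then so would be, up to small errors, the values of the convex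
    functional \<open>Q\<close> at the \<open>D (k n)\<close>, at their midpoint combinations and at the limit \<open>Dl\<close> of these. Three
    errors of size \<open>e / 4\<close> occur: the change of the base point from \<open>x (k n)\<close> to \<open>y\<close>, the factor \<open>1 + l\<close> in
    Young's inequality, and the distance of \<open>m n\<close> from \<open>Dl\<close>.\<close>
  have lsc: "\<exists>n. Q Dl < integral {a..b} (acc T (qn n)) + e" if e: "e > 0" for e
  proof (rule ccontr)
    assume "\<not> ?thesis"
    then have big: "integral {a..b} (acc T (qn n)) \<le> Q Dl - e" for n by (meson add_le_imp_le_diff linorder_not_less)
    define d where "d = e / (4 * (B' + 1))"
    have d: "d > 0" "d * B' \<le> e / 4" using e B'0 by (auto simp: d_def field_simps)
    obtain \<rho> where \<rho>: "\<rho> > 0" "\<And>z z' u. z \<in> K \<Longrightarrow> z' \<in> K \<Longrightarrow> norm (z - z') < \<rho> \<Longrightarrow> gm c z u u \<le> gm c z' u u + d * (norm u)\<^sup>2"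
      using gm_uniform[OF c K d(1)] by metis
    obtain N where N: "\<And>n t. n \<ge> N \<Longrightarrow> t \<in> {a..b} \<Longrightarrow> norm (y t - x (k n) t) < \<rho>" using unif[OF \<rho>(1)] by blast
    have QD: "Q (D (k n)) \<le> Q Dl - 3 * e / 4" if n: "n \<ge> N" for n
    proof -
      have "Q (D (k n)) \<le> integral {a..b} (\<lambda>t. gm c (x (k n) t) (D (k n) t) (D (k n) t) + d * (norm (D (k n) t))\<^sup>2)"
        unfolding Q_def
        by (rule integral_le) (use Qi[OF DL] gmD D2i \<rho>(2) xK yK N[OF n] in \<open>auto intro!: integrable_add integrable_on_mult_right\<close>)
      also have "\<dots> = integral {a..b} (acc T (qn (k n))) + d * integral {a..b} (\<lambda>t. (norm (D (k n) t))\<^sup>2)"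
        unfolding acc_eq using gmD D2i by (simp add: Henstock_Kurzweil_Integration.integral_add integrable_on_mult_right)
      also have "\<dots> \<le> (Q Dl - e) + d * B'" using big[of "k n"] DB[of "k n"] d(1) by (intro add_mono mult_left_mono) auto
      also have "\<dots> \<le> Q Dl - 3 * e / 4" using d(2) by simp
      finally show ?thesis .
    qed
    have Qm: "Q f \<le> Q Dl - 3 * e / 4" if f: "f \<in> mid_hull ((\<lambda>n. D (k n)) ` {N..})" for f
      using f
    proof induction
      case (base f) then show ?case using QD by auto
    next
      case (mid f f')
      have i: "L2_on a b f" "L2_on a b f'" "L2_on a b (\<lambda>x. (1/2) *\<^sub>R (f x + f' x))"
        using hullL mid mid_hull.mid by blast+
      have "Q (\<lambda>x. (1/2) *\<^sub>R (f x + f' x)) \<le> integral {a..b} (\<lambda>t. (gm c (y t) (f t) (f t) + gm c (y t) (f' t) (f' t)) / 2)"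
        unfolding Q_def
        by (rule integral_le[OF Qi[OF i(3)]])
           (use Qi i gm_midpoint[OF c yXt] in \<open>auto intro!: integrable_on_divide integrable_add\<close>)
      also have "\<dots> = (Q f + Q f') / 2" unfolding Q_def using Qi i
        by (simp add: Henstock_Kurzweil_Integration.integral_add)
      finally show ?case using mid.IH by simp
    qed
    define E where "E = Q Dl"
    have E0: "E \<ge> 0" using Q0[OF Dl] by (simp add: E_def)
    define l where "l = e / (4 * (E + 1))"
    have l: "l > 0" "l * E \<le> e / 4" using e E0 by (auto simp: l_def field_simps)
    have pos: "(1 + 1 / l) * C > 0" using l \<kappa>(2) by (simp add: add_pos_pos)
    obtain N' where N': "\<And>n. n \<ge> N' \<Longrightarrow> I n < e / 4 / ((1 + 1 / l) * C)"
      using order_tendstoD(2)[OF Ilim, of "e / 4 / ((1 + 1 / l) * C)"] e pos unfolding eventually_sequentially by auto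
    define n where "n = max N N'"
    have mh: "m n \<in> mid_hull ((\<lambda>n. D (k n)) ` {N..})"
    proof -
      have "mid_hull ((\<lambda>n. D (k n)) ` {n..}) \<subseteq> mid_hull ((\<lambda>n. D (k n)) ` {N..})"
        by (intro mid_hull_mono image_mono) (simp add: n_def)
      then show ?thesis using m[of n] by blast
    qed
    have mdi: "(\<lambda>t. (norm (m n t - Dl t))\<^sup>2) integrable_on {a..b}"
      using L2_on_norm_square(1)[OF mdL] by (simp add: absolutely_integrable_on_def)
    have "E \<le> integral {a..b} (\<lambda>t. (1 + l) * gm c (y t) (m n t) (m n t) + (1 + 1 / l) * C * (norm (m n t - Dl t))\<^sup>2)"
      unfolding E_def Q_def
    proof (rule integral_le[OF Qi[OF Dl]])
      show "(\<lambda>t. (1 + l) * gm c (y t) (m n t) (m n t) + (1 + 1 / l) * C * (norm (m n t - Dl t))\<^sup>2) integrable_on {a..b}"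
        by (intro integrable_add integrable_on_mult_right Qi mL mdi)
      fix t assume t: "t \<in> {a..b}"
      have "(1 + 1 / l) * gm c (y t) (Dl t - m n t) (Dl t - m n t) \<le> (1 + 1 / l) * (C * (norm (Dl t - m n t))\<^sup>2)"
        using l by (intro mult_left_mono \<kappa>(4) yK t) auto
      then show "gm c (y t) (Dl t) (Dl t) \<le> (1 + l) * gm c (y t) (m n t) (m n t) + (1 + 1 / l) * C * (norm (m n t - Dl t))\<^sup>2"
        using gm_split[OF c yXt[OF t] l(1), of "Dl t" "m n t"] by (simp add: norm_minus_commute mult.assoc)
    qed
    also have "\<dots> = (1 + l) * Q (m n) + (1 + 1 / l) * C * I n"
      unfolding Q_def I_def using Qi[OF mL] mdi
      by (subst Henstock_Kurzweil_Integration.integral_add) (auto intro: integrable_on_mult_right)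
    also have "\<dots> \<le> (1 + l) * (E - 3 * e / 4) + e / 4"
    proof (intro add_mono mult_left_mono)
      show "Q (m n) \<le> E - 3 * e / 4" using Qm[OF mh] by (simp add: E_def)
      have "I n < e / 4 / ((1 + 1 / l) * C)" by (rule N') (simp add: n_def)
      then have "I n * ((1 + 1 / l) * C) < e / 4" by (rule pos_less_divide_eq[OF pos, THEN iffD1])
      then show "(1 + 1 / l) * C * I n \<le> e / 4" by (simp only: mult.commute less_imp_le)
    qed (use l in auto)
    also have "\<dots> \<le> E - 3 * e / 4 + e / 4 + e / 4"
    proof -
      have "l * (E - 3 * e / 4) \<le> l * E" using l e by (intro mult_left_mono) auto
      then show ?thesis using l(2) by (simp add: algebra_simps)
    qed
    finally show False using e by simp
  qed
  show thesis
  proof (rule that[OF rep v(2)])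
    show "(\<lambda>n. velocity A {0..T} (qn (k n)) t c) \<longlonglongrightarrow> v t" if "t \<in> {a..b}" for t
      using vlim[OF that] by (simp add: vn_def)
    show "\<exists>n. integral {a..b} (\<lambda>t. gm c (y t) (acc_coords c y v h t) (acc_coords c y v h t)) < integral {a..b} (acc T (qn n)) + e" if "e > 0" for e
      using lsc[OF that] unfolding hD Q_def .
  qed
qed

end

text \<open>Fatou's lemma in a form without lower limits.\<close>

lemma Fatou_continuous:
  fixes f :: "nat \<Rightarrow> real \<Rightarrow> real"
  assumes f: "\<And>n. continuous_on {a..b} (f n)" "\<And>n t. t \<in> {a..b} \<Longrightarrow> f n t \<ge> 0"
    and g: "continuous_on {a..b} g" and lim: "\<And>t. t \<in> {a..b} \<Longrightarrow> (\<lambda>n. f n t) \<longlonglongrightarrow> g t" and e: "e > 0"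
  shows "\<forall>\<^sub>F n in sequentially. integral {a..b} g \<le> integral {a..b} (f n) + e"
proof -
  let ?M = "lebesgue_on {a..b}"
  note af = absolutely_integrable_continuous_real[OF f(1)] and ag = absolutely_integrable_continuous_real[OF g]
  have g0: "g t \<ge> 0" if "t \<in> {a..b}" for t
    by (rule LIMSEQ_le_const[OF lim[OF that]]) (use f(2)[OF that] in blast)
  have fi: "(\<integral>\<^sup>+t. ennreal (f n t) \<partial>?M) = ennreal (integral {a..b} (f n))" for n
    unfolding LINT_eq_integral(2)[OF af[of n], symmetric]
    by (rule nn_integral_eq_integral[OF LINT_eq_integral(1)[OF af[of n]]]) (use f(2) in \<open>auto intro!: AE_I2\<close>)
  have gi: "(\<integral>\<^sup>+t. ennreal (g t) \<partial>?M) = ennreal (integral {a..b} g)"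
    unfolding LINT_eq_integral(2)[OF ag, symmetric]
    by (rule nn_integral_eq_integral[OF LINT_eq_integral(1)[OF ag]]) (use g0 in \<open>auto intro!: AE_I2\<close>)
  have "(\<integral>\<^sup>+t. ennreal (g t) \<partial>?M) = (\<integral>\<^sup>+t. liminf (\<lambda>n. ennreal (f n t)) \<partial>?M)"
  proof (rule nn_integral_cong)
    fix t assume "t \<in> space ?M"
    then have "(\<lambda>n. ennreal (f n t)) \<longlonglongrightarrow> ennreal (g t)" using lim by (intro tendsto_ennrealI) auto
    then show "ennreal (g t) = liminf (\<lambda>n. ennreal (f n t))" by (rule lim_imp_Liminf[OF sequentially_bot, symmetric])
  qed
  also have "\<dots> \<le> liminf (\<lambda>n. \<integral>\<^sup>+t. ennreal (f n t) \<partial>?M)"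
    by (rule nn_integral_liminf) (use LINT_eq_integral(1)[OF af] in auto)
  finally have le: "ennreal (integral {a..b} g) \<le> liminf (\<lambda>n. ennreal (integral {a..b} (f n)))"
    unfolding fi gi .
  have fn0: "integral {a..b} (f n) \<ge> 0" for n
    by (rule Henstock_Kurzweil_Integration.integral_nonneg[OF integrable_continuous_interval[OF f(1)]]) (rule f(2))
  show ?thesis
  proof (cases "integral {a..b} g \<le> 0")
    case True
    have "integral {a..b} g \<le> integral {a..b} (f n) + e" for n using True fn0[of n] e by linarith
    then show ?thesis by simp
  next
    case False
    define y where "y = max 0 (integral {a..b} g - e)"
    have "ennreal y < ennreal (integral {a..b} g)" using False e by (subst ennreal_less_iff) (auto simp: y_def)
    then have "ennreal y < liminf (\<lambda>n. ennreal (integral {a..b} (f n)))" using le by (rule less_le_trans)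
    then have "\<forall>\<^sub>F n in sequentially. ennreal y < ennreal (integral {a..b} (f n))" by (rule less_LiminfD)
    then show ?thesis
    proof eventually_elim
      case (elim n)
      then have "y < integral {a..b} (f n)" by (subst (asm) ennreal_less_iff) (auto simp: y_def)
      then show ?case by (simp add: y_def)
    qed
  qed
qed

context connected_riemannian begin

section \<open>Compactness of curves of bounded speed\<close>

lemma tendsto_rd: "f \<longlonglongrightarrow> l \<longleftrightarrow> (\<forall>e>0. \<forall>\<^sub>F n in sequentially. rd (f n) l < e)"
  using M.limitin_metric[of f l sequentially] unfolding mtopology_euclidean by simp

text \<open>
  Local compactness in metric terms: finitely many coordinate balls cover \<open>K\<close>, and the factor \<open>2\<close> leaves
  room for a uniform radius.
\<close>

lemma compact_thicken:
  assumes K: "compact K"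
  obtains r K' where "r > 0" "compact K'" "\<And>x y. x \<in> K \<Longrightarrow> rd x y < r \<Longrightarrow> y \<in> K'"
proof -
  have "\<exists>r C. r > 0 \<and> compact C \<and> (\<forall>y. rd x y < 2 * r \<longrightarrow> y \<in> C)" for x
  proof -
    obtain c where c: "c \<in> A" "x \<in> fst c" by (rule chart_exists)
    have "open (X c)" "snd c x \<in> X c" using chart(2) c by auto
    then obtain \<rho> where \<rho>: "\<rho> > 0" "cball (snd c x) \<rho> \<subseteq> X c" unfolding open_contains_cball by blast
    define U where "U = fst c \<inter> snd c -` ball (snd c x) \<rho>"
    have "open U" "x \<in> U" unfolding U_def using c \<rho> by (auto intro!: continuous_open_preimage chart)
    then obtain r where r: "r > 0" "\<And>y. rd x y < r \<Longrightarrow> y \<in> U" by (rule rd_ball_subset) blast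
    have "compact (param c ` cball (snd c x) \<rho>)"
      by (intro compact_continuous_image compact_cball continuous_on_subset[OF chart(8)[OF c(1)]] \<rho>(2))
    moreover have "y \<in> param c ` cball (snd c x) \<rho>" if "y \<in> U" for y
      using that chart(4)[OF c(1), of y] by (auto simp: U_def intro!: image_eqI[of _ _ "snd c y"])
    ultimately show ?thesis using r by (intro exI[of _ "r / 2"] exI[of _ "param c ` cball (snd c x) \<rho>"]) auto
  qed
  then obtain r C where rC: "\<And>x. r x > 0" "\<And>x. compact (C x)" "\<And>x y. rd x y < 2 * r x \<Longrightarrow> y \<in> C x" by metis
  have ob: "open (M.mball x (r x))" for x
    using M.openin_mball[of x "r x"] unfolding mtopology_euclidean by (simp add: open_openin[symmetric])
  have cov: "K \<subseteq> (\<Union>x\<in>K. M.mball x (r x))" using rC(1) by auto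
  obtain F where F: "F \<subseteq> K" "finite F" "K \<subseteq> (\<Union>x\<in>F. M.mball x (r x))"
    using compactE_image[OF K ob cov] by blast
  show thesis
  proof (cases "F = {}")
    case True
    then show thesis using that[of 1 "{}"] F by auto
  next
    case False
    define r0 where "r0 = Min (r ` F)"
    show thesis
    proof (rule that[of r0 "\<Union>x\<in>F. C x"])
      show "r0 > 0" using F False rC(1) by (auto simp: r0_def)
      show "compact (\<Union>x\<in>F. C x)" using F rC(2) by (intro compact_UN) auto
      fix x y assume "x \<in> K" and y: "rd x y < r0"
      then obtain z where z: "z \<in> F" "rd z x < r z" using F by auto
      have "r0 \<le> r z" using F z by (auto simp: r0_def)
      then have "rd z y < 2 * r z" using M.triangle[of z x y] z y by auto
      then show "y \<in> (\<Union>x\<in>F. C x)" using rC(3) z by blast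
    qed
  qed
qed

text \<open>
  The only place where completeness turns bounds into compactness. The times at which the points lie in
  a common compact set form a set that contains \<open>0\<close>. It is open by \<open>compact_thicken\<close> and the Lipschitz
  bound. It is closed because at a limit time the points are within \<open>e / 3\<close> of a compact set, hence
  totally bounded, and in a complete space the closure of a totally bounded set is compact.
\<close>

lemma bounded_speed_compact:
  fixes qn :: "nat \<Rightarrow> real \<Rightarrow> 'm"
  assumes compl: "M.mcomplete" and T: "T > 0" and R: "R \<ge> 0"
    and lip: "\<And>n s t. s \<in> {0..T} \<Longrightarrow> t \<in> {0..T} \<Longrightarrow> rd (qn n s) (qn n t) \<le> R * \<bar>t - s\<bar>"
    and start: "\<And>n. qn n 0 = p" and t: "t \<in> {0..T}"
  shows "\<exists>K. compact K \<and> (\<forall>n. qn n t \<in> K)"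
proof -
  define S where "S = {t \<in> {0..T}. \<exists>K. compact K \<and> (\<forall>n. qn n t \<in> K)}"
  have "openin (top_of_set {0..T}) S"
    unfolding openin_euclidean_subtopology_iff
  proof (intro conjI ballI)
    show "S \<subseteq> {0..T}" by (auto simp: S_def)
    fix s assume "s \<in> S"
    then obtain K where K: "s \<in> {0..T}" "compact K" "\<And>n. qn n s \<in> K" by (auto simp: S_def)
    obtain r K' where r: "r > 0" "compact K'" "\<And>x y. x \<in> K \<Longrightarrow> rd x y < r \<Longrightarrow> y \<in> K'" using compact_thicken[OF K(2)] by metis
    define d where "d = r / (R + 1)"
    have d: "d > 0" "R * d < r" using r(1) R by (auto simp: d_def field_simps)
    have "u \<in> S" if u: "u \<in> {0..T}" "dist u s < d" for u
    proof -
      have "qn n u \<in> K'" for n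
      proof (rule r(3)[OF K(3)])
        have "rd (qn n s) (qn n u) \<le> R * \<bar>u - s\<bar>" by (rule lip[OF K(1) u(1)])
        also have "\<dots> \<le> R * d" using u R by (intro mult_left_mono) (auto simp: dist_real_def)
        finally show "rd (qn n s) (qn n u) < r" using d by simp
      qed
      then show ?thesis using r(2) u by (auto simp: S_def)
    qed
    then show "\<exists>e>0. \<forall>x'\<in>{0..T}. dist x' s < e \<longrightarrow> x' \<in> S" using d(1) by blast
  qed
  moreover have "closedin (top_of_set {0..T}) S"
    unfolding closedin_limpt
  proof (intro conjI allI impI)
    show "S \<subseteq> {0..T}" by (auto simp: S_def)
    fix s assume s: "s islimpt S \<and> s \<in> {0..T}"
    have "M.mtotally_bounded (range (\<lambda>n. qn n s))"
      unfolding M.mtotally_bounded_def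
    proof (intro allI impI)
      fix e :: real assume e: "e > 0"
      define d where "d = e / (3 * (R + 1))"
      have d: "d > 0" "R * d \<le> e / 3" using e R by (auto simp: d_def field_simps)
      obtain u where u: "u \<in> S" "dist u s < d" using s d(1) unfolding islimpt_approachable by blast
      then obtain K where K: "u \<in> {0..T}" "compact K" "\<And>n. qn n u \<in> K" by (auto simp: S_def)
      have "compactin M.mtopology K" unfolding mtopology_euclidean using K(2) by simp
      then have "M.mtotally_bounded K" by (rule M.compactin_imp_mtotally_bounded)
      then have "M.mtotally_bounded (range (\<lambda>n. qn n u))" by (rule M.mtotally_bounded_subset) (use K(3) in auto)
      then obtain F where F: "finite F" "F \<subseteq> range (\<lambda>n. qn n u)" "range (\<lambda>n. qn n u) \<subseteq> (\<Union>x\<in>F. M.mball x (e/3))"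
        using e unfolding M.mtotally_bounded_def by (metis zero_less_divide_iff zero_less_numeral)
      then obtain I where I: "finite I" "F = (\<lambda>n. qn n u) ` I" by (metis finite_subset_image subset_UNIV)
      have close: "rd (qn n u) (qn n s) \<le> e / 3" for n
      proof -
        have "rd (qn n u) (qn n s) \<le> R * \<bar>s - u\<bar>" using lip K(1) s by blast
        also have "\<dots> \<le> R * d" using u R by (intro mult_left_mono) (auto simp: dist_real_def)
        finally show ?thesis using d by simp
      qed
      show "\<exists>K. finite K \<and> K \<subseteq> range (\<lambda>n. qn n s) \<and> range (\<lambda>n. qn n s) \<subseteq> (\<Union>x\<in>K. M.mball x e)"
      proof (intro exI[of _ "(\<lambda>n. qn n s) ` I"] conjI subsetI)
        fix x assume "x \<in> range (\<lambda>n. qn n s)"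
        then obtain n where n: "x = qn n s" by auto
        have "qn n u \<in> (\<Union>x\<in>F. M.mball x (e/3))" using F(3) by blast
        then obtain i where i: "i \<in> I" "rd (qn i u) (qn n u) < e / 3" unfolding I(2) by auto
        have "rd (qn i s) (qn n s) \<le> rd (qn i s) (qn i u) + (rd (qn i u) (qn n u) + rd (qn n u) (qn n s))"
          using M.triangle[of "qn i s" "qn i u" "qn n s"] M.triangle[of "qn i u" "qn n u" "qn n s"] by simp
        also have "\<dots> < e" using close[of i] close[of n] i(2) M.commute[of "qn i s" "qn i u"] by simp
        finally show "x \<in> (\<Union>x\<in>(\<lambda>n. qn n s) ` I. M.mball x e)" using i(1) n by auto
      qed (use I in auto)
    qed
    then have "compactin M.mtopology (M.mtopology closure_of (range (\<lambda>n. qn n s)))"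
      using M.mtotally_bounded_eq_compact_closure_of[OF compl] by blast
    then have "compact (closure (range (\<lambda>n. qn n s)))" unfolding mtopology_euclidean by simp
    then show "s \<in> S" using s closure_subset[of "range (\<lambda>n. qn n s)"] by (auto simp: S_def)
  qed
  moreover have "0 \<in> S" using T start by (auto simp: S_def intro!: exI[of _ "{p}"])
  ultimately have "S = {0..T}"
    using connected_Icc[of 0 T] unfolding connected_clopen by blast
  then have "t \<in> S" using t by simp
  then show ?thesis unfolding S_def by blast
qed

text \<open>
  A diagonal sequence converges at all rational times. By the uniform Lipschitz bound it is then a Cauchy
  sequence at every time, and the limit inherits the Lipschitz bound.
\<close>

lemma bounded_speed_subsequence:
  fixes qn :: "nat \<Rightarrow> real \<Rightarrow> 'm"
  assumes compl: "M.mcomplete" and T: "T > 0" and R: "R \<ge> 0"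
    and lip: "\<And>n s t. s \<in> {0..T} \<Longrightarrow> t \<in> {0..T} \<Longrightarrow> rd (qn n s) (qn n t) \<le> R * \<bar>t - s\<bar>"
    and start: "\<And>n. qn n 0 = p"
  shows "\<exists>r q. strict_mono (r :: nat \<Rightarrow> nat) \<and> continuous_on {0..T} q \<and> (\<forall>t\<in>{0..T}. (\<lambda>n. qn (r n) t) \<longlonglongrightarrow> q t)"
proof -
  define D where "D = \<rat> \<inter> {0..T}"
  have "0 \<in> D" using T by (simp add: D_def)
  moreover have "countable D" unfolding D_def by (intro countable_Int1 countable_rat)
  ultimately have D: "countable D" "D \<noteq> {}" by auto
  define d where "d = from_nat_into D"
  have dD: "d i \<in> {0..T}" for i using from_nat_into[OF D(2), of i] by (auto simp: d_def D_def)
  define P where "P i s \<longleftrightarrow> (\<exists>l. (\<lambda>n. qn (s n) (d i)) \<longlonglongrightarrow> l)" for i and s :: "nat \<Rightarrow> nat"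
  interpret subseqs P
  proof
    fix i and s :: "nat \<Rightarrow> nat" assume "strict_mono s"
    have "\<exists>K. compact K \<and> (\<forall>n. qn n (d i) \<in> K)"
      by (rule bounded_speed_compact[where qn=qn and t="d i", OF compl T R _ start dD]) (rule lip)
    then obtain K where K: "compact K" "\<And>n. qn n (d i) \<in> K" by blast
    have "compactin M.mtopology K" unfolding mtopology_euclidean using K(1) by simp
    moreover have "range (\<lambda>n. qn (s n) (d i)) \<subseteq> K" using K(2) by auto
    ultimately obtain l r where "strict_mono r" "limitin M.mtopology ((\<lambda>n. qn (s n) (d i)) \<circ> r) l sequentially"
      unfolding M.compactin_sequentially by metis
    then show "\<exists>r'. strict_mono r' \<and> P i (s \<circ> r')"
      unfolding mtopology_euclidean P_def by (auto simp: o_def)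
  qed
  define r where "r = diagseq"
  have r: "strict_mono r" unfolding r_def by (rule subseq_diagseq)
  have conv: "\<exists>l. (\<lambda>n. qn (r n) (d i)) \<longlonglongrightarrow> l" for i
  proof -
    have "P i (diagseq \<circ> (+) (Suc i))"
    proof (rule diagseq_holds)
      fix s n and r' :: "nat \<Rightarrow> nat" assume "strict_mono r'" "P n s"
      then show "P n (s \<circ> r')" unfolding P_def using LIMSEQ_subseq_LIMSEQ by (fastforce simp: o_def)
    qed
    then obtain l where "(\<lambda>n. qn (r (Suc i + n)) (d i)) \<longlonglongrightarrow> l" unfolding P_def r_def by (auto simp: o_def)
    then have "(\<lambda>n. qn (r (n + Suc i)) (d i)) \<longlonglongrightarrow> l" by (simp add: add.commute)
    then show ?thesis using LIMSEQ_offset[of "\<lambda>n. qn (r n) (d i)" "Suc i"] by blast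
  qed
  have lim: "\<exists>l. (\<lambda>n. qn (r n) t) \<longlonglongrightarrow> l" if t: "t \<in> {0..T}" for t
  proof -
    have "M.MCauchy (\<lambda>n. qn (r n) t)"
      unfolding M.MCauchy_def
    proof (intro conjI allI impI)
      fix e :: real assume e: "e > 0"
      define \<delta> where "\<delta> = e / (4 * (R + 1))"
      have \<delta>: "\<delta> > 0" "R * \<delta> \<le> e / 4" using e R by (auto simp: \<delta>_def field_simps)
      obtain i where i: "\<bar>d i - t\<bar> < \<delta>"
      proof -
        have "max 0 (t - \<delta>) < min T (t + \<delta>)" using \<delta>(1) t T by auto
        then obtain u where u: "u \<in> \<rat>" "max 0 (t - \<delta>) < u" "u < min T (t + \<delta>)" using Rats_dense_in_real by blast
        then have "u \<in> D" by (auto simp: D_def)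
        then obtain i where "d i = u" using from_nat_into_surj[OF D(1)] unfolding d_def by blast
        then show thesis using u by (intro that[of i]) auto
      qed
      obtain l where l: "(\<lambda>n. qn (r n) (d i)) \<longlonglongrightarrow> l" using conv by blast
      have "\<forall>\<^sub>F n in sequentially. rd (qn (r n) (d i)) l < e / 4" using l e unfolding tendsto_rd by (simp del: less_divide_eq_numeral1)
      then obtain N where N: "\<And>n. n \<ge> N \<Longrightarrow> rd (qn (r n) (d i)) l < e / 4" unfolding eventually_sequentially by blast
      have close: "rd (qn n t) (qn n (d i)) \<le> e / 4" for n
      proof -
        have "rd (qn n t) (qn n (d i)) \<le> R * \<bar>d i - t\<bar>" using lip t dD by blast
        also have "\<dots> \<le> R * \<delta>" using i R by (intro mult_left_mono) auto
        finally show ?thesis using \<delta> by simp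
      qed
      show "\<exists>N. \<forall>n n'. N \<le> n \<longrightarrow> N \<le> n' \<longrightarrow> rd (qn (r n) t) (qn (r n') t) < e"
      proof (intro exI[of _ N] allI impI)
        fix n n' assume n: "N \<le> n" "N \<le> n'"
        let ?x = "\<lambda>n. qn (r n) t" and ?y = "\<lambda>n. qn (r n) (d i)"
        have "rd (?x n) (?x n') \<le> rd (?x n) (?y n) + (rd (?y n) l + (rd l (?y n') + rd (?y n') (?x n')))"
          using M.triangle[of "?x n" "?y n" "?x n'"] M.triangle[of "?y n" l "?x n'"] M.triangle[of l "?y n'" "?x n'"] by simp
        also have "\<dots> < e / 4 + (e / 4 + (e / 4 + e / 4))"
          using close[of "r n"] close[of "r n'"] N[OF n(1)] N[OF n(2)] M.commute[of l "?y n'"] M.commute[of "?y n'" "?x n'"]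
          by linarith
        finally show "rd (?x n) (?x n') < e" by simp
      qed
    qed simp
    then obtain l where "limitin M.mtopology (\<lambda>n. qn (r n) t) l sequentially" using compl unfolding M.mcomplete_def by blast
    then show ?thesis unfolding mtopology_euclidean by auto
  qed
  then obtain q where q: "\<And>t. t \<in> {0..T} \<Longrightarrow> (\<lambda>n. qn (r n) t) \<longlonglongrightarrow> q t" by metis
  have qlip: "rd (q s) (q t) \<le> R * \<bar>t - s\<bar>" if st: "s \<in> {0..T}" "t \<in> {0..T}" for s t
  proof (rule field_le_epsilon)
    fix e :: real assume e: "e > 0"
    have "\<forall>\<^sub>F n in sequentially. rd (qn (r n) s) (q s) < e/2" "\<forall>\<^sub>F n in sequentially. rd (qn (r n) t) (q t) < e/2"
      using q[OF st(1)] q[OF st(2)] e unfolding tendsto_rd by (simp_all del: less_divide_eq_numeral1)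
    then have "\<forall>\<^sub>F n in sequentially. rd (q s) (q t) \<le> R * \<bar>t - s\<bar> + e"
    proof eventually_elim
      case (elim n)
      then show ?case
        using M.triangle[of "q s" "qn (r n) s" "q t"] M.triangle[of "qn (r n) s" "qn (r n) t" "q t"]
          lip[OF st, of "r n"] M.commute[of "q s" "qn (r n) s"] by simp
    qed
    then show "rd (q s) (q t) \<le> R * \<bar>t - s\<bar> + e" by simp
  qed
  have "continuous_on {0..T} q"
    unfolding continuous_on_def
  proof (intro ballI topological_tendstoI)
    fix t W assume t: "t \<in> {0..T}" and W: "open W" "q t \<in> W"
    obtain \<rho> where \<rho>: "\<rho> > 0" "\<And>y. rd (q t) y < \<rho> \<Longrightarrow> y \<in> W" using rd_ball_subset[OF W] by metis
    define \<delta> where "\<delta> = \<rho> / (R + 1)"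
    have \<delta>: "\<delta> > 0" "R * \<delta> < \<rho>" using \<rho>(1) R by (auto simp: \<delta>_def field_simps)
    have "q s \<in> W" if s: "s \<in> {0..T}" "dist s t < \<delta>" for s
    proof (rule \<rho>(2))
      have "rd (q t) (q s) \<le> R * \<bar>s - t\<bar>" by (rule qlip[OF t s(1)])
      also have "\<dots> \<le> R * \<delta>" using s R by (intro mult_left_mono) (auto simp: dist_real_def)
      finally show "rd (q t) (q s) < \<rho>" using \<delta> by simp
    qed
    then show "\<forall>\<^sub>F s in at t within {0..T}. q s \<in> W" unfolding eventually_at using \<delta>(1) by blast
  qed
  then show ?thesis using r q by blast
qed

text \<open>
  While the limit curve stays in a chart domain, the approximating curves eventually stay in a common
  compact subset of it. Near each time this follows from pointwise convergence at that time and the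
  Lipschitz bound; bisection makes it uniform.
\<close>

lemma limit_in_chart:
  fixes pn :: "nat \<Rightarrow> real \<Rightarrow> 'm"
  assumes R: "R \<ge> 0"
    and lip: "\<And>n s t. s \<in> {0..T} \<Longrightarrow> t \<in> {0..T} \<Longrightarrow> rd (pn n s) (pn n t) \<le> R * \<bar>t - s\<bar>"
    and lim: "\<And>t. t \<in> {0..T} \<Longrightarrow> (\<lambda>n. pn n t) \<longlonglongrightarrow> q t"
    and c: "c \<in> A" and ab: "0 \<le> a" "a \<le> b" "b \<le> T" "q ` {a..b} \<subseteq> fst c"
  shows "\<exists>K N. compact K \<and> K \<subseteq> X c \<and> (\<forall>n\<ge>N. \<forall>t\<in>{a..b}. pn n t \<in> fst c \<and> snd c (pn n t) \<in> K)"
proof -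
  define Pr where "Pr s t \<longleftrightarrow> (\<exists>K N. compact K \<and> K \<subseteq> X c \<and> (\<forall>n\<ge>N. \<forall>u\<in>{s..t}. pn n u \<in> fst c \<and> snd c (pn n u) \<in> K))" for s t
  have "a \<le> a \<and> b \<le> b \<longrightarrow> Pr a b"
  proof (rule Bolzano[where P="\<lambda>s t. a \<le> s \<and> t \<le> b \<longrightarrow> Pr s t", OF ab(2)])
    fix u v w assume 1: "a \<le> u \<and> v \<le> b \<longrightarrow> Pr u v" "a \<le> v \<and> w \<le> b \<longrightarrow> Pr v w" "u \<le> v" "v \<le> w"
    show "a \<le> u \<and> w \<le> b \<longrightarrow> Pr u w"
    proof
      assume "a \<le> u \<and> w \<le> b"
      then have "Pr u v" "Pr v w" using 1 by auto
      then obtain K N K' N' where K: "compact K" "K \<subseteq> X c" "\<And>n t. n \<ge> N \<Longrightarrow> t \<in> {u..v} \<Longrightarrow> pn n t \<in> fst c \<and> snd c (pn n t) \<in> K"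
        and K': "compact K'" "K' \<subseteq> X c" "\<And>n t. n \<ge> N' \<Longrightarrow> t \<in> {v..w} \<Longrightarrow> pn n t \<in> fst c \<and> snd c (pn n t) \<in> K'"
        unfolding Pr_def by metis
      have "pn n t \<in> fst c \<and> snd c (pn n t) \<in> K \<union> K'" if "n \<ge> max N N'" "t \<in> {u..w}" for n t
        using K(3)[of n t] K'(3)[of n t] that by (cases "t \<le> v") auto
      then show "Pr u w" unfolding Pr_def using K K'
        by (intro exI[of _ "K \<union> K'"] exI[of _ "max N N'"]) (auto intro: compact_Un)
    qed
  next
    fix x assume x: "a \<le> x" "x \<le> b"
    have qx: "q x \<in> fst c" using x ab by auto
    have "open (X c)" "snd c (q x) \<in> X c" using chart(2) c qx by auto
    then obtain \<rho> where \<rho>: "\<rho> > 0" "cball (snd c (q x)) \<rho> \<subseteq> X c" unfolding open_contains_cball by blast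
    define U where "U = fst c \<inter> snd c -` ball (snd c (q x)) \<rho>"
    have "open U" "q x \<in> U" unfolding U_def using c qx \<rho> by (auto intro!: continuous_open_preimage chart)
    then obtain r where r: "r > 0" "\<And>y. rd (q x) y < r \<Longrightarrow> y \<in> U" by (rule rd_ball_subset) blast
    define d where "d = r / (2 * (R + 1))"
    have d: "d > 0" "R * d \<le> r / 2" using r(1) R by (auto simp: d_def field_simps)
    have x0T: "x \<in> {0..T}" using x ab by auto
    obtain N where N: "\<And>n. n \<ge> N \<Longrightarrow> rd (pn n x) (q x) < r / 2"
      using lim[OF x0T] r(1) unfolding tendsto_rd eventually_sequentially by (metis half_gt_zero)
    have "Pr s t" if st: "s \<le> x" "x \<le> t" "t - s < d" "a \<le> s" "t \<le> b" for s t
      unfolding Pr_def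
    proof (intro exI[of _ "cball (snd c (q x)) \<rho>"] exI[of _ N] conjI allI impI ballI compact_cball \<rho>(2))
      fix n u assume n: "n \<ge> N" and u: "u \<in> {s..t}"
      have "rd (pn n x) (pn n u) \<le> R * \<bar>u - x\<bar>" using lip[OF x0T, of u n] u st ab by auto
      also have "\<dots> \<le> R * d" using u st R by (intro mult_left_mono) auto
      finally have "rd (q x) (pn n u) < r"
        using M.triangle[of "q x" "pn n x" "pn n u"] N[OF n] d(2) M.commute[of "q x" "pn n x"] by simp
      then have "pn n u \<in> U" by (rule r(2))
      then show "pn n u \<in> fst c" "snd c (pn n u) \<in> cball (snd c (q x)) \<rho>" by (auto simp: U_def)
    qed
    then show "\<exists>d>0. \<forall>s t. s \<le> x \<and> x \<le> t \<and> t - s < d \<longrightarrow> a \<le> s \<and> t \<le> b \<longrightarrow> Pr s t" using d(1) by blast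
  qed
  then show ?thesis unfolding Pr_def by simp
qed

section \<open>The minimizer\<close>

lemma smooth_function_continuous:
  assumes "smooth_function UNIV A V" shows "continuous_on UNIV V"
  unfolding continuous_on_eq_continuous_at[OF open_UNIV]
proof
  fix p
  obtain c where c: "c \<in> A" "p \<in> fst c" by (rule chart_exists)
  have "continuous_on (X c) (V \<circ> param c)" using assms c smooth_on_continuous unfolding smooth_function_def by blast
  then have "continuous_on (fst c) (\<lambda>p. (V \<circ> param c) (snd c p))"
    by (rule continuous_on_compose2[OF _ chart(7)[OF c(1)]]) auto
  then have "continuous_on (fst c) V" by (rule continuous_on_eq) (simp add: chart(4)[OF c(1)])
  then show "isCont V p" using chart(1)[OF c(1)] c(2) continuous_on_eq_continuous_at by blast
qed

lemma action_eq:
  assumes q: "q \<in> H2_curves A T" and T: "T > 0" and V: "continuous_on UNIV V"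
  shows "action A g V T q = (integral {0..T} (acc T q) + integral {0..T} (\<lambda>t. V (q t))) / 2"
    and "continuous_on {0..T} (\<lambda>t. V (q t))"
proof -
  show cV: "continuous_on {0..T} (\<lambda>t. V (q t))"
    by (rule continuous_on_compose2[OF V H2_curvesD(1)[OF q]]) auto
  have a: "acc T q absolutely_integrable_on {0..T}" using acc_integrable[OF q T] T by simp
  have b: "(\<lambda>t. V (q t)) absolutely_integrable_on {0..T}" by (rule absolutely_integrable_continuous_real[OF cV])
  have "(LINT t|lebesgue_on {0..T}. acc T q t + V (q t)) = integral {0..T} (acc T q) + integral {0..T} (\<lambda>t. V (q t))"
    using LINT_eq_integral[OF a] LINT_eq_integral[OF b] by simp
  then show "action A g V T q = (integral {0..T} (acc T q) + integral {0..T} (\<lambda>t. V (q t))) / 2"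
    by (simp add: action_def acc_def)
qed

lemma not_eventually_subsequence:
  assumes "\<not> (\<forall>\<^sub>F n in sequentially. P n)"
  shows "\<exists>r. strict_mono (r :: nat \<Rightarrow> nat) \<and> (\<forall>n. \<not> P (r n))"
proof -
  have inf: "infinite {n. \<not> P n}"
    using assms unfolding cofinite_eq_sequentially[symmetric] eventually_cofinite .
  show ?thesis
    using strict_mono_enumerate[OF inf] enumerate_in_set[OF inf] by (intro exI[of _ "enumerate {n. \<not> P n}"]) auto
qed

text \<open>
  The direct method in positive dimension. Convergence of the velocities and lower semicontinuity are
  obtained from the chart-wise result, applied to suitable subsequences: to the whole sequence for the
  regularity of \<open>q\<close>, and to a subsequence that violates the desired inequality for lower
  semicontinuity.
\<close>

lemma minimizer_exists:
  assumes compl: "M.mcomplete" and T: "T > 0" and \<xi>: "\<xi> \<in> tangent_bundle UNIV A" and \<eta>: "\<eta> \<in> tangent_bundle UNIV A"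
    and V: "smooth_function UNIV A V" "\<And>x. V x \<ge> 0"
  shows "\<exists>q \<in> admissible_curves A T \<xi> \<eta>. \<forall>q' \<in> admissible_curves A T \<xi> \<eta>. action A g V T q \<le> action A g V T q'"
proof -
  let ?\<Omega> = "admissible_curves A T \<xi> \<eta>"
  note cV = smooth_function_continuous[OF V(1)]
  have ne: "?\<Omega> \<noteq> {}" by (rule admissible_nonempty[OF T \<xi> \<eta>])
  have \<Omega>: "q \<in> H2_curves A T" "q 0 = fst \<xi>" "q T = fst \<eta>" "velocity A {0..T} q 0 = snd \<xi>" "velocity A {0..T} q T = snd \<eta>"
    if "q \<in> ?\<Omega>" for q using that by (auto simp: admissible_curves_def)
  have int0: "integral {0..T} (acc T q) \<ge> 0" if "q \<in> ?\<Omega>" for q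
    using acc_integrable[OF \<Omega>(1)[OF that] T, of 0 T] T
    by (intro Henstock_Kurzweil_Integration.integral_nonneg) (auto simp: acc_def absolutely_integrable_on_def)
  have V0: "integral {0..T} (\<lambda>t. V (q t)) \<ge> 0" if "q \<in> ?\<Omega>" for q
    using action_eq(2)[OF \<Omega>(1)[OF that] T cV] V(2)
    by (intro Henstock_Kurzweil_Integration.integral_nonneg integrable_continuous_interval) auto
  have act0: "action A g V T q \<ge> 0" if "q \<in> ?\<Omega>" for q
    unfolding action_eq(1)[OF \<Omega>(1)[OF that] T cV] using int0[OF that] V0[OF that] by simp
  define m where "m = Inf (action A g V T ` ?\<Omega>)"
  have bdd: "bdd_below (action A g V T ` ?\<Omega>)" by (rule bdd_belowI[of _ 0]) (use act0 in auto)
  have m_le: "m \<le> action A g V T q" if "q \<in> ?\<Omega>" for q unfolding m_def by (intro cInf_lower imageI that bdd)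
  have "\<exists>q\<in>?\<Omega>. action A g V T q < m + 1 / (real n + 1)" for n
  proof -
    have "Inf (action A g V T ` ?\<Omega>) < m + 1 / (real n + 1)" by (simp add: m_def)
    then show ?thesis using cInf_lessD[of "action A g V T ` ?\<Omega>"] ne by blast
  qed
  then obtain qn where qn: "\<And>n. qn n \<in> ?\<Omega>" "\<And>n. action A g V T (qn n) < m + 1 / (real n + 1)" by metis
  note qH = \<Omega>(1)[OF qn(1)]
  \<comment> \<open>The members of the minimizing sequence have action at most \<open>m + 1\<close>, which contains half of the
    acceleration integral.\<close>
  define B where "B = 2 * (m + 1)"
  have accB: "integral {0..T} (acc T (qn n)) \<le> B" for n
  proof -
    have "1 / (real n + 1) \<le> 1" by simp
    then have "action A g V T (qn n) \<le> m + 1" using qn(2)[of n] by linarith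
    then show ?thesis using V0[OF qn(1), of n] unfolding action_eq(1)[OF qH T cV] B_def by simp
  qed
  define k0 where "k0 = g (fst \<xi>) (snd \<xi>) (snd \<xi>)"
  have kin0: "kin T (qn n) 0 = k0" for n unfolding kin_def k0_def using \<Omega>[OF qn(1)] by simp
  have kb: "kin T (qn n) t \<le> 2 * k0 + 4 * T * B" if "0 \<le> t" "t \<le> T" for n t
  proof -
    have "kin T (qn n) t \<le> 2 * k0 + 4 * T * integral {0..T} (acc T (qn n))" using kin_bound[OF qH T that] kin0 by simp
    also have "\<dots> \<le> 2 * k0 + 4 * T * B" using accB T by (intro add_left_mono mult_left_mono) auto
    finally show ?thesis .
  qed
  define R where "R = sqrt (2 * k0 + 4 * T * B)"
  have "0 \<le> 2 * k0 + 4 * T * B" using kb[of 0 0] kin_nonneg[OF qH T, of 0 0] T by simp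
  then have R: "R \<ge> 0" "R\<^sup>2 = 2 * k0 + 4 * T * B" by (auto simp: R_def)
  have kR: "kin T (qn n) t \<le> R\<^sup>2" if "0 \<le> t" "t \<le> T" for n t using kb[OF that] R(2) by simp
  have lip: "rd (qn n s) (qn n t) \<le> R * \<bar>t - s\<bar>" if "s \<in> {0..T}" "t \<in> {0..T}" for n s t
    by (rule rd_lipschitz[OF qH T _ _ _ _ R(1)]) (use that kR in simp_all)
  have "\<exists>r q. strict_mono (r :: nat \<Rightarrow> nat) \<and> continuous_on {0..T} q \<and> (\<forall>t\<in>{0..T}. (\<lambda>n. qn (r n) t) \<longlonglongrightarrow> q t)"
    by (rule bounded_speed_subsequence[where qn=qn, OF compl T R(1) _ \<Omega>(2)[OF qn(1)]]) (rule lip)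
  then obtain r q where r: "strict_mono (r :: nat \<Rightarrow> nat)" and cq: "continuous_on {0..T} q"
    and lim: "\<And>t. t \<in> {0..T} \<Longrightarrow> (\<lambda>n. qn (r n) t) \<longlonglongrightarrow> q t"
    by blast
  define pn where "pn n = qn (r n)" for n
  have pn: "pn n \<in> ?\<Omega>" for n using qn by (simp add: pn_def)
  \<comment> \<open>The chart-wise limit theorem, applied to any subsequence of \<open>pn\<close>.\<close>
  have chart_lim: "\<exists>v h s. H2_rep a b (snd c \<circ> q) v h \<and> strict_mono s \<and>
      (\<forall>t\<in>{a..b}. (\<lambda>n. velocity A {0..T} (pn (s n)) t c) \<longlonglongrightarrow> v t) \<and>
      (\<forall>e>0. \<exists>n. integral {a..b} (\<lambda>t. gm c (snd c (q t)) (acc_coords c (snd c \<circ> q) v h t) (acc_coords c (snd c \<circ> q) v h t))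
         < integral {a..b} (acc T (pn (k n))) + e)"
    if c: "c \<in> A" and ab: "0 \<le> a" "a < b" "b \<le> T" "q ` {a..b} \<subseteq> fst c" and k: "strict_mono k" for c a b and k :: "nat \<Rightarrow> nat"
  proof -
    have lp: "rd (pn (k n) s) (pn (k n) t) \<le> R * \<bar>t - s\<bar>" if "s \<in> {0..T}" "t \<in> {0..T}" for n s t using lip that by (simp add: pn_def)
    have lm: "(\<lambda>n. pn (k n) t) \<longlonglongrightarrow> q t" if "t \<in> {0..T}" for t
      using LIMSEQ_subseq_LIMSEQ[OF lim[OF that] k] by (simp add: pn_def o_def)
    have "\<exists>K N. compact K \<and> K \<subseteq> X c \<and> (\<forall>n\<ge>N. \<forall>t\<in>{a..b}. pn (k n) t \<in> fst c \<and> snd c (pn (k n) t) \<in> K)"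
      by (rule limit_in_chart[OF R(1) _ _ c ab(1) less_imp_le[OF ab(2)] ab(3,4)]) (rule lp lm, assumption+)+
    then obtain K N where K: "compact K" "K \<subseteq> X c" "\<And>n t. n \<ge> N \<Longrightarrow> t \<in> {a..b} \<Longrightarrow> pn (k n) t \<in> fst c \<and> snd c (pn (k n) t) \<in> K"
      by blast
    define u where "u n = pn (k (n + N))" for n
    have L: "(\<lambda>n. snd c (u n t)) \<longlonglongrightarrow> (snd c \<circ> q) t" if t: "t \<in> {a..b}" for t
    proof -
      have "(\<lambda>n. u n t) \<longlonglongrightarrow> q t" unfolding u_def using LIMSEQ_ignore_initial_segment[OF lm] t ab by auto
      moreover have "isCont (snd c) (q t)"
        using chart(1,7)[OF c] ab(4) t continuous_on_eq_continuous_at by blast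
      ultimately show ?thesis unfolding o_def by (rule isCont_tendsto_compose[rotated])
    qed
    have ik: "u n t \<in> fst c \<and> snd c (u n t) \<in> K" if "t \<in> {a..b}" for n t unfolding u_def using K(3) that by simp
    have uH: "u n \<in> H2_curves A T" for n unfolding u_def using \<Omega>(1)[OF pn] .
    have uk: "kin T (u n) t \<le> R\<^sup>2" if "t \<in> {a..b}" for n t unfolding u_def pn_def using kR that ab by auto
    have ua: "integral {a..b} (acc T (u n)) \<le> B" for n
    proof -
      have "integral {a..b} (acc T (u n)) \<le> integral {0..T} (acc T (u n))"
        using acc_integrable[OF uH T, of 0 T] acc_integrable[OF uH T, of a b] ab T
        by (intro integral_subset_le) (auto simp: acc_def absolutely_integrable_on_def)
      then show ?thesis using accB[of "r (k (n + N))"] by (simp add: u_def pn_def)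
    qed
    obtain v h s where vh: "H2_rep a b (snd c \<circ> q) v h" "strict_mono s"
      "\<And>t. t \<in> {a..b} \<Longrightarrow> (\<lambda>n. velocity A {0..T} (u (s n)) t c) \<longlonglongrightarrow> v t"
      "\<And>e. e > 0 \<Longrightarrow> \<exists>n. integral {a..b} (\<lambda>t. gm c ((snd c \<circ> q) t) (acc_coords c (snd c \<circ> q) v h t) (acc_coords c (snd c \<circ> q) v h t))
          < integral {a..b} (acc T (u n)) + e"
      by (rule chart_limit[OF T uH c ab(1-3) K(1,2) ik L uk ua]) blast+
    have "strict_mono (\<lambda>n. k (s n + N))" using vh(2) k unfolding strict_mono_def by simp
    then show ?thesis using vh(1,3,4) unfolding u_def
      by (intro exI[of _ v] exI[of _ h] exI[of _ "\<lambda>n. k (s n + N)"]) auto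
  qed
  have qH2: "q \<in> H2_curves A T"
    unfolding H2_curves_def
  proof (intro CollectI conjI ballI allI impI cq)
    fix c a b assume c: "c \<in> A" and ab: "0 \<le> a \<and> a < b \<and> b \<le> T \<and> q ` {a..b} \<subseteq> fst c"
    then obtain v h where "H2_rep a b (snd c \<circ> q) v h" using chart_lim[OF c, of a b id] by (auto simp: strict_mono_def)
    then show "H2_on a b (snd c \<circ> q)" by (rule H2_rep_imp_H2_on) (use ab in simp)
  qed
  \<comment> \<open>A velocity that is shared by all approximating curves at a point they share with the limit passes to
    the limit, by convergence of the velocities in a chart. This gives the boundary conditions.\<close>
  have vel_lim: "velocity A {0..T} q t = w" if t: "t \<in> {0..T}" and w: "\<And>n. velocity A {0..T} (pn n) t = w" and qt: "\<And>n. pn n t = q t" for t w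
  proof
    fix c
    show "velocity A {0..T} q t c = w c"
    proof (cases "c \<in> charts_at A (q t)")
      case True
      then have c: "c \<in> A" "q t \<in> fst c" by (auto simp: charts_at_def)
      have t0T: "0 \<le> t" "t \<le> T" using t by auto
      obtain a b where n: "0 \<le> a" "a < b" "b \<le> T" "a \<le> t" "t \<le> b" "q ` {a..b} \<subseteq> fst c"
        "at t within {0..T} = at t within {a..b}"
        using chart_neighbourhood[OF cq t0T T c] by metis
      obtain v h s where vh: "H2_rep a b (snd c \<circ> q) v h"
        "\<forall>t\<in>{a..b}. (\<lambda>n. velocity A {0..T} (pn (s n)) t c) \<longlonglongrightarrow> v t"
        using chart_lim[OF c(1) n(1-3,6), of id] by (auto simp: strict_mono_def)
      have "(\<lambda>n. velocity A {0..T} (pn (s n)) t c) \<longlonglongrightarrow> v t" using vh(2) n(4,5) by simp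
      then have vt: "v t = w c" unfolding w by (simp add: LIMSEQ_const_iff)
      have "((snd c \<circ> q) has_vector_derivative v t) (at t within {0..T})"
        using H2_rep_has_vector_derivative[OF vh(1) n(4,5)] n(7) by simp
      then have "velocity A {0..T} q t c = v t"
        by (rule velocity_unique[where c=c and q=q and t=t and T=T, OF _ t0T T c])
      then show ?thesis using vt by simp
    next
      case False
      then have "velocity A {0..T} (pn 0) t c = 0" "velocity A {0..T} q t c = 0" by (simp_all add: velocity_def qt)
      then show ?thesis unfolding w by simp
    qed
  qed
  have q0: "q 0 = fst \<xi>" "q T = fst \<eta>"
  proof -
    have "(\<lambda>n. fst \<xi>) \<longlonglongrightarrow> q 0" using lim[of 0] \<Omega>(2)[OF qn(1)] T by simp
    then show "q 0 = fst \<xi>" using LIMSEQ_unique[OF tendsto_const] by metis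
    have "(\<lambda>n. fst \<eta>) \<longlonglongrightarrow> q T" using lim[of T] \<Omega>(3)[OF qn(1)] T by simp
    then show "q T = fst \<eta>" using LIMSEQ_unique[OF tendsto_const] by metis
  qed
  have "velocity A {0..T} q 0 = snd \<xi>" by (rule vel_lim) (use \<Omega>[OF pn] q0 T in auto)
  moreover have "velocity A {0..T} q T = snd \<eta>" by (rule vel_lim) (use \<Omega>[OF pn] q0 T in auto)
  ultimately have q\<Omega>: "q \<in> ?\<Omega>" using qH2 q0 by (simp add: admissible_curves_def)
  \<comment> \<open>Lower semicontinuity in a form that is stable under concatenation of intervals.\<close>
  have acc_lsc: "\<forall>e>0. \<forall>\<^sub>F n in sequentially. integral {a..b} (acc T q) \<le> integral {a..b} (acc T (pn n)) + e"
    if ab: "0 \<le> a" "a \<le> b" "b \<le> T" for a b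
    using cq ab
  proof (induction a b rule: chart_induction)
    case (trans s t u)
    show ?case
    proof (intro allI impI)
      fix e :: real assume "e > 0"
      then have "\<forall>\<^sub>F n in sequentially. integral {s..t} (acc T q) \<le> integral {s..t} (acc T (pn n)) + e / 2"
        "\<forall>\<^sub>F n in sequentially. integral {t..u} (acc T q) \<le> integral {t..u} (acc T (pn n)) + e / 2"
        using trans(5,6) by simp_all
      then show "\<forall>\<^sub>F n in sequentially. integral {s..u} (acc T q) \<le> integral {s..u} (acc T (pn n)) + e"
      proof eventually_elim
        case (elim n)
        have comb: "integral {s..t} (acc T p) + integral {t..u} (acc T p) = integral {s..u} (acc T p)" if "p \<in> H2_curves A T" for p
          using acc_integrable[OF that T, of s u] trans(1-4) ab
          by (intro Henstock_Kurzweil_Integration.integral_combine) (auto simp: absolutely_integrable_on_def)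
        show ?case using elim comb[OF qH2] comb[OF \<Omega>(1)[OF pn[of n]]] by linarith
      qed
    qed
  next
    case (triv s)
    then show ?case by simp
  next
    case (chart c s t)
    with ab have pc: "c \<in> A" "0 \<le> s" "s < t" "t \<le> T" "q ` {s..t} \<subseteq> fst c" by auto
    show ?case
    proof (intro allI impI)
      fix e :: real assume e: "e > 0"
      show "\<forall>\<^sub>F n in sequentially. integral {s..t} (acc T q) \<le> integral {s..t} (acc T (pn n)) + e"
      proof (rule ccontr)
        assume "\<not> (\<forall>\<^sub>F n in sequentially. integral {s..t} (acc T q) \<le> integral {s..t} (acc T (pn n)) + e)"
        from not_eventually_subsequence[OF this] obtain k :: "nat \<Rightarrow> nat"
          where k: "strict_mono k" "\<And>n. \<not> integral {s..t} (acc T q) \<le> integral {s..t} (acc T (pn (k n))) + e"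
          by blast
        from chart_lim[OF pc k(1)] obtain v h s' where vh: "H2_rep s t (snd c \<circ> q) v h" "strict_mono s'"
          "\<forall>u\<in>{s..t}. (\<lambda>n. velocity A {0..T} (pn (s' n)) u c) \<longlonglongrightarrow> v u"
          "\<forall>e>0. \<exists>n. integral {s..t} (\<lambda>t. gm c (snd c (q t)) (acc_coords c (snd c \<circ> q) v h t) (acc_coords c (snd c \<circ> q) v h t))
             < integral {s..t} (acc T (pn (k n))) + e"
          by (elim exE conjE) (rule that)
        have vv: "v u = velocity A {0..T} q u c" if u: "s \<le> u" "u \<le> t" for u
        proof (rule vector_derivative_unique_within_closed_interval[OF pc(3), of u "snd c \<circ> q"])
          show "((snd c \<circ> q) has_vector_derivative v u) (at u within cbox s t)"
            using H2_rep_has_vector_derivative[OF vh(1) u] by simp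
          have "((snd c \<circ> q) has_vector_derivative velocity A {0..T} q u c) (at u within {0..T})"
            using u pc by (intro velocity_derivative[OF qH2 T]) auto
          then show "((snd c \<circ> q) has_vector_derivative velocity A {0..T} q u c) (at u within cbox s t)"
            by (rule has_vector_derivative_within_subset) (use pc in auto)
        qed (use u in auto)
        have rep: "H2_rep s t (snd c \<circ> q) (\<lambda>u. velocity A {0..T} q u c) h"
          using vh(1) vv unfolding H2_rep_def by (auto intro: AC_rep_cong)
        obtain Z where Z: "negligible Z" "\<And>u. u \<in> {s..t} - Z \<Longrightarrow> acc T q u = gm c (snd c (q u))
            (acc_coords c (snd c \<circ> q) (\<lambda>u. velocity A {0..T} q u c) h u) (acc_coords c (snd c \<circ> q) (\<lambda>u. velocity A {0..T} q u c) h u)"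
          using acc_coords[OF qH2 T pc rep] by metis
        have eq: "integral {s..t} (acc T q) = integral {s..t} (\<lambda>t. gm c (snd c (q t)) (acc_coords c (snd c \<circ> q) v h t) (acc_coords c (snd c \<circ> q) v h t))"
          by (rule integral_spike[OF Z(1)]) (use Z(2) vv in \<open>auto simp: acc_coords_def\<close>)
        obtain n where "integral {s..t} (acc T q) < integral {s..t} (acc T (pn (k n))) + e" using vh(4) e unfolding eq by blast
        then show False using k(2)[of n] by simp
      qed
    qed
  qed
  have V_lsc: "\<forall>\<^sub>F n in sequentially. integral {0..T} (\<lambda>t. V (q t)) \<le> integral {0..T} (\<lambda>t. V (pn n t)) + e" if "e > 0" for e
  proof (rule Fatou_continuous[OF action_eq(2)[OF \<Omega>(1)[OF pn] T cV] V(2) action_eq(2)[OF qH2 T cV] _ that])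
    fix t assume t: "t \<in> {0..T}"
    have "isCont V (q t)" using cV by (simp add: continuous_on_eq_continuous_at)
    then show "(\<lambda>n. V (pn n t)) \<longlonglongrightarrow> V (q t)" using isCont_tendsto_compose lim[OF t] unfolding pn_def by blast
  qed
  have "action A g V T q \<le> m"
  proof (rule field_le_epsilon)
    fix e :: real assume e: "e > 0"
    have "(\<lambda>n. 1 / (real n + 1)) \<longlonglongrightarrow> 0" by real_asymp
    then have "\<forall>\<^sub>F n in sequentially. 1 / (real n + 1) < e / 2" using e by (intro order_tendstoD) auto
    moreover have "\<forall>\<^sub>F n in sequentially. integral {0..T} (acc T q) \<le> integral {0..T} (acc T (pn n)) + e / 2"
      using acc_lsc[of 0 T] T e by simp
    moreover have "\<forall>\<^sub>F n in sequentially. integral {0..T} (\<lambda>t. V (q t)) \<le> integral {0..T} (\<lambda>t. V (pn n t)) + e / 2"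
      using V_lsc e by simp
    ultimately have "\<forall>\<^sub>F n in sequentially. action A g V T q \<le> m + e"
    proof eventually_elim
      case (elim n)
      have "n \<le> r n" by (rule seq_suble[OF r])
      then have "1 / (real (r n) + 1) \<le> 1 / (real n + 1)" by (intro divide_left_mono) auto
      then have "action A g V T (pn n) \<le> m + e / 2" using qn(2)[of "r n"] elim(1) by (simp add: pn_def)
      then show ?case
        using elim(2,3) unfolding action_eq(1)[OF qH2 T cV] action_eq(1)[OF \<Omega>(1)[OF pn] T cV] by (simp add: field_simps)
    qed
    then show "action A g V T q \<le> m + e" by simp
  qed
  then show ?thesis using q\<Omega> m_le by (intro bexI[of _ q] ballI) (auto intro: order_trans)
qed

end

section \<open>Dimension zero\<close>

text \<open>A chart with values in \<open>{0}\<close> has a domain consisting of one point, which is therefore open and closed.\<close>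

lemma zero_dimensional_point:
  fixes A :: "('m::{t2_space, second_countable_topology}, 'n::finite) chart set"
  assumes st: "smooth_structure {0} A" and conn: "connected (UNIV :: 'm set)"
  shows "x = (y :: 'm)"
proof -
  have "x \<in> (\<Union>c\<in>A. fst c)" using st unfolding smooth_structure_def by blast
  then obtain c where c: "c \<in> A" "x \<in> fst c" by blast
  have "is_chart {0} c" using st c unfolding smooth_structure_def by blast
  then have o: "open (fst c)" and i: "openin (top_of_set {0}) (snd c ` fst c)" and h: "homeomorphism (fst c) (snd c ` fst c) (snd c) (param c)"
    by (auto simp: is_chart_def)
  have "snd c ` fst c \<subseteq> {0}" using openin_imp_subset[OF i] .
  then have 0: "snd c z = 0" if "z \<in> fst c" for z using that by auto
  have "z = x" if "z \<in> fst c" for z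
    using homeomorphism_apply1[OF h that] homeomorphism_apply1[OF h c(2)] 0[OF that] 0[OF c(2)] by simp
  then have "fst c = {x}" using c(2) by blast
  then have "open {x}" using o by simp
  then have "{x} = UNIV" using conn connected_clopen[of "UNIV :: 'm set"] by auto
  then show ?thesis by auto
qed

lemma zero_dimensional_constant:
  fixes A :: "('m::{t2_space, second_countable_topology}, 'n::finite) chart set"
  assumes st: "smooth_structure {0} A" and conn: "connected (UNIV :: 'm set)" and T: "T > 0"
    and \<xi>: "\<xi> \<in> tangent_bundle {0} A" and \<eta>: "\<eta> \<in> tangent_bundle {0} A"
  shows "(\<lambda>_. fst \<xi>) \<in> admissible_curves A T \<xi> \<eta>"
proof -
  let ?q = "\<lambda>_::real. fst \<xi>"
  have zero: "snd \<zeta> = (\<lambda>c. 0)" if "\<zeta> \<in> tangent_bundle {0} A" for \<zeta>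
  proof
    fix c
    have "snd \<zeta> \<in> tangent_space {0} A (fst \<zeta>)" using that unfolding tangent_bundle_def by (cases \<zeta>) simp
    then show "snd \<zeta> c = 0" unfolding tangent_space_def by blast
  qed
  have vel: "velocity A {0..T} ?q t = (\<lambda>c. 0)" if "0 \<le> t" "t \<le> T" for t
    unfolding velocity_def using that T
    by (auto simp: fun_eq_iff o_def intro!: vector_derivative_within_closed_interval has_vector_derivative_const)
  have "H2_on a b (snd c \<circ> ?q)" if "a < b" for a b and c :: "('m, 'n) chart"
  proof (rule H2_rep_imp_H2_on)
    show "H2_rep a b (snd c \<circ> ?q) (\<lambda>t. 0) (\<lambda>t. 0)"
      unfolding H2_rep_def o_def by (intro conjI AC_rep_const L2_on_continuous continuous_on_const)
  qed (use that in simp)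
  then have "?q \<in> H2_curves A T" unfolding H2_curves_def by (auto intro!: continuous_on_const)
  then show ?thesis
    unfolding admissible_curves_def using vel[of 0] vel[of T] zero[OF \<xi>] zero[OF \<eta>] T zero_dimensional_point[OF st conn, of "fst \<xi>" "fst \<eta>"]
    by simp
qed

theorem theorem4p2:
  fixes E :: "(real ^ 'n::finite) set"
    and A :: "('m::{t2_space, second_countable_topology}, 'n) chart set"
    and g :: "('m, 'n) metric"
    and T :: real
    and \<xi> \<eta> :: "'m \<times> ('m, 'n) tangent"
    and V :: "'m \<Rightarrow> real"
  assumes "smooth_structure E A"
    and "riemannian_metric E A g"
    and "connected (UNIV :: 'm set)"
    and "complete_riemannian A g"
    and "T > 0"
    and "\<xi> \<in> tangent_bundle E A"
    and "\<eta> \<in> tangent_bundle E A"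
    and "smooth_function E A V"
    and "\<And>x. V x \<ge> 0"
  shows "\<exists>q \<in> admissible_curves A T \<xi> \<eta>. \<forall>q' \<in> admissible_curves A T \<xi> \<eta>.
           action A g V T q \<le> action A g V T q'"
proof -
  have "E = UNIV \<or> E = {0}" using assms(1) unfolding smooth_structure_def by blast
  then show ?thesis
  proof
    assume E: "E = UNIV"
    interpret connected_riemannian A g
      by unfold_locales (use assms(1-3) E in auto)
    have "M.mcomplete" using assms(4) unfolding complete_riemannian_def .
    then show ?thesis using minimizer_exists assms(5-9) unfolding E by blast
  next
    assume E: "E = {0}"
    note point = zero_dimensional_point[OF assms(1)[unfolded E] assms(3)]
    have "q' = (\<lambda>_. fst \<xi>)" for q' :: "real \<Rightarrow> 'm" using point by (simp add: fun_eq_iff)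
    then show ?thesis
      using zero_dimensional_constant[OF assms(1)[unfolded E] assms(3,5) assms(6,7)[unfolded E]] by (metis order_refl)
  qed
qed

end
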